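(* The following results, valid for Veronese powers $A^{[d]}$ of weight graded associative algebras $A$, are, in general, false in the case of operads (that is, when the weight graded algebra $A$ is replaced by a weight graded operad $\mathcal{O}$ and $A^{[d]}$ by the Veronese power $\mathcal{O}^{[d]}$): (1) "improvement of defining relations for Veronese powers": if all elements of the minimal set of defining relations of $A$ are of weight at most $(k-1)d+1$, then all elements of the minimal set of defining relations of $A^{[d]}$ are of weight at most $k$ (for the standard grading of the Veronese power where all generators have weight one); (2) "improvement of the slope of the off-diagonal homology of the bar complexes for Veronese powers": the rate $r(A)$, defined as $\sup\left\{\frac{j-1}{i-1} : (\mathrm{Tor}_i^A)_{(j)}(\Bbbk,\Bbbk)\ne 0\right\}$, satisfies $r(A^{[d]})\le\left\lceil\frac{r(A)}{d}\right\rceil$; (3) "high" Veronese powers (that is, $A^{[d]}$ for all sufficiently large $d$) of a weight graded algebra $A$ with a finite Gröbner basis admit a quadratic Gröbner basis; (4) all Veronese powers of a weight graded algebra $A$ with a quadratic Gröbner basis admit a quadratic Gröbner basis.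
   Context: We work over a field $\Bbbk$ of characteristic zero. For a weight graded associative algebra $A=\bigoplus_{k\ge0}A_k$, the $d$-th Veronese power is the subalgebra $A^{[d]}=\bigoplus_{k\ge0}A_{kd}$. Operads (nonsymmetric, symmetric or shuffle) are weight graded (each component decomposes as $\mathcal{O}(n)=\bigoplus_{k\ge0}\mathcal{O}(n)_{(k)}$, with weights additive under composition), reduced ($\mathcal{O}(0)=0$) and connected ($\mathcal{O}(1)_{(0)}=\Bbbk$, $\mathcal{O}(n)_{(0)}=0$ for $n>1$). The $d$-th Veronese power $\mathcal{O}^{[d]}$ of a weight graded operad $\mathcal{O}$ is the suboperad of $\mathcal{O}$ generated by the weight $d$ part $\mathcal{O}_{(d)}$; it is presented as a quotient of the free operad on $\mathcal{O}_{(d)}$, and in the statements above it is considered with the standard weight grading for which these generators have weight one. Gröbner bases of operads are operadic Gröbner bases of the ideal of relations (for nonsymmetric or shuffle operads), for some choice of a basis of generators and of a monomial ordering of tree monomials compatible with compositions; "quadratic" means consisting of elements of weight two when the generators have weight one. In the operadic version of (2), $\mathrm{Tor}^A_i(\Bbbk,\Bbbk)_{(j)}$ is replaced by the homology of the bar complex of the operad in homological (bar) degree $i$ and weight $j$; the supremum is taken over $i\ge2$. *)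

theory Defs
  imports Complex_Main "HOL-Library.Poly_Mapping" "HOL-Library.Extended_Real"
begin

section \<open>Weight graded nonsymmetric operads\<close>

text \<open>
  Operads are given by partial compositions. \<open>part P n k\<close> is the component of arity \<open>n\<close> and
  weight \<open>k\<close>; all components are subspaces of one ambient space (for abstractly given components,
  take the direct sum). \<open>circ P i a b\<close> inserts \<open>b\<close> into the input \<open>i\<close> of \<open>a\<close>. The inputs of an
  operation of arity \<open>n\<close>, like the children of a vertex and the leaves of a tree, are numbered
  from left to right by \<open>0, \<dots>, n - 1\<close>.
\<close>

record ('k, 'v) ns_operad =
  smul :: "'k \<Rightarrow> 'v \<Rightarrow> 'v"
  part :: "nat \<Rightarrow> nat \<Rightarrow> 'v set"
  ident :: 'v
  circ :: "nat \<Rightarrow> 'v \<Rightarrow> 'v \<Rightarrow> 'v"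

definition arity_part :: "('k::field, 'v::ab_group_add) ns_operad \<Rightarrow> nat \<Rightarrow> 'v set" where
  "arity_part P n = module.span (smul P) (\<Union>k. part P n k)"

locale weight_graded_ns_operad = vector_space "smul P"
  for P :: "('k::field, 'v::ab_group_add) ns_operad" +
  assumes part_subspace: "subspace (part P n k)"
    and part_independent:
      "\<lbrakk>finite K; \<And>k. k \<in> K \<Longrightarrow> v k \<in> part P n k; (\<Sum>k\<in>K. v k) = 0; l \<in> K\<rbrakk> \<Longrightarrow> v l = 0"
    and circ_part:
      "\<lbrakk>a \<in> part P n k; b \<in> part P m l; i < n\<rbrakk> \<Longrightarrow> circ P i a b \<in> part P (n + m - 1) (k + l)"
    and circ_add_left:
      "\<lbrakk>a \<in> arity_part P n; a' \<in> arity_part P n; b \<in> arity_part P m; i < n\<rbrakk>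
        \<Longrightarrow> circ P i (a + a') b = circ P i a b + circ P i a' b"
    and circ_smul_left:
      "\<lbrakk>a \<in> arity_part P n; b \<in> arity_part P m; i < n\<rbrakk>
        \<Longrightarrow> circ P i (smul P c a) b = smul P c (circ P i a b)"
    and circ_add_right:
      "\<lbrakk>a \<in> arity_part P n; b \<in> arity_part P m; b' \<in> arity_part P m; i < n\<rbrakk>
        \<Longrightarrow> circ P i a (b + b') = circ P i a b + circ P i a b'"
    and circ_smul_right:
      "\<lbrakk>a \<in> arity_part P n; b \<in> arity_part P m; i < n\<rbrakk>
        \<Longrightarrow> circ P i a (smul P c b) = smul P c (circ P i a b)"
    and circ_sequential:
      "\<lbrakk>a \<in> arity_part P n; b \<in> arity_part P m; e \<in> arity_part P p; i < n; j < m\<rbrakk>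
        \<Longrightarrow> circ P (i + j) (circ P i a b) e = circ P i a (circ P j b e)"
    and circ_parallel:
      "\<lbrakk>a \<in> arity_part P n; b \<in> arity_part P m; e \<in> arity_part P p; i < j; j < n\<rbrakk>
        \<Longrightarrow> circ P i (circ P j a b) e = circ P (j + p - 1) (circ P i a e) b"
    and circ_ident_left: "a \<in> arity_part P n \<Longrightarrow> circ P 0 (ident P) a = a"
    and circ_ident_right: "\<lbrakk>a \<in> arity_part P n; i < n\<rbrakk> \<Longrightarrow> circ P i a (ident P) = a"
    and reduced: "part P 0 k = {0}"
    and connected_one: "part P 1 0 = span {ident P}" "ident P \<noteq> 0"
    and connected: "n > 1 \<Longrightarrow> part P n 0 = {0}"

inductive generated_suboperad ::
  "('k::field, 'v::ab_group_add) ns_operad \<Rightarrow> (nat \<Rightarrow> 'v set) \<Rightarrow> nat \<Rightarrow> 'v \<Rightarrow> bool"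
  for P S where
  gen_base: "a \<in> S n \<Longrightarrow> generated_suboperad P S n a"
| gen_ident: "generated_suboperad P S 1 (ident P)"
| gen_zero: "generated_suboperad P S n 0"
| gen_add: "\<lbrakk>generated_suboperad P S n a; generated_suboperad P S n b\<rbrakk>
    \<Longrightarrow> generated_suboperad P S n (a + b)"
| gen_smul: "generated_suboperad P S n a \<Longrightarrow> generated_suboperad P S n (smul P c a)"
| gen_circ: "\<lbrakk>generated_suboperad P S n a; generated_suboperad P S m b; i < n\<rbrakk>
    \<Longrightarrow> generated_suboperad P S (n + m - 1) (circ P i a b)"

definition generated_in_weight_one :: "('k::field, 'v::ab_group_add) ns_operad \<Rightarrow> bool" where
  "generated_in_weight_one P \<longleftrightarrow>
    (\<forall>n k. \<forall>a \<in> part P n k. generated_suboperad P (\<lambda>m. part P m 1) n a)"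

text \<open>
  In the standard weight grading of the Veronese power, weight \<open>k\<close> corresponds to weight \<open>k * d\<close>
  of the original operad.
\<close>

definition veronese ::
  "('k::field, 'v::ab_group_add) ns_operad \<Rightarrow> nat \<Rightarrow> ('k, 'v) ns_operad" where
  "veronese P d = P\<lparr>part := (\<lambda>n k.
    {a \<in> part P n (k * d). generated_suboperad P (\<lambda>m. part P m d) n a})\<rparr>"


section \<open>Trees and free operads\<close>

datatype 'x tree = Leaf | Node 'x "'x tree list"

fun leaves :: "'x tree \<Rightarrow> nat" where
  "leaves Leaf = 1"
| "leaves (Node x ts) = sum_list (map leaves ts)"

fun vertices :: "'x tree \<Rightarrow> nat" where
  "vertices Leaf = 0"
| "vertices (Node x ts) = 1 + sum_list (map vertices ts)"

fun graft :: "nat \<Rightarrow> 'x tree \<Rightarrow> 'x tree \<Rightarrow> 'x tree"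
  and graft_list :: "nat \<Rightarrow> 'x tree list \<Rightarrow> 'x tree \<Rightarrow> 'x tree list" where
  "graft i Leaf t = (if i = 0 then t else Leaf)"
| "graft i (Node x ss) t = Node x (graft_list i ss t)"
| "graft_list i [] t = []"
| "graft_list i (s # ss) t =
    (if i < leaves s then graft i s t # ss else s # graft_list (i - leaves s) ss t)"

fun decorated_by :: "(nat \<Rightarrow> 'x set) \<Rightarrow> 'x tree \<Rightarrow> bool" where
  "decorated_by X Leaf \<longleftrightarrow> True"
| "decorated_by X (Node x ts) \<longleftrightarrow> x \<in> X (length ts) \<and> (\<forall>t \<in> set ts. decorated_by X t)"

definition tree_monomials :: "(nat \<Rightarrow> 'x set) \<Rightarrow> nat \<Rightarrow> 'x tree set" where
  "tree_monomials X n = {t. decorated_by X t \<and> leaves t = n}"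

definition pscale :: "'k::field \<Rightarrow> ('a \<Rightarrow>\<^sub>0 'k) \<Rightarrow> ('a \<Rightarrow>\<^sub>0 'k)" where
  "pscale c = Poly_Mapping.map ((*) c)"

definition linear_extension ::
  "('k::field \<Rightarrow> 'v \<Rightarrow> 'v::ab_group_add) \<Rightarrow> ('a \<Rightarrow> 'v) \<Rightarrow> ('a \<Rightarrow>\<^sub>0 'k) \<Rightarrow> 'v" where
  "linear_extension sc F f = (\<Sum>a\<in>Poly_Mapping.keys f. sc (Poly_Mapping.lookup f a) (F a))"

definition free_operad :: "(nat \<Rightarrow> 'x set) \<Rightarrow> nat \<Rightarrow> ('x tree \<Rightarrow>\<^sub>0 'k::field) set" where
  "free_operad X n = {f. Poly_Mapping.keys f \<subseteq> tree_monomials X n}"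

definition free_circ ::
  "nat \<Rightarrow> ('x tree \<Rightarrow>\<^sub>0 'k::field) \<Rightarrow> ('x tree \<Rightarrow>\<^sub>0 'k) \<Rightarrow> ('x tree \<Rightarrow>\<^sub>0 'k)" where
  "free_circ i f g =
    linear_extension pscale
      (\<lambda>s. linear_extension pscale (\<lambda>t. Poly_Mapping.single (graft i s t) 1) g) f"

inductive generated_ideal ::
  "(nat \<Rightarrow> 'x set) \<Rightarrow> (nat \<Rightarrow> ('x tree \<Rightarrow>\<^sub>0 'k::field) set) \<Rightarrow> nat \<Rightarrow> ('x tree \<Rightarrow>\<^sub>0 'k) \<Rightarrow> bool"
  for X R where
  ideal_base: "f \<in> R n \<Longrightarrow> generated_ideal X R n f"
| ideal_zero: "generated_ideal X R n 0"
| ideal_add: "\<lbrakk>generated_ideal X R n f; generated_ideal X R n g\<rbrakk> \<Longrightarrow> generated_ideal X R n (f + g)"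
| ideal_scale: "generated_ideal X R n f \<Longrightarrow> generated_ideal X R n (pscale c f)"
| ideal_left: "\<lbrakk>generated_ideal X R n f; g \<in> free_operad X m; i < n\<rbrakk>
    \<Longrightarrow> generated_ideal X R (n + m - 1) (free_circ i f g)"
| ideal_right: "\<lbrakk>g \<in> free_operad X m; generated_ideal X R n f; i < m\<rbrakk>
    \<Longrightarrow> generated_ideal X R (m + n - 1) (free_circ i g f)"


section \<open>Generators and relations\<close>

definition generator_basis ::
  "('k::field, 'v::ab_group_add) ns_operad \<Rightarrow> (nat \<Rightarrow> 'v set) \<Rightarrow> bool" where
  "generator_basis P B \<longleftrightarrow>
    (\<forall>n. \<not> module.dependent (smul P) (B n) \<and> module.span (smul P) (B n) = part P n 1)"

text \<open>The full composition \<open>x(y\<^sub>0, \<dots>, y\<^bsub>n-1\<^esub>)\<close>, inserting from right to left.\<close>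

definition full_circ :: "('k, 'v) ns_operad \<Rightarrow> 'v \<Rightarrow> 'v list \<Rightarrow> 'v" where
  "full_circ P x ys = foldr (\<lambda>(j, y) a. circ P j a y) (List.enumerate 0 ys) x"

fun eval_tree :: "('k, 'v) ns_operad \<Rightarrow> 'v tree \<Rightarrow> 'v" where
  "eval_tree P Leaf = ident P"
| "eval_tree P (Node x ts) = full_circ P x (map (eval_tree P) ts)"

definition relation_ideal ::
  "('k::field, 'v::ab_group_add) ns_operad \<Rightarrow> (nat \<Rightarrow> 'v set) \<Rightarrow> nat \<Rightarrow> ('v tree \<Rightarrow>\<^sub>0 'k) set" where
  "relation_ideal P B n =
    {f \<in> free_operad B n. linear_extension (smul P) (eval_tree P) f = 0}"

definition homogeneous_of_weight :: "nat \<Rightarrow> ('x tree \<Rightarrow>\<^sub>0 'k::zero) \<Rightarrow> bool" where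
  "homogeneous_of_weight w f \<longleftrightarrow> (\<forall>t \<in> Poly_Mapping.keys f. vertices t = w)"

definition defining_relations ::
  "('k::field, 'v::ab_group_add) ns_operad \<Rightarrow> (nat \<Rightarrow> 'v set) \<Rightarrow>
    (nat \<Rightarrow> ('v tree \<Rightarrow>\<^sub>0 'k) set) \<Rightarrow> bool" where
  "defining_relations P B R \<longleftrightarrow>
    (\<forall>n. \<forall>f \<in> R n. \<exists>w. homogeneous_of_weight w f) \<and>
    (\<forall>n. Collect (generated_ideal B R n) = relation_ideal P B n)"

definition minimal_defining_relations ::
  "('k::field, 'v::ab_group_add) ns_operad \<Rightarrow> (nat \<Rightarrow> 'v set) \<Rightarrow>
    (nat \<Rightarrow> ('v tree \<Rightarrow>\<^sub>0 'k) set) \<Rightarrow> bool" where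
  "minimal_defining_relations P B R \<longleftrightarrow>
    defining_relations P B R \<and>
    (\<forall>R'. (\<forall>n. R' n \<subseteq> R n) \<and> defining_relations P B R' \<longrightarrow> R' = R)"

text \<open>
  A minimal set of homogeneous defining relations always exists, and the number of its elements of
  each arity and weight does not depend on the choices; so quantifying universally over the choices
  is not a restriction.
\<close>

definition minimal_relations_weight_le ::
  "('k::field, 'v::ab_group_add) ns_operad \<Rightarrow> nat \<Rightarrow> bool" where
  "minimal_relations_weight_le P N \<longleftrightarrow>
    (\<forall>B R. generator_basis P B \<and> minimal_defining_relations P B R \<longrightarrow>
      (\<forall>n. \<forall>f \<in> R n. \<exists>w\<le>N. homogeneous_of_weight w f))"


section \<open>Groebner bases\<close>

definition monomial_order :: "(nat \<Rightarrow> 'x set) \<Rightarrow> ('x tree \<Rightarrow> 'x tree \<Rightarrow> bool) \<Rightarrow> bool" where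
  "monomial_order X lt \<longleftrightarrow>
    (\<forall>n. irreflp_on (tree_monomials X n) lt \<and> transp_on (tree_monomials X n) lt \<and>
         totalp_on (tree_monomials X n) lt \<and> wfp_on (tree_monomials X n) lt) \<and>
    (\<forall>n m i. i < n \<longrightarrow>
      (\<forall>s \<in> tree_monomials X n. \<forall>s' \<in> tree_monomials X n. \<forall>t \<in> tree_monomials X m.
        lt s s' \<longrightarrow> lt (graft i s t) (graft i s' t)) \<and>
      (\<forall>s \<in> tree_monomials X n. \<forall>t \<in> tree_monomials X m. \<forall>t' \<in> tree_monomials X m.
        lt t t' \<longrightarrow> lt (graft i s t) (graft i s t')))"

definition is_leading_monomial ::
  "('x tree \<Rightarrow> 'x tree \<Rightarrow> bool) \<Rightarrow> ('x tree \<Rightarrow>\<^sub>0 'k::zero) \<Rightarrow> 'x tree \<Rightarrow> bool" where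
  "is_leading_monomial lt f t \<longleftrightarrow>
    t \<in> Poly_Mapping.keys f \<and> (\<forall>s \<in> Poly_Mapping.keys f. s \<noteq> t \<longrightarrow> lt s t)"

inductive tree_divides :: "'x tree \<Rightarrow> 'x tree \<Rightarrow> bool" for s where
  divides_refl: "tree_divides s s"
| divides_left: "\<lbrakk>tree_divides s t; i < leaves t\<rbrakk> \<Longrightarrow> tree_divides s (graft i t u)"
| divides_right: "\<lbrakk>tree_divides s t; i < leaves u\<rbrakk> \<Longrightarrow> tree_divides s (graft i u t)"

definition groebner_basis ::
  "('x tree \<Rightarrow> 'x tree \<Rightarrow> bool) \<Rightarrow> (nat \<Rightarrow> ('x tree \<Rightarrow>\<^sub>0 'k::zero) set) \<Rightarrow>
    (nat \<Rightarrow> ('x tree \<Rightarrow>\<^sub>0 'k) set) \<Rightarrow> bool" where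
  "groebner_basis lt I G \<longleftrightarrow>
    (\<forall>n. G n \<subseteq> I n) \<and>
    (\<forall>n. \<forall>f \<in> I n. f \<noteq> 0 \<longrightarrow>
      (\<exists>m. \<exists>g \<in> G m. \<exists>s t. is_leading_monomial lt g s \<and> is_leading_monomial lt f t \<and>
        tree_divides s t))"

definition has_finite_groebner_basis :: "('k::field, 'v::ab_group_add) ns_operad \<Rightarrow> bool" where
  "has_finite_groebner_basis P \<longleftrightarrow>
    (\<exists>B lt G. generator_basis P B \<and> monomial_order B lt \<and>
      groebner_basis lt (relation_ideal P B) G \<and> finite (\<Union>n. G n))"

definition has_quadratic_groebner_basis :: "('k::field, 'v::ab_group_add) ns_operad \<Rightarrow> bool" where
  "has_quadratic_groebner_basis P \<longleftrightarrow>
    (\<exists>B lt G. generator_basis P B \<and> monomial_order B lt \<and>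
      groebner_basis lt (relation_ideal P B) G \<and>
      (\<forall>n. \<forall>g \<in> G n. homogeneous_of_weight 2 g))"


section \<open>Bar homology and the rate\<close>

text \<open>
  The bar complex is the cofree cooperad on the suspension of the positive weight part of \<open>P\<close>. It is
  represented by linear combinations of planar trees whose vertices with \<open>n\<close> inputs carry labels
  \<open>(w, a)\<close> with \<open>w > 0\<close> and \<open>a \<in> part P n w\<close>, modulo the span of \<open>multilinearity P\<close>. The homological
  degree is the number of vertices.
\<close>

fun bar_tree :: "('k, 'v) ns_operad \<Rightarrow> (nat \<times> 'v) tree \<Rightarrow> bool" where
  "bar_tree P Leaf \<longleftrightarrow> True"
| "bar_tree P (Node (w, a) ts) \<longleftrightarrow>
    w > 0 \<and> a \<in> part P (length ts) w \<and> (\<forall>t \<in> set ts. bar_tree P t)"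

fun bar_weight :: "(nat \<times> 'v) tree \<Rightarrow> nat" where
  "bar_weight Leaf = 0"
| "bar_weight (Node (w, a) ts) = w + sum_list (map bar_weight ts)"

definition bar_chains ::
  "('k::field, 'v) ns_operad \<Rightarrow> nat \<Rightarrow> nat \<Rightarrow> ((nat \<times> 'v) tree \<Rightarrow>\<^sub>0 'k) set" where
  "bar_chains P i j =
    {z. \<forall>t \<in> Poly_Mapping.keys z. bar_tree P t \<and> vertices t = i \<and> bar_weight t = j}"

definition replace_child ::
  "'x \<Rightarrow> 'x tree list \<Rightarrow> nat \<Rightarrow> ('x tree \<Rightarrow>\<^sub>0 'k::field) \<Rightarrow> ('x tree \<Rightarrow>\<^sub>0 'k)" where
  "replace_child x ts j =
    linear_extension pscale (\<lambda>t. Poly_Mapping.single (Node x (ts[j := t])) 1)"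

inductive_set multilinearity ::
  "('k::field, 'v::ab_group_add) ns_operad \<Rightarrow> ((nat \<times> 'v) tree \<Rightarrow>\<^sub>0 'k) set"
  for P where
  multi_add: "\<lbrakk>bar_tree P (Node (w, a) ts); bar_tree P (Node (w, b) ts)\<rbrakk> \<Longrightarrow>
    Poly_Mapping.single (Node (w, a + b) ts) 1
      - Poly_Mapping.single (Node (w, a) ts) 1 - Poly_Mapping.single (Node (w, b) ts) 1
    \<in> multilinearity P"
| multi_smul: "bar_tree P (Node (w, a) ts) \<Longrightarrow>
    Poly_Mapping.single (Node (w, smul P c a) ts) 1 - Poly_Mapping.single (Node (w, a) ts) c
    \<in> multilinearity P"
| multi_child: "\<lbrakk>r \<in> multilinearity P; bar_tree P (Node x ts); j < length ts\<rbrakk> \<Longrightarrow>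
    replace_child x ts j r \<in> multilinearity P"

definition contract_child ::
  "('k::field, 'v) ns_operad \<Rightarrow> nat \<times> 'v \<Rightarrow> (nat \<times> 'v) tree list \<Rightarrow> nat \<Rightarrow>
    ((nat \<times> 'v) tree \<Rightarrow>\<^sub>0 'k)" where
  "contract_child P x ts j =
    (case ts ! j of
       Leaf \<Rightarrow> 0
     | Node y us \<Rightarrow>
         Poly_Mapping.single
           (Node (fst x + fst y, circ P j (snd x) (snd y)) (take j ts @ us @ drop (Suc j) ts)) 1)"

text \<open>
  Enumerate the vertices of a tree in prefix order, starting with \<open>0\<close> at the root, and read the tree
  as the word of its suspended labels in this order. Contracting the edge above the vertex \<open>q\<close>
  deletes \<open>q\<close> from the enumeration, and by the Koszul sign rule (all suspended labels and the
  induced infinitesimal composition have odd degree) it occurs in the differential with the sign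
  \<open>(-1)\<^sup>q\<close>, up to a global sign. In the recursion below, the root of the child \<open>j\<close> has the
  number \<open>1 + (\<Sum>l<j. vertices (ts ! l))\<close>.
\<close>

lemma size_nth_tree [termination_simp]: "j < length ts \<Longrightarrow> size (ts ! j) < Suc (size_list size ts)"
  by (meson less_SucI nth_mem size_list_estimation' less_Suc_eq_le order_refl)

fun bar_boundary ::
  "('k::field, 'v) ns_operad \<Rightarrow> (nat \<times> 'v) tree \<Rightarrow> ((nat \<times> 'v) tree \<Rightarrow>\<^sub>0 'k)" where
  "bar_boundary P Leaf = 0"
| "bar_boundary P (Node x ts) =
    (\<Sum>j<length ts. pscale ((-1) ^ (1 + (\<Sum>l<j. vertices (ts ! l))))
      (contract_child P x ts j + replace_child x ts j (bar_boundary P (ts ! j))))"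

definition bar_homology_nonzero ::
  "('k::field, 'v::ab_group_add) ns_operad \<Rightarrow> nat \<Rightarrow> nat \<Rightarrow> bool" where
  "bar_homology_nonzero P i j \<longleftrightarrow>
    (\<exists>z \<in> bar_chains P i j.
      linear_extension pscale (bar_boundary P) z \<in> module.span pscale (multilinearity P) \<and>
      \<not> (\<exists>y \<in> bar_chains P (i + 1) j.
          z - linear_extension pscale (bar_boundary P) y \<in> module.span pscale (multilinearity P)))"

definition rate :: "('k::field, 'v::ab_group_add) ns_operad \<Rightarrow> ereal" where
  "rate P = Sup {ereal ((real j - 1) / (real i - 1)) | i j. i \<ge> 2 \<and> bar_homology_nonzero P i j}"

definition ereal_ceiling :: "ereal \<Rightarrow> ereal" where
  "ereal_ceiling x = (if \<bar>x\<bar> = \<infinity> then x else ereal (of_int \<lceil>real_of_ereal x\<rceil>))"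

end

theory Submission
  imports Defs "HOL-Library.Countable"
begin

text \<open>
  A single operad refutes all four statements. It is spanned by the unary powers \<open>[n] = a\<^sup>n\<close> and by quaternary
  monomials \<open>[x, y, w, z]\<close>, the result of putting powers of \<open>a\<close> on the inputs of one of two generators; a
  quaternary monomial vanishes as soon as both of its first two exponents are positive. All relations
  are quadratic and form a quadratic Groebner basis. In the Veronese power of weight \<open>d\<close> the element
  \<open>[0, 0, 1, d - 1]\<close> is a generator that cannot be decomposed further, so that the monomial relation saying
  that \<open>a\<^sup>d\<close> on the first and on the second input gives zero is a new relation of weight three: the two
  inputs are independent, hence no relation of weight two implies it. It also produces a class of homological
  degree two and weight three in the bar complex, while the bar complex of the operad itself has no homology of
  slope greater than eight.
\<close>

text \<open>The generators are \<open>a = [1]\<close>, \<open>op_e = [0, 0, 1, 0]\<close> and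
  \<open>op_f = [0, 1, 0, 0]\<close>. Quadratic relations force the vanishing by a detour:
  \<open>a\<close> on input 1 of \<open>op_e\<close> equals \<open>a\<close> on input 2 of
  \<open>op_f\<close>, and \<open>a\<close> on input 0 of \<open>op_f\<close> is zero. For
  \<open>d \<ge> 2\<close> the Veronese power loses this detour: the entries \<open>1\<close> and
  \<open>d - 1\<close> are below \<open>d\<close>, so from \<open>[d, 0, 1, d - 1]\<close> and
  \<open>[0, d, 1, d - 1]\<close> the power \<open>a^d\<close> splits off in one way only, and no
  relation of weight two rewrites them. That the cubic relation is really new is shown by a test
  operad in which \<open>[d, d, 1, d - 1]\<close> is nonzero although every relation of weight at
  most two still holds. For the rate a crude bound is enough. In a monomial tree of weight above
  four times its number of vertices some input carries two letters, and
  \<open>4 * i \<le> 8 * (i - 1)\<close> for \<open>i \<ge> 2\<close>; this is the origin of the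
  constant eight. Taking \<open>d = 8\<close> makes the claimed bound 1, while degree two and weight
  three give slope 2.\<close>

abbreviation "keys \<equiv> Poly_Mapping.keys"
abbreviation "lookup \<equiv> Poly_Mapping.lookup"
abbreviation "single \<equiv> Poly_Mapping.single"

subsection \<open>Linear extension\<close>

lemma lookup_pscale [simp]: "lookup (pscale c f) a = c * lookup f a"
  unfolding pscale_def by (simp add: Poly_Mapping.map.rep_eq when_def)

interpretation pscale: vector_space "pscale :: 'k::field \<Rightarrow> ('a \<Rightarrow>\<^sub>0 'k) \<Rightarrow> _"
  by unfold_locales (auto intro!: poly_mapping_eqI simp: lookup_add algebra_simps)

lemma keys_pscale: "keys (pscale c f) \<subseteq> keys f"
  by (auto simp: in_keys_iff)

lemma pscale_single [simp]: "pscale c (single a b) = single a (c * b)"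
  by (rule poly_mapping_eqI) (simp add: lookup_single when_def)

lemma keys_minus_subset: "keys (f - g) \<subseteq> keys f \<union> keys (g :: 'a \<Rightarrow>\<^sub>0 'k::ab_group_add)"
  by (auto simp: in_keys_iff lookup_minus)

lemma keys_sum_subset: "keys (\<Sum>i\<in>A. f i) \<subseteq> (\<Union>i\<in>A. keys (f i))"
proof (cases "finite A")
  case True
  then show ?thesis
    by (induction A rule: finite_induct) (use Poly_Mapping.keys_add in fastforce)+
qed simp

lemma sum_singles: "(\<Sum>a\<in>keys f. single a (lookup f a)) = f"
  by (rule poly_mapping_eqI) (simp add: lookup_sum lookup_single when_def in_keys_iff)

text \<open>The linear and bilinear identities below are reduced to basis elements by this
  induction. The set \<open>S\<close> carries the arity condition along, since the operad laws hold
  only for monomials of the right arity.\<close>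

lemma keys_subset_induct [consumes 1, case_names zero add]:
  fixes f :: "'a \<Rightarrow>\<^sub>0 'k::ab_group_add"
  assumes "keys f \<subseteq> S" and zero: "P 0"
    and add: "\<And>a c g. \<lbrakk>a \<in> S; keys g \<subseteq> S; P g\<rbrakk> \<Longrightarrow> P (single a c + g)"
  shows "P f"
proof -
  have "P (\<Sum>a\<in>A. single a (lookup f a)) \<and> keys (\<Sum>a\<in>A. single a (lookup f a)) \<subseteq> S"
    if "A \<subseteq> S" "finite A" for A
    using that(2,1)
  proof (induction A rule: finite_induct)
    case (insert x F)
    let ?g = "\<Sum>a\<in>F. single a (lookup f a)"
    have "keys (single x (lookup f x) + ?g) \<subseteq> keys (single x (lookup f x)) \<union> keys ?g"
      by (rule Poly_Mapping.keys_add)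
    moreover have "keys (single x (lookup f x)) \<subseteq> {x}" by simp
    ultimately show ?case using insert add[of x ?g "lookup f x"] by auto
  qed (simp add: zero)
  from this[OF assms(1)] show ?thesis by (simp add: sum_singles)
qed

context vector_space
begin

lemma linear_extension_superset:
  assumes "finite A" "keys f \<subseteq> A"
  shows "linear_extension scale F f = (\<Sum>a\<in>A. scale (lookup f a) (F a))"
  unfolding linear_extension_def
  by (rule sum.mono_neutral_left) (use assms in \<open>auto simp: in_keys_iff\<close>)

lemma linear_extension_zero [simp]: "linear_extension scale F 0 = 0"
  by (simp add: linear_extension_def)

lemma linear_extension_single [simp]: "linear_extension scale F (single a c) = scale c (F a)"
  by (subst linear_extension_superset[of "{a}"]) auto

lemma linear_extension_add:
  "linear_extension scale F (f + g) = linear_extension scale F f + linear_extension scale F g"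
proof -
  let ?A = "keys f \<union> keys g"
  have "linear_extension scale F h = (\<Sum>a\<in>?A. scale (lookup h a) (F a))"
    if "keys h \<subseteq> ?A" for h
    by (rule linear_extension_superset) (use that in auto)
  from this[of f] this[of g] this[OF Poly_Mapping.keys_add] show ?thesis
    by (simp add: lookup_add scale_left_distrib sum.distrib)
qed

lemma linear_extension_pscale:
  "linear_extension scale F (pscale c f) = scale c (linear_extension scale F f)"
proof -
  have "linear_extension scale F (pscale c f) = (\<Sum>a\<in>keys f. scale (c * lookup f a) (F a))"
    by (subst linear_extension_superset[OF finite_keys keys_pscale]) (simp only: lookup_pscale)
  then show ?thesis by (simp only: linear_extension_def scale_sum_right scale_scale)
qed

lemma linear_extension_uminus:
  "linear_extension scale F (- f) = - linear_extension scale F f"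
  using linear_extension_add[of F f "- f"] by (simp add: eq_neg_iff_add_eq_0 add.commute)

lemma linear_extension_diff:
  "linear_extension scale F (f - g) = linear_extension scale F f - linear_extension scale F g"
  using linear_extension_add[of F f "- g"] by (simp add: linear_extension_uminus)

lemma linear_extension_sum:
  "linear_extension scale F (\<Sum>i\<in>A. f i) = (\<Sum>i\<in>A. linear_extension scale F (f i))"
  by (induction A rule: infinite_finite_induct) (simp_all add: linear_extension_add)

lemma linear_extension_cong:
  "(\<And>a. a \<in> keys f \<Longrightarrow> F a = G a) \<Longrightarrow> linear_extension scale F f = linear_extension scale G f"
  by (simp add: linear_extension_def)

lemma linear_extension_fun_add:
  "linear_extension scale (\<lambda>a. F a + G a) f = linear_extension scale F f + linear_extension scale G f"
  by (simp add: linear_extension_def scale_right_distrib sum.distrib)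

lemma linear_extension_fun_scale:
  "linear_extension scale (\<lambda>a. scale c (F a)) f = scale c (linear_extension scale F f)"
  by (simp add: linear_extension_def scale_sum_right mult.commute)

lemma linear_extension_fun_zero [simp]: "linear_extension scale (\<lambda>a. 0) f = 0"
  by (simp add: linear_extension_def)

lemma linear_extension_in_subspace:
  assumes "subspace V" "\<And>a. a \<in> keys f \<Longrightarrow> F a \<in> V"
  shows "linear_extension scale F f \<in> V"
  unfolding linear_extension_def by (intro subspace_sum subspace_scale assms)

end

lemma linear_extension_id [simp]: "linear_extension pscale (\<lambda>a. single a 1) f = f"
  by (simp add: linear_extension_def sum_singles)

lemma keys_linear_extension:
  "keys (linear_extension pscale F f) \<subseteq> (\<Union>a\<in>keys f. keys (F a))"
proof -
  have "keys (linear_extension pscale F f) \<subseteq> (\<Union>a\<in>keys f. keys (pscale (lookup f a) (F a)))"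
    unfolding linear_extension_def by (rule keys_sum_subset)
  also have "\<dots> \<subseteq> (\<Union>a\<in>keys f. keys (F a))"
    by (rule UN_mono) (rule order_refl, rule keys_pscale)
  finally show ?thesis .
qed

text \<open>The target space is left general because three targets occur: an operad, formal
  combinations, and the field itself.\<close>

lemma linear_extension_comp:
  assumes "vector_space sc"
  shows "linear_extension sc F (linear_extension pscale G f)
    = linear_extension sc (\<lambda>a. linear_extension sc F (G a)) f"
proof -
  interpret vector_space sc by fact
  show ?thesis
    by (simp add: linear_extension_def[of pscale] linear_extension_sum linear_extension_pscale)
       (simp add: linear_extension_def)
qed

text \<open>Common form of \<open>free_circ\<close> and of the composition of
  \<open>label_operad\<close>; the operad laws of both then follow from identities between basis
  elements.\<close>

definition bilinear_extension ::
  "('a \<Rightarrow> 'b \<Rightarrow> ('c \<Rightarrow>\<^sub>0 'k::field)) \<Rightarrow> ('a \<Rightarrow>\<^sub>0 'k) \<Rightarrow> ('b \<Rightarrow>\<^sub>0 'k) \<Rightarrow> ('c \<Rightarrow>\<^sub>0 'k)" where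
  "bilinear_extension F f g = linear_extension pscale (\<lambda>s. linear_extension pscale (F s) g) f"

lemma bilinear_extension_simps [simp]:
  "bilinear_extension F 0 g = 0" "bilinear_extension F f 0 = 0"
  "bilinear_extension F (f + f') g = bilinear_extension F f g + bilinear_extension F f' g"
  "bilinear_extension F f (g + g') = bilinear_extension F f g + bilinear_extension F f g'"
  "bilinear_extension F (pscale c f) g = pscale c (bilinear_extension F f g)"
  "bilinear_extension F f (pscale c g) = pscale c (bilinear_extension F f g)"
  "bilinear_extension F (single a x) (single b y) = pscale (x * y) (F a b)"
  by (simp_all add: bilinear_extension_def pscale.linear_extension_add pscale.linear_extension_pscale
      pscale.linear_extension_fun_add pscale.linear_extension_fun_scale)

lemma keys_bilinear_extension:
  "keys (bilinear_extension F f g) \<subseteq> (\<Union>a\<in>keys f. \<Union>b\<in>keys g. keys (F a b))"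
  unfolding bilinear_extension_def
  by (rule order_trans[OF keys_linear_extension]) (intro UN_mono order_refl keys_linear_extension)

lemma free_circ_eq_bilinear: "free_circ i = bilinear_extension (\<lambda>s t. single (graft i s t) 1)"
  by (intro ext) (simp add: free_circ_def bilinear_extension_def)

lemma free_circ_simps [simp]:
  "free_circ i 0 g = 0" "free_circ i f 0 = 0"
  "free_circ i (f + f') g = free_circ i f g + free_circ i f' g"
  "free_circ i f (g + g') = free_circ i f g + free_circ i f g'"
  "free_circ i (pscale c f) g = pscale c (free_circ i f g)"
  "free_circ i f (pscale c g) = pscale c (free_circ i f g)"
  "free_circ i (single s x) (single t y) = single (graft i s t) (x * y)"
  by (simp_all add: free_circ_eq_bilinear)

lemma keys_free_circ:
  "keys (free_circ i f g) \<subseteq> (\<Union>s\<in>keys f. \<Union>t\<in>keys g. {graft i s t})"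
  using keys_bilinear_extension[of "\<lambda>s t. single (graft i s t) 1" f g]
  by (simp add: free_circ_eq_bilinear)

subsection \<open>Grafting\<close>

abbreviation corolla :: "nat \<Rightarrow> 'x \<Rightarrow> 'x tree" where
  "corolla n x \<equiv> Node x (replicate n Leaf)"

lemma graft_list_append_right:
  "graft_list (sum_list (map leaves ss) + i) (ss @ ss') t = ss @ graft_list i ss' t"
  by (induction ss arbitrary: i) auto

text \<open>Translates between the global number of a leaf and its number inside the child
  \<open>j\<close>: the leaves of the earlier children are counted first.\<close>

lemma graft_list_nth:
  assumes "j < length ss" "i < leaves (ss ! j)"
  shows "graft_list (sum_list (map leaves (take j ss)) + i) ss t = ss[j := graft i (ss ! j) t]"
proof -
  have "graft_list (sum_list (map leaves (take j ss)) + i) (take j ss @ ss ! j # drop (Suc j) ss) t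
      = take j ss @ graft i (ss ! j) t # drop (Suc j) ss"
    by (subst graft_list_append_right) (use assms in auto)
  then show ?thesis
    using assms by (simp add: id_take_nth_drop[symmetric] upd_conv_take_nth_drop)
qed

lemma length_graft_list [simp]: "length (graft_list i ss t) = length ss"
  by (induction ss arbitrary: i) auto

lemma leaves_graft: "i < leaves s \<Longrightarrow> leaves (graft i s t) = leaves s + leaves t - 1"
  and leaves_graft_list: "i < sum_list (map leaves ss) \<Longrightarrow>
    sum_list (map leaves (graft_list i ss t)) = sum_list (map leaves ss) + leaves t - 1"
  by (induction i s t and i ss t rule: graft_graft_list.induct) (simp_all, linarith)

lemma vertices_graft: "i < leaves s \<Longrightarrow> vertices (graft i s t) = vertices s + vertices t"
  and vertices_graft_list: "i < sum_list (map leaves ss) \<Longrightarrow>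
    sum_list (map vertices (graft_list i ss t)) = sum_list (map vertices ss) + vertices t"
  by (induction i s t and i ss t rule: graft_graft_list.induct) simp_all

lemma decorated_graft: "i < leaves s \<Longrightarrow>
    decorated_by X (graft i s t) \<longleftrightarrow> decorated_by X s \<and> decorated_by X t"
  and decorated_graft_list: "i < sum_list (map leaves ss) \<Longrightarrow>
    list_all (decorated_by X) (graft_list i ss t) \<longleftrightarrow>
      list_all (decorated_by X) ss \<and> decorated_by X t"
  by (induction i s t and i ss t rule: graft_graft_list.induct) (auto simp: list_all_iff)

lemma leaves_map_tree [simp]: "leaves (map_tree h s) = leaves s"
  by (induction s) (simp_all add: comp_def cong: map_cong)

lemma vertices_map_tree [simp]: "vertices (map_tree h s) = vertices s"
  by (induction s) (simp_all add: comp_def cong: map_cong)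

lemma map_tree_graft: "map_tree h (graft i s t) = graft i (map_tree h s) (map_tree h t)"
  and map_tree_graft_list: "map (map_tree h) (graft_list i ss t)
    = graft_list i (map (map_tree h) ss) (map_tree h t)"
  by (induction i s t and i ss t rule: graft_graft_list.induct) auto

lemma graft_Leaf: "t = Leaf \<Longrightarrow> graft i s t = s"
  and graft_list_Leaf: "t = Leaf \<Longrightarrow> graft_list i ss t = ss"
  by (induction i s t and i ss t rule: graft_graft_list.induct) auto

lemma graft_sequential:
  "\<lbrakk>i < leaves s; j < leaves t\<rbrakk> \<Longrightarrow> graft (i + j) (graft i s t) u = graft i s (graft j t u)"
  and graft_list_sequential:
  "\<lbrakk>i < sum_list (map leaves ss); j < leaves t\<rbrakk> \<Longrightarrow>
    graft_list (i + j) (graft_list i ss t) u = graft_list i ss (graft j t u)"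
proof (induction i s t and i ss t rule: graft_graft_list.induct)
  case (4 i s ss t)
  then show ?case
    by (cases "i < leaves s") (simp_all add: leaves_graft, auto)
qed simp_all

lemma graft_parallel:
  "\<lbrakk>i < j; j < leaves s\<rbrakk> \<Longrightarrow>
    graft i (graft j s t) u = graft (j + leaves u - 1) (graft i s u) t"
  and graft_list_parallel:
  "\<lbrakk>i < j; j < sum_list (map leaves ss)\<rbrakk> \<Longrightarrow>
    graft_list i (graft_list j ss t) u = graft_list (j + leaves u - 1) (graft_list i ss u) t"
proof (induction j s t and j ss t arbitrary: i and i rule: graft_graft_list.induct)
  case (4 j s ss t)
  show ?case
  proof (cases "j < leaves s")
    case True
    have "j + leaves u - 1 < leaves s + leaves u - 1" "i < leaves s + leaves t - 1" "i < leaves s"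
      using True \<open>i < j\<close> by linarith+
    then show ?thesis using 4 True by (simp add: leaves_graft)
  next
    case False
    \<comment> \<open>\<open>i < j\<close> gives \<open>1 \<le> j\<close>, so the truncated
      subtraction in \<open>j + leaves u - 1\<close> is exact even if \<open>u\<close> has no
      leaves.\<close>
    have *: "j + leaves u - 1 - leaves (graft i s u) = j - leaves s"
      "\<not> j + leaves u - 1 < leaves (graft i s u)" if "i < leaves s"
      using that False leaves_graft[OF that, of u] by linarith+
    have **: "j + leaves u - 1 - leaves s = j - leaves s + leaves u - 1"
      "\<not> j + leaves u - 1 < leaves s" if "\<not> i < leaves s"
      using that False 4 by linarith+
    show ?thesis using 4 False * ** by (cases "i < leaves s") simp_all
  qed
qed simp_all

lemma leaves_corolla [simp]: "leaves (corolla n x) = n"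
  by (simp add: map_replicate_const sum_list_replicate)

lemma vertices_corolla [simp]: "vertices (corolla n x) = 1"
  by (simp add: map_replicate_const sum_list_replicate)

lemma replicate_eq_if: "(\<forall>x\<in>set xs. x = y) \<Longrightarrow> replicate (length xs) y = xs"
  by (simp add: replicate_length_same)

lemma sum_list_take_bound:
  fixes f :: "'a \<Rightarrow> nat"
  assumes "j < length xs" "i < f (xs ! j)"
  shows "sum_list (map f (take j xs)) + i < sum_list (map f xs)"
proof -
  have "sum_list (map f xs) = sum_list (map f (take j xs @ xs ! j # drop (Suc j) xs))"
    using assms by (simp add: id_take_nth_drop[symmetric])
  then show ?thesis using assms by simp
qed

text \<open>Every tree other than \<open>Leaf\<close> is built from a smaller one by grafting a corolla.\<close>

lemma tree_graft_corolla_cases: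
  assumes "t \<noteq> Leaf" "decorated_by X t"
  obtains i s n x where "t = graft i s (corolla n x)" "i < leaves s" "x \<in> X n" "decorated_by X s"
proof -
  have "\<exists>i s n x. t = graft i s (corolla n x) \<and> i < leaves s \<and> x \<in> X n \<and> decorated_by X s"
    using assms
  proof (induction t)
    case (Node y ts)
    show ?case
    proof (cases "\<forall>u\<in>set ts. u = Leaf")
      case True
      then have "Node y ts = graft 0 Leaf (corolla (length ts) y)"
        by (simp add: replicate_eq_if)
      then show ?thesis using Node.prems by (intro exI[of _ 0] exI[of _ Leaf] exI) auto
    next
      case False
      \<comment> \<open>A child that is not a leaf is decomposed instead, so that the corolla split
        off is always an uppermost vertex.\<close>
      then obtain j where j: "j < length ts" "ts ! j \<noteq> Leaf" by (metis in_set_conv_nth)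
      then obtain i s n x where ih: "ts ! j = graft i s (corolla n x)" "i < leaves s" "x \<in> X n"
          "decorated_by X s"
        using Node.IH[of "ts ! j"] Node.prems by auto
      let ?k = "sum_list (map leaves (take j (ts[j := s]))) + i"
      have k: "?k < sum_list (map leaves (ts[j := s]))"
        by (rule sum_list_take_bound) (use j ih in auto)
      have "graft_list ?k (ts[j := s]) (corolla n x) = ts"
        by (subst graft_list_nth) (use j ih(2) in \<open>simp_all flip: ih(1)\<close>)
      then have "Node y ts = graft ?k (Node y (ts[j := s])) (corolla n x)" by simp
      moreover have "decorated_by X (Node y (ts[j := s]))"
        using Node.prems ih(4) set_update_subset_insert[of ts j s] by auto
      moreover have "?k < leaves (Node y (ts[j := s]))" using k by simp
      ultimately show ?thesis using ih(3) by blast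
    qed
  qed simp
  then show ?thesis using that by blast
qed

lemma tree_monomials_graft:
  "\<lbrakk>s \<in> tree_monomials X n; t \<in> tree_monomials X m; i < n\<rbrakk> \<Longrightarrow>
    graft i s t \<in> tree_monomials X (n + m - 1)"
  by (auto simp: tree_monomials_def leaves_graft decorated_graft)

lemma corolla_in_tree_monomials [simp]: "x \<in> X n \<Longrightarrow> corolla n x \<in> tree_monomials X n"
  using leaves_corolla[of x n] by (auto simp: tree_monomials_def)

lemma Leaf_in_tree_monomials [simp]: "Leaf \<in> tree_monomials X 1"
  by (simp add: tree_monomials_def)

text \<open>Properties of evaluations can thus be proved by looking only at partial compositions
  with one generator, without the nested recursion over lists of children.\<close>

lemma tree_monomials_induct [consumes 1, case_names Leaf graft]:
  assumes "t \<in> tree_monomials X n"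
    and "P 1 Leaf"
    and "\<And>n m i s x. \<lbrakk>s \<in> tree_monomials X n; x \<in> X m; i < n; P n s\<rbrakk> \<Longrightarrow>
      P (n + m - 1) (graft i s (corolla m x))"
  shows "P n t"
  using assms(1)
proof (induction "vertices t" arbitrary: t n rule: less_induct)
  case less
  show ?case
  proof (cases "t = Leaf")
    case True
    then show ?thesis using less.prems assms(2) by (simp add: tree_monomials_def)
  next
    case False
    have "decorated_by X t" using less.prems by (simp add: tree_monomials_def)
    from tree_graft_corolla_cases[OF False this]
    obtain i s m x where t: "t = graft i s (corolla m x)" "i < leaves s" "x \<in> X m"
        "decorated_by X s" .
    have s: "s \<in> tree_monomials X (leaves s)" using t by (simp add: tree_monomials_def)
    have "vertices s < vertices t"
      unfolding t(1) vertices_graft[OF t(2)] vertices_corolla by simp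
    from assms(3)[OF s t(3,2) less.hyps[OF this s]]
    have "P (leaves s + m - 1) t" unfolding t(1) .
    moreover have "n = leaves s + m - 1"
      using less.prems leaves_graft[OF t(2), of "corolla m x"] leaves_corolla[of x m]
      by (simp only: tree_monomials_def t(1) mem_Collect_eq)
    ultimately show ?thesis by simp
  qed
qed

subsection \<open>Evaluation of trees in an operad\<close>

text \<open>The start index \<open>k\<close> makes \<open>full_circ\<close> accessible to induction
  over the list. Since inputs are filled from right to left, the positions of the inputs still to be
  filled do not move.\<close>

definition circ_list :: "('k, 'v) ns_operad \<Rightarrow> nat \<Rightarrow> 'v \<Rightarrow> 'v list \<Rightarrow> 'v" where
  "circ_list P k x ys = foldr (\<lambda>(j, y) a. circ P j a y) (List.enumerate k ys) x"

lemma circ_list_simps [simp]: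
  "circ_list P k x [] = x"
  "circ_list P k x (y # ys) = circ P k (circ_list P (Suc k) x ys) y"
  by (simp_all add: circ_list_def)

lemma eval_tree_Node: "eval_tree P (Node x ts) = circ_list P 0 x (map (eval_tree P) ts)"
  by (simp add: full_circ_def circ_list_def)

text \<open>\<open>S\<close> is any family closed under composition, so one proof serves both for
  the arity components, where the weight index is ignored, and for the components of fixed
  weight.\<close>

lemma circ_list_closed:
  fixes S :: "nat \<Rightarrow> nat \<Rightarrow> 'v set"
  assumes circ: "\<And>n k m l a b i. \<lbrakk>a \<in> S n k; b \<in> S m l; i < n\<rbrakk> \<Longrightarrow> circ P i a b \<in> S (n + m - 1) (k + l)"
    and "x \<in> S n v" "j + length ts \<le> n" "\<And>t. t \<in> set ts \<Longrightarrow> y t \<in> S (m t) (w t)"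
  shows "circ_list P j x (map y ts) \<in> S (n + sum_list (map m ts) - length ts) (v + sum_list (map w ts))"
  using assms(2-4)
proof (induction ts arbitrary: j)
  case (Cons t ts)
  let ?N = "n + sum_list (map m ts) - length ts"
  have "circ_list P (Suc j) x (map y ts) \<in> S ?N (v + sum_list (map w ts))"
    by (rule Cons.IH) (use Cons.prems in auto)
  then have "circ P j (circ_list P (Suc j) x (map y ts)) (y t)
      \<in> S (?N + m t - 1) (v + sum_list (map w ts) + w t)"
    by (rule circ) (use Cons.prems in auto)
  moreover have "?N + m t - 1 = n + sum_list (map m (t # ts)) - length (t # ts)"
    using Cons.prems by simp
  moreover have "v + sum_list (map w ts) + w t = v + sum_list (map w (t # ts))"
    by simp
  ultimately show ?case by (simp only: list.map circ_list_simps)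
qed simp

lemma eval_tree_closed:
  fixes S :: "nat \<Rightarrow> nat \<Rightarrow> 'v set"
  assumes circ: "\<And>n k m l a b i. \<lbrakk>a \<in> S n k; b \<in> S m l; i < n\<rbrakk> \<Longrightarrow> circ P i a b \<in> S (n + m - 1) (k + l)"
    and "ident P \<in> S 1 0" "decorated_by X t" "\<And>n x. x \<in> X n \<Longrightarrow> x \<in> S n 1"
  shows "eval_tree P t \<in> S (leaves t) (vertices t)"
  using assms(3)
proof (induction t)
  case (Node x ts)
  have "circ_list P 0 x (map (eval_tree P) ts)
      \<in> S (length ts + sum_list (map leaves ts) - length ts) (1 + sum_list (map vertices ts))"
    by (rule circ_list_closed[where S = S, OF circ]) (use Node assms(4) in auto)
  then show ?case by (simp add: eval_tree_Node del: eval_tree.simps)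
qed (use assms(2) in simp)

text \<open>The morphism from the free operad that sends each generator \<open>x\<close> to
  \<open>h x\<close>. Renaming the labels first allows generators of a type different from that of
  the operad.\<close>

definition free_hom ::
  "('k::field, 'v::ab_group_add) ns_operad \<Rightarrow> ('x \<Rightarrow> 'v) \<Rightarrow> ('x tree \<Rightarrow>\<^sub>0 'k) \<Rightarrow> 'v" where
  "free_hom P h = linear_extension (smul P) (\<lambda>t. eval_tree P (map_tree h t))"

lemma relation_ideal_eq: "relation_ideal P B n = {f \<in> free_operad B n. free_hom P (\<lambda>x. x) f = 0}"
  by (simp add: relation_ideal_def free_hom_def tree.map_ident)

context weight_graded_ns_operad
begin

abbreviation "AP \<equiv> arity_part P"

lemma AP_eq: "AP n = span (\<Union>k. part P n k)"
  by (simp add: arity_part_def)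

lemma part_AP: "a \<in> part P n k \<Longrightarrow> a \<in> AP n"
  unfolding AP_eq by (rule span_base) auto

lemma subspace_AP [simp]: "subspace (AP n)"
  by (simp add: AP_eq)

lemma AP_closed [simp]:
  "0 \<in> AP n" "\<lbrakk>a \<in> AP n; b \<in> AP n\<rbrakk> \<Longrightarrow> a + b \<in> AP n" "a \<in> AP n \<Longrightarrow> smul P c a \<in> AP n"
  "(\<And>i. i \<in> A \<Longrightarrow> g i \<in> AP n) \<Longrightarrow> sum g A \<in> AP n"
  by (auto intro: subspace_0 subspace_add subspace_scale subspace_sum)

lemma AP_induct [consumes 1, case_names zero add]:
  assumes "a \<in> AP n" "Q 0"
    and "\<And>c k x y. \<lbrakk>x \<in> part P n k; y \<in> AP n; Q y\<rbrakk> \<Longrightarrow> Q (smul P c x + y)"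
  shows "Q a"
proof -
  have "a \<in> AP n \<and> Q a"
    using assms(1) unfolding AP_eq
  proof (induction rule: span_induct_alt)
    case (step c x y)
    then obtain k where k: "x \<in> part P n k" by auto
    show ?case
      using assms(3)[OF k, of y c] step(2) span_base[OF step(1)]
      by (auto simp: AP_eq intro!: span_add span_scale)
  qed (simp add: assms(2) span_zero)
  then show ?thesis ..
qed

lemma ident_part: "ident P \<in> part P 1 0"
  unfolding connected_one by (rule span_base) simp

lemma ident_AP [simp]: "ident P \<in> AP 1" "ident P \<in> AP (Suc 0)"
  using part_AP[OF ident_part] by simp_all

lemma circ_zero_left [simp]: "\<lbrakk>b \<in> AP m; i < n\<rbrakk> \<Longrightarrow> circ P i 0 b = 0"
  using circ_smul_left[of 0 n b m i 0] by simp

lemma circ_zero_right [simp]: "\<lbrakk>a \<in> AP n; i < n\<rbrakk> \<Longrightarrow> circ P i a 0 = 0"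
  using circ_smul_right[of a n 0 m i 0] by simp

lemma circ_AP: "\<lbrakk>a \<in> AP n; b \<in> AP m; i < n\<rbrakk> \<Longrightarrow> circ P i a b \<in> AP (n + m - 1)"
proof (induction a rule: AP_induct)
  case (add c k x y)
  have x: "x \<in> AP n" using add(1) by (rule part_AP)
  have "circ P i x b \<in> AP (n + m - 1)" using add(4)
  proof (induction b rule: AP_induct)
    case (add c' l x' y')
    then show ?case
      using part_AP[OF \<open>x \<in> part P n k\<close>] part_AP[OF add(1)] circ_part[OF \<open>x \<in> part P n k\<close> add(1) \<open>i < n\<close>] \<open>i < n\<close>
      by (simp add: circ_add_right[of _ n _ m] circ_smul_right[of _ n _ m] part_AP)
  qed (use add x in auto)
  then show ?case using add x
    by (simp add: circ_add_left[of _ n _ _ m] circ_smul_left[of _ n _ m])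
qed auto

lemma circ_list_AP:
  "\<lbrakk>x \<in> AP n; j + length ts \<le> n; \<And>t. t \<in> set ts \<Longrightarrow> y t \<in> AP (m t)\<rbrakk> \<Longrightarrow>
    circ_list P j x (map y ts) \<in> AP (n + sum_list (map m ts) - length ts)"
  using circ_list_closed[of "\<lambda>n k. AP n" P x n undefined j ts y m] circ_AP by blast

lemma circ_list_ident: "\<lbrakk>x \<in> AP n; k + m \<le> n\<rbrakk> \<Longrightarrow> circ_list P k x (replicate m (ident P)) = x"
  by (induction m arbitrary: k) (simp_all add: circ_ident_right[of _ n])

lemma eval_corolla: "x \<in> AP n \<Longrightarrow> eval_tree P (corolla n x) = x"
  by (simp add: eval_tree_Node circ_list_ident del: eval_tree.simps(2))

context
  fixes X :: "nat \<Rightarrow> 'v set"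
  assumes X: "\<And>n x. x \<in> X n \<Longrightarrow> x \<in> AP n"
begin

lemma eval_tree_AP: "decorated_by X t \<Longrightarrow> eval_tree P t \<in> AP (leaves t)"
  using eval_tree_closed[of "\<lambda>n k. AP n" P X t] circ_AP X by auto

text \<open>The children are inserted from right to left. If the grafted leaf lies in the child
  inserted last, the sequential law moves the new insertion into that child; otherwise the parallel
  law moves it past that child.\<close>

lemma eval_tree_graft:
  "\<lbrakk>decorated_by X s; decorated_by X t; i < leaves s\<rbrakk> \<Longrightarrow>
    eval_tree P (graft i s t) = circ P i (eval_tree P s) (eval_tree P t)"
  and circ_list_graft:
  "\<lbrakk>list_all (decorated_by X) ss; decorated_by X t; i < sum_list (map leaves ss)\<rbrakk> \<Longrightarrow>
    \<forall>x k n. x \<in> AP n \<longrightarrow> k + length ss \<le> n \<longrightarrow>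
      circ_list P k x (map (eval_tree P) (graft_list i ss t))
      = circ P (k + i) (circ_list P k x (map (eval_tree P) ss)) (eval_tree P t)"
proof (induction i s t and i ss t rule: graft_graft_list.induct)
  case (1 i t)
  then show ?case using circ_ident_left[OF eval_tree_AP] by simp
next
  case (2 i x ss t)
  then show ?case using X[of x "length ss"] 
    by (auto simp: eval_tree_Node list_all_iff simp del: eval_tree.simps(2))
next
  case (4 i s ss t)
  show ?case
  proof (intro allI impI)
    fix x k n assume x: "x \<in> AP n" and k: "k + length (s # ss) \<le> n"
    define G where "G = circ_list P (Suc k) x (map (eval_tree P) ss)"
    define N where "N = n + sum_list (map leaves ss) - length ss"
    have G: "G \<in> AP N" unfolding G_def N_def
      by (rule circ_list_AP[OF x]) (use k 4(3) in \<open>auto simp: list_all_iff eval_tree_AP\<close>)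
    have s: "eval_tree P s \<in> AP (leaves s)" and t: "eval_tree P t \<in> AP (leaves t)"
      using 4(3,4) by (auto intro: eval_tree_AP)
    have kN: "k < N" using k by (simp add: N_def)
    show "circ_list P k x (map (eval_tree P) (graft_list i (s # ss) t))
      = circ P (k + i) (circ_list P k x (map (eval_tree P) (s # ss))) (eval_tree P t)"
    proof (cases "i < leaves s")
      case True
      then show ?thesis
        using 4 circ_sequential[OF G s t kN True] by (simp add: G_def)
    next
      case False
      \<comment> \<open>The position of the leaf before \<open>s\<close> is inserted, while
        \<open>s\<close> still occupies the single input \<open>k\<close>.\<close>
      let ?j = "Suc k + (i - leaves s)"
      have j: "k < ?j" "?j < N" "?j + leaves s - 1 = k + i"
        using False 4(5) k by (auto simp: N_def)
      have "list_all (decorated_by X) ss" "i - leaves s < sum_list (map leaves ss)"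
        using 4(3,5) False by auto
      from 4(2)[OF False this(1) 4(4) this(2), rule_format, OF x, of "Suc k"] k
      have "circ_list P (Suc k) x (map (eval_tree P) (graft_list (i - leaves s) ss t))
          = circ P ?j G (eval_tree P t)"
        unfolding G_def by simp
      then show ?thesis
        using False circ_parallel[OF G t s j(1,2)] j(3) by (simp add: G_def)
    qed
  qed
qed simp

end

context
  fixes X :: "nat \<Rightarrow> 'x set" and h :: "'x \<Rightarrow> 'v"
  assumes h: "\<And>n x. x \<in> X n \<Longrightarrow> h x \<in> AP n"
begin

lemma decorated_map_tree: "decorated_by X t \<Longrightarrow> decorated_by (\<lambda>n. h ` X n) (map_tree h t)"
  by (induction t) auto

lemma image_AP: "y \<in> h ` X n \<Longrightarrow> y \<in> AP n"
  using h by auto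

lemma eval_map_tree_AP: "t \<in> tree_monomials X n \<Longrightarrow> eval_tree P (map_tree h t) \<in> AP n"
  using eval_tree_AP[OF image_AP decorated_map_tree, of t] by (auto simp: tree_monomials_def)

lemma eval_map_tree_graft:
  "\<lbrakk>s \<in> tree_monomials X n; t \<in> tree_monomials X m; i < n\<rbrakk> \<Longrightarrow>
    eval_tree P (map_tree h (graft i s t))
    = circ P i (eval_tree P (map_tree h s)) (eval_tree P (map_tree h t))"
  unfolding map_tree_graft
  by (rule eval_tree_graft[OF image_AP])
     (auto simp: tree_monomials_def intro: decorated_map_tree)

lemma free_hom_AP: "f \<in> free_operad X n \<Longrightarrow> free_hom P h f \<in> AP n"
  unfolding free_hom_def free_operad_def
  by (rule linear_extension_in_subspace) (auto intro: eval_map_tree_AP)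

lemma free_hom_circ:
  assumes "f \<in> free_operad X n" "g \<in> free_operad X m" "i < n"
  shows "free_hom P h (free_circ i f g) = circ P i (free_hom P h f) (free_hom P h g)"
proof -
  have f: "keys f \<subseteq> tree_monomials X n" and g: "keys g \<subseteq> tree_monomials X m"
    using assms by (auto simp: free_operad_def)
  have 1: "free_hom P h (free_circ i (single s c) g) = circ P i (free_hom P h (single s c)) (free_hom P h g)"
    if s: "s \<in> tree_monomials X n" for s c
    using g
  proof (induction g rule: keys_subset_induct)
    case zero
    then show ?case
      using assms(3) circ_zero_right[of "smul P c (eval_tree P (map_tree h s))" n i]
        eval_map_tree_AP[OF s] by (simp add: free_hom_def)
  next
    case (add t c' g)
    have "free_hom P h g \<in> AP m" by (rule free_hom_AP) (use add in \<open>auto simp: free_operad_def\<close>)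
    then show ?case
      using add s assms(3) eval_map_tree_AP[OF s] eval_map_tree_AP[OF add(1)] 
      by (simp add: free_hom_def linear_extension_add eval_map_tree_graft circ_add_right[of _ n _ m]
          circ_smul_left[of _ n _ m] circ_smul_right[of _ n _ m])
  qed
  show ?thesis
    using f
  proof (induction f rule: keys_subset_induct)
    case zero
    then show ?case using free_hom_AP[OF assms(2)] assms(3) by (simp add: free_hom_def)
  next
    case (add t c f)
    have "free_hom P h f \<in> AP n" by (rule free_hom_AP) (use add in \<open>auto simp: free_operad_def\<close>)
    moreover have "free_hom P h (single t c) \<in> AP n"
      using eval_map_tree_AP[OF add(1)] by (simp add: free_hom_def)
    moreover have "free_hom P h (f' + f'') = free_hom P h f' + free_hom P h f''" for f' f''
      by (simp add: free_hom_def linear_extension_add)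
    ultimately show ?case
      using add(3) 1[OF add(1), of c] free_hom_AP[OF assms(2)] assms(3)
      by (simp add: circ_add_left[of _ n _ _ m])
  qed
qed

lemma free_hom_corolla: "x \<in> X n \<Longrightarrow> free_hom P h (single (corolla n x) c) = smul P c (h x)"
  using eval_corolla[OF h, of x n] by (simp add: free_hom_def map_replicate_const)

end

lemma free_hom_linear [simp]:
  "free_hom P h 0 = 0"
  "free_hom P h (f + g) = free_hom P h f + free_hom P h g"
  "free_hom P h (f - g) = free_hom P h f - free_hom P h g"
  "free_hom P h (pscale c f) = smul P c (free_hom P h f)"
  "free_hom P h (\<Sum>i\<in>A. F i) = (\<Sum>i\<in>A. free_hom P h (F i))"
  "free_hom P h (single Leaf c) = smul P c (ident P)"
  by (simp_all add: free_hom_def linear_extension_add linear_extension_diff linear_extension_pscale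
      linear_extension_sum)

lemma eval_map_tree_part:
  assumes "\<And>n x. x \<in> X n \<Longrightarrow> h x \<in> part P n 1" "t \<in> tree_monomials X n"
  shows "eval_tree P (map_tree h t) \<in> part P n (vertices t)"
proof -
  have t: "decorated_by X t" "leaves t = n" using assms(2) by (auto simp: tree_monomials_def)
  have "eval_tree P (map_tree h t) \<in> part P (leaves (map_tree h t)) (vertices (map_tree h t))"
    by (rule eval_tree_closed[where S = "part P" and X = "\<lambda>n. h ` X n"])
       (use assms(1) t in \<open>auto intro: decorated_map_tree part_AP
          simp del: One_nat_def intro!: circ_part ident_part\<close>)
  then show ?thesis by (simp add: t)
qed

lemma free_hom_part:
  assumes "\<And>n x. x \<in> X n \<Longrightarrow> h x \<in> part P n 1" "f \<in> free_operad X n" "homogeneous_of_weight w f"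
  shows "free_hom P h f \<in> part P n w"
  unfolding free_hom_def
proof (rule linear_extension_in_subspace[OF part_subspace])
  fix t assume "t \<in> keys f"
  then show "eval_tree P (map_tree h t) \<in> part P n w"
    using eval_map_tree_part[of X h t n] assms by (auto simp: free_operad_def homogeneous_of_weight_def)
qed

end

section \<open>Kernels of morphisms and associativity of bilinear extensions\<close>

lemma free_operad_closed:
  "0 \<in> free_operad X n"
  "\<lbrakk>f \<in> free_operad X n; g \<in> free_operad X n\<rbrakk> \<Longrightarrow> f + g \<in> free_operad X n"
  "\<lbrakk>f \<in> free_operad X n; g \<in> free_operad X n\<rbrakk> \<Longrightarrow> f - g \<in> free_operad X n"
  "f \<in> free_operad X n \<Longrightarrow> pscale c f \<in> free_operad X n"
  "(\<And>i. i \<in> A \<Longrightarrow> F i \<in> free_operad X n) \<Longrightarrow> sum F A \<in> free_operad X n"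
  "t \<in> tree_monomials X n \<Longrightarrow> single t c \<in> free_operad X n"
  "\<lbrakk>f \<in> free_operad X n; g \<in> free_operad X m; i < n\<rbrakk> \<Longrightarrow> free_circ i f g \<in> free_operad X (n + m - 1)"
proof -
  show "\<lbrakk>f \<in> free_operad X n; g \<in> free_operad X n\<rbrakk> \<Longrightarrow> f + g \<in> free_operad X n"
    using Poly_Mapping.keys_add[of f g] by (auto simp: free_operad_def)
  show "\<lbrakk>f \<in> free_operad X n; g \<in> free_operad X n\<rbrakk> \<Longrightarrow> f - g \<in> free_operad X n"
    using keys_minus_subset[of f g] by (auto simp: free_operad_def)
  show "f \<in> free_operad X n \<Longrightarrow> pscale c f \<in> free_operad X n"
    using keys_pscale[of c f] by (auto simp: free_operad_def)
  show "(\<And>i. i \<in> A \<Longrightarrow> F i \<in> free_operad X n) \<Longrightarrow> sum F A \<in> free_operad X n"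
    using keys_sum_subset[of F A] unfolding free_operad_def by blast
  show "\<lbrakk>f \<in> free_operad X n; g \<in> free_operad X m; i < n\<rbrakk> \<Longrightarrow>
      free_circ i f g \<in> free_operad X (n + m - 1)"
    using keys_free_circ[of i f g] tree_monomials_graft unfolding free_operad_def by fastforce
qed (auto simp: free_operad_def)

text \<open>The kernel of a morphism is an ideal. Applied to a well chosen target operad, this is
  the tool for showing that an element does not lie in a given ideal.\<close>

lemma generated_ideal_kernel:
  assumes "weight_graded_ns_operad P" "\<And>n x. x \<in> X n \<Longrightarrow> h x \<in> arity_part P n"
    and R: "\<And>n f. f \<in> R n \<Longrightarrow> f \<in> free_operad X n \<and> free_hom P h f = 0"
    and "generated_ideal X R n f"
  shows "f \<in> free_operad X n \<and> free_hom P h f = 0"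
proof -
  interpret weight_graded_ns_operad P by fact
  show ?thesis using assms(4)
  proof (induction rule: generated_ideal.induct)
    case (ideal_left n f g m i)
    then show ?case
      using free_hom_circ[of X h f n g m i] free_hom_AP[of X h g m] assms(2)
        free_operad_closed(7)[of f X n g m i]
      by simp
  next
    case (ideal_right g m n f i)
    then show ?case
      using free_hom_circ[of X h g m f n i] free_hom_AP[of X h g m] assms(2)
        free_operad_closed(7)[of g X m f n i]
      by simp
  qed (use R in \<open>auto simp: free_operad_closed\<close>)
qed

text \<open>Both sides are trilinear, so triples of basis elements suffice. The inner values
  \<open>G s t\<close> and \<open>G' t u\<close> are arbitrary combinations, which covers grafting
  as well as compositions of labels that may vanish.\<close>

lemma bilinear_extension_assoc:
  assumes f: "keys f \<subseteq> S" and g: "keys g \<subseteq> T" and h: "keys h \<subseteq> U"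
    and eq: "\<And>s t u. \<lbrakk>s \<in> S; t \<in> T; u \<in> U\<rbrakk> \<Longrightarrow>
      bilinear_extension F (G s t) (single u 1) = bilinear_extension F' (single s 1) (G' t u)"
  shows "bilinear_extension F (bilinear_extension G f g) h
    = bilinear_extension F' f (bilinear_extension G' g h)"
  using f
proof (induction f rule: keys_subset_induct)
  case (add s x f)
  have "bilinear_extension F (bilinear_extension G (single s x) g) h
    = bilinear_extension F' (single s x) (bilinear_extension G' g h)"
    using g
  proof (induction g rule: keys_subset_induct)
    case (add t y g)
    have "bilinear_extension F (bilinear_extension G (single s x) (single t y)) h
      = bilinear_extension F' (single s x) (bilinear_extension G' (single t y) h)"
      using h
    proof (induction h rule: keys_subset_induct)
      case (add u z h)
      have *: "single u z = pscale z (single u 1)" "single s x = pscale x (single s 1)" by simp_all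
      have "bilinear_extension F (bilinear_extension G (single s x) (single t y)) (single u z)
        = pscale (x * y * z) (bilinear_extension F (G s t) (single u 1))"
        by (subst *(1), simp only: bilinear_extension_simps pscale.scale_scale) (simp add: mult_ac)
      also have "\<dots> = bilinear_extension F' (single s x) (bilinear_extension G' (single t y) (single u z))"
        unfolding eq[OF \<open>s \<in> S\<close> \<open>t \<in> T\<close> \<open>u \<in> U\<close>]
        by (subst *(2), simp only: bilinear_extension_simps pscale.scale_scale) (simp add: mult_ac)
      finally show ?case using add by simp
    qed simp
    then show ?case using add by simp
  qed simp
  then show ?case using add by simp
qed simp

lemma bilinear_extension_swap:
  assumes f: "keys f \<subseteq> S" and g: "keys g \<subseteq> T" and h: "keys h \<subseteq> U"
    and eq: "\<And>s t u. \<lbrakk>s \<in> S; t \<in> T; u \<in> U\<rbrakk> \<Longrightarrow>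
      bilinear_extension F (G s t) (single u 1) = bilinear_extension F' (G' s u) (single t 1)"
  shows "bilinear_extension F (bilinear_extension G f g) h
    = bilinear_extension F' (bilinear_extension G' f h) g"
  using f
proof (induction f rule: keys_subset_induct)
  case (add s x f)
  have "bilinear_extension F (bilinear_extension G (single s x) g) h
    = bilinear_extension F' (bilinear_extension G' (single s x) h) g"
    using g
  proof (induction g rule: keys_subset_induct)
    case (add t y g)
    have "bilinear_extension F (bilinear_extension G (single s x) (single t y)) h
      = bilinear_extension F' (bilinear_extension G' (single s x) h) (single t y)"
      using h
    proof (induction h rule: keys_subset_induct)
      case (add u z h)
      have *: "single u z = pscale z (single u 1)" "single t y = pscale y (single t 1)" by simp_all
      have "bilinear_extension F (bilinear_extension G (single s x) (single t y)) (single u z)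
        = pscale (x * y * z) (bilinear_extension F (G s t) (single u 1))"
        by (subst *(1), simp only: bilinear_extension_simps pscale.scale_scale) (simp add: mult_ac)
      also have "\<dots> = bilinear_extension F' (bilinear_extension G' (single s x) (single u z)) (single t y)"
        unfolding eq[OF \<open>s \<in> S\<close> \<open>t \<in> T\<close> \<open>u \<in> U\<close>]
        by (subst *(2), simp only: bilinear_extension_simps pscale.scale_scale) (simp add: mult_ac)
      finally show ?case using add by simp
    qed simp
    then show ?case using add by simp
  qed simp
  then show ?case using add by simp
qed simp

subsection \<open>The free operad and Veronese powers\<close>

text \<open>The free operad is made an instance of the same record, so that a substitution of
  generators is itself a morphism \<open>free_hom\<close> and needs no separate theory.\<close>

definition free_ns_operad :: "(nat \<Rightarrow> 'x set) \<Rightarrow> ('k::field, 'x tree \<Rightarrow>\<^sub>0 'k) ns_operad" where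
  "free_ns_operad X = \<lparr>smul = pscale, part = (\<lambda>n k. {f \<in> free_operad X n. homogeneous_of_weight k f}),
    ident = single Leaf 1, circ = free_circ\<rparr>"

lemma free_ns_operad_simps [simp]:
  "smul (free_ns_operad X) = pscale" "ident (free_ns_operad X) = single Leaf 1"
  "circ (free_ns_operad X) = free_circ"
  "part (free_ns_operad X) n k = {f \<in> free_operad X n. homogeneous_of_weight k f}"
  by (simp_all add: free_ns_operad_def)

lemma free_operad_subspace: "pscale.subspace (free_operad X n)"
  by (auto simp: pscale.subspace_def free_operad_closed)

lemma arity_part_free: "arity_part (free_ns_operad X) n \<subseteq> free_operad X n"
  unfolding arity_part_def free_ns_operad_simps
  by (rule pscale.span_minimal[OF _ free_operad_subspace]) auto

lemma homogeneous_closed: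
  "homogeneous_of_weight w 0"
  "\<lbrakk>homogeneous_of_weight w f; homogeneous_of_weight w g\<rbrakk> \<Longrightarrow> homogeneous_of_weight w (f + g)"
  "homogeneous_of_weight w f \<Longrightarrow> homogeneous_of_weight w (pscale c f)"
  "vertices t = w \<Longrightarrow> homogeneous_of_weight w (single t c)"
  using Poly_Mapping.keys_add[of f g] keys_pscale[of c f] by (auto simp: homogeneous_of_weight_def)

lemma homogeneous_free_circ:
  assumes "f \<in> free_operad X n" "homogeneous_of_weight k f" "homogeneous_of_weight l g" "i < n"
  shows "homogeneous_of_weight (k + l) (free_circ i f g)"
  unfolding homogeneous_of_weight_def
proof
  fix t assume "t \<in> keys (free_circ i f g)"
  then obtain s u where "s \<in> keys f" "u \<in> keys g" "t = graft i s u"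
    using keys_free_circ[of i f g] by auto
  then show "vertices t = k + l"
    using assms by (auto simp: homogeneous_of_weight_def free_operad_def tree_monomials_def
        vertices_graft dest!: subsetD)
qed

lemma decorated_by_vertices_0: "vertices t = 0 \<longleftrightarrow> t = Leaf"
  by (cases t) auto

lemma keys_subset_singleton: "keys f \<subseteq> {a} \<Longrightarrow> f = single a (lookup f a)"
  by (rule poly_mapping_eqI) (auto simp: lookup_single when_def in_keys_iff)

lemma decorated_leaves_pos: "\<lbrakk>X 0 = {}; decorated_by X t\<rbrakk> \<Longrightarrow> leaves t > 0"
proof (induction t)
  case (Node x ts)
  then have "ts \<noteq> []" by auto
  then show ?case using Node by (cases ts) auto
qed simp

text \<open>Without nullary generators every tree has a leaf, which is what \<open>reduced\<close>
  demands; the remaining laws are those of grafting.\<close>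

lemma free_operad_is_operad:
  assumes X: "X 0 = {}"
  shows "weight_graded_ns_operad (free_ns_operad X :: ('k::field, 'x tree \<Rightarrow>\<^sub>0 'k) ns_operad)"
proof -
  let ?F = "free_ns_operad X :: ('k, 'x tree \<Rightarrow>\<^sub>0 'k) ns_operad"
  have AD: "keys f \<subseteq> tree_monomials X n" if "f \<in> arity_part ?F n" for f n
    using that arity_part_free[of X n] by (auto simp: free_operad_def)
  show ?thesis
  \<comment> \<open>Goals 1 to 4 are the vector space axioms; from goal 5 on they follow the
    assumptions of \<open>weight_graded_ns_operad\<close> in order.\<close>
  proof (unfold_locales, goal_cases)
    case (5 n k)
    show ?case
      by (auto simp: pscale.subspace_def free_operad_closed homogeneous_closed)
  next
    case (6 K v n l)
    have "lookup (v l) t = 0" for t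
    proof (cases "vertices t = l")
      case True
      then have "lookup (v k) t = 0" if "k \<in> K" "k \<noteq> l" for k
        using 6(2)[OF that(1)] that(2) by (auto simp: homogeneous_of_weight_def in_keys_iff)
      then have "(\<Sum>k\<in>K. lookup (v k) t) = lookup (v l) t"
        using 6(1,4) by (subst sum.remove[of K l]) auto
      then show ?thesis using arg_cong[OF 6(3), of "\<lambda>f. lookup f t"] by (simp add: lookup_sum)
    next
      case False
      then show ?thesis using 6(2)[OF 6(4)] by (auto simp: homogeneous_of_weight_def in_keys_iff)
    qed
    then show ?case by (intro poly_mapping_eqI) simp
  next
    case (7 a n k b m l i)
    then show ?case
      using free_operad_closed(7)[of a X n b m i] homogeneous_free_circ[of a X n k l b i] by simp
  next
    case (12 a n b m e p i j)
    show ?case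
      using bilinear_extension_assoc[OF AD[OF 12(1)] AD[OF 12(2)] AD[OF 12(3)],
          of "\<lambda>s t. single (graft (i + j) s t) 1" "\<lambda>s t. single (graft i s t) 1"
             "\<lambda>s t. single (graft i s t) 1" "\<lambda>s t. single (graft j s t) 1"] 12(4,5)
      by (simp add: free_circ_eq_bilinear tree_monomials_def graft_sequential)
  next
    case (13 a n b m e p i j)
    show ?case
      using bilinear_extension_swap[OF AD[OF 13(1)] AD[OF 13(2)] AD[OF 13(3)],
          of "\<lambda>s t. single (graft i s t) 1" "\<lambda>s t. single (graft j s t) 1"
             "\<lambda>s t. single (graft (j + p - 1) s t) 1" "\<lambda>s t. single (graft i s t) 1"] 13(4,5)
      by (simp add: free_circ_eq_bilinear tree_monomials_def graft_parallel)
  next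
    case (14 a n)
    show ?case using AD[OF 14]
      by (induction a rule: keys_subset_induct) simp_all
  next
    case (15 a n i)
    show ?case using AD[OF 15(1)]
      by (induction a rule: keys_subset_induct) (simp_all add: graft_Leaf)
  next
    case (16 k)
    have "tree_monomials X 0 = {}"
      using decorated_leaves_pos[of X] X by (auto simp: tree_monomials_def)
    then show ?case by (auto simp: free_operad_def homogeneous_closed)
  next
    case 17
    show ?case
    proof (intro equalityI subsetI)
      fix f assume "f \<in> part ?F 1 0"
      then have "keys f \<subseteq> {Leaf}"
        by (auto simp: homogeneous_of_weight_def decorated_by_vertices_0)
      then have "f = pscale (lookup f Leaf) (single Leaf 1)"
        using keys_subset_singleton by simp
      then show "f \<in> module.span (smul ?F) {ident ?F}"
        by (metis free_ns_operad_simps(1,2) pscale.span_base pscale.span_scale singletonI)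
    next
      fix f assume "f \<in> module.span (smul ?F) {ident ?F}"
      then have "f \<in> pscale.span {single Leaf 1}" by simp
      then obtain c where "f = pscale c (single Leaf 1)"
        by (auto simp: pscale.span_singleton)
      then show "f \<in> part ?F 1 0"
        using free_operad_closed(6)[OF Leaf_in_tree_monomials, of c X]
        by (simp add: homogeneous_closed)
    qed
  next
    case 18
    have "lookup (single Leaf 1 :: 'x tree \<Rightarrow>\<^sub>0 'k) Leaf \<noteq> 0" by simp
    then show ?case by (metis free_ns_operad_simps(2) lookup_zero)
  next
    case (19 n)
    have "keys f = {}" if "f \<in> free_operad X n" "homogeneous_of_weight 0 f" for f :: "'x tree \<Rightarrow>\<^sub>0 'k"
    proof (rule equals0I)
      fix t assume t: "t \<in> keys f"
      then have "t = Leaf" using that(2) by (auto simp: homogeneous_of_weight_def decorated_by_vertices_0)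
      moreover have "t \<in> tree_monomials X n" using t that(1) by (auto simp: free_operad_def)
      ultimately show False using 19 by (simp add: tree_monomials_def)
    qed
    then show ?case
      by (auto simp: free_operad_closed homogeneous_closed) 
  qed (auto simp: algebra_simps)
qed

lemma veronese_simps [simp]:
  "smul (veronese P d) = smul P" "ident (veronese P d) = ident P" "circ (veronese P d) = circ P"
  "part (veronese P d) n k = {a \<in> part P n (k * d). generated_suboperad P (\<lambda>m. part P m d) n a}"
  by (simp_all add: veronese_def)

text \<open>Weight \<open>k\<close> of the Veronese power is weight \<open>k * d\<close> of
  \<open>P\<close>. For \<open>d \<ge> 1\<close> different weights stay different, so the
  independence of the components is inherited by reindexing.\<close>

lemma veronese_is_operad:
  assumes "weight_graded_ns_operad P" "d \<ge> 1"
  shows "weight_graded_ns_operad (veronese P d)"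
proof -
  interpret weight_graded_ns_operad P by fact
  have AP': "a \<in> AP n" if "a \<in> arity_part (veronese P d) n" for a n
    using that unfolding arity_part_def veronese_simps
    by (rule subsetD[OF span_mono, rotated]) auto
  show ?thesis
  proof (unfold_locales, goal_cases)
    case (5 n k)
    show ?case
      using part_subspace[of n "k * d"]
      by (auto simp: subspace_def intro: gen_zero gen_add gen_smul)
  next
    case (6 K v n l)
    have inj: "inj_on (\<lambda>k. k * d) K" using assms(2) by (auto simp: inj_on_def)
    have div: "k * d div d = k" for k using assms(2) by simp
    have "v (l * d div d) = 0"
    proof (rule part_independent[of "(\<lambda>k. k * d) ` K" "\<lambda>m. v (m div d)" n])
      show "(\<Sum>k\<in>(\<lambda>k. k * d) ` K. v (k div d)) = 0"
        using 6(3) by (subst sum.reindex[OF inj]) (simp add: div)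
    qed (use 6 div in auto)
    then show ?case by (simp add: div)
  next
    case (7 a n k b m l i)
    then show ?case
      using circ_part[of a n "k * d" b m "l * d" i] gen_circ[of P "\<lambda>m. part P m d" n a m b i]
      by (simp add: add_mult_distrib)
  next
    case 17
    have "generated_suboperad P (\<lambda>m. part P m d) 1 a" if "a \<in> span {ident P}" for a
      using that gen_smul[OF gen_ident] by (auto simp: span_singleton)
    then show ?case using connected_one(1) by auto
  next
    case (12 a n b m e p i j)
    show ?case using circ_sequential[OF AP'[OF 12(1)] AP'[OF 12(2)] AP'[OF 12(3)] 12(4,5)] by simp
  next
    case (13 a n b m e p i j)
    show ?case using circ_parallel[OF AP'[OF 13(1)] AP'[OF 13(2)] AP'[OF 13(3)] 13(4,5)] by simp
  next
    case (19 n)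
    then show ?case using connected[of n] gen_zero by auto
  qed (use AP' reduced connected_one gen_zero in \<open>auto simp: scale_right_distrib scale_left_distrib intro!: circ_add_left circ_add_right circ_smul_left
     circ_smul_right circ_ident_left circ_ident_right\<close>)
qed

subsection \<open>Ideals and homogeneous components\<close>

lemma generated_ideal_subspace: "pscale.subspace (Collect (generated_ideal X R n))"
  by (auto simp: pscale.subspace_def intro: ideal_zero ideal_add ideal_scale)

lemma generated_ideal_mono:
  assumes "generated_ideal X R n f" "\<And>n f. f \<in> R n \<Longrightarrow> generated_ideal X R' n f"
  shows "generated_ideal X R' n f"
  using assms(1) by (induction rule: generated_ideal.induct)
    (use assms(2) in \<open>auto intro: generated_ideal.intros simp del: One_nat_def\<close>)

lemma generated_ideal_free:
  assumes "generated_ideal X R n f" "\<And>n. R n \<subseteq> free_operad X n"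
  shows "f \<in> free_operad X n"
  using assms(1) by (induction rule: generated_ideal.induct)
    (use assms(2) in \<open>auto intro!: free_operad_closed simp del: One_nat_def\<close>)

definition hcomp :: "nat \<Rightarrow> ('x tree \<Rightarrow>\<^sub>0 'k::field) \<Rightarrow> ('x tree \<Rightarrow>\<^sub>0 'k)" where
  "hcomp w = linear_extension pscale (\<lambda>t. if vertices t = w then single t 1 else 0)"

lemma hcomp_linear [simp]:
  "hcomp w 0 = 0" "hcomp w (f + g) = hcomp w f + hcomp w g" "hcomp w (pscale c f) = pscale c (hcomp w f)"
  "hcomp w (single t c) = (if vertices t = w then single t c else 0)"
  by (simp_all add: hcomp_def pscale.linear_extension_add pscale.linear_extension_pscale)

lemma lookup_hcomp: "lookup (hcomp w f) t = (if vertices t = w then lookup f t else 0)"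
  using subset_UNIV[of "keys f"]
  by (induction f rule: keys_subset_induct) (auto simp: lookup_add lookup_single when_def)

lemma hcomp_homogeneous [simp]: "homogeneous_of_weight w (hcomp w f)"
  by (auto simp: homogeneous_of_weight_def in_keys_iff lookup_hcomp split: if_splits)

lemma hcomp_of_homogeneous:
  "homogeneous_of_weight v f \<Longrightarrow> hcomp w f = (if v = w then f else 0)"
  by (intro poly_mapping_eqI) (auto simp: lookup_hcomp homogeneous_of_weight_def in_keys_iff)

lemma hcomp_free: "f \<in> free_operad X n \<Longrightarrow> hcomp w f \<in> free_operad X n"
  by (auto simp: free_operad_def in_keys_iff lookup_hcomp split: if_splits)

text \<open>\<open>Leaf\<close> is the only tree without vertices. This isolates the factors of a
  composition that do not raise the weight.\<close>

lemma hcomp_0_free: "f \<in> free_operad X n \<Longrightarrow> hcomp 0 f = 0 \<or> n = 1 \<and> (\<exists>c. hcomp 0 f = single Leaf c)"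
proof -
  assume "f \<in> free_operad X n"
  then have *: "hcomp 0 f \<in> free_operad X n" by (rule hcomp_free)
  have "keys (hcomp 0 f) \<subseteq> {Leaf}"
    by (auto simp: in_keys_iff lookup_hcomp decorated_by_vertices_0 split: if_splits)
  then have s: "hcomp 0 f = single Leaf (lookup (hcomp 0 f) Leaf)" by (rule keys_subset_singleton)
  show ?thesis
  proof (cases "lookup (hcomp 0 f) Leaf = 0")
    case False
    then have "Leaf \<in> tree_monomials X n" using * by (auto simp: free_operad_def in_keys_iff)
    then show ?thesis using s by (auto simp: tree_monomials_def)
  qed (use s in simp)
qed

lemma sum_hcomp: "(\<Sum>w\<in>vertices ` keys f. hcomp w f) = f"
  by (rule poly_mapping_eqI) (auto simp: lookup_sum lookup_hcomp in_keys_iff)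

lemma hcomp_free_circ:
  assumes "f \<in> free_operad X n" "i < n"
  shows "hcomp w (free_circ i f g) = (\<Sum>u\<le>w. free_circ i (hcomp u f) (hcomp (w - u) g))"
proof -
  have "keys f \<subseteq> {s. i < leaves s}" using assms by (auto simp: free_operad_def tree_monomials_def)
  then show ?thesis
  proof (induction f rule: keys_subset_induct)
    case (add s x f)
    have "hcomp w (free_circ i (single s x) g)
        = (\<Sum>u\<le>w. free_circ i (hcomp u (single s x)) (hcomp (w - u) g))"
      using subset_UNIV[of "keys g"]
    proof (induction g rule: keys_subset_induct)
      case (add t y g)
      have "(\<Sum>u\<le>w. free_circ i (hcomp u (single s x)) (hcomp (w - u) (single t y)))
          = (\<Sum>u\<le>w. if u = vertices s then free_circ i (single s x) (hcomp (w - u) (single t y)) else 0)"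
        by (intro sum.cong) auto
      also have "\<dots> = hcomp w (free_circ i (single s x) (single t y))"
        using \<open>s \<in> _\<close> by (auto simp: sum.delta vertices_graft)
      finally show ?case using add by (simp add: sum.distrib)
    qed simp
    then show ?case using add by (simp add: sum.distrib)
  qed simp
qed

lemma free_circ_Leaf_right: "free_circ i f (single Leaf c) = pscale c f"
  using subset_UNIV[of "keys f"]
  by (induction f rule: keys_subset_induct) (simp_all add: graft_Leaf pscale.scale_right_distrib mult.commute)

lemma free_circ_Leaf_left: "free_circ 0 (single Leaf c) f = pscale c f"
  using subset_UNIV[of "keys f"]
  by (induction f rule: keys_subset_induct) (simp_all add: pscale.scale_right_distrib)

text \<open>
  Modulo the ideal generated by relations of lower weight, the weight \<open>w\<close> part of an ideal is
  spanned by the generators of weight \<open>w\<close>: composing with anything but a multiple of the unit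
  raises the weight.
\<close>

lemma generated_ideal_hcomp:
  assumes "generated_ideal X R n f" and R: "\<And>n. R n \<subseteq> free_operad X n"
    and hom: "\<And>n f. f \<in> R n \<Longrightarrow> \<exists>w. homogeneous_of_weight w f"
  shows "\<exists>a b. hcomp w f = a + b \<and>
    generated_ideal X (\<lambda>n. {g \<in> R n. \<exists>v<w. homogeneous_of_weight v g}) n a \<and>
    b \<in> pscale.span {g \<in> R n. homogeneous_of_weight w g}"
proof -
  define L where "L = (\<lambda>w n. {g \<in> R n. \<exists>v<w. homogeneous_of_weight v g})"
  define S where "S = (\<lambda>w n. {g \<in> R n. homogeneous_of_weight w g})"
  \<comment> \<open>All \<open>w\<close> are treated at once, because the part of weight
    \<open>w\<close> of a composition involves the parts of all lower weights of its
    factors.\<close>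
  define Q where "Q = (\<lambda>n f. \<forall>w. \<exists>a b. hcomp w f = a + b \<and> generated_ideal X (L w) n a \<and> b \<in> pscale.span (S w n))"
  \<comment> \<open>For \<open>u < w\<close> the relations of weight \<open>u\<close> that span the
    second summand belong to \<open>L w\<close> themselves, so the whole part of weight
    \<open>u\<close> lies in the ideal of \<open>L w\<close>.\<close>
  have low: "generated_ideal X (L w) n (hcomp u f)" if "Q n f" "u < w" for n f u w
  proof -
    from that obtain a b where ab: "hcomp u f = a + b" "generated_ideal X (L u) n a"
      "b \<in> pscale.span (S u n)" unfolding Q_def by blast
    have "generated_ideal X (L w) n a"
      using ab(2)
    proof (rule generated_ideal_mono)
      fix n f assume "f \<in> L u n"
      then have "f \<in> L w n" unfolding L_def using that(2) less_trans by blast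
      then show "generated_ideal X (L w) n f" by (rule ideal_base)
    qed
    moreover have "pscale.span (S u n) \<subseteq> Collect (generated_ideal X (L w) n)"
      by (rule pscale.span_minimal[OF _ generated_ideal_subspace])
         (use that(2) in \<open>auto simp: S_def L_def intro!: ideal_base\<close>)
    ultimately show ?thesis using ab by (auto intro: ideal_add)
  qed
  have "Q n f" using assms(1)
  proof (induction rule: generated_ideal.induct)
    case (ideal_base f n)
    show ?case unfolding Q_def
    proof
      fix w
      from hom[OF ideal_base] obtain v where v: "homogeneous_of_weight v f" by blast
      have "hcomp w f \<in> pscale.span (S w n)"
        using ideal_base v by (auto simp: S_def hcomp_of_homogeneous[OF v] intro: pscale.span_base pscale.span_zero)
      then show "\<exists>a b. hcomp w f = a + b \<and> generated_ideal X (L w) n a \<and> b \<in> pscale.span (S w n)"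
        by (intro exI[of _ 0] exI[of _ "hcomp w f"]) (simp add: ideal_zero)
    qed
  next
    case (ideal_zero n)
    show ?case unfolding Q_def
      by (intro allI exI[of _ 0]) (simp add: generated_ideal.ideal_zero pscale.span_zero)
  next
    case (ideal_add n f g)
    show ?case unfolding Q_def
    proof
      fix w
      from ideal_add.IH obtain a b a' b' where "hcomp w f = a + b" "generated_ideal X (L w) n a"
        "b \<in> pscale.span (S w n)" "hcomp w g = a' + b'" "generated_ideal X (L w) n a'"
        "b' \<in> pscale.span (S w n)" unfolding Q_def by meson
      then show "\<exists>a b. hcomp w (f + g) = a + b \<and> generated_ideal X (L w) n a \<and> b \<in> pscale.span (S w n)"
        by (intro exI[of _ "a + a'"] exI[of _ "b + b'"])
           (auto intro: generated_ideal.ideal_add pscale.span_add)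
    qed
  next
    case (ideal_scale n f c)
    show ?case unfolding Q_def
    proof
      fix w
      from ideal_scale.IH obtain a b where "hcomp w f = a + b" "generated_ideal X (L w) n a"
        "b \<in> pscale.span (S w n)" unfolding Q_def by meson
      then show "\<exists>a b. hcomp w (pscale c f) = a + b \<and> generated_ideal X (L w) n a \<and> b \<in> pscale.span (S w n)"
        by (intro exI[of _ "pscale c a"] exI[of _ "pscale c b"])
           (auto intro: generated_ideal.ideal_scale pscale.span_scale simp: pscale.scale_right_distrib)
    qed
  next
    case (ideal_left n f g m i)
    have f: "f \<in> free_operad X n" by (rule generated_ideal_free[OF ideal_left(1) R])
    show ?case unfolding Q_def
    proof
      fix w
      let ?h = "\<lambda>u. free_circ i (hcomp u f) (hcomp (w - u) g)"
      have "generated_ideal X (L w) (n + m - 1) (\<Sum>u<w. ?h u)"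
        using pscale.subspace_sum[OF generated_ideal_subspace, of "{..<w}" ?h X "L w" "n + m - 1"]
          generated_ideal.ideal_left[OF low[OF ideal_left.IH] hcomp_free[OF ideal_left(2)] ideal_left(3)] by simp
      moreover have eq: "hcomp w (free_circ i f g) = (\<Sum>u<w. ?h u) + ?h w"
        by (simp add: hcomp_free_circ[OF f ideal_left(3)] lessThan_Suc_atMost[symmetric])
      moreover have "?h w = 0 \<or> m = 1 \<and> (\<exists>c. ?h w = pscale c (hcomp w f))"
        using hcomp_0_free[OF ideal_left(2)] by (auto simp: free_circ_Leaf_right simp del: pscale_single)
      then have "\<exists>a b. ?h w = a + b \<and> generated_ideal X (L w) (n + m - 1) a \<and> b \<in> pscale.span (S w (n + m - 1))"
      proof (elim disjE conjE exE)
        assume "?h w = 0"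
        then show ?thesis by (intro exI[of _ 0]) (simp add: ideal_zero pscale.span_zero)
      next
        fix c assume 2: "m = 1" "?h w = pscale c (hcomp w f)"
        from ideal_left.IH obtain a b where "hcomp w f = a + b" "generated_ideal X (L w) n a"
          "b \<in> pscale.span (S w n)" unfolding Q_def by meson
        then show ?thesis using 2
          by (intro exI[of _ "pscale c a"] exI[of _ "pscale c b"])
             (auto intro: generated_ideal.ideal_scale pscale.span_scale simp: pscale.scale_right_distrib)
      qed
      ultimately show "\<exists>a b. hcomp w (free_circ i f g) = a + b \<and> generated_ideal X (L w) (n + m - 1) a \<and>
          b \<in> pscale.span (S w (n + m - 1))"
        by (elim exE conjE) (rule exI, rule exI, rule conjI[rotated],
          rule conjI[OF generated_ideal.ideal_add], assumption+, simp add: add.assoc)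
    qed
  next
    case (ideal_right g m n f i)
    have f: "f \<in> free_operad X n" by (rule generated_ideal_free[OF ideal_right(2) R])
    show ?case unfolding Q_def
    proof
      fix w
      let ?h = "\<lambda>u. free_circ i (hcomp u g) (hcomp (w - u) f)"
      have "generated_ideal X (L w) (m + n - 1) (\<Sum>u\<in>{0<..w}. ?h u)"
        using pscale.subspace_sum[OF generated_ideal_subspace, of "{0<..w}" ?h X "L w" "m + n - 1"]
          generated_ideal.ideal_right[OF hcomp_free[OF ideal_right(1)] low[OF ideal_right.IH] ideal_right(3)] by simp
      moreover have eq: "hcomp w (free_circ i g f) = (\<Sum>u\<in>{0<..w}. ?h u) + ?h 0"
      proof -
        have "{..w} = insert 0 {0<..w}" by auto
        then show ?thesis by (simp add: hcomp_free_circ[OF ideal_right(1,3)] add.commute)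
      qed
      moreover have "?h 0 = 0 \<or> m = 1 \<and> (\<exists>c. ?h 0 = pscale c (hcomp w f))"
        using hcomp_0_free[OF ideal_right(1)] ideal_right(3)
        by (auto simp: free_circ_Leaf_left simp del: pscale_single)
      then have "\<exists>a b. ?h 0 = a + b \<and> generated_ideal X (L w) (m + n - 1) a \<and> b \<in> pscale.span (S w (m + n - 1))"
      proof (elim disjE conjE exE)
        assume "?h 0 = 0"
        then show ?thesis by (intro exI[of _ 0]) (simp add: ideal_zero pscale.span_zero)
      next
        fix c assume 2: "m = 1" "?h 0 = pscale c (hcomp w f)"
        from ideal_right.IH obtain a b where "hcomp w f = a + b" "generated_ideal X (L w) n a"
          "b \<in> pscale.span (S w n)" unfolding Q_def by meson
        then show ?thesis using 2
          by (intro exI[of _ "pscale c a"] exI[of _ "pscale c b"])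
             (auto intro: generated_ideal.ideal_scale pscale.span_scale simp: pscale.scale_right_distrib)
      qed
      ultimately show "\<exists>a b. hcomp w (free_circ i g f) = a + b \<and> generated_ideal X (L w) (m + n - 1) a \<and>
          b \<in> pscale.span (S w (m + n - 1))"
        by (elim exE conjE) (rule exI, rule exI, rule conjI[rotated],
          rule conjI[OF generated_ideal.ideal_add], assumption+, simp add: add.assoc)
    qed
  qed
  then show ?thesis unfolding Q_def L_def S_def by blast
qed

subsection \<open>Minimal relations\<close>

text \<open>Involves no choice of a minimal set. Whether these relations generate the full ideal is
  the choice-free form of the bound in \<open>minimal_relations_weight_le\<close>.\<close>

definition relations_up_to ::
  "('k::field, 'v::ab_group_add) ns_operad \<Rightarrow> (nat \<Rightarrow> 'v set) \<Rightarrow> nat \<Rightarrow> nat \<Rightarrow> ('v tree \<Rightarrow>\<^sub>0 'k) set" where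
  "relations_up_to P B N n = {f \<in> relation_ideal P B n. \<exists>w\<le>N. homogeneous_of_weight w f}"

context weight_graded_ns_operad
begin

lemma relation_ideal_free: "relation_ideal P B n \<subseteq> free_operad B n"
  by (auto simp: relation_ideal_def)

lemma relation_ideal_subspace: "pscale.subspace (relation_ideal P B n)"
  by (auto simp: pscale.subspace_def relation_ideal_eq free_operad_closed)

lemma generator_basis_part: "generator_basis P B \<Longrightarrow> x \<in> B n \<Longrightarrow> x \<in> part P n 1"
  by (metis generator_basis_def span_base)

lemma generator_basis_0: "generator_basis P B \<Longrightarrow> B 0 = {}"
proof -
  assume B: "generator_basis P B"
  have "B 0 \<subseteq> {0}" using generator_basis_part[OF B, of _ 0] reduced[of 1] by auto
  moreover have "0 \<notin> B 0" using B dependent_zero unfolding generator_basis_def by blast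
  ultimately show ?thesis by blast
qed

context
  fixes B assumes B: "\<And>n x. x \<in> B n \<Longrightarrow> x \<in> part P n 1"
begin

text \<open>Evaluation preserves the weight, and components of different weight are independent in
  \<open>P\<close>; hence each homogeneous part of a relation evaluates to zero separately.\<close>

lemma relation_ideal_hcomp:
  assumes f: "f \<in> relation_ideal P B n"
  shows "hcomp w f \<in> relation_ideal P B n"
proof -
  let ?K = "vertices ` keys f" and ?e = "free_hom P (\<lambda>x. x)"
  have ff: "f \<in> free_operad B n" and f0: "?e f = 0" using f by (auto simp: relation_ideal_eq)
  have "(\<Sum>k\<in>?K. ?e (hcomp k f)) = 0"
    using f0 by (simp only: free_hom_linear(5)[symmetric] sum_hcomp)
  moreover have "?e (hcomp k f) \<in> part P n k" for k
    by (rule free_hom_part[OF B hcomp_free[OF ff] hcomp_homogeneous])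
  ultimately have "?e (hcomp w f) = 0" if "w \<in> ?K"
    using part_independent[of ?K "\<lambda>k. ?e (hcomp k f)" n w] that by auto
  moreover have "hcomp w f = 0" if "w \<notin> ?K"
    using that by (intro poly_mapping_eqI) (auto simp: lookup_hcomp in_keys_iff)
  ultimately show ?thesis using hcomp_free[OF ff] by (cases "w \<in> ?K") (auto simp: relation_ideal_eq free_operad_closed(1))
qed

lemma generated_ideal_relations:
  assumes "generated_ideal B R n f" "\<And>n. R n \<subseteq> relation_ideal P B n"
  shows "f \<in> relation_ideal P B n"
  using generated_ideal_kernel[OF weight_graded_ns_operad_axioms _ _ assms(1), of "\<lambda>x. x"]
    part_AP[OF B] assms(2) by (auto simp: relation_ideal_eq)

text \<open>In each arity and weight a basis \<open>C0\<close> of the relations that follow from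
  lower weights is extended to a basis \<open>C\<close> of all relations; the added vectors form
  \<open>R\<close>. Existence is needed because \<open>minimal_relations_weight_le\<close>
  quantifies universally and could otherwise hold vacuously.\<close>

lemma minimal_relations_exist: "\<exists>R. minimal_defining_relations P B R"
proof -
  define I where "I = (\<lambda>w n. {f \<in> relation_ideal P B n. homogeneous_of_weight w f})"
  define J where "J = (\<lambda>w n. {f \<in> I w n. generated_ideal B (\<lambda>n. \<Union>v<w. I v n) n f})"
  have subI: "pscale.subspace (I w n)" for w n
    using relation_ideal_subspace[of B n]
    by (auto simp: I_def pscale.subspace_def homogeneous_closed)
  have subJ: "pscale.subspace (J w n)" for w n
    using subI[of w n] generated_ideal_subspace[of B "\<lambda>n. \<Union>v<w. I v n" n]
    by (auto simp: J_def pscale.subspace_def)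
  have "\<exists>C0 C. C0 \<subseteq> C \<and> C \<subseteq> I w n \<and> pscale.independent C \<and> pscale.span C = I w n \<and> pscale.span C0 = J w n" for w n
  proof -
    obtain C0 where C0: "C0 \<subseteq> J w n" "pscale.independent C0" "J w n \<subseteq> pscale.span C0"
      using pscale.basis_exists[of "J w n"] by metis
    have "C0 \<subseteq> I w n" using C0 by (auto simp: J_def)
    from pscale.maximal_independent_subset_extend[OF this C0(2)]
    obtain C where C: "C0 \<subseteq> C" "C \<subseteq> I w n" "pscale.independent C" "I w n \<subseteq> pscale.span C" .
    have "pscale.span C = I w n" "pscale.span C0 = J w n"
      using C C0 pscale.span_minimal[OF C(2) subI] pscale.span_minimal[OF C0(1) subJ] by auto
    with C show ?thesis by blast
  qed
  then have "\<exists>D. fst D \<subseteq> snd D \<and> snd D \<subseteq> I w n \<and> pscale.independent (snd D) \<and>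
      pscale.span (snd D) = I w n \<and> pscale.span (fst D) = J w n" for w n
    by simp
  then obtain D where D: "\<And>w n. fst (D w n) \<subseteq> snd (D w n) \<and> snd (D w n) \<subseteq> I w n \<and>
      pscale.independent (snd (D w n)) \<and> pscale.span (snd (D w n)) = I w n \<and>
      pscale.span (fst (D w n)) = J w n"
    by metis
  define C0 C where "C0 w n = fst (D w n)" and "C w n = snd (D w n)" for w n
  have C: "\<And>w n. C0 w n \<subseteq> C w n" "\<And>w n. C w n \<subseteq> I w n"
    "\<And>w n. pscale.independent (C w n)" "\<And>w n. pscale.span (C w n) = I w n"
    "\<And>w n. pscale.span (C0 w n) = J w n"
    using D by (simp_all add: C0_def C_def)
  define R where "R = (\<lambda>n. \<Union>w. C w n - C0 w n)"
  have R_hom: "\<exists>w. homogeneous_of_weight w f" if "f \<in> R n" for f n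
    using that C(2) by (auto simp: R_def I_def)
  have R_I: "R n \<subseteq> relation_ideal P B n" for n
    using C(2) by (auto simp: R_def I_def)
  have gen: "generated_ideal B R n f" if "f \<in> I w n" for f n w
    using that
  proof (induction w arbitrary: f n rule: less_induct)
    case (less w)
    have "C w n \<subseteq> Collect (generated_ideal B R n)"
    proof
      fix c assume c: "c \<in> C w n"
      show "c \<in> Collect (generated_ideal B R n)"
      proof (cases "c \<in> C0 w n")
        case True
        then have "c \<in> J w n" using C(5)[of w n] pscale.span_base by blast
        then have "generated_ideal B (\<lambda>n. \<Union>v<w. I v n) n c" by (simp add: J_def)
        then have "generated_ideal B R n c" by (rule generated_ideal_mono) (use less.IH in auto)
        then show ?thesis by simp
      next
        case False
        with c show ?thesis by (auto simp: R_def intro!: ideal_base)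
      qed
    qed
    from pscale.span_minimal[OF this generated_ideal_subspace] less.prems C(4) show ?case by blast
  qed
  have def_rel: "defining_relations P B R"
    unfolding defining_relations_def
  proof (intro conjI allI ballI equalityI subsetI)
    fix n f assume "f \<in> relation_ideal P B n"
    then have "generated_ideal B R n (hcomp w f)" for w
      by (intro gen[of _ w]) (simp add: I_def relation_ideal_hcomp)
    then have "(\<Sum>w\<in>vertices ` keys f. hcomp w f) \<in> Collect (generated_ideal B R n)"
      by (intro pscale.subspace_sum[OF generated_ideal_subspace]) auto
    then show "f \<in> Collect (generated_ideal B R n)" by (simp only: sum_hcomp)
  qed (use R_hom generated_ideal_relations[OF _ R_I] in auto)
  \<comment> \<open>An omitted \<open>f\<close> would be a consequence of lower weights plus a
    combination of the other added vectors of its weight. The first summand lies in the span of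
    \<open>C0 w n\<close>, so the basis \<open>C w n\<close> would be dependent.\<close>
  have "R' = R" if R': "\<And>n. R' n \<subseteq> R n" "defining_relations P B R'" for R'
  proof (rule ccontr)
    assume "R' \<noteq> R"
    then obtain n where "R' n \<noteq> R n" by (meson ext)
    then obtain f where f: "f \<in> R n" "f \<notin> R' n" using R'(1) by auto
    then obtain w where w: "f \<in> C w n" "f \<notin> C0 w n" by (auto simp: R_def)
    have fI: "f \<in> I w n" using w C(2) by auto
    then have fw: "homogeneous_of_weight w f" and "f \<in> relation_ideal P B n" by (auto simp: I_def)
    then have "generated_ideal B R' n f" using R'(2) by (auto simp: defining_relations_def)
    moreover have "R' n \<subseteq> free_operad B n" for n
      using R'(1)[of n] R_I[of n] relation_ideal_free[of B n] by (meson order_trans)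
    moreover have "\<exists>w. homogeneous_of_weight w f" if "f \<in> R' n" for f n
      using R'(1)[of n] R_hom that by (meson subsetD)
    ultimately obtain a b where ab: "hcomp w f = a + b"
      "generated_ideal B (\<lambda>n. {g \<in> R' n. \<exists>v<w. homogeneous_of_weight v g}) n a"
      "b \<in> pscale.span {g \<in> R' n. homogeneous_of_weight w g}"
      using generated_ideal_hcomp[of B R' n f w] by auto
    have "{g \<in> R' n. homogeneous_of_weight w g} \<subseteq> C w n - C0 w n - {f}"
    proof
      fix g assume g: "g \<in> {g \<in> R' n. homogeneous_of_weight w g}"
      then obtain v where v: "g \<in> C v n" "g \<notin> C0 v n" using R'(1)[of n] by (auto simp: R_def)
      have "homogeneous_of_weight v g" using v C(2) by (auto simp: I_def)
      \<comment> \<open>Only a nonzero element has a unique weight; \<open>0\<close> is homogeneous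
        of every weight.\<close>
      moreover have "g \<noteq> 0" using v C(3)[of v n] pscale.dependent_zero by auto
      then obtain t where "t \<in> keys g" using poly_mapping_eqI[of g 0] by (auto simp: in_keys_iff)
      ultimately have "v = w" using g by (auto simp: homogeneous_of_weight_def)
      then show "g \<in> C w n - C0 w n - {f}" using v g f by auto
    qed
    then have b: "b \<in> pscale.span (C w n - C0 w n - {f})" using ab(3) pscale.span_mono by blast
    have "pscale.span (C w n - C0 w n - {f}) \<subseteq> I w n"
      using pscale.span_mono[of "C w n - C0 w n - {f}" "C w n"] C(4) by auto
    then have "b \<in> I w n" using b by auto
    moreover have "f = a + b" using ab(1) hcomp_of_homogeneous[OF fw, of w] by simp
    ultimately have "a \<in> I w n" using fI pscale.subspace_diff[OF subI, of f w n b] by (simp add: algebra_simps)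
    moreover have "generated_ideal B (\<lambda>n. \<Union>v<w. I v n) n a"
      using ab(2)
    proof (rule generated_ideal_mono)
      fix n f assume "f \<in> {g \<in> R' n. \<exists>v<w. homogeneous_of_weight v g}"
      then have "f \<in> (\<Union>v<w. I v n)" using R'(1)[of n] R_I[of n] unfolding I_def by blast
      then show "generated_ideal B (\<lambda>n. \<Union>v<w. I v n) n f" by (rule ideal_base)
    qed
    ultimately have "a \<in> pscale.span (C0 w n)" by (simp add: C(5) J_def)
    then have "a \<in> pscale.span (C w n - {f})"
      using pscale.span_mono[of "C0 w n" "C w n - {f}"] C(1)[of w n] w by blast
    moreover have "b \<in> pscale.span (C w n - {f})"
      using b pscale.span_mono[of "C w n - C0 w n - {f}" "C w n - {f}"] by blast
    ultimately have "f \<in> pscale.span (C w n - {f})"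
      using \<open>f = a + b\<close> pscale.span_add by blast
    then show False using C(3)[of w n] w by (auto simp: pscale.dependent_def)
  qed
  then show ?thesis using def_rel unfolding minimal_defining_relations_def by blast
qed

text \<open>By comparison of homogeneous parts, the members of \<open>R\<close> of weight at most
  \<open>N\<close> generate all relations of weight at most \<open>N\<close>, hence the whole ideal.
  Minimality then leaves no room for further members.\<close>

lemma minimal_relations_weight_bound:
  assumes gen: "\<And>n f. f \<in> relation_ideal P B n \<Longrightarrow> generated_ideal B (relations_up_to P B N) n f"
    and R: "minimal_defining_relations P B R" and f: "f \<in> R n"
  shows "\<exists>w\<le>N. homogeneous_of_weight w f"
proof -
  define R' where "R' = (\<lambda>n. {g \<in> R n. \<exists>v\<le>N. homogeneous_of_weight v g})"
  have def_rel: "defining_relations P B R" using R by (simp add: minimal_defining_relations_def)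
  have R_hom: "\<exists>w. homogeneous_of_weight w f" if "f \<in> R n" for f n
    using that def_rel by (auto simp: defining_relations_def)
  have R_I: "R n \<subseteq> relation_ideal P B n" for n
    using def_rel ideal_base[of _ R n B] unfolding defining_relations_def by blast
  have R_free: "R n \<subseteq> free_operad B n" for n
    using R_I[of n] relation_ideal_free[of B n] by (rule order_trans)
  have "generated_ideal B R' n g" if g: "g \<in> relations_up_to P B N n" for g n
  proof -
    obtain w where w: "w \<le> N" "homogeneous_of_weight w g" "g \<in> relation_ideal P B n"
      using g by (auto simp: relations_up_to_def)
    then have "generated_ideal B R n g" using def_rel by (auto simp: defining_relations_def)
    then obtain a b where ab: "hcomp w g = a + b"
      "generated_ideal B (\<lambda>n. {g \<in> R n. \<exists>v<w. homogeneous_of_weight v g}) n a"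
      "b \<in> pscale.span {g \<in> R n. homogeneous_of_weight w g}"
      using generated_ideal_hcomp[of B R n g w] R_free R_hom by auto
    have "generated_ideal B R' n a"
      using ab(2)
    proof (rule generated_ideal_mono)
      fix n f assume "f \<in> {g \<in> R n. \<exists>v<w. homogeneous_of_weight v g}"
      then obtain v where "f \<in> R n" "v < w" "homogeneous_of_weight v f" by auto
      then have "f \<in> R' n" using w(1) by (auto simp: R'_def intro!: exI[of _ v])
      then show "generated_ideal B R' n f" by (rule ideal_base)
    qed
    moreover have "pscale.span {g \<in> R n. homogeneous_of_weight w g} \<subseteq> Collect (generated_ideal B R' n)"
      by (rule pscale.span_minimal[OF _ generated_ideal_subspace])
         (use w in \<open>auto simp: R'_def intro!: ideal_base\<close>)
    moreover have "g = a + b" using ab(1) hcomp_of_homogeneous[OF w(2), of w] by simp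
    ultimately show ?thesis using ab(3) by (auto intro: ideal_add)
  qed
  then have "generated_ideal B R' n g" if "g \<in> relation_ideal P B n" for g n
    by (rule generated_ideal_mono[OF gen[OF that]])
  moreover have "R' n \<subseteq> relation_ideal P B n" for n using R_I by (auto simp: R'_def)
  ultimately have "defining_relations P B R'"
    using generated_ideal_relations[of R'] by (auto simp: defining_relations_def R'_def)
  then have "R' = R" using R by (auto simp: minimal_defining_relations_def R'_def)
  then have "f \<in> R' n" using f by simp
  then show ?thesis by (auto simp: R'_def)
qed

end

lemma generator_basis_exists: "\<exists>B. generator_basis P B"
proof -
  have "\<exists>C. independent C \<and> span C = part P n 1" for n
  proof -
    obtain C where "C \<subseteq> part P n 1" "independent C" "part P n 1 \<subseteq> span C"
      using basis_exists[of "part P n 1"] by metis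
    then show ?thesis using span_minimal[OF _ part_subspace] by blast
  qed
  then have "\<exists>B. \<forall>n. independent (B n) \<and> span (B n) = part P n 1" by (intro choice allI)
  then show ?thesis by (simp add: generator_basis_def)
qed

end

subsection \<open>Groebner bases\<close>

lemma leading_monomial_exists:
  assumes "monomial_order X lt" "f \<in> free_operad X n" "f \<noteq> 0"
  shows "\<exists>t. is_leading_monomial lt f t"
proof -
  have tot: "totalp_on (tree_monomials X n) lt" and tr: "transp_on (tree_monomials X n) lt"
    using assms(1) by (auto simp: monomial_order_def)
  have "\<exists>t\<in>A. \<forall>s\<in>A. s \<noteq> t \<longrightarrow> lt s t" if "finite A" "A \<noteq> {}" "A \<subseteq> tree_monomials X n" for A
    using that
  proof (induction A rule: finite_ne_induct)
    case (insert x F)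
    then obtain t where t: "t \<in> F" "\<forall>s\<in>F. s \<noteq> t \<longrightarrow> lt s t" by auto
    show ?case
    proof (cases "lt x t")
      case True
      then show ?thesis using t by blast
    next
      case False
      then have "lt t x" using tot t insert by (auto simp: totalp_on_def)
      then have "lt s x" if "s \<in> F" for s
        using that t insert.prems transp_onD[OF tr, of s t x] by (cases "s = t") auto
      then show ?thesis using insert.hyps by blast
    qed
  qed simp
  from this[of "keys f"] assms(2,3) show ?thesis
    by (auto simp: free_operad_def is_leading_monomial_def)
qed

text \<open>Composition with a monomial is strictly increasing for the order. It therefore carries
  the leading monomial to the leading monomial, and no other term can cancel it.\<close>

lemma tree_divides_ideal:
  assumes lt: "monomial_order X lt" and R: "\<And>n. R n \<subseteq> free_operad X n"
    and "tree_divides s t" and "generated_ideal X R m g" "is_leading_monomial lt g s"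
    and "t \<in> tree_monomials X n"
  shows "\<exists>g'. generated_ideal X R n g' \<and> is_leading_monomial lt g' t"
  using assms(3,6)
proof (induction arbitrary: n rule: tree_divides.induct)
  case divides_refl
  have "s \<in> tree_monomials X m"
    using assms(5) generated_ideal_free[OF assms(4) R] by (auto simp: is_leading_monomial_def free_operad_def)
  then show ?case using divides_refl assms(4,5) by (auto simp: tree_monomials_def)
next
  case (divides_left t i u)
  have tX: "t \<in> tree_monomials X (leaves t)" and uX: "u \<in> tree_monomials X (leaves u)"
    and n: "n = leaves t + leaves u - 1"
    using divides_left by (auto simp: tree_monomials_def decorated_graft leaves_graft)
  from divides_left.IH[OF tX] obtain g' where g': "generated_ideal X R (leaves t) g'" "is_leading_monomial lt g' t"
    by blast
  let ?g = "free_circ i g' (single u 1)"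
  have ideal: "generated_ideal X R n ?g"
    unfolding n by (rule ideal_left[OF g'(1) free_operad_closed(6)[OF uX] divides_left(2)])
  have g'X: "keys g' \<subseteq> tree_monomials X (leaves t)"
    using generated_ideal_free[OF g'(1) R] by (simp add: free_operad_def)
  have mono: "lt (graft i k u) (graft i t u)" if "k \<in> keys g'" "k \<noteq> t" for k
    using lt that g'(2) g'X tX uX divides_left(2) by (auto simp: monomial_order_def is_leading_monomial_def)
  have irr: "\<not> lt (graft i t u) (graft i t u)"
    using lt divides_left.prems by (auto simp: monomial_order_def irreflp_on_def)
  have eq: "?g = (\<Sum>k\<in>keys g'. single (graft i k u) (lookup g' k))"
    by (simp add: free_circ_def linear_extension_def)
  have inj: "graft i k u = graft i t u \<longleftrightarrow> k = t" if "k \<in> keys g'" for k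
    using mono[OF that] irr by metis
  have "lookup ?g (graft i t u) = (\<Sum>k\<in>keys g'. if k = t then lookup g' t else 0)"
    unfolding eq lookup_sum lookup_single
    by (intro sum.cong) (use inj in \<open>auto simp: when_def\<close>)
  then have "graft i t u \<in> keys ?g"
    using g'(2) by (simp add: in_keys_iff is_leading_monomial_def)
  moreover have "keys ?g \<subseteq> {graft i k u | k. k \<in> keys g'}"
    using keys_free_circ[of i g' "single u 1"] by auto
  ultimately show ?case using ideal mono by (fastforce simp: is_leading_monomial_def)
next
  case (divides_right t i u)
  have tX: "t \<in> tree_monomials X (leaves t)" and uX: "u \<in> tree_monomials X (leaves u)"
    and n: "n = leaves u + leaves t - 1"
    using divides_right by (auto simp: tree_monomials_def decorated_graft leaves_graft)
  from divides_right.IH[OF tX] obtain g' where g': "generated_ideal X R (leaves t) g'" "is_leading_monomial lt g' t"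
    by blast
  let ?g = "free_circ i (single u 1) g'"
  have ideal: "generated_ideal X R n ?g"
    unfolding n by (rule ideal_right[OF free_operad_closed(6)[OF uX] g'(1) divides_right(2)])
  have g'X: "keys g' \<subseteq> tree_monomials X (leaves t)"
    using generated_ideal_free[OF g'(1) R] by (simp add: free_operad_def)
  have mono: "lt (graft i u k) (graft i u t)" if "k \<in> keys g'" "k \<noteq> t" for k
    using lt that g'(2) g'X tX uX divides_right(2) by (auto simp: monomial_order_def is_leading_monomial_def)
  have irr: "\<not> lt (graft i u t) (graft i u t)"
    using lt divides_right.prems by (auto simp: monomial_order_def irreflp_on_def)
  have eq: "?g = (\<Sum>k\<in>keys g'. single (graft i u k) (lookup g' k))"
    by (simp add: free_circ_def linear_extension_def)
  have inj: "graft i u k = graft i u t \<longleftrightarrow> k = t" if "k \<in> keys g'" for k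
    using mono[OF that] irr by metis
  have "lookup ?g (graft i u t) = (\<Sum>k\<in>keys g'. if k = t then lookup g' t else 0)"
    unfolding eq lookup_sum lookup_single
    by (intro sum.cong) (use inj in \<open>auto simp: when_def\<close>)
  then have "graft i u t \<in> keys ?g"
    using g'(2) by (simp add: in_keys_iff is_leading_monomial_def)
  moreover have "keys ?g \<subseteq> {graft i u k | k. k \<in> keys g'}"
    using keys_free_circ[of i "single u 1" g'] by auto
  ultimately show ?case using ideal mono by (fastforce simp: is_leading_monomial_def)
qed

text \<open>Subtracting a multiple of an ideal element with the same leading monomial leaves an
  element with a smaller one, and the order is well-founded. This turns a quadratic Groebner basis
  into generation by relations of weight two.\<close>

lemma groebner_basis_generates:
  assumes lt: "monomial_order X lt" and G: "groebner_basis lt I G"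
    and I: "\<And>n. I n \<subseteq> free_operad X n" "\<And>n. pscale.subspace (I n)"
    and ideal: "\<And>n g. generated_ideal X G n g \<Longrightarrow> g \<in> I n"
    and f: "f \<in> I n"
  shows "generated_ideal X G n f"
proof -
  have G_free: "G n \<subseteq> free_operad X n" for n
    using G I(1)[of n] unfolding groebner_basis_def by blast
  have wf: "wfp_on (tree_monomials X n) lt" and irr: "irreflp_on (tree_monomials X n) lt"
    and tr: "transp_on (tree_monomials X n) lt" using lt by (auto simp: monomial_order_def)
  have *: "\<forall>f. f \<in> I n \<longrightarrow> is_leading_monomial lt f t \<longrightarrow> generated_ideal X G n f" if "t \<in> tree_monomials X n" for t
    using that
  proof (induction t rule: wfp_on_induct[OF wf, consumes 1])
    case (1 t)
    show ?case
    proof (intro allI impI)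
      fix f assume f: "f \<in> I n" "is_leading_monomial lt f t"
      then have "f \<noteq> 0" by (auto simp: is_leading_monomial_def)
      from G f this obtain m g s t' where gs: "g \<in> G m" "is_leading_monomial lt g s"
        "is_leading_monomial lt f t'" "tree_divides s t'" by (auto simp: groebner_basis_def) blast
      have fX: "keys f \<subseteq> tree_monomials X n" using f I by (auto simp: free_operad_def)
      have "t' = t"
      proof (rule ccontr)
        assume "t' \<noteq> t"
        then have "lt t t'" "lt t' t" using f(2) gs(3) by (auto simp: is_leading_monomial_def)
        moreover have "t \<in> tree_monomials X n" "t' \<in> tree_monomials X n"
          using f(2) gs(3) fX by (auto simp: is_leading_monomial_def)
        ultimately show False using irr tr by (meson irreflp_onD transp_onD)
      qed
      then obtain g' where g': "generated_ideal X G n g'" "is_leading_monomial lt g' t"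
        using tree_divides_ideal[OF lt G_free gs(4) ideal_base[of g G, OF gs(1)] gs(2), of n] 1(1) by auto
      have g'X: "keys g' \<subseteq> tree_monomials X n"
        using generated_ideal_free[OF g'(1) G_free] by (simp add: free_operad_def)
      define c where "c = lookup f t / lookup g' t"
      define r where "r = f - pscale c g'"
      have rI: "r \<in> I n" unfolding r_def
        using f(1) ideal[OF g'(1)] I(2)[of n] pscale.subspace_diff pscale.subspace_scale by blast
      have "lookup r t = 0"
        using g'(2) by (simp add: r_def c_def lookup_minus is_leading_monomial_def in_keys_iff)
      then have keys_r: "k \<in> tree_monomials X n \<and> lt k t" if "k \<in> keys r" for k
      proof -
        have "k \<noteq> t" using that \<open>lookup r t = 0\<close> by (auto simp: in_keys_iff)
        moreover have "k \<in> keys f \<union> keys g'"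
          using that keys_minus_subset[of f "pscale c g'"] keys_pscale[of c g'] unfolding r_def by blast
        ultimately show ?thesis
          using f(2) g'(2) fX g'X unfolding is_leading_monomial_def by blast
      qed
      have "generated_ideal X G n r"
      proof (cases "r = 0")
        case False
        then obtain u where u: "is_leading_monomial lt r u"
          using leading_monomial_exists[OF lt] rI I(1)[of n] by blast
        then have "u \<in> keys r" by (simp add: is_leading_monomial_def)
        then show ?thesis using 1(2)[of u] keys_r[of u] u rI by auto
      qed (simp add: ideal_zero)
      moreover have "f = r + pscale c g'" by (simp add: r_def)
      ultimately show "generated_ideal X G n f"
        using g'(1) by (auto intro: ideal_add ideal_scale)
    qed
  qed
  show ?thesis
  proof (cases "f = 0")
    case False
    then obtain u where u: "is_leading_monomial lt f u"
      using leading_monomial_exists[OF lt] f I(1)[of n] by blast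
    then have "u \<in> tree_monomials X n" using f I(1)[of n] by (auto simp: is_leading_monomial_def free_operad_def)
    then show ?thesis using * u f by blast
  qed (simp add: ideal_zero)
qed

subsection \<open>Change of generators\<close>

lemma arity_part_free_eq: "arity_part (free_ns_operad X) n = free_operad X n"
proof (rule equalityI[OF arity_part_free subsetI])
  fix f assume f: "f \<in> free_operad X n"
  have "(\<Sum>w\<in>vertices ` keys f. hcomp w f) \<in> arity_part (free_ns_operad X) n"
    unfolding arity_part_def free_ns_operad_simps
    by (intro pscale.span_sum pscale.span_base) (use hcomp_free[OF f] hcomp_homogeneous in blast)
  then show "f \<in> arity_part (free_ns_operad X) n" by (simp only: sum_hcomp)
qed

context weight_graded_ns_operad
begin

lemma eval_tree_free_hom:
  assumes h: "\<And>n x. x \<in> X n \<Longrightarrow> h x \<in> AP n" and X: "X 0 = {}"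
    and \<theta>: "\<And>n y. y \<in> Y n \<Longrightarrow> \<theta> y \<in> free_operad X n"
    and t: "t \<in> tree_monomials Y n"
  shows "eval_tree (free_ns_operad X) (map_tree \<theta> t) \<in> free_operad X n \<and>
    free_hom P h (eval_tree (free_ns_operad X) (map_tree \<theta> t))
    = eval_tree P (map_tree (\<lambda>y. free_hom P h (\<theta> y)) t)"
proof -
  interpret F: weight_graded_ns_operad "free_ns_operad X :: ('k, _) ns_operad"
    by (rule free_operad_is_operad) (rule X)
  have \<theta>': "\<theta> y \<in> arity_part (free_ns_operad X) n" if "y \<in> Y n" for y n
    using \<theta> that by (simp add: arity_part_free_eq)
  have h\<theta>: "free_hom P h (\<theta> y) \<in> AP n" if "y \<in> Y n" for y n
    by (rule free_hom_AP[OF h \<theta>[OF that]])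
  show ?thesis using t
  proof (induction rule: tree_monomials_induct)
    case Leaf
    show ?case using free_operad_closed(6)[OF Leaf_in_tree_monomials, of 1 X] by simp
  next
    case (graft n m i s y)
    have c: "corolla m y \<in> tree_monomials Y m" using graft by simp
    have e: "eval_tree (free_ns_operad X) (map_tree \<theta> (graft i s (corolla m y)))
        = free_circ i (eval_tree (free_ns_operad X) (map_tree \<theta> s)) (\<theta> y)"
      using F.eval_map_tree_graft[of Y \<theta>, OF \<theta>' graft(1) c graft(3)] F.eval_corolla[OF \<theta>'[OF graft(2)]]
      by (simp add: map_replicate_const)
    have e': "eval_tree P (map_tree (\<lambda>y. free_hom P h (\<theta> y)) (graft i s (corolla m y)))
        = circ P i (eval_tree P (map_tree (\<lambda>y. free_hom P h (\<theta> y)) s)) (free_hom P h (\<theta> y))"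
      using eval_map_tree_graft[of Y "\<lambda>y. free_hom P h (\<theta> y)", OF h\<theta> graft(1) c graft(3)]
        eval_corolla[OF h\<theta>[OF graft(2)]]
      by (simp add: map_replicate_const)
    show ?case unfolding e e'
      using graft free_hom_circ[of X h _ n "\<theta> y" m i, OF h] \<theta>[OF graft(2)] 
        free_operad_closed(7)[of _ X n "\<theta> y" m i] by auto
  qed
qed

text \<open>Both sides respect partial composition and agree on generators, hence on all trees:
  substituting and then evaluating is the same as evaluating with the substituted values.\<close>

lemma free_hom_comp:
  assumes h: "\<And>n x. x \<in> X n \<Longrightarrow> h x \<in> AP n" and X: "X 0 = {}"
    and \<theta>: "\<And>n y. y \<in> Y n \<Longrightarrow> \<theta> y \<in> free_operad X n"
    and f: "f \<in> free_operad Y n"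
  shows "free_hom P h (free_hom (free_ns_operad X) \<theta> f) = free_hom P (\<lambda>y. free_hom P h (\<theta> y)) f"
proof -
  have *: "eval_tree P (map_tree (\<lambda>y. free_hom P h (\<theta> y)) t)
      = free_hom P h (eval_tree (free_ns_operad X) (map_tree \<theta> t))" if "t \<in> keys f" for t
    using eval_tree_free_hom[of X h Y \<theta> t n, OF h X \<theta>] f that by (auto simp: free_operad_def)
  have "free_hom P (\<lambda>y. free_hom P h (\<theta> y)) f
      = linear_extension (smul P) (\<lambda>t. free_hom P h (eval_tree (free_ns_operad X) (map_tree \<theta> t))) f"
    unfolding free_hom_def[of P "\<lambda>y. free_hom P h (\<theta> y)"]
    by (rule linear_extension_cong) (simp add: *)
  then show ?thesis
    using linear_extension_comp[OF vector_space_axioms]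
    by (simp add: free_hom_def)
qed

lemma free_hom_cong:
  assumes "\<And>n x. x \<in> X n \<Longrightarrow> h x = h' x" "f \<in> free_operad X n"
  shows "free_hom P h f = free_hom P h' f"
proof -
  have "map_tree h t = map_tree h' t" if "decorated_by X t" for t
    using that assms(1) by (induction t) auto
  then show ?thesis unfolding free_hom_def using assms(2)
    by (intro linear_extension_cong arg_cong[of _ _ "eval_tree P"])
       (auto simp: free_operad_def tree_monomials_def)
qed

lemma vertices_1_corolla:
  assumes "t \<in> tree_monomials X n" "vertices t = 1"
  obtains x where "x \<in> X n" "t = corolla n x"
proof -
  from assms have "t \<noteq> Leaf" "decorated_by X t" by (auto simp: tree_monomials_def)
  from tree_graft_corolla_cases[OF this] obtain i s m x where
    t: "t = graft i s (corolla m x)" "i < leaves s" "x \<in> X m" "decorated_by X s" .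
  have "vertices t = vertices s + 1" unfolding t(1) vertices_graft[OF t(2)] by simp
  then have "s = Leaf" using assms(2) decorated_by_vertices_0 by auto
  then have "t = corolla m x" using t by simp
  moreover have "m = n" using calculation assms(1) leaves_corolla[of x m] by (auto simp: tree_monomials_def)
  ultimately show ?thesis using t(3) that by blast
qed

context
  fixes B assumes B: "generator_basis P B"
begin

lemma B_AP: "x \<in> B n \<Longrightarrow> x \<in> AP n"
  using generator_basis_part[OF B] part_AP by blast

lemma linear_lift:
  assumes "x \<in> part P n 1"
  shows "\<exists>g. g \<in> free_operad B n \<and> homogeneous_of_weight 1 g \<and> free_hom P (\<lambda>x. x) g = x"
proof -
  have "x \<in> span (B n)" using assms B by (simp add: generator_basis_def)
  then show ?thesis
  proof (induction rule: span_induct_alt)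
    case base
    show ?case by (intro exI[of _ 0]) (simp add: free_operad_closed homogeneous_closed)
  next
    case (step c b y)
    then obtain g where g: "g \<in> free_operad B n" "homogeneous_of_weight 1 g" "free_hom P (\<lambda>x. x) g = y"
      by blast
    have "free_hom P (\<lambda>x. x) (single (corolla n b) c) = smul P c b"
      by (rule free_hom_corolla[of B]) (use step B_AP in auto)
    moreover have "homogeneous_of_weight 1 (single (corolla n b) c)"
      by (rule homogeneous_closed(4)) (rule vertices_corolla)
    moreover have "single (corolla n b) c \<in> free_operad B n"
      using step by (intro free_operad_closed) simp
    ultimately show ?case using g
      by (intro exI[of _ "single (corolla n b) c + g"])
         (simp add: free_operad_closed(2) homogeneous_closed(2))
  qed
qed

text \<open>Trees with one vertex are corollas, and they evaluate to the elements of the basis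
  \<open>B n\<close>, which are independent.\<close>

lemma free_hom_weight_1_inj:
  assumes f: "f \<in> free_operad B n" "homogeneous_of_weight 1 f" "free_hom P (\<lambda>x. x) f = 0"
  shows "f = 0"
proof -
  let ?c = "\<lambda>x. corolla n x"
  define S where "S = {x \<in> B n. ?c x \<in> keys f}"
  have inj: "inj_on ?c S" by (auto simp: inj_on_def)
  have keys: "keys f = ?c ` S"
  proof (intro equalityI subsetI)
    fix t assume t: "t \<in> keys f"
    then have "t \<in> tree_monomials B n" "vertices t = 1"
      using f by (auto simp: free_operad_def homogeneous_of_weight_def)
    from vertices_1_corolla[OF this] obtain x where "x \<in> B n" "t = ?c x" .
    then show "t \<in> ?c ` S" using t by (auto simp: S_def)
  qed (auto simp: S_def)
  have fin: "finite S" using finite_imageD[OF _ inj] keys finite_keys by metis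
  have "free_hom P (\<lambda>x. x) f = (\<Sum>x\<in>S. smul P (lookup f (?c x)) (eval_tree P (?c x)))"
    unfolding free_hom_def linear_extension_def keys sum.reindex[OF inj] by (simp add: tree.map_ident map_replicate_const)
  also have "\<dots> = (\<Sum>x\<in>S. smul P (lookup f (?c x)) x)"
    by (intro sum.cong refl arg_cong2[of _ _ _ _ "smul P"]) (use B_AP eval_corolla in \<open>auto simp: S_def\<close>)
  finally have "(\<Sum>x\<in>S. smul P (lookup f (?c x)) x) = 0" using f by simp
  then have "lookup f (?c x) = 0" if "x \<in> S" for x
    using independentD[of "B n" S "\<lambda>x. lookup f (?c x)" x] B fin that
    by (auto simp: generator_basis_def S_def)
  then have "keys f = {}" unfolding keys by (auto simp: S_def in_keys_iff)
  then show ?thesis by (intro poly_mapping_eqI) (auto simp: in_keys_iff)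
qed

end

text \<open>All components share one ambient space and the substitution is a function of the element
  alone. The assumption \<open>disj\<close> makes the arity of a generator recoverable from the
  element.\<close>

lemma substitution_exists:
  assumes B0: "generator_basis P B0" and B: "generator_basis P B"
    and disj: "\<And>n m x. \<lbrakk>x \<in> part P n 1; x \<in> part P m 1; x \<noteq> 0\<rbrakk> \<Longrightarrow> n = m"
  shows "\<exists>\<theta>. \<forall>n b. b \<in> B0 n \<longrightarrow>
    \<theta> b \<in> free_operad B n \<and> homogeneous_of_weight 1 (\<theta> b) \<and> free_hom P (\<lambda>x. x) (\<theta> b) = b"
proof -
  have "\<exists>g. \<forall>n. b \<in> B0 n \<longrightarrow> g \<in> free_operad B n \<and> homogeneous_of_weight 1 g \<and> free_hom P (\<lambda>x. x) g = b" for b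
  proof (cases "\<exists>n. b \<in> B0 n")
    case True
    then obtain n where n: "b \<in> B0 n" by blast
    have "b \<noteq> 0" using n B0 dependent_zero unfolding generator_basis_def by blast
    then have "m = n" if "b \<in> B0 m" for m
      using disj[of b m n] generator_basis_part[OF B0] n that by blast
    then show ?thesis using linear_lift[OF B generator_basis_part[OF B0 n]] by blast
  qed blast
  then show ?thesis by metis
qed

text \<open>\<open>minimal_relations_weight_le\<close> speaks of all bases of generators, while
  normal forms are computed for one. A relation over \<open>B\<close> is carried to
  \<open>B0\<close> by a substitution of weight one, expressed there through relations of low
  weight, and carried back; the round trip is the identity and evaluation is preserved
  throughout.\<close>

lemma change_of_generators:
  assumes B0: "generator_basis P B0" and B: "generator_basis P B"
    and disj: "\<And>n m x. \<lbrakk>x \<in> part P n 1; x \<in> part P m 1; x \<noteq> 0\<rbrakk> \<Longrightarrow> n = m"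
    and gen0: "\<And>n f. f \<in> relation_ideal P B0 n \<Longrightarrow> generated_ideal B0 (relations_up_to P B0 N) n f"
    and f: "f \<in> relation_ideal P B n"
  shows "generated_ideal B (relations_up_to P B N) n f"
proof -
  let ?G = "free_ns_operad B0 :: ('k, _) ns_operad" and ?F = "free_ns_operad B :: ('k, _) ns_operad"
  have B00: "B0 0 = {}" and B_0: "B 0 = {}" using generator_basis_0 B0 B by auto
  interpret F: weight_graded_ns_operad ?F by (rule free_operad_is_operad) (rule B_0)
  interpret G: weight_graded_ns_operad ?G by (rule free_operad_is_operad) (rule B00)
  have "\<exists>\<theta>. \<forall>n b. b \<in> B0 n \<longrightarrow>
      \<theta> b \<in> free_operad B n \<and> homogeneous_of_weight 1 (\<theta> b) \<and> free_hom P (\<lambda>x. x) (\<theta> b) = b"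
    by (rule substitution_exists[OF B0 B]) (rule disj)
  then obtain \<theta> where *: "\<forall>n b. b \<in> B0 n \<longrightarrow>
      \<theta> b \<in> free_operad B n \<and> homogeneous_of_weight 1 (\<theta> b) \<and> free_hom P (\<lambda>x. x) (\<theta> b) = b"
    by (rule exE)
  have \<theta>: "\<theta> b \<in> free_operad B n" "homogeneous_of_weight 1 (\<theta> b)"
    "free_hom P (\<lambda>x. x) (\<theta> b) = b" if "b \<in> B0 n" for n b
    using * that by simp_all
  have "\<exists>\<theta>'. \<forall>n b. b \<in> B n \<longrightarrow>
      \<theta>' b \<in> free_operad B0 n \<and> homogeneous_of_weight 1 (\<theta>' b) \<and> free_hom P (\<lambda>x. x) (\<theta>' b) = b"
    by (rule substitution_exists[OF B B0]) (rule disj)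
  then obtain \<theta>' where *: "\<forall>n b. b \<in> B n \<longrightarrow>
      \<theta>' b \<in> free_operad B0 n \<and> homogeneous_of_weight 1 (\<theta>' b) \<and> free_hom P (\<lambda>x. x) (\<theta>' b) = b"
    by (rule exE)
  have \<theta>': "\<theta>' b \<in> free_operad B0 n" "homogeneous_of_weight 1 (\<theta>' b)"
    "free_hom P (\<lambda>x. x) (\<theta>' b) = b" if "b \<in> B n" for n b
    using * that by simp_all
  have \<theta>p: "\<theta> b \<in> part ?F n 1" if "b \<in> B0 n" for n b using \<theta> that by simp
  have \<theta>a: "\<theta> b \<in> arity_part ?F n" if "b \<in> B0 n" for n b using \<theta>(1) that by (simp add: arity_part_free_eq)
  have \<theta>'p: "\<theta>' b \<in> part ?G n 1" if "b \<in> B n" for n b using \<theta>' that by simp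
  have \<theta>'a: "\<theta>' b \<in> arity_part ?G n" if "b \<in> B n" for n b using \<theta>'(1) that by (simp add: arity_part_free_eq)
  have ev: "free_hom P (\<lambda>x. x) (free_hom ?F \<theta> g) = free_hom P (\<lambda>x. x) g"
    if "g \<in> free_operad B0 n" for g n
    using free_hom_comp[of B "\<lambda>x. x" B0, OF B_AP[OF B] B_0 \<theta>(1) that] free_hom_cong[of B0, OF \<theta>(3) that]
    by (rule trans)
  have ev': "free_hom P (\<lambda>x. x) (free_hom ?G \<theta>' g) = free_hom P (\<lambda>x. x) g"
    if "g \<in> free_operad B n" for g n
    using free_hom_comp[of B0 "\<lambda>x. x" B, OF B_AP[OF B0] B00 \<theta>'(1) that] free_hom_cong[of B, OF \<theta>'(3) that]
    by (rule trans)
  have free: "free_hom ?F \<theta> g \<in> free_operad B n" if "g \<in> free_operad B0 n" for g n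
    using F.free_hom_AP[of B0 \<theta>, OF \<theta>a that] unfolding arity_part_free_eq .
  have free': "free_hom ?G \<theta>' g \<in> free_operad B0 n" if "g \<in> free_operad B n" for g n
    using G.free_hom_AP[of B \<theta>', OF \<theta>'a that] unfolding arity_part_free_eq .
  \<comment> \<open>On a generator the round trip differs from the corolla by an element of weight
    one with value zero, which is zero by \<open>free_hom_weight_1_inj\<close>.\<close>
  have id: "free_hom ?F \<theta> (free_hom ?G \<theta>' f) = f"
  proof -
    have gen: "free_hom ?F \<theta> (\<theta>' b) = single (corolla n b) 1" if b: "b \<in> B n" for n b
    proof -
      let ?d = "free_hom ?F \<theta> (\<theta>' b) - single (corolla n b) 1"
      have cor: "single (corolla n b) 1 \<in> free_operad B n"
        using b by (intro free_operad_closed) simp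
      have hom: "homogeneous_of_weight 1 (free_hom ?F \<theta> (\<theta>' b))"
        using F.free_hom_part[of B0 \<theta> "\<theta>' b" n 1] \<theta>p \<theta>'(1,2)[OF b] by simp
      have "homogeneous_of_weight 1 (single (corolla n b) (1::'k))"
        by (rule homogeneous_closed(4)) (rule vertices_corolla)
      then have "homogeneous_of_weight 1 ?d"
        using hom keys_minus_subset[of "free_hom ?F \<theta> (\<theta>' b)" "single (corolla n b) 1"]
        unfolding homogeneous_of_weight_def by blast
      moreover have "?d \<in> free_operad B n"
        by (rule free_operad_closed(3)[OF free[OF \<theta>'(1)[OF b]] cor])
      moreover have "free_hom P (\<lambda>x. x) ?d = 0"
        using ev[OF \<theta>'(1)[OF b]] \<theta>'(3)[OF b] free_hom_corolla[of B "\<lambda>x. x" b n 1] B_AP[OF B] b by simp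
      ultimately show ?thesis using free_hom_weight_1_inj[OF B] by fastforce
    qed
    have tree: "eval_tree ?F (map_tree (\<lambda>b. free_hom ?F \<theta> (\<theta>' b)) t) = single t 1"
      if "t \<in> tree_monomials B m" for t m
      using that
    proof (induction rule: tree_monomials_induct)
      case (graft n m i s y)
      have lab: "free_hom ?F \<theta> (\<theta>' b) \<in> arity_part ?F n" if "b \<in> B n" for b n
        using free[OF \<theta>'(1)[OF that]] by (simp add: arity_part_free_eq)
      have c: "corolla m y \<in> tree_monomials B m" using graft by simp
      show ?case
        using F.eval_map_tree_graft[of B "\<lambda>b. free_hom ?F \<theta> (\<theta>' b)", OF lab graft(1) c graft(3)]
          F.eval_corolla[OF lab[OF graft(2)]] graft gen
        by (simp add: map_replicate_const)
    qed simp
    have fB: "f \<in> free_operad B n" using f by (auto simp: relation_ideal_eq)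
    have "free_hom ?F \<theta> (free_hom ?G \<theta>' f) = free_hom ?F (\<lambda>b. free_hom ?F \<theta> (\<theta>' b)) f"
      by (rule F.free_hom_comp[OF \<theta>a B00 \<theta>'(1) fB])
    also have "\<dots> = linear_extension pscale (\<lambda>t. single t 1) f"
      unfolding free_hom_def[of _ "\<lambda>b. free_hom ?F \<theta> (\<theta>' b)"] free_ns_operad_simps
      by (rule pscale.linear_extension_cong) (use fB tree in \<open>auto simp: free_operad_def\<close>)
    finally show ?thesis by simp
  qed
  \<comment> \<open>Since \<open>\<theta>\<close> sends generators to weight one, it preserves
    weights, so relations of weight at most \<open>N\<close> go to such relations.\<close>
  have push: "generated_ideal B (relations_up_to P B N) n (free_hom ?F \<theta> g) \<and> g \<in> free_operad B0 n"
    if "generated_ideal B0 (relations_up_to P B0 N) n g" for n g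
    using that
  proof (induction rule: generated_ideal.induct)
    case (ideal_base g n)
    then obtain w where w: "w \<le> N" "homogeneous_of_weight w g" "g \<in> free_operad B0 n"
      "free_hom P (\<lambda>x. x) g = 0"
      by (auto simp: relations_up_to_def relation_ideal_eq)
    have "free_hom ?F \<theta> g \<in> part ?F n w"
      by (rule F.free_hom_part[of B0 \<theta> g n w]) (use \<theta>p w in auto)
    then have "free_hom ?F \<theta> g \<in> relations_up_to P B N n"
      using w ev[OF w(3)] by (auto simp: relations_up_to_def relation_ideal_eq)
    then show ?case using w by (auto intro: generated_ideal.ideal_base)
  next
    case (ideal_left n f g m i)
    then show ?case
      using F.free_hom_circ[of B0 \<theta> f n g m i, OF \<theta>a]
        generated_ideal.ideal_left[OF _ free[OF ideal_left(2)] ideal_left(3)]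
        free_operad_closed(7)[of f B0 n g m i] by auto
  next
    case (ideal_right g m n f i)
    then show ?case
      using F.free_hom_circ[of B0 \<theta> g m f n i, OF \<theta>a]
        generated_ideal.ideal_right[OF free[OF ideal_right(1)] _ ideal_right(3)]
        free_operad_closed(7)[of g B0 m f n i] by auto
  qed (auto intro: generated_ideal.intros simp: free_operad_closed(1-4))
  have fB: "f \<in> free_operad B n" using f by (auto simp: relation_ideal_eq)
  have "free_hom ?G \<theta>' f \<in> relation_ideal P B0 n"
    using f ev'[OF fB] free'[OF fB] by (simp add: relation_ideal_eq)
  from push[OF gen0[OF this]] id show ?thesis by simp
qed

end

subsection \<open>Operads of monomials\<close>

text \<open>
  A list \<open>v\<close> of length \<open>n\<close> stands for an operation of arity \<open>n\<close>. Lists of length one are the powers of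
  a unary operation \<open>a\<close>, and composing \<open>v\<close> with \<open>a\<^sup>m\<close> at the input \<open>i\<close> adds \<open>m\<close> to the entry \<open>i\<close>
  of \<open>v\<close>. All other compositions vanish, except for those forced by the unit \<open>[0]\<close>.
\<close>

definition label_comp :: "nat list set \<Rightarrow> nat \<Rightarrow> nat list \<Rightarrow> nat list \<Rightarrow> nat list option" where
  "label_comp X i v w =
    (let r = if length w = 1 then v[i := v ! i + hd w] else w
     in if (length w = 1 \<or> v = [0]) \<and> r \<in> X then Some r else None)"

abbreviation monom :: "nat list \<Rightarrow> (nat \<Rightarrow>\<^sub>0 'k::field)" where
  "monom v \<equiv> single (to_nat v) 1"

definition opt_monom :: "nat list option \<Rightarrow> (nat \<Rightarrow>\<^sub>0 'k::field)" where
  "opt_monom r = (case r of None \<Rightarrow> 0 | Some v \<Rightarrow> monom v)"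

lemma opt_monom_simps [simp]: "opt_monom None = 0" "opt_monom (Some v) = monom v"
  by (simp_all add: opt_monom_def)

text \<open>Lists are coded by \<open>to_nat\<close>, so that the elements are combinations over
  \<open>nat\<close>. Dividing the sum of the entries by \<open>d\<close> gives the weight, so that
  the same construction can carry the weights of a Veronese power.\<close>

definition label_operad :: "nat list set \<Rightarrow> nat \<Rightarrow> ('k::field, nat \<Rightarrow>\<^sub>0 'k) ns_operad" where
  "label_operad X d = \<lparr>smul = pscale,
    part = (\<lambda>n k. {f. keys f \<subseteq> to_nat ` {v \<in> X. length v = n \<and> sum_list v = k * d}}),
    ident = monom [0],
    circ = (\<lambda>i. bilinear_extension (\<lambda>p q. opt_monom (label_comp X i (from_nat p) (from_nat q))))\<rparr>"

lemma label_operad_simps [simp]: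
  "smul (label_operad X d) = pscale" "ident (label_operad X d) = monom [0]"
  "part (label_operad X d) n k = {f. keys f \<subseteq> to_nat ` {v \<in> X. length v = n \<and> sum_list v = k * d}}"
  by (simp_all add: label_operad_def)

lemma label_circ:
  "circ (label_operad X d) i = bilinear_extension (\<lambda>p q. opt_monom (label_comp X i (from_nat p) (from_nat q)))"
  by (simp add: label_operad_def)

lemma label_circ_simps [simp]:
  "circ (label_operad X d) i 0 g = 0" "circ (label_operad X d) i f 0 = 0"
  "circ (label_operad X d) i (f + f') g = circ (label_operad X d) i f g + circ (label_operad X d) i f' g"
  "circ (label_operad X d) i f (g + g') = circ (label_operad X d) i f g + circ (label_operad X d) i f g'"
  "circ (label_operad X d) i (pscale c f) g = pscale c (circ (label_operad X d) i f g)"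
  "circ (label_operad X d) i f (pscale c g) = pscale c (circ (label_operad X d) i f g)"
  "circ (label_operad X d) i (single (to_nat v) x) (single (to_nat w) y)
    = pscale (x * y) (opt_monom (label_comp X i v w))"
  by (simp_all add: label_circ)

lemma label_part_subspace: "pscale.subspace {f :: nat \<Rightarrow>\<^sub>0 'k::field. keys f \<subseteq> A}"
  unfolding pscale.subspace_def
proof (intro conjI ballI allI)
  fix f g :: "nat \<Rightarrow>\<^sub>0 'k" assume "f \<in> {f. keys f \<subseteq> A}" "g \<in> {f. keys f \<subseteq> A}"
  then show "f + g \<in> {f. keys f \<subseteq> A}" using Poly_Mapping.keys_add[of f g] by blast
next
  fix f :: "nat \<Rightarrow>\<^sub>0 'k" and c assume "f \<in> {f. keys f \<subseteq> A}"
  then show "pscale c f \<in> {f. keys f \<subseteq> A}" using keys_pscale[of c f] by blast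
qed simp

lemma arity_part_label:
  "arity_part (label_operad X d :: ('k::field, _) ns_operad) n \<subseteq> {f. keys f \<subseteq> to_nat ` {v \<in> X. length v = n}}"
  unfolding arity_part_def label_operad_simps
  by (rule pscale.span_minimal[OF _ label_part_subspace]) auto

lemma label_comp_Some:
  assumes "label_comp X i v w = Some r" "i < length v"
  shows "r \<in> X" "length r = length v + length w - 1" "sum_list r = sum_list v + sum_list w"
proof -
  have "sum_list (v[i := v ! i + n]) = sum_list v + n" for n
    using assms(2) elem_le_sum_list[of i v] by (simp add: sum_list_update)
  then show "r \<in> X" "length r = length v + length w - 1" "sum_list r = sum_list v + sum_list w"
    using assms by (auto simp: label_comp_def Let_def length_Suc_conv split: if_splits)
qed

text \<open>\<open>seq\<close> and \<open>par\<close> are what the two associativity laws ask of the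
  set of surviving monomials: when the final result survives, the intermediate results on both sides
  must survive together (\<open>seq\<close>) or survive in either order
  (\<open>par\<close>).\<close>

locale monomial_labels =
  fixes X :: "nat list set" and d :: nat
  assumes unit: "[0] \<in> X" and nonempty: "[] \<notin> X" and weight_0: "\<lbrakk>v \<in> X; sum_list v = 0\<rbrakk> \<Longrightarrow> v = [0]"
    and d_pos: "d > 0"
    and seq: "\<lbrakk>v \<in> X; [m] \<in> X; [n] \<in> X; i < length v; v[i := v ! i + (m + n)] \<in> X\<rbrakk> \<Longrightarrow>
      v[i := v ! i + m] \<in> X \<longleftrightarrow> [m + n] \<in> X"
    and par: "\<lbrakk>v \<in> X; [m] \<in> X; [n] \<in> X; i < length v; j < length v; i \<noteq> j; v[i := v ! i + m, j := v ! j + n] \<in> X\<rbrakk> \<Longrightarrow>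
      v[i := v ! i + m] \<in> X"
begin

lemma label_comp_sequential:
  assumes "a \<in> X" "b \<in> X" "c \<in> X" "i < length a" "j < length b"
  shows "Option.bind (label_comp X i a b) (\<lambda>r. label_comp X (i + j) r c)
    = Option.bind (label_comp X j b c) (\<lambda>r. label_comp X i a r)"
proof (cases "length b = 1")
  case True
  then obtain m where b: "b = [m]" by (auto simp: length_Suc_conv)
  then have j: "j = 0" using assms by simp
  show ?thesis
  proof (cases "length c = 1")
    case True
    then obtain n where c: "c = [n]" by (auto simp: length_Suc_conv)
    have "a[i := a ! i + (m + n)] \<in> X \<Longrightarrow> a[i := a ! i + m] \<in> X \<longleftrightarrow> [m + n] \<in> X"
      using seq assms b c by blast
    then show ?thesis using assms(4)
      by (auto simp: label_comp_def Let_def b c j add.assoc)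
  next
    case False
    \<comment> \<open>A non-unary \<open>c\<close> can be inserted only into the unit
      \<open>[0]\<close>, which \<open>a[i := a ! i + m]\<close> cannot be once
      \<open>m > 0\<close>.\<close>
    have ne: "a[i := a ! i + m] \<noteq> [0]" if "m > 0"
      using assms(4) that by (cases a; cases i) auto
    have "a[i := a ! i] = a" by simp
    then show ?thesis using False ne assms by (cases "m = 0") (auto simp: label_comp_def Let_def b j)
  qed
next
  case False
  show ?thesis
  proof (cases "a = [0]")
    case True
    have "label_comp X 0 [0] r = Some r" if "r \<in> X" for r
      using that by (auto simp: label_comp_def length_Suc_conv)
    moreover have "r \<in> X" if "label_comp X j b c = Some r" for r
      using label_comp_Some(1)[OF that assms(5)] .
    ultimately show ?thesis using True assms False
      by (cases "label_comp X j b c") (auto simp: label_comp_def[of X 0 "[0]" b])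
  next
    case a: False
    have "label_comp X i a r = None" if "label_comp X j b c = Some r" for r
    proof -
      have "length c = 1" using that False by (auto simp: label_comp_def Let_def split: if_splits)
      then have "length r \<noteq> 1" using label_comp_Some(2)[OF that assms(5)] False by simp
      then show ?thesis using a by (simp add: label_comp_def)
    qed
    then show ?thesis using a False
      by (cases "label_comp X j b c") (auto simp: label_comp_def[of X i a b])
  qed
qed

lemma label_comp_parallel:
  assumes "a \<in> X" "b \<in> X" "c \<in> X" "i < j" "j < length a"
  shows "Option.bind (label_comp X j a b) (\<lambda>r. label_comp X i r c)
    = Option.bind (label_comp X i a c) (\<lambda>r. label_comp X (j + length c - 1) r b)"
proof (cases "length b = 1 \<and> length c = 1")
  case True
  then obtain m n where b: "b = [m]" and c: "c = [n]" by (auto simp: length_Suc_conv)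
  have "a[i := a ! i + n] \<in> X \<and> a[j := a ! j + m] \<in> X" if "a[j := a ! j + m, i := a ! i + n] \<in> X"
    using par[of a m n j i] par[of a n m i j] that assms b c by (auto simp: list_update_swap)
  then show ?thesis using assms by (auto simp: label_comp_def Let_def b c list_update_swap)
next
  case False
  have "r \<noteq> [0]" "length r \<noteq> 1" if "length r \<ge> length a" for r :: "nat list"
    using that assms by auto
  then show ?thesis using False assms by (auto simp: label_comp_def Let_def)
qed

lemma keys_AP: "f \<in> arity_part (label_operad X d) n \<Longrightarrow> keys f \<subseteq> to_nat ` {v \<in> X. length v = n}"
  using arity_part_label[of X d n] by blast

lemma is_operad: "weight_graded_ns_operad (label_operad X d :: ('k::field, _) ns_operad)"
proof -
  let ?P = "label_operad X d :: ('k, _) ns_operad"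
  let ?c = "\<lambda>i p q. opt_monom (label_comp X i (from_nat p) (from_nat q)) :: nat \<Rightarrow>\<^sub>0 'k"
  have L: "bilinear_extension (?c k) (opt_monom r) (monom c) = opt_monom (Option.bind r (\<lambda>r. label_comp X k r c))"
    for k r c by (cases r) simp_all
  have R: "bilinear_extension (?c k) (monom c) (opt_monom r) = opt_monom (Option.bind r (\<lambda>r. label_comp X k c r))"
    for k r c by (cases r) simp_all
  have no_keys: "{f :: nat \<Rightarrow>\<^sub>0 'k. keys f \<subseteq> {}} = {0}"
  proof (intro equalityI subsetI)
    fix f :: "nat \<Rightarrow>\<^sub>0 'k" assume "f \<in> {f. keys f \<subseteq> {}}"
    then have "f = 0" by (intro poly_mapping_eqI) (auto simp: in_keys_iff)
    then show "f \<in> {0}" by simp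
  qed simp
  have span: "pscale.span {monom v :: nat \<Rightarrow>\<^sub>0 'k} = {f. keys f \<subseteq> {to_nat v}}" for v :: "nat list"
  proof (intro equalityI subsetI)
    fix f :: "nat \<Rightarrow>\<^sub>0 'k" assume "f \<in> {f. keys f \<subseteq> {to_nat v}}"
    then have "f = pscale (lookup f (to_nat v)) (monom v)" using keys_subset_singleton by simp
    then show "f \<in> pscale.span {monom v}"
      unfolding pscale.span_singleton by (rule range_eqI)
  next
    fix f :: "nat \<Rightarrow>\<^sub>0 'k" assume "f \<in> pscale.span {monom v}"
    then obtain c where "f = pscale c (monom v)" by (auto simp: pscale.span_singleton)
    then show "f \<in> {f. keys f \<subseteq> {to_nat v}}" by simp
  qed
  have wt: "{v \<in> X. length v = 1 \<and> sum_list v = 0} = {[0]}"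
  proof -
    have "v \<in> {[0]}" if "v \<in> {v \<in> X. length v = 1 \<and> sum_list v = 0}" for v
      using weight_0[of v] that by simp
    then have "{v \<in> X. length v = 1 \<and> sum_list v = 0} \<subseteq> {[0]}" by (rule subsetI)
    then show ?thesis using unit by (intro equalityI) simp_all
  qed
  have wt': "{v \<in> X. length v = n \<and> sum_list v = 0} = {}" if "n > 1" for n
  proof (rule equals0I)
    fix v assume "v \<in> {v \<in> X. length v = n \<and> sum_list v = 0}"
    then show False using weight_0[of v] \<open>n > 1\<close> by simp
  qed
  show ?thesis
  proof (unfold_locales, goal_cases)
    case (5 n k)
    show ?case by (simp add: label_part_subspace)
  next
    case (6 K v n l)
    have "lookup (v l) p = 0" for p
    proof (rule ccontr)
      assume p: "lookup (v l) p \<noteq> 0"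
      have "lookup (v k) p = 0" if k: "k \<in> K" "k \<noteq> l" for k
      proof (rule ccontr)
        assume "lookup (v k) p \<noteq> 0"
        then obtain u where "p = to_nat u" "sum_list u = k * d"
          using 6(2)[OF k(1)] by (auto simp: in_keys_iff)
        moreover obtain u' where "p = to_nat u'" "sum_list u' = l * d"
          using 6(2)[OF 6(4)] p by (auto simp: in_keys_iff)
        ultimately show False using k(2) d_pos by simp
      qed
      then have "(\<Sum>k\<in>K. lookup (v k) p) = lookup (v l) p"
        using 6(1,4) by (subst sum.remove[of K l]) auto
      then show False using p arg_cong[OF 6(3), of "\<lambda>f. lookup f p"] by (simp add: lookup_sum)
    qed
    then show ?case by (intro poly_mapping_eqI) simp
  next
    case (7 a n k b m l i)
    have "keys (?c i p q) \<subseteq> to_nat ` {v \<in> X. length v = n + m - 1 \<and> sum_list v = (k + l) * d}"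
      if "p \<in> keys a" "q \<in> keys b" for p q
    proof -
      have "p \<in> to_nat ` {v \<in> X. length v = n \<and> sum_list v = k * d}"
        "q \<in> to_nat ` {v \<in> X. length v = m \<and> sum_list v = l * d}"
        using 7(1,2) that by auto
      then obtain v w where vw: "p = to_nat v" "length v = n" "sum_list v = k * d"
        "q = to_nat w" "length w = m" "sum_list w = l * d" by blast
      show ?thesis
        using label_comp_Some[of X i v w] vw 7(3) by (cases "label_comp X i v w") (auto simp: add_mult_distrib)
    qed
    then show ?case
      using keys_bilinear_extension[of "?c i" a b] unfolding label_circ label_operad_simps by blast
  next
    case (12 a n b m e p i j)
    show ?case unfolding label_circ
    proof (rule bilinear_extension_assoc[OF keys_AP[OF 12(1)] keys_AP[OF 12(2)] keys_AP[OF 12(3)]])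
      fix s t u
      assume "s \<in> to_nat ` {v \<in> X. length v = n}" "t \<in> to_nat ` {v \<in> X. length v = m}"
        "u \<in> to_nat ` {v \<in> X. length v = p}"
      then obtain x y z where xyz: "s = to_nat x" "t = to_nat y" "u = to_nat z" "x \<in> X" "y \<in> X" "z \<in> X"
        "length x = n" "length y = m" by auto
      show "bilinear_extension (?c (i + j)) (?c i s t) (single u 1)
          = bilinear_extension (?c i) (single s 1) (?c j t u)"
        using label_comp_sequential[of x y z i j] 12(4,5) xyz by (simp only: L R from_nat_to_nat)
    qed
  next
    case (13 a n b m e p i j)
    show ?case unfolding label_circ
    proof (rule bilinear_extension_swap[OF keys_AP[OF 13(1)] keys_AP[OF 13(2)] keys_AP[OF 13(3)]])
      fix s t u
      assume "s \<in> to_nat ` {v \<in> X. length v = n}" "t \<in> to_nat ` {v \<in> X. length v = m}"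
        "u \<in> to_nat ` {v \<in> X. length v = p}"
      then obtain x y z where xyz: "s = to_nat x" "t = to_nat y" "u = to_nat z" "x \<in> X" "y \<in> X" "z \<in> X"
        "length x = n" "length z = p" by auto
      show "bilinear_extension (?c i) (?c j s t) (single u 1)
          = bilinear_extension (?c (j + p - 1)) (?c i s u) (single t 1)"
        using label_comp_parallel[of x y z i j] 13(4,5) xyz by (simp only: L from_nat_to_nat)
    qed
  next
    case (14 a n)
    have *: "label_comp X 0 [0] v = Some v" if "v \<in> X" for v
      using that by (auto simp: label_comp_def length_Suc_conv)
    show ?case using keys_AP[OF 14]
      by (induction a rule: keys_subset_induct) (auto simp: *)
  next
    case (15 a n i)
    have *: "label_comp X i v [0] = Some v" if "v \<in> X" for v
      using that by (auto simp: label_comp_def)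
    show ?case using keys_AP[OF 15(1)]
      by (induction a rule: keys_subset_induct) (auto simp: *)
  next
    case (16 k)
    have "{v \<in> X. length v = 0 \<and> sum_list v = k * d} = {}" using nonempty by auto
    then show ?case by (simp only: label_operad_simps image_empty no_keys)
  next
    case 17
    show ?case by (simp only: label_operad_simps mult_0 wt span) simp
  next
    case 18
    have "lookup (monom [0] :: nat \<Rightarrow>\<^sub>0 'k) (to_nat [0::nat]) \<noteq> 0" by simp
    then show ?case by (metis label_operad_simps(2) lookup_zero)
  next
    case (19 n)
    show ?case by (simp only: label_operad_simps mult_0 wt'[OF 19] image_empty no_keys)
  qed (auto simp: algebra_simps)
qed

end

text \<open>Entry 2 counts the letter of \<open>op_e\<close> itself and entry 1 the letter of
  \<open>op_f\<close>, hence one of them is positive. For \<open>[0, 1, 1, 0]\<close> both readings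
  are possible; this is the one defining relation that is not a monomial.\<close>

definition labelsP :: "nat list set" where
  "labelsP = {v. length v = 1} \<union> {v. length v = 4 \<and> (v ! 0 = 0 \<or> v ! 1 = 0) \<and> v ! 1 + v ! 2 > 0}"

text \<open>Labels of the test operad: the monomials of weight \<open>d\<close>,
  \<open>2 * d\<close> and \<open>3 * d\<close> around the cubic relation, all other products being
  zero. \<open>[d, d, 1, d - 1]\<close> survives here although it vanishes in
  \<open>P_op\<close>.\<close>

definition labelsQ :: "nat \<Rightarrow> nat list set" where
  "labelsQ d = {[0], [d], [0, 0, 1, d - 1], [d, 0, 1, d - 1], [0, d, 1, d - 1], [d, d, 1, d - 1]}"

lemma length_4_conv: "length v = 4 \<longleftrightarrow> (\<exists>x y w z. v = [x, y, w, z])"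
  by (auto simp: eval_nat_numeral length_Suc_conv)

lemma labelsP_cases:
  assumes "v \<in> labelsP"
  obtains n where "v = [n]" | x y w z where "v = [x, y, w, z]" "x = 0 \<or> y = 0" "y + w > 0"
  using assms by (auto simp: labelsP_def length_4_conv length_Suc_conv eval_nat_numeral)

lemma labelsP_simps [simp]:
  "[n] \<in> labelsP" "[x, y, w, z] \<in> labelsP \<longleftrightarrow> (x = 0 \<or> y = 0) \<and> y + w > 0" "[] \<notin> labelsP"
  by (auto simp: labelsP_def eval_nat_numeral)

lemma monomial_labelsP: "monomial_labels labelsP 1"
proof (unfold_locales, goal_cases)
  case (3 v)
  then show ?case by (auto elim!: labelsP_cases)
next
  case (5 v m n i)
  from 5(1) show ?case
  proof (cases rule: labelsP_cases)
    case (2 x y w z)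
    then show ?thesis using 5 by (auto simp: less_Suc_eq eval_nat_numeral)
  qed (use 5 in auto)
next
  case (6 v m n i j)
  from 6(1) show ?case
  proof (cases rule: labelsP_cases)
    case (2 x y w z)
    then show ?thesis using 6 by (auto simp: less_Suc_eq eval_nat_numeral)
  qed (use 6 in auto)
qed auto

lemma labelsQ_nth_le: "\<lbrakk>v \<in> labelsQ d; i < length v; d \<ge> 2\<rbrakk> \<Longrightarrow> v ! i \<le> d"
  by (auto simp: labelsQ_def less_Suc_eq)

lemma monomial_labelsQ:
  assumes "d \<ge> 2"
  shows "monomial_labels (labelsQ d) d"
proof (unfold_locales, goal_cases)
  case (5 v m n i)
  have mn: "m = 0 \<or> m = d" "n = 0 \<or> n = d" using 5(2,3) by (auto simp: labelsQ_def)
  have "v ! i + (m + n) \<le> d" using labelsQ_nth_le[OF 5(5), of i] 5(4) assms by simp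
  then have "m = 0 \<or> n = 0" using mn assms by auto
  then show ?case using 5 by auto
next
  case (6 v m n i j)
  have mn: "m = 0 \<or> m = d" "n = 0 \<or> n = d" using 6(2,3) by (auto simp: labelsQ_def)
  show ?case
  proof (cases "m = 0 \<or> n = 0")
    case True
    have "v[i := v ! i + m, j := v ! j] = v[i := v ! i + m]"
      using 6(6) by (simp add: list_update_swap)
    then show ?thesis using True 6 by auto
  next
    case False
    \<comment> \<open>Both increased entries reach \<open>d\<close>, while the entries after the
      second stay below \<open>d\<close>. So \<open>i\<close> and \<open>j\<close> are the first two
      inputs and \<open>v\<close> is \<open>[0, 0, 1, d - 1]\<close>.\<close>
    let ?u = "v[i := v ! i + d, j := v ! j + d]"
    have u: "?u \<in> labelsQ d" "m = d" using False mn 6(7) by auto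
    have large: "?u ! i \<ge> d" "?u ! j \<ge> d" and len: "length v \<noteq> 1" using 6(4-6) by auto
    have lt: "?u ! k < d" if "k < length v" "k \<noteq> 0" "k \<noteq> 1" for k
    proof -
      have "w ! k < d" if "w \<in> labelsQ d" "length w \<noteq> 1" "k < length w" for w
        using that \<open>k \<noteq> 0\<close> \<open>k \<noteq> 1\<close> assms by (auto simp: labelsQ_def less_Suc_eq)
      from this[OF u(1)] show ?thesis using len that(1) by simp
    qed
    have ij: "i < 2" "j < 2"
      using lt[of i] lt[of j] large 6(4,5) by (auto simp: less_2_cases_iff leD)
    then have "v \<in> {[0, 0, 1, d - 1], [d, 0, 1, d - 1], [0, d, 1, d - 1], [d, d, 1, d - 1]}"
      using 6(1) len by (auto simp: labelsQ_def)
    moreover have "v ! i = 0" "v ! j = 0"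
      using labelsQ_nth_le[OF u(1), of i] labelsQ_nth_le[OF u(1), of j] 6(4-6) assms by auto
    ultimately have "v = [0, 0, 1, d - 1]"
      using ij 6(6) assms by (auto simp: less_2_cases_iff)
    then show ?thesis using ij u(2) by (auto simp: less_2_cases_iff labelsQ_def)
  qed
qed (use assms in \<open>auto simp: labelsQ_def\<close>)

subsection \<open>Veronese powers with a cubic relation\<close>

abbreviation P_op :: "('k::field, nat \<Rightarrow>\<^sub>0 'k) ns_operad" where
  "P_op \<equiv> label_operad labelsP (Suc 0)"

abbreviation Q_op :: "nat \<Rightarrow> ('k::field, nat \<Rightarrow>\<^sub>0 'k) ns_operad" where
  "Q_op d \<equiv> label_operad (labelsQ d) d"

lemmas P_op_operad = monomial_labels.is_operad[OF monomial_labelsP, unfolded One_nat_def]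
lemmas Q_op_operad = monomial_labels.is_operad[OF monomial_labelsQ]

text \<open>Forgets all monomials outside \<open>labelsQ d\<close>. It cannot respect iterated
  compositions, because \<open>[d, d, 1, d - 1]\<close> is zero in \<open>P_op\<close>, but it
  respects a single composition of two elements of weight \<open>d\<close>.\<close>

definition projQ :: "nat \<Rightarrow> (nat \<Rightarrow>\<^sub>0 'k::field) \<Rightarrow> (nat \<Rightarrow>\<^sub>0 'k)" where
  "projQ d = linear_extension pscale (\<lambda>p. if p \<in> to_nat ` labelsQ d then single p 1 else 0)"

lemma projQ_simps [simp]:
  "projQ d 0 = 0" "projQ d (f + g) = projQ d f + projQ d g" "projQ d (pscale c f) = pscale c (projQ d f)"
  "projQ d (\<Sum>i\<in>A. F i) = (\<Sum>i\<in>A. projQ d (F i))"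
  "projQ d (single (to_nat v) c) = (if v \<in> labelsQ d then single (to_nat v) c else 0)"
  by (auto simp: projQ_def pscale.linear_extension_add pscale.linear_extension_pscale
      pscale.linear_extension_sum)

lemma keys_projQ: "keys (projQ d f) \<subseteq> keys f \<inter> to_nat ` labelsQ d"
proof
  fix p assume "p \<in> keys (projQ d f)"
  then have "p \<in> (\<Union>q\<in>keys f. keys (if q \<in> to_nat ` labelsQ d then single q 1 else (0 :: nat \<Rightarrow>\<^sub>0 'a)))"
    unfolding projQ_def by (rule subsetD[OF keys_linear_extension])
  then show "p \<in> keys f \<inter> to_nat ` labelsQ d" by (auto split: if_splits)
qed

lemma projQ_part: "x \<in> part P_op n d \<Longrightarrow> projQ d x \<in> part (Q_op d) n 1"
proof -
  assume "x \<in> part P_op n d"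
  then have x: "keys x \<subseteq> to_nat ` {v \<in> labelsP. length v = n \<and> sum_list v = d}" by simp
  have "p \<in> to_nat ` {v \<in> labelsQ d. length v = n \<and> sum_list v = d}" if "p \<in> keys (projQ d x)" for p
  proof -
    have p: "p \<in> keys x" "p \<in> to_nat ` labelsQ d" using that keys_projQ[of d x] by auto
    then obtain v where "p = to_nat v" "length v = n" "sum_list v = d" using x by auto
    with p(2) show ?thesis by auto
  qed
  then show ?thesis by (simp add: subsetI)
qed

text \<open>The only labels of sum \<open>2 * d\<close> in \<open>labelsQ d\<close> are
  \<open>[d, 0, 1, d - 1]\<close> and \<open>[0, d, 1, d - 1]\<close>. Their other entries are below
  \<open>d\<close>, so each arises only from \<open>[0, 0, 1, d - 1]\<close>, which also lies in
  \<open>labelsQ d\<close>.\<close>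

lemma label_comp_projQ:
  assumes d: "d \<ge> 2" and v: "v \<in> labelsP" "sum_list v = d" and w: "w \<in> labelsP" "sum_list w = d"
    and i: "i < length v"
  shows "projQ d (opt_monom (label_comp labelsP i v w))
    = (if v \<in> labelsQ d \<and> w \<in> labelsQ d then opt_monom (label_comp (labelsQ d) i v w) else 0)"
proof (cases "length w = 1")
  case False
  then show ?thesis using v d by (auto simp: label_comp_def Let_def)
next
  case True
  then have w: "w = [d]" using w by (auto simp: length_Suc_conv)
  have wQ: "[d] \<in> labelsQ d" by (simp add: labelsQ_def)
  let ?r = "v[i := v ! i + d]"
  have "?r \<in> labelsP \<and> v \<in> labelsQ d" if r: "?r \<in> labelsQ d"
  proof -
    have "sum_list ?r = 2 * d" using v i elem_le_sum_list[of i v] by (simp add: sum_list_update)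
    then have r': "?r = [d, 0, 1, d - 1] \<or> ?r = [0, d, 1, d - 1]"
      using r d unfolding labelsQ_def by auto
    then have "length ?r = 4" by (elim disjE) simp_all
    then have l: "length v = 4" by simp
    then obtain x y w z where v4: "v = [x, y, w, z]" by (auto simp: length_4_conv)
    from i l have "i = 0 \<or> i = 1 \<or> i = 2 \<or> i = 3" by auto
    then show ?thesis using r' d unfolding v4 by (elim disjE) (auto simp: labelsQ_def)
  qed
  then show ?thesis using wQ by (auto simp: label_comp_def Let_def w)
qed

lemma projQ_circ:
  fixes x y :: "nat \<Rightarrow>\<^sub>0 'k::field"
  assumes d: "d \<ge> 2" and x: "x \<in> part P_op n d" and y: "y \<in> part P_op m d" and i: "i < n"
  shows "projQ d (circ P_op i x y) = circ (Q_op d) i (projQ d x) (projQ d y)"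
proof -
  let ?S = "\<lambda>n. to_nat ` {v \<in> labelsP. length v = n \<and> sum_list v = d * Suc 0}"
  have x': "keys x \<subseteq> ?S n" and y': "keys y \<subseteq> ?S m" using x y by simp_all
  show ?thesis using x'
  proof (induction x rule: keys_subset_induct)
    case (add p c x)
    have "projQ d (circ P_op i (single p c) y) = circ (Q_op d) i (projQ d (single p c)) (projQ d y)"
      using y'
    proof (induction y rule: keys_subset_induct)
      case (add q c' y)
      have "\<exists>v w. p = to_nat v \<and> q = to_nat w \<and> v \<in> labelsP \<and> w \<in> labelsP \<and> sum_list v = d
        \<and> sum_list w = d \<and> length v = n"
        using \<open>p \<in> _\<close> \<open>q \<in> _\<close> by auto
      then obtain v w where vw: "p = to_nat v" "q = to_nat w" "v \<in> labelsP" "w \<in> labelsP" "sum_list v = d"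
        "sum_list w = d" "length v = n" by blast
      have "projQ d (opt_monom (label_comp labelsP i v w) :: nat \<Rightarrow>\<^sub>0 'k)
          = (if v \<in> labelsQ d \<and> w \<in> labelsQ d then opt_monom (label_comp (labelsQ d) i v w) else 0)"
        by (rule label_comp_projQ) (use d vw i in auto)
      then have "projQ d (circ P_op i (single p c) (single q c'))
          = circ (Q_op d) i (projQ d (single p c)) (projQ d (single q c'))"
        unfolding vw(1,2) by simp
      then show ?case using add by simp
    qed simp
    then show ?case using add by simp
  qed simp
qed

lemma veronese_weight_1: "a \<in> part P n d \<Longrightarrow> a \<in> part (veronese P d) n 1"
  by (simp add: gen_base)

context
  fixes d :: nat and B :: "nat \<Rightarrow> (nat \<Rightarrow>\<^sub>0 'k::field) set"
  assumes d: "d \<ge> 2" and B: "generator_basis (veronese P_op d) B"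
begin

interpretation V: weight_graded_ns_operad "veronese P_op d :: ('k, _) ns_operad"
  by (rule veronese_is_operad[OF P_op_operad]) (use d in simp)

interpretation Q: weight_graded_ns_operad "Q_op d :: ('k, _) ns_operad"
  by (rule Q_op_operad[OF d])

lemma B_part: "x \<in> B n \<Longrightarrow> x \<in> part P_op n d"
  using V.generator_basis_part[OF B, of x n] by (simp del: label_operad_simps)

lemma B_V: "x \<in> B n \<Longrightarrow> x \<in> arity_part (veronese P_op d) n"
  by (rule V.B_AP[OF B])

lemma projQ_B: "x \<in> B n \<Longrightarrow> projQ d x \<in> arity_part (Q_op d) n"
  by (rule Q.part_AP[OF projQ_part[OF B_part]])

text \<open>At most two vertices means at most one composition, which \<open>projQ\<close> respects.
  Consequently the test operad satisfies all relations of weight at most two.\<close>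

lemma eval_projQ:
  assumes t: "t \<in> tree_monomials B n" "vertices t \<le> 2"
  shows "eval_tree (Q_op d) (map_tree (projQ d) t) = projQ d (eval_tree (veronese P_op d) t)"
proof -
  have cor: "eval_tree (Q_op d) (map_tree (projQ d) (corolla m x)) = projQ d x"
    "eval_tree (veronese P_op d) (corolla m x) = x" if "x \<in> B m" for m x
    using Q.eval_corolla[OF projQ_B[OF that]] V.eval_corolla[OF B_V[OF that]]
    by (simp_all add: map_replicate_const)
  have tt: "eval_tree (Q_op d) (map_tree (projQ d) (graft i (corolla l x) (corolla m y)))
      = projQ d (eval_tree (veronese P_op d) (graft i (corolla l x) (corolla m y)))"
    if "x \<in> B l" "y \<in> B m" "i < l" for i l m x y
  proof -
    have x: "corolla l x \<in> tree_monomials B l" and y: "corolla m y \<in> tree_monomials B m"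
      using that by simp_all
    show ?thesis
      using Q.eval_map_tree_graft[of B "projQ d", OF projQ_B x y that(3)]
        V.eval_map_tree_graft[of B "\<lambda>x. x", OF B_V x y that(3)]
        projQ_circ[OF d B_part[OF that(1)] B_part[OF that(2)] that(3)]
      by (simp only: tree.map_ident cor[OF that(1)] cor[OF that(2)] veronese_simps)
  qed
  show ?thesis
  proof (cases "t = Leaf")
    case True
    then show ?thesis by (simp add: labelsQ_def)
  next
    case False
    from t have "decorated_by B t" by (simp add: tree_monomials_def)
    from tree_graft_corolla_cases[OF False this] obtain i s m y where
      s: "t = graft i s (corolla m y)" "i < leaves s" "y \<in> B m" "decorated_by B s" .
    have vs: "vertices t = vertices s + 1" unfolding s(1) vertices_graft[OF s(2)] by simp
    show ?thesis
    proof (cases "s = Leaf")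
      case True
      then have "t = corolla m y" using s by simp
      then show ?thesis using cor[OF s(3)] by simp
    next
      case False
      then have "vertices s = 1" using vs t(2) decorated_by_vertices_0[of s] by linarith
      moreover have "s \<in> tree_monomials B (leaves s)" using s by (simp add: tree_monomials_def)
      ultimately obtain x where x: "x \<in> B (leaves s)" "s = corolla (leaves s) x"
        using V.vertices_1_corolla[of s B "leaves s" thesis] by blast
      show ?thesis using tt[OF x(1) s(3,2)] unfolding s(1) x(2)[symmetric] .
    qed
  qed
qed

lemma free_hom_projQ:
  assumes "f \<in> free_operad B n" "homogeneous_of_weight w f" "w \<le> 2"
  shows "free_hom (Q_op d) (projQ d) f = projQ d (free_hom (veronese P_op d) (\<lambda>x. x) f)"
proof -
  have "eval_tree (Q_op d) (map_tree (projQ d) t) = projQ d (eval_tree (veronese P_op d) t)" if "t \<in> keys f" for t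
    using that assms by (intro eval_projQ[of t n]) (auto simp: free_operad_def homogeneous_of_weight_def)
  then show ?thesis
    by (simp add: free_hom_def linear_extension_def tree.map_ident)
qed

text \<open>\<open>f\<close> lifts the composition of \<open>[0, 0, 1, d - 1]\<close> with
  \<open>a^d\<close> on inputs 0 and 1. It evaluates to zero in the Veronese power but to
  \<open>[d, d, 1, d - 1]\<close> in the test operad, where everything generated by relations of
  weight at most two vanishes. Lifting through \<open>linear_lift\<close> makes the argument work
  for every basis \<open>B\<close>.\<close>

lemma veronese_cubic_relation:
  "\<exists>f. f \<in> relation_ideal (veronese P_op d) B 4 \<and>
    \<not> generated_ideal B (relations_up_to (veronese P_op d) B 2) 4 f"
proof -
  let ?V = "veronese P_op d :: ('k, _) ns_operad" and ?ev = "free_hom (veronese P_op d) (\<lambda>x. x)"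
    and ?q = "free_hom (Q_op d) (projQ d)"
  define e a where "e = (monom [0, 0, 1, d - 1] :: nat \<Rightarrow>\<^sub>0 'k)" and "a = (monom [d] :: nat \<Rightarrow>\<^sub>0 'k)"
  have "e \<in> part P_op 4 d" "a \<in> part P_op 1 d"
    using d by (auto simp: e_def a_def)
  then have "e \<in> part ?V 4 1" "a \<in> part ?V 1 1" by (simp_all only: veronese_weight_1)
  then obtain e' a' where e': "e' \<in> free_operad B 4" "homogeneous_of_weight 1 e'" "?ev e' = e"
    and a': "a' \<in> free_operad B 1" "homogeneous_of_weight 1 a'" "?ev a' = a"
    using V.linear_lift[OF B] by meson
  define g where "g = free_circ 0 e' a'"
  define f where "f = free_circ 1 g a'"
  have g: "g \<in> free_operad B 4"
    using free_operad_closed(7)[OF e'(1) a'(1), of 0] by (simp add: g_def)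
  have f: "f \<in> free_operad B 4"
    using free_operad_closed(7)[OF g a'(1), of 1] by (simp add: f_def)
  have "?ev g = monom [d, 0, 1, d - 1]"
    using V.free_hom_circ[of B "\<lambda>x. x", OF B_V e'(1) a'(1), of 0] e' a'
    by (simp add: g_def e_def a_def label_comp_def)
  then have "?ev f = 0"
    using V.free_hom_circ[of B "\<lambda>x. x", OF B_V g a'(1), of 1] a' d
    by (simp add: f_def a_def label_comp_def)
  then have 1: "f \<in> relation_ideal ?V B 4" using f by (simp add: relation_ideal_eq)
  have qe: "?q e' = e" "?q a' = a"
    using free_hom_projQ[OF e'(1,2)] free_hom_projQ[OF a'(1,2)] e'(3) a'(3)
    by (simp_all add: e_def a_def labelsQ_def)
  have "?q g = monom [d, 0, 1, d - 1]"
    using Q.free_hom_circ[of B "projQ d", OF projQ_B e'(1) a'(1), of 0] qe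
    by (simp add: g_def e_def a_def label_comp_def labelsQ_def)
  then have "?q f = monom [d, d, 1, d - 1]"
    using Q.free_hom_circ[of B "projQ d", OF projQ_B g a'(1), of 1] qe
    by (simp add: f_def a_def label_comp_def labelsQ_def)
  then have "lookup (?q f) (to_nat [d, d, 1, d - 1]) \<noteq> 0" by simp
  then have "?q f \<noteq> 0" by (metis lookup_zero)
  moreover have "f \<in> free_operad B n \<and> ?q f = 0" if "f \<in> relations_up_to ?V B 2 n" for f n
    using that free_hom_projQ[of f n] by (auto simp: relations_up_to_def relation_ideal_eq)
  ultimately have "\<not> generated_ideal B (relations_up_to ?V B 2) 4 f"
    using generated_ideal_kernel[OF Q.weight_graded_ns_operad_axioms, of B "projQ d" "relations_up_to ?V B 2" 4 f]
      projQ_B by blast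
  with 1 show ?thesis by blast
qed

end

text \<open>A Groebner basis generates the ideal, so a quadratic one would derive the cubic relation
  from relations of weight two.\<close>

lemma veronese_no_quadratic_groebner_basis:
  assumes d: "d \<ge> 2"
  shows "\<not> has_quadratic_groebner_basis (veronese P_op d :: ('k::field, _) ns_operad)"
proof
  let ?V = "veronese P_op d :: ('k, _) ns_operad"
  interpret V: weight_graded_ns_operad ?V
    by (rule veronese_is_operad[OF P_op_operad]) (use d in simp)
  assume "has_quadratic_groebner_basis ?V"
  then obtain B lt G where B: "generator_basis ?V B" and lt: "monomial_order B lt"
    and G: "groebner_basis lt (relation_ideal ?V B) G" "\<And>n g. g \<in> G n \<Longrightarrow> homogeneous_of_weight 2 g"
    unfolding has_quadratic_groebner_basis_def by blast
  from veronese_cubic_relation[OF d B] obtain f where f: "f \<in> relation_ideal ?V B 4"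
    "\<not> generated_ideal B (relations_up_to ?V B 2) 4 f" by blast
  have GI: "G n \<subseteq> relation_ideal ?V B n" for n using G(1) by (simp add: groebner_basis_def)
  have "generated_ideal B G 4 f"
    by (rule groebner_basis_generates[OF lt G(1) V.relation_ideal_free V.relation_ideal_subspace _ f(1)])
       (rule V.generated_ideal_relations[OF V.generator_basis_part[OF B] _ GI])
  then have "generated_ideal B (relations_up_to ?V B 2) 4 f"
  proof (rule generated_ideal_mono)
    fix n g assume "g \<in> G n"
    then have "g \<in> relations_up_to ?V B 2 n" using GI G(2) by (auto simp: relations_up_to_def)
    then show "generated_ideal B (relations_up_to ?V B 2) n g" by (rule ideal_base)
  qed
  with f show False by blast
qed

text \<open>Any minimal set of relations, and one exists, must contain an element of weight above
  two: otherwise the cubic relation would follow from \<open>relations_up_to\<close> with bound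
  2.\<close>

lemma veronese_minimal_relations:
  assumes d: "d \<ge> 2"
  shows "\<not> minimal_relations_weight_le (veronese P_op d :: ('k::field, _) ns_operad) 2"
proof
  let ?V = "veronese P_op d :: ('k, _) ns_operad"
  interpret V: weight_graded_ns_operad ?V
    by (rule veronese_is_operad[OF P_op_operad]) (use d in simp)
  assume le: "minimal_relations_weight_le ?V 2"
  obtain B where B: "generator_basis ?V B" using V.generator_basis_exists by blast
  obtain R where R: "minimal_defining_relations ?V B R"
    using V.minimal_relations_exist[OF V.generator_basis_part[OF B]] by blast
  from veronese_cubic_relation[OF d B] obtain f where f: "f \<in> relation_ideal ?V B 4"
    "\<not> generated_ideal B (relations_up_to ?V B 2) 4 f" by blast
  have def_rel: "defining_relations ?V B R" using R by (simp add: minimal_defining_relations_def)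
  then have "generated_ideal B R 4 f" using f(1) by (auto simp: defining_relations_def)
  then have "generated_ideal B (relations_up_to ?V B 2) 4 f"
  proof (rule generated_ideal_mono)
    fix n g assume g: "g \<in> R n"
    then have "g \<in> relation_ideal ?V B n"
      using def_rel ideal_base[of g R n B] unfolding defining_relations_def by blast
    moreover have "\<exists>w\<le>2. homogeneous_of_weight w g"
      using le B R g unfolding minimal_relations_weight_le_def by blast
    ultimately have "g \<in> relations_up_to ?V B 2 n" by (simp add: relations_up_to_def)
    then show "generated_ideal B (relations_up_to ?V B 2) n g" by (rule ideal_base)
  qed
  with f show False by blast
qed

subsection \<open>The path order\<close>

text \<open>The path sequence of a planar tree: for each leaf, from left to right, the word of ranks
  met on the way from the root.\<close>

fun paths :: "('x \<Rightarrow> nat) \<Rightarrow> 'x tree \<Rightarrow> nat list list" where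
  "paths rk Leaf = [[]]"
| "paths rk (Node x ts) = map (Cons (rk x)) (concat (map (paths rk) ts))"

text \<open>The path-lexicographic order. On trees of equal arity the outer \<open>lenlex\<close> is
  purely lexicographic; comparing words by length first keeps the order well-founded.\<close>

definition path_less :: "('x \<Rightarrow> nat) \<Rightarrow> 'x tree \<Rightarrow> 'x tree \<Rightarrow> bool" where
  "path_less rk s t \<longleftrightarrow> (paths rk s, paths rk t) \<in> lenlex (lenlex less_than)"

lemma length_paths: "length (paths rk t) = leaves t"
  by (induction t) (simp_all add: length_concat comp_def cong: map_cong)

lemma length_concat_paths: "length (concat (map (paths rk) ts)) = sum_list (map leaves ts)"
  by (simp add: length_concat comp_def length_paths)

lemma paths_graft: "i < leaves s \<Longrightarrow> paths rk (graft i s t)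
    = take i (paths rk s) @ map ((@) (paths rk s ! i)) (paths rk t) @ drop (Suc i) (paths rk s)"
  and paths_graft_list: "i < sum_list (map leaves ss) \<Longrightarrow> concat (map (paths rk) (graft_list i ss t))
    = take i (concat (map (paths rk) ss)) @ map ((@) (concat (map (paths rk) ss) ! i)) (paths rk t)
      @ drop (Suc i) (concat (map (paths rk) ss))"
proof (induction i s t and i ss t rule: graft_graft_list.induct)
  case (2 i x ss t)
  then show ?case
    by (simp add: take_map drop_map length_concat_paths del: map_concat)
next
  case (4 i s ss t)
  show ?case
  proof (cases "i < leaves s")
    case True
    then show ?thesis using 4 by (simp add: length_paths nth_append)
  next
    case False
    then have "Suc i - leaves s = Suc (i - leaves s)" by simp
    then show ?thesis using 4 False by (simp add: length_paths nth_append)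
  qed
qed (simp_all add: map_idI)

text \<open>The paths of the children are concatenated without separators. The trailing lists
  \<open>L\<close> and \<open>L'\<close> let the induction recover where the paths of one child
  end.\<close>

lemma paths_injective:
  assumes inj: "\<And>n m x y. \<lbrakk>x \<in> X n; y \<in> X m; rk x = rk y\<rbrakk> \<Longrightarrow> x = y \<and> n = m" and X: "X 0 = {}"
  shows "\<lbrakk>decorated_by X s; decorated_by X t; paths rk s @ L = paths rk t @ L'\<rbrakk> \<Longrightarrow> s = t \<and> L = L'"
proof (induction s arbitrary: t L L')
  case Leaf
  show ?case
  proof (cases t)
    case (Node y ts)
    have "leaves t > 0" using decorated_leaves_pos[of X, OF X Leaf(2)] .
    then have "0 < length (concat (map (paths rk) ts))"
      unfolding length_concat_paths Node leaves.simps .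
    then have "concat (map (paths rk) ts) \<noteq> []" unfolding length_greater_0_conv .
    then show ?thesis using Leaf(3) Node by (cases "concat (map (paths rk) ts)") auto
  qed (use Leaf in simp)
next
  case (Node x ss)
  have ne: "concat (map (paths rk) us) \<noteq> []" if "decorated_by X (Node y us)" for y us
  proof -
    have "0 < length (concat (map (paths rk) us))"
      using decorated_leaves_pos[of X, OF X that] unfolding length_concat_paths leaves.simps .
    then show ?thesis unfolding length_greater_0_conv .
  qed
  show ?case
  proof (cases t)
    case Leaf
    then show ?thesis using Node(4) ne[OF Node(2)] by (cases "concat (map (paths rk) ss)") auto
  next
    case t: (Node y ts)
    let ?A = "concat (map (paths rk) ss)" and ?C = "concat (map (paths rk) ts)"
    have "rk x = rk y"
      using Node(4) ne[OF Node(2)] ne[of y ts] Node(3) t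
      by (cases ?A; cases ?C) auto
    then have xy: "x = y" "length ss = length ts" using inj[of x "length ss" y "length ts"] Node(2,3) t by simp_all
    have list: "us = vs \<and> M = M'"
      if "length us = length vs" "set us \<subseteq> set ss" "\<forall>u\<in>set vs. decorated_by X u"
        "concat (map (paths rk) us) @ M = concat (map (paths rk) vs) @ M'" for us vs M M'
      using that
    proof (induction us vs arbitrary: M M' rule: list_induct2)
      case (Cons u us v vs)
      have "u \<in> set ss" "decorated_by X u" "decorated_by X v" using Cons.prems Node(2) by auto
      moreover have "paths rk u @ (concat (map (paths rk) us) @ M) = paths rk v @ (concat (map (paths rk) vs) @ M')"
        using Cons.prems(3) by simp
      ultimately have uv: "u = v" "concat (map (paths rk) us) @ M = concat (map (paths rk) vs) @ M'"
        using Node.IH by blast+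
      show ?case using Cons.IH[OF _ _ uv(2)] Cons.prems uv(1) by simp
    qed simp
    have eq: "map (Cons (rk x)) ?A @ L = map (Cons (rk x)) ?C @ L'"
      using Node(4) t xy by simp
    then consider us where "map (Cons (rk x)) ?A = map (Cons (rk x)) ?C @ us" "us @ L = L'"
      | us where "map (Cons (rk x)) ?A @ us = map (Cons (rk x)) ?C" "L = us @ L'"
      unfolding append_eq_append_conv2 by blast
    then have "ss = ts \<and> L = L'"
    proof cases
      case 1
      then obtain us' where us: "us = map (Cons (rk x)) us'" "map (Cons (rk x)) ?A = map (Cons (rk x)) (?C @ us')"
        by (auto simp: map_eq_append_conv)
      from us(2) have "?A = ?C @ us'" by (rule map_injective) (simp add: inj_on_def)
      then have "ss = ts \<and> [] = us'"
        using list[of ss ts "[]" us'] xy(2) Node(3) unfolding t by simp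
      then show ?thesis using 1 us(1) by simp
    next
      case 2
      have "map (Cons (rk x)) ?C = map (Cons (rk x)) ?A @ us" using 2 by simp
      then obtain us' where us: "us = map (Cons (rk x)) us'" "map (Cons (rk x)) ?C = map (Cons (rk x)) (?A @ us')"
        by (auto simp: map_eq_append_conv)
      from us(2) have "?C = ?A @ us'" by (rule map_injective) (simp add: inj_on_def)
      then have "ss = ts \<and> us' = []"
        using list[of ss ts us' "[]"] xy(2) Node(3) unfolding t by simp
      then show ?thesis using 2 us(1) by simp
    qed
    then show ?thesis using xy t by simp
  qed
qed

lemma lenlex_split:
  "length xs = length ys \<Longrightarrow> (xs, ys) \<in> lenlex r \<longleftrightarrow>
    (\<exists>u x y v w. xs = u @ x # v \<and> ys = u @ y # w \<and> (x, y) \<in> r)"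
  by (auto simp: lenlex_conv lex_conv)

text \<open>Totality is injectivity of path sequences. For compatibility with grafting,
  \<open>X 0 = {}\<close> ensures that a grafted tree has at least one leaf, so that the first
  differing path does not disappear.\<close>

lemma path_monomial_order:
  assumes inj: "\<And>n m x y. \<lbrakk>x \<in> X n; y \<in> X m; rk x = rk y\<rbrakk> \<Longrightarrow> x = y \<and> n = m" and X: "X 0 = {}"
  shows "monomial_order X (path_less rk)"
proof -
  let ?r = "lenlex less_than :: (nat list \<times> nat list) set"
  have tr: "trans ?r" "trans (lenlex ?r)" by (intro lenlex_transI trans_less_than)+
  have irr: "irrefl ?r" using lenlex_irreflexive[of less_than] by (auto simp: irrefl_def)
  have tot: "total (lenlex ?r)" by (intro total_lenlex total_less_than)
  have wf: "wfp (path_less rk :: 'a tree \<Rightarrow> _)"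
  proof -
    have "wf (inv_image (lenlex ?r) (paths rk))" by (intro wf_inv_image wf_lenlex wf_less_than)
    moreover have "inv_image (lenlex ?r) (paths rk) = {(s, t). path_less rk s t}"
      by (auto simp: path_less_def)
    ultimately show ?thesis by (simp add: wfp_def)
  qed
  have A: "path_less rk (graft i s t) (graft i s' t)"
    if s: "s \<in> tree_monomials X n" "s' \<in> tree_monomials X n" and t: "t \<in> tree_monomials X m"
      and i: "i < n" and lt: "path_less rk s s'" for n m i s s' t
  proof -
    have "0 < length (paths rk t)"
      unfolding length_paths using t decorated_leaves_pos[of X t, OF X] by (simp add: tree_monomials_def)
    then have ne: "paths rk t \<noteq> []" unfolding length_greater_0_conv .
    have len: "length (paths rk s) = n" "length (paths rk s') = n"
      using s by (auto simp: tree_monomials_def length_paths)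
    then obtain u x y v w where *: "paths rk s = u @ x # v" "paths rk s' = u @ y # w" "(x, y) \<in> ?r"
      using lt lenlex_split[of "paths rk s" "paths rk s'" ?r] by (auto simp: path_less_def)
    have eq_len: "length (paths rk (graft i s t)) = length (paths rk (graft i s' t))"
      using s i by (simp add: length_paths tree_monomials_def leaves_graft)
    have g: "paths rk (graft i s t) = take i (u @ x # v) @ map ((@) ((u @ x # v) ! i)) (paths rk t) @ drop (Suc i) (u @ x # v)"
      "paths rk (graft i s' t) = take i (u @ y # w) @ map ((@) ((u @ y # w) ! i)) (paths rk t) @ drop (Suc i) (u @ y # w)"
      using paths_graft[of i s rk t] paths_graft[of i s' rk t] s i * by (auto simp: tree_monomials_def)
    \<comment> \<open>The grafting position is compared with the first difference: before it both
      sides change equally, at it the differing words are extended by the same suffix, and after it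
      the difference is untouched.\<close>
    consider "i < length u" | "i = length u" | "i > length u" by linarith
    then show ?thesis
      unfolding path_less_def lenlex_split[OF eq_len]
    proof cases
      case 1
      let ?u = "take i u @ map ((@) (u ! i)) (paths rk t) @ drop (Suc i) u"
      have "paths rk (graft i s t) = ?u @ x # v" "paths rk (graft i s' t) = ?u @ y # w"
        using 1 by (simp_all add: g nth_append)
      then show "\<exists>u x y v w. paths rk (graft i s t) = u @ x # v \<and> paths rk (graft i s' t) = u @ y # w \<and> (x, y) \<in> ?r"
        using *(3) by blast
    next
      case 2
      obtain p ps where p: "paths rk t = p # ps" using ne by (cases "paths rk t") auto
      have "paths rk (graft i s t) = u @ (x @ p) # (map ((@) x) ps @ v)"
        "paths rk (graft i s' t) = u @ (y @ p) # (map ((@) y) ps @ w)"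
        by (simp_all only: g) (simp_all add: 2 p)
      moreover have "(x @ p, y @ p) \<in> ?r" by (rule lenlex_append1[OF *(3)]) simp
      ultimately show "\<exists>u x y v w. paths rk (graft i s t) = u @ x # v \<and> paths rk (graft i s' t) = u @ y # w \<and> (x, y) \<in> ?r"
        by blast
    next
      case 3
      then obtain k where k: "i - length u = Suc k" by (cases "i - length u") auto
      have "Suc i - length u = Suc (Suc k)" using 3 k by simp
      then have "\<exists>v'. paths rk (graft i s t) = u @ x # v'" "\<exists>w'. paths rk (graft i s' t) = u @ y # w'"
        using 3 k by (simp_all add: g nth_append)
      then show "\<exists>u x y v w. paths rk (graft i s t) = u @ x # v \<and> paths rk (graft i s' t) = u @ y # w \<and> (x, y) \<in> ?r"
        using *(3) by blast
    qed
  qed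
  have B: "path_less rk (graft i s t) (graft i s t')"
    if s: "s \<in> tree_monomials X n" and t: "t \<in> tree_monomials X m" "t' \<in> tree_monomials X m"
      and i: "i < n" and lt: "path_less rk t t'" for n m i s t t'
  proof -
    have len: "length (paths rk t) = length (paths rk t')"
      using t by (simp add: tree_monomials_def length_paths)
    then obtain u x y v w where *: "paths rk t = u @ x # v" "paths rk t' = u @ y # w" "(x, y) \<in> ?r"
      using lt lenlex_split[OF len, of ?r] by (auto simp: path_less_def)
    have eq_len: "length (paths rk (graft i s t)) = length (paths rk (graft i s t'))"
      using s t i by (simp add: length_paths tree_monomials_def leaves_graft)
    let ?p = "paths rk s ! i"
    have "paths rk (graft i s t) = (take i (paths rk s) @ map ((@) ?p) u) @ (?p @ x) # (map ((@) ?p) v @ drop (Suc i) (paths rk s))"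
      "paths rk (graft i s t') = (take i (paths rk s) @ map ((@) ?p) u) @ (?p @ y) # (map ((@) ?p) w @ drop (Suc i) (paths rk s))"
      using paths_graft[of i s rk] s i * by (auto simp: tree_monomials_def)
    moreover have "(?p @ x, ?p @ y) \<in> ?r"
      using *(3) by (subst lenlex_append2) (auto simp: irrefl_def)
    ultimately show ?thesis
      unfolding path_less_def lenlex_split[OF eq_len] by blast
  qed
  have "totalp_on (tree_monomials X n) (path_less rk)" for n
  proof (rule totalp_onI)
    fix s t assume st: "s \<in> tree_monomials X n" "t \<in> tree_monomials X n" "s \<noteq> t"
    then have "paths rk s \<noteq> paths rk t"
      using paths_injective[of X rk s t "[]" "[]", OF inj X] by (auto simp: tree_monomials_def)
    then show "path_less rk s t \<or> path_less rk t s" using tot by (auto simp: path_less_def total_on_def)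
  qed
  moreover have "irreflp_on S (path_less rk)" for S
    using lenlex_irreflexive[of ?r] irr by (auto simp: irreflp_on_def path_less_def irrefl_def)
  moreover have "transp_on S (path_less rk)" for S
    using tr(2) by (auto simp: transp_on_def path_less_def dest: transD)
  moreover have "wfp_on S (path_less rk)" for S by (rule wfp_on_subset[OF wf subset_UNIV])
  ultimately show ?thesis
    unfolding monomial_order_def using A B by blast
qed

subsection \<open>Divisibility of trees\<close>

lemma tree_divides_child:
  assumes "tree_divides s (ts ! j)" "j < length ts"
  shows "tree_divides s (Node x ts)"
proof -
  let ?k = "sum_list (map leaves (take j (ts[j := Leaf]))) + 0"
  have "graft_list ?k (ts[j := Leaf]) (ts ! j) = ts"
    by (subst graft_list_nth) (use assms in simp_all)
  moreover have "?k < leaves (Node x (ts[j := Leaf]))"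
    using sum_list_take_bound[of j "ts[j := Leaf]" 0 leaves] assms by simp
  ultimately show ?thesis
    using divides_right[OF assms(1), of ?k "Node x (ts[j := Leaf])"] by simp
qed

text \<open>The child \<open>j\<close> is grafted back onto the tree with a leaf in its place, so
  the pruned tree is a divisor.\<close>

lemma tree_divides_prune:
  assumes "tree_divides s (Node x (ts[j := Leaf]))" "j < length ts"
  shows "tree_divides s (Node x ts)"
proof -
  let ?k = "sum_list (map leaves (take j (ts[j := Leaf]))) + 0"
  have "graft_list ?k (ts[j := Leaf]) (ts ! j) = ts"
    by (subst graft_list_nth) (use assms in simp_all)
  moreover have "?k < leaves (Node x (ts[j := Leaf]))"
    using sum_list_take_bound[of j "ts[j := Leaf]" 0 leaves] assms by simp
  ultimately show ?thesis
    using divides_left[OF assms(1), of ?k "ts ! j"] by simp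
qed

text \<open>Pruning the three other children one after another isolates the root together with the
  child \<open>i\<close>, which is where quadratic leading monomials are found.\<close>

lemma tree_divides_edge:
  assumes "tree_divides s (Node x ((replicate 4 Leaf)[i := ts ! i]))" "length ts = 4" "i < 4"
  shows "tree_divides s (Node x ts)"
proof -
  obtain a b c e where ts: "ts = [a, b, c, e]"
    using assms(2) by (auto simp: eval_nat_numeral length_Suc_conv)
  have *: "tree_divides s (Node x [p, q, r, t])" if "tree_divides s (Node x ([p, q, r, t][j := Leaf]))" "j < 4" for p q r t j
    using tree_divides_prune[OF that(1)] that(2) by simp
  from assms(3) have "i = 0 \<or> i = 1 \<or> i = 2 \<or> i = 3" by auto
  then show ?thesis using assms(1) unfolding ts
  proof (elim disjE)
    assume "i = 0" with assms(1) show "tree_divides s (Node x [a, b, c, e])"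
      by (intro *[where j = 1], simp_all, intro *[where j = 2], simp_all, intro *[where j = 3])
         (simp_all add: ts eval_nat_numeral)
  next
    assume "i = 1" with assms(1) show "tree_divides s (Node x [a, b, c, e])"
      by (intro *[where j = 0], simp_all, intro *[where j = 2], simp_all, intro *[where j = 3])
         (simp_all add: ts eval_nat_numeral)
  next
    assume "i = 2" with assms(1) show "tree_divides s (Node x [a, b, c, e])"
      by (intro *[where j = 0], simp_all, intro *[where j = 1], simp_all, intro *[where j = 3])
         (simp_all add: ts eval_nat_numeral)
  next
    assume "i = 3" with assms(1) show "tree_divides s (Node x [a, b, c, e])"
      by (intro *[where j = 0], simp_all, intro *[where j = 1], simp_all, intro *[where j = 2])
         (simp_all add: ts eval_nat_numeral)
  qed
qed

subsection \<open>A quadratic Groebner basis\<close>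

lemma monom_eq_iff [simp]: "(monom v :: nat \<Rightarrow>\<^sub>0 'k::field) = monom w \<longleftrightarrow> v = w"
proof
  assume "(monom v :: nat \<Rightarrow>\<^sub>0 'k) = monom w"
  then have "keys (monom v :: nat \<Rightarrow>\<^sub>0 'k) = keys (monom w :: nat \<Rightarrow>\<^sub>0 'k)" by simp
  then show "v = w" by simp
qed simp

lemma monom_neq_0 [simp]: "(monom v :: nat \<Rightarrow>\<^sub>0 'k::field) \<noteq> 0"
proof
  assume "(monom v :: nat \<Rightarrow>\<^sub>0 'k) = 0"
  then have "lookup (monom v :: nat \<Rightarrow>\<^sub>0 'k) (to_nat v) = 0" by simp
  then show False by simp
qed

abbreviation op_a :: "nat \<Rightarrow>\<^sub>0 'k::field" where "op_a \<equiv> monom [Suc 0]"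
abbreviation op_e :: "nat \<Rightarrow>\<^sub>0 'k::field" where "op_e \<equiv> monom [0, 0, Suc 0, 0]"
abbreviation op_f :: "nat \<Rightarrow>\<^sub>0 'k::field" where "op_f \<equiv> monom [0, Suc 0, 0, 0]"

definition basisP :: "nat \<Rightarrow> (nat \<Rightarrow>\<^sub>0 'k::field) set" where
  "basisP n = (if n = 1 then {op_a} else if n = 4 then {op_e, op_f} else {})"

lemma basisP_cases:
  assumes "x \<in> basisP n"
  obtains "n = 1" "x = op_a" | "n = 4" "x = op_e" | "n = 4" "x = op_f"
  using assms by (auto simp: basisP_def split: if_splits)

lemma basisP_simps [simp]: "op_a \<in> basisP (Suc 0)" "op_e \<in> basisP 4" "op_f \<in> basisP 4" "basisP 0 = {}"
  by (auto simp: basisP_def)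

lemma monom_independent: "pscale.independent (monom ` S :: (nat \<Rightarrow>\<^sub>0 'k::field) set)"
  unfolding pscale.dependent_def
proof
  assume "\<exists>a\<in>monom ` S. a \<in> pscale.span (monom ` S - {a :: nat \<Rightarrow>\<^sub>0 'k})"
  then obtain v where v: "(monom v :: nat \<Rightarrow>\<^sub>0 'k) \<in> pscale.span (monom ` S - {monom v})" by auto
  have "pscale.span (monom ` S - {monom v :: nat \<Rightarrow>\<^sub>0 'k}) \<subseteq> {f. keys f \<subseteq> to_nat ` (S - {v})}"
    by (rule pscale.span_minimal[OF _ label_part_subspace]) auto
  with v have "(monom v :: nat \<Rightarrow>\<^sub>0 'k) \<in> {f. keys f \<subseteq> to_nat ` (S - {v})}" by (rule subsetD[rotated])
  then show False by auto
qed

lemma monom_span: "pscale.span (monom ` S :: (nat \<Rightarrow>\<^sub>0 'k::field) set) = {f. keys f \<subseteq> to_nat ` S}"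
proof (intro equalityI subsetI)
  fix f :: "nat \<Rightarrow>\<^sub>0 'k" assume "f \<in> {f. keys f \<subseteq> to_nat ` S}"
  then have "keys f \<subseteq> to_nat ` S" by simp
  then show "f \<in> pscale.span (monom ` S)"
  proof (induction f rule: keys_subset_induct)
    case (add p c g)
    then obtain v where v: "p = to_nat v" "v \<in> S" by auto
    have "pscale c (monom v) \<in> pscale.span (monom ` S :: (nat \<Rightarrow>\<^sub>0 'k) set)"
      by (intro pscale.span_scale pscale.span_base) (use v in auto)
    then show ?case using add v(1) by (simp add: pscale.span_add)
  qed (simp add: pscale.span_zero)
next
  fix f :: "nat \<Rightarrow>\<^sub>0 'k" assume f: "f \<in> pscale.span (monom ` S)"
  have "pscale.span (monom ` S :: (nat \<Rightarrow>\<^sub>0 'k) set) \<subseteq> {f. keys f \<subseteq> to_nat ` S}"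
    by (rule pscale.span_minimal[OF _ label_part_subspace]) auto
  then show "f \<in> {f. keys f \<subseteq> to_nat ` S}" using f by blast
qed

lemma basisP_generator_basis: "generator_basis P_op (basisP :: nat \<Rightarrow> (nat \<Rightarrow>\<^sub>0 'k::field) set)"
proof -
  define S where "S n = {v \<in> labelsP. length v = n \<and> sum_list v = 1}" for n
  have "S n = (if n = 1 then {[Suc 0]} else if n = 4 then {[0, 0, Suc 0, 0], [0, Suc 0, 0, 0]} else {})" for n
  proof -
    have "v \<in> S n \<longleftrightarrow> (n = 1 \<and> v = [Suc 0]) \<or> (n = 4 \<and> (v = [0, 0, Suc 0, 0] \<or> v = [0, Suc 0, 0, 0]))" for v
    proof
      assume "v \<in> S n"
      then have v: "v \<in> labelsP" "length v = n" "sum_list v = 1" by (auto simp: S_def)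
      from v(1) show "(n = 1 \<and> v = [Suc 0]) \<or> (n = 4 \<and> (v = [0, 0, Suc 0, 0] \<or> v = [0, Suc 0, 0, 0]))"
        proof (cases rule: labelsP_cases)
        case (2 x y w z)
        then have "x + y + w + z = 1" using v(3) by simp
        then have "x = 0 \<and> z = 0 \<and> (y = 1 \<and> w = 0 \<or> y = 0 \<and> w = 1)" using 2(3) by arith
        then show ?thesis using v(2) 2(1) by auto
      qed (use v(2,3) in simp)
    qed (elim disjE conjE; simp add: S_def)
    then have "S n = {v. (n = 1 \<and> v = [Suc 0]) \<or> (n = 4 \<and> (v = [0, 0, Suc 0, 0] \<or> v = [0, Suc 0, 0, 0]))}"
      by (intro set_eqI) (simp only: mem_Collect_eq)
    then show ?thesis by (auto simp: Collect_disj_eq insert_commute)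
  qed
  then have eq: "basisP n = (monom ` S n :: (nat \<Rightarrow>\<^sub>0 'k) set)" for n
    by (simp add: basisP_def)
  show ?thesis
    unfolding generator_basis_def eq label_operad_simps monom_span
    by (intro allI conjI monom_independent) (simp add: S_def)
qed

interpretation P: weight_graded_ns_operad "P_op :: ('k::field, nat \<Rightarrow>\<^sub>0 'k) ns_operad"
  by (rule P_op_operad)

text \<open>\<open>op_e\<close> is ranked above \<open>op_f\<close>, so that in the relation between
  \<open>a\<close> on input 1 of \<open>op_e\<close> and \<open>a\<close> on input 2 of
  \<open>op_f\<close> the tree with root \<open>op_e\<close> is leading.\<close>

definition rankP :: "(nat \<Rightarrow>\<^sub>0 'k::field) \<Rightarrow> nat" where
  "rankP x = (if x = op_a then 0 else if x = op_f then 1 else 2)"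

lemma rankP_simps [simp]: "rankP op_a = 0" "rankP op_f = 1" "rankP op_e = 2"
  by (simp_all add: rankP_def)

abbreviation ltP :: "(nat \<Rightarrow>\<^sub>0 'k::field) tree \<Rightarrow> (nat \<Rightarrow>\<^sub>0 'k) tree \<Rightarrow> bool" where
  "ltP \<equiv> path_less rankP"

lemma ltP_order: "monomial_order (basisP :: nat \<Rightarrow> (nat \<Rightarrow>\<^sub>0 'k::field) set) ltP"
proof (rule path_monomial_order)
  fix n m and x y :: "nat \<Rightarrow>\<^sub>0 'k"
  assume x: "x \<in> basisP n" and y: "y \<in> basisP m" and "rankP x = rankP y"
  then show "x = y \<and> n = m"
    by (cases rule: basisP_cases[OF x]; cases rule: basisP_cases[OF y]; simp)
qed simp

definition chain :: "nat \<Rightarrow> (nat \<Rightarrow>\<^sub>0 'k::field) tree" where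
  "chain n = ((\<lambda>t. Node op_a [t]) ^^ n) Leaf"

lemma chain_simps [simp]: "chain 0 = Leaf" "chain (Suc n) = Node op_a [chain n]" "leaves (chain n) = 1"
  by (induction n) (simp_all add: chain_def)

lemma graft_chain: "graft 0 (chain n) (corolla 1 op_a) = chain (Suc n)"
  by (induction n) simp_all

lemma decorated_chain: "decorated_by basisP (chain n)"
  by (induction n) auto

text \<open>The tree monomials that are normal with respect to the quadratic relations below.\<close>

definition normal_tree :: "nat list \<Rightarrow> (nat \<Rightarrow>\<^sub>0 'k::field) tree" where
  "normal_tree v = (if length v = 1 then chain (v ! 0)
    else if v ! 1 = 0 then Node op_e [chain (v ! 0), Leaf, chain (v ! 2 - 1), chain (v ! 3)]
    else Node op_f [chain (v ! 0), chain (v ! 1 - 1), chain (v ! 2), chain (v ! 3)])"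

lemma normal_tree_simps:
  "normal_tree [n] = chain n"
  "normal_tree [x, 0, w, z] = Node op_e [chain x, Leaf, chain (w - 1), chain z]"
  "y > 0 \<Longrightarrow> normal_tree [x, y, w, z] = Node op_f [chain x, chain (y - 1), chain w, chain z]"
  by (simp_all add: normal_tree_def eval_nat_numeral)

lemma normal_tree_monomial: "v \<in> labelsP \<Longrightarrow> normal_tree v \<in> tree_monomials basisP (length v)"
proof (erule labelsP_cases)
  fix n assume "v = [n]"
  then show ?thesis
    by (simp add: normal_tree_simps tree_monomials_def decorated_chain del: One_nat_def)
next
  fix x y w z assume v: "v = [x, y, w, z]"
  have "op_e \<in> basisP (Suc (Suc (Suc (Suc 0))))" "op_f \<in> basisP (Suc (Suc (Suc (Suc 0))))"
    by (simp_all add: basisP_def)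
  then show ?thesis
    unfolding v by (cases "y = 0") (simp_all add: normal_tree_simps tree_monomials_def decorated_chain)
qed

text \<open>Membership in \<open>relation_ideal\<close> selects from the monomials with two vertices
  those that vanish, so no list of the vanishing products is needed. It also discards corollas whose
  label has another arity.\<close>

definition quadratic_relations :: "nat \<Rightarrow> ((nat \<Rightarrow>\<^sub>0 'k::field) tree \<Rightarrow>\<^sub>0 'k) set" where
  "quadratic_relations n = {g \<in> relation_ideal P_op basisP n.
    g = single (graft 1 (corolla 4 op_e) (corolla 1 op_a)) 1 - single (graft 2 (corolla 4 op_f) (corolla 1 op_a)) 1 \<or>
    (\<exists>k\<in>{1, 4}. \<exists>i<k. \<exists>l\<in>{1, 4}. \<exists>x\<in>{op_a, op_e, op_f}. \<exists>y\<in>{op_a, op_e, op_f}.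
      g = single (graft i (corolla k x) (corolla l y)) 1)}"

definition reducible :: "(nat \<Rightarrow>\<^sub>0 'k::field) tree \<Rightarrow> bool" where
  "reducible t \<longleftrightarrow> (\<exists>m. \<exists>g \<in> (quadratic_relations m :: ((nat \<Rightarrow>\<^sub>0 'k) tree \<Rightarrow>\<^sub>0 'k) set). \<exists>s.
    is_leading_monomial ltP g s \<and> tree_divides s t)"

lemma reducible_mono:
  assumes "reducible t" "\<And>s. tree_divides s t \<Longrightarrow> tree_divides s u"
  shows "reducible u"
proof -
  from assms(1) obtain m g s where g: "g \<in> quadratic_relations m" "is_leading_monomial ltP g s" "tree_divides s t"
    unfolding reducible_def by (elim exE bexE conjE)
  show ?thesis
    unfolding reducible_def
    by (intro exI[of _ m] bexI[of _ g] exI[of _ s] conjI g assms(2))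
qed

lemma reducible_graft_left: "\<lbrakk>reducible t; i < leaves t\<rbrakk> \<Longrightarrow> reducible (graft i t u)"
  by (erule reducible_mono) (rule divides_left)

lemma reducible_graft_right: "\<lbrakk>reducible t; i < leaves u\<rbrakk> \<Longrightarrow> reducible (graft i u t)"
  by (erule reducible_mono) (rule divides_right)

lemma reducible_child: "\<lbrakk>reducible (ts ! j); j < length ts\<rbrakk> \<Longrightarrow> reducible (Node x ts)"
  by (erule reducible_mono) (rule tree_divides_child)

lemma reducible_edge:
  "\<lbrakk>reducible (Node x ((replicate 4 Leaf)[i := ts ! i])); length ts = 4; i < 4\<rbrakk> \<Longrightarrow> reducible (Node x ts)"
  by (erule reducible_mono) (rule tree_divides_edge)

lemma reducibleI: "\<lbrakk>g \<in> quadratic_relations m; is_leading_monomial ltP g t\<rbrakk> \<Longrightarrow> reducible t"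
  unfolding reducible_def by (intro exI[of _ m] bexI[of _ g] exI[of _ t] conjI divides_refl)

lemma basisP_AP: "x \<in> basisP n \<Longrightarrow> x \<in> arity_part P_op n"
  by (rule P.B_AP[OF basisP_generator_basis])

lemma eval_graft_corolla:
  assumes "s \<in> tree_monomials basisP n" "x \<in> basisP m" "i < n"
  shows "eval_tree P_op (graft i s (corolla m x)) = circ P_op i (eval_tree P_op s) x"
proof -
  have "corolla m x \<in> tree_monomials basisP m" using assms by simp
  from P.eval_map_tree_graft[of basisP "\<lambda>x. x", OF basisP_AP assms(1) this assms(3)]
    P.eval_corolla[OF basisP_AP[OF assms(2)]] show ?thesis by (simp only: tree.map_ident)
qed

lemma free_hom_single: "free_hom P_op (\<lambda>x. x) (single t c) = pscale c (eval_tree P_op t)"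
  by (simp add: free_hom_def tree.map_ident)

lemma reducible_two:
  assumes x: "x \<in> basisP n" and y: "y \<in> basisP m" and i: "i < n" and 0: "circ P_op i x y = (0 :: nat \<Rightarrow>\<^sub>0 'k::field)"
  shows "reducible (graft i (corolla n x) (corolla m y))"
proof -
  let ?t = "graft i (corolla n x) (corolla m y)" 
  have t: "?t \<in> tree_monomials basisP (n + m - 1)"
    using x y i by (intro tree_monomials_graft) simp_all
  have "corolla n x \<in> tree_monomials basisP n" using x by simp
  then have "eval_tree P_op ?t = 0"
    using eval_graft_corolla[of "corolla n x" n y m i] x y i 0 P.eval_corolla[OF basisP_AP[OF x]] by simp
  then have "single ?t 1 \<in> relation_ideal P_op basisP (n + m - 1)"
    using t by (simp add: relation_ideal_eq free_hom_single free_operad_closed(6))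
  moreover have x': "n \<in> {1, 4}" "x \<in> {op_a, op_e, op_f}" using x by (cases rule: basisP_cases; simp)+
  moreover have "m \<in> {1, 4}" "y \<in> {op_a, op_e, op_f}" using y by (cases rule: basisP_cases; simp)+
  moreover note i
  ultimately have "single ?t (1 :: 'k) \<in> quadratic_relations (n + m - 1)"
    unfolding quadratic_relations_def by blast
  moreover have "is_leading_monomial ltP (single ?t (1 :: 'k)) ?t" by (simp add: is_leading_monomial_def)
  ultimately show ?thesis by (rule reducibleI)
qed

text \<open>The last letter of the chain and the corolla on top of it form a vanishing product of
  two generators.\<close>

lemma reducible_chain:
  assumes b: "b \<in> basisP 4"
  shows "reducible (graft 0 (chain (Suc k)) (corolla 4 (b :: nat \<Rightarrow>\<^sub>0 'k::field)))"
proof -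
  have "graft (0 + 0) (graft 0 (chain k) (corolla 1 op_a)) (corolla 4 b)
      = graft 0 (chain k) (graft 0 (corolla 1 op_a) (corolla 4 b))"
    by (rule graft_sequential) simp_all
  then have eq: "graft 0 (chain (Suc k)) (corolla 4 b) = graft 0 (chain k) (graft 0 (corolla 1 op_a) (corolla 4 b))"
    unfolding graft_chain add_0 .
  have "circ P_op 0 op_a b = 0"
    using b by (cases rule: basisP_cases) (simp_all add: label_comp_def)
  then have "reducible (graft 0 (corolla 1 op_a) (corolla 4 b))"
    using b by (intro reducible_two) simp_all
  then show ?thesis unfolding eq by (rule reducible_graft_right) simp
qed

lemma lt_move:
  "ltP (Node op_f [Leaf, t1, t2, t3]) (Node op_e [Leaf, t1', t2', t3'])"
  if "leaves t1 + leaves t2 + leaves t3 = leaves t1' + leaves t2' + leaves t3'"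
  using that by (simp add: path_less_def Cons_lenlex_iff length_paths)

lemma graft_corolla_4:
  "i < 4 \<Longrightarrow> graft i (corolla 4 x) u = Node x ((replicate 4 Leaf)[i := u])"
proof -
  assume "i < 4"
  then have "i = 0 \<or> i = 1 \<or> i = 2 \<or> i = 3" by auto
  then show ?thesis by (elim disjE) (simp_all add: eval_nat_numeral)
qed

lemma graft_list_corolla_4: "i < 4 \<Longrightarrow> graft_list i (replicate 4 Leaf) u = (replicate 4 Leaf)[i := u]"
  using graft_corolla_4[of i undefined u] by simp

text \<open>Both trees evaluate to \<open>[0, 1, 1, 0]\<close>, so their difference is a relation;
  \<open>lt_move\<close> identifies the leading one.\<close>

lemma reducible_e_a: "reducible (graft 1 (corolla 4 op_e) (corolla 1 (op_a :: nat \<Rightarrow>\<^sub>0 'k::field)))"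
proof -
  let ?s = "graft 1 (corolla 4 op_e) (corolla 1 op_a) :: (nat \<Rightarrow>\<^sub>0 'k) tree"
  let ?t = "graft 2 (corolla 4 op_f) (corolla 1 op_a) :: (nat \<Rightarrow>\<^sub>0 'k) tree"
  have mon: "?s \<in> tree_monomials basisP 4" "?t \<in> tree_monomials basisP 4"
    using tree_monomials_graft[of "corolla 4 op_e :: (nat \<Rightarrow>\<^sub>0 'k) tree" basisP 4 "corolla 1 op_a" 1 1]
      tree_monomials_graft[of "corolla 4 op_f :: (nat \<Rightarrow>\<^sub>0 'k) tree" basisP 4 "corolla 1 op_a" 1 2]
    by (simp_all del: replicate.simps)
  have lt: "ltP ?t ?s" by (simp add: graft_corolla_4 eval_nat_numeral lt_move)
  then have ne: "?s \<noteq> ?t" by (simp add: graft_corolla_4 eval_nat_numeral)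
  have ev: "eval_tree P_op (corolla 4 op_e) = (op_e :: nat \<Rightarrow>\<^sub>0 'k)" "eval_tree P_op (corolla 4 op_f) = (op_f :: nat \<Rightarrow>\<^sub>0 'k)"
    by (rule P.eval_corolla[OF basisP_AP], simp)+
  have "eval_tree P_op ?s = circ P_op 1 (eval_tree P_op (corolla 4 op_e)) op_a"
    "eval_tree P_op ?t = circ P_op 2 (eval_tree P_op (corolla 4 op_f)) op_a"
    by (rule eval_graft_corolla[where n = 4], rule corolla_in_tree_monomials, simp, simp, simp)+
  then have "eval_tree P_op ?s = monom [0, 1, 1, 0]" "eval_tree P_op ?t = monom [0, 1, 1, 0]"
    unfolding ev by (simp_all add: label_comp_def eval_nat_numeral)
  then have "single ?s 1 - single ?t 1 \<in> relation_ideal P_op basisP 4"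
    using mon by (simp add: relation_ideal_eq free_hom_single free_operad_closed(3,6))
  then have G: "single ?s (1 :: 'k) - single ?t 1 \<in> quadratic_relations 4"
    unfolding quadratic_relations_def by blast
  have "keys (single ?s (1 :: 'k) - single ?t 1) = {?s, ?t}"
    using ne by (auto simp: in_keys_iff lookup_minus lookup_single when_def split: if_splits)
  then have "is_leading_monomial ltP (single ?s (1 :: 'k) - single ?t 1) ?s"
    using lt by (simp add: is_leading_monomial_def)
  with G show ?thesis by (rule reducibleI)
qed

text \<open>Two adjacent vertices decide every case: a quaternary generator on top of any vertex
  gives zero, so does \<open>a\<close> on input 0 of \<open>op_f\<close>, an \<open>a\<close> on
  input 1 of \<open>op_e\<close> is rewritten, and on each remaining input \<open>a\<close> just
  lengthens a chain.\<close>

lemma normal_graft_step: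
  assumes v: "v \<in> labelsP" and i: "i < length v" and b: "b \<in> basisP m"
  shows "(circ P_op i (monom v) b = (0 :: nat \<Rightarrow>\<^sub>0 'k::field) \<and> reducible (graft i (normal_tree v) (corolla m b))) \<or>
    (\<exists>v'\<in>labelsP. length v' = length v + m - 1 \<and> circ P_op i (monom v) b = monom v' \<and>
      (graft i (normal_tree v) (corolla m b) = normal_tree v' \<or>
       reducible (graft i (normal_tree v) (corolla m b)) \<and> ltP (normal_tree v') (graft i (normal_tree v) (corolla m b))))"
  using v
proof (cases rule: labelsP_cases)
  case (1 n)
  have i0: "i = 0" using i 1 by simp
  from b show ?thesis
  proof (cases rule: basisP_cases)
    case 1
    have "graft 0 (chain n) (Node op_a [Leaf]) = (Node op_a [chain n] :: (nat \<Rightarrow>\<^sub>0 'k) tree)"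
      using graft_chain[of n, where 'a = 'k] by simp
    then show ?thesis
      using 1 \<open>v = [n]\<close> i0
      by (intro disjI2 bexI[of _ "[Suc n]"]) (simp_all add: normal_tree_simps label_comp_def)
  next
    case 2
    show ?thesis
    proof (cases n)
      case 0
      then show ?thesis using 2 \<open>v = [n]\<close> i0
        by (intro disjI2 bexI[of _ "[0, 0, Suc 0, 0]"]) (simp_all add: normal_tree_simps label_comp_def eval_nat_numeral)
    next
      case (Suc k)
      have "reducible (graft 0 (chain n) (corolla 4 (op_e :: nat \<Rightarrow>\<^sub>0 'k)))"
        unfolding Suc by (rule reducible_chain) simp
      then show ?thesis using 2 \<open>v = [n]\<close> i0 Suc
        by (intro disjI1) (simp add: normal_tree_simps label_comp_def del: chain_simps(2))
    qed
  next
    case 3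
    show ?thesis
    proof (cases n)
      case 0
      then show ?thesis using 3 \<open>v = [n]\<close> i0
        by (intro disjI2 bexI[of _ "[0, Suc 0, 0, 0]"]) (simp_all add: normal_tree_simps label_comp_def eval_nat_numeral)
    next
      case (Suc k)
      have "reducible (graft 0 (chain n) (corolla 4 (op_f :: nat \<Rightarrow>\<^sub>0 'k)))"
        unfolding Suc by (rule reducible_chain) simp
      then show ?thesis using 3 \<open>v = [n]\<close> i0 Suc
        by (intro disjI1) (simp add: normal_tree_simps label_comp_def del: chain_simps(2))
    qed
  qed
next
  case (2 x y w z)
  define c :: "nat \<Rightarrow>\<^sub>0 'k" where "c = (if y = 0 then op_e else op_f)"
  \<comment> \<open>Lengths of the four chains; one letter is carried by the root \<open>c\<close>.
    For \<open>y = 0\<close> the truncated \<open>y - 1\<close> is \<open>0\<close>, which is the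
    leaf on input 1 of \<open>op_e\<close>.\<close>
  define p where "p = [x, y - 1, if y = 0 then w - 1 else w, z]"
  have nv: "normal_tree v = Node c (map chain p)"
    using 2 by (auto simp: normal_tree_simps c_def p_def)
  have i4: "i < 4" using i 2 by (simp add: eval_nat_numeral)
  have lp: "length p = 4" by (simp add: p_def)
  have graft: "graft i (normal_tree v) u = Node c ((map chain p)[i := graft 0 (chain (p ! i)) u])" for u
  proof -
    from i4 have "i = 0 \<or> i = 1 \<or> i = 2 \<or> i = 3" by auto
    then show ?thesis unfolding nv p_def by (elim disjE) simp_all
  qed
  have cB: "c \<in> basisP 4" by (simp add: c_def)
  show ?thesis
  proof (cases "m = 1")
    case False
    have bm: "m = 4" "b = op_e \<or> b = op_f"
      using b False by (cases rule: basisP_cases; simp)+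
    have "reducible (Node c ((map chain p)[i := graft 0 (chain (p ! i)) (corolla 4 b)]))"
    proof (cases "p ! i")
      case 0
      have "reducible (graft i (corolla 4 c) (corolla 4 b))"
      proof (rule reducible_two[OF cB _ i4])
        show "b \<in> basisP 4" using b bm(1) by simp
        show "circ P_op i c b = 0"
          using bm(2) by (elim disjE) (simp_all add: c_def label_comp_def)
      qed
      then show ?thesis using 0 i4 lp
        by - (rule reducible_edge[of _ i], simp_all add: graft_list_corolla_4)
    next
      case (Suc k)
      have "reducible (graft 0 (chain (p ! i)) (corolla 4 b))"
        unfolding Suc by (rule reducible_chain) (use b bm in simp)
      then show ?thesis using i4 lp by - (rule reducible_child[of _ i], simp_all)
    qed
    moreover have "circ P_op i (monom v) b = 0"
      using bm(2) 2(1) by (elim disjE) (simp_all add: label_comp_def)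
    ultimately show ?thesis using bm graft by (intro disjI1) simp
  next
    case True
    have ba: "b = op_a" using b True by (cases rule: basisP_cases) simp_all
    have t: "graft i (normal_tree v) (corolla m b) = Node c ((map chain p)[i := chain (Suc (p ! i))])"
      unfolding True ba graft graft_chain ..
    have circ: "circ P_op i (monom v) b = opt_monom (label_comp labelsP i v [1])" by (simp add: ba)
    have plain: ?thesis if "(y = 0 \<and> (i = 0 \<or> i = 2 \<or> i = 3)) \<or> (y > 0 \<and> (i = 1 \<or> i = 2 \<or> i = 3))"
    proof -
      let ?v = "v[i := v ! i + 1]"
      have w: "Suc (w - Suc 0) = w" if "y = 0" using 2(3) that by simp
      have v': "?v \<in> labelsP" "normal_tree ?v = Node c ((map chain p)[i := chain (Suc (p ! i))])"
        using that 2 w by (elim disjE conjE; simp add: c_def p_def normal_tree_simps del: chain_simps(2))+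
      then have "label_comp labelsP i v [1] = Some ?v" by (simp add: label_comp_def)
      then show ?thesis unfolding t circ
        by (intro disjI2 bexI[of _ ?v]) (use v' \<open>m = 1\<close> in simp_all)
    qed
    from i4 have "i = 0 \<or> i = 1 \<or> i = 2 \<or> i = 3" by auto
    then consider "y = 0" "i = 1" | "y > 0" "i = 0" | "y = 0" "i = 0 \<or> i = 2 \<or> i = 3" | "y > 0" "i = 1 \<or> i = 2 \<or> i = 3"
      by (cases "y = 0") auto
    then show ?thesis
    proof cases
      case 1
      \<comment> \<open>One \<open>a\<close> on input 1 of \<open>op_e\<close>: for
        \<open>x = 0\<close> the normal form has root \<open>op_f\<close>, for \<open>x > 0\<close>
        the value is zero; the same edge is reducible in both cases.\<close>
      then have te: "graft i (normal_tree v) (corolla m b) = Node op_e [chain x, chain 1, chain (w - 1), chain z]"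
        using t by (simp add: c_def p_def)
      have red: "reducible (Node (op_e :: nat \<Rightarrow>\<^sub>0 'k) [chain x, chain 1, chain (w - 1), chain z])"
        using reducible_e_a[where 'k = 'k]
        by - (rule reducible_edge[of _ 1], simp_all add: graft_list_corolla_4)
      show ?thesis
      proof (cases "x = 0")
        case True
        have "ltP (normal_tree [0, 1, w, z]) (Node (op_e :: nat \<Rightarrow>\<^sub>0 'k) [chain x, chain 1, chain (w - 1), chain z])"
          using True by (simp add: normal_tree_simps lt_move del: chain_simps(2))
        then show ?thesis
          unfolding te circ using True 1 2 \<open>m = 1\<close> red
          by (intro disjI2 bexI[of _ "[0, 1, w, z]"]) (simp_all add: label_comp_def)
      next
        case False
        then show ?thesis unfolding te circ using 1 2 red by (intro disjI1) (simp add: label_comp_def)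
      qed
    next
      case fy: 2
      have "reducible (graft 0 (corolla 4 op_f) (corolla 1 (op_a :: nat \<Rightarrow>\<^sub>0 'k)))"
        by (rule reducible_two) (simp_all add: label_comp_def)
      then have "reducible (Node (op_f :: nat \<Rightarrow>\<^sub>0 'k) [chain 1, chain (y - 1), chain w, chain z])"
        by - (rule reducible_edge[of _ 0], simp_all add: graft_list_corolla_4)
      then show ?thesis unfolding t circ using 2 fy by (intro disjI1) (auto simp: label_comp_def c_def p_def)
    next
      case 3
      then show ?thesis by (intro plain disjI1) simp
    next
      case 4
      then show ?thesis by (intro plain disjI2) simp
    qed
  qed
qed

text \<open>Only the lower tree has to be normalised. Grafting is compatible with the order, so
  replacing that tree by its smaller normal form makes the whole tree smaller, and
  \<open>normal_graft_step\<close> treats the last vertex.\<close>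

lemma tree_normal_form:
  assumes "t \<in> tree_monomials basisP n"
  shows "(eval_tree P_op t = (0 :: nat \<Rightarrow>\<^sub>0 'k::field) \<and> reducible t) \<or>
    (\<exists>v\<in>labelsP. length v = n \<and> eval_tree P_op t = monom v \<and>
      (t = normal_tree v \<or> reducible t \<and> ltP (normal_tree v) t))"
  using assms
proof (induction rule: tree_monomials_induct)
  case Leaf
  show ?case by (intro disjI2 bexI[of _ "[0]"]) (simp_all add: normal_tree_simps)
next
  case (graft n m i s b)
  have i: "i < leaves s" using graft(1,3) by (simp add: tree_monomials_def)
  let ?t = "graft i s (corolla m b)"
  have ev: "eval_tree P_op ?t = circ P_op i (eval_tree P_op s) b"
    by (rule eval_graft_corolla[OF graft(1-3)])
  from graft(4) show ?case
  proof
    assume s: "eval_tree P_op s = 0 \<and> reducible s"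
    then have "reducible ?t" by (intro reducible_graft_left i) simp
    then show ?thesis using ev s by simp
  next
    assume "\<exists>v\<in>labelsP. length v = n \<and> eval_tree P_op s = monom v \<and>
      (s = normal_tree v \<or> reducible s \<and> ltP (normal_tree v) s)"
    then obtain v where v: "v \<in> labelsP" "length v = n" "eval_tree P_op s = monom v"
      "s = normal_tree v \<or> reducible s \<and> ltP (normal_tree v) s" by blast
    have iv: "i < length v" using graft(3) v(2) by simp
    note step = normal_graft_step[OF v(1) iv graft(2)]
    show ?thesis
    proof (cases "s = normal_tree v")
      case True
      show ?thesis using step unfolding ev v(3) v(2) True[symmetric] .
    next
      case False
      then have s: "reducible s" "ltP (normal_tree v) s" using v(4) by auto
      have red: "reducible ?t" by (rule reducible_graft_left[OF s(1) i])
      have mon: "normal_tree v \<in> tree_monomials basisP n" "corolla m b \<in> tree_monomials basisP m"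
        using normal_tree_monomial[OF v(1)] v(2) graft(2) by simp_all
      have lt: "ltP (graft i (normal_tree v) (corolla m b)) ?t"
        using ltP_order mon graft(1,3) s(2) unfolding monomial_order_def by blast
      from step show ?thesis
      proof
        assume "circ P_op i (monom v) b = 0 \<and> reducible (graft i (normal_tree v) (corolla m b))"
        then show ?thesis using red ev v(3) by simp
      next
        assume "\<exists>v'\<in>labelsP. length v' = length v + m - 1 \<and> circ P_op i (monom v) b = monom v' \<and>
          (graft i (normal_tree v) (corolla m b) = normal_tree v' \<or>
           reducible (graft i (normal_tree v) (corolla m b)) \<and> ltP (normal_tree v') (graft i (normal_tree v) (corolla m b)))"
        then obtain v' where v': "v' \<in> labelsP" "length v' = n + m - 1" "circ P_op i (monom v) b = monom v'"
          "graft i (normal_tree v) (corolla m b) = normal_tree v' \<or> ltP (normal_tree v') (graft i (normal_tree v) (corolla m b))"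
          using v(2) by blast
        have mon': "normal_tree v' \<in> tree_monomials basisP (n + m - 1)"
          using normal_tree_monomial[OF v'(1)] v'(2) by simp
        have g: "graft i (normal_tree v) (corolla m b) \<in> tree_monomials basisP (n + m - 1)"
          "?t \<in> tree_monomials basisP (n + m - 1)"
          by (rule tree_monomials_graft[OF mon graft(3)], rule tree_monomials_graft[OF graft(1) mon(2) graft(3)])
        have tr: "transp_on (tree_monomials basisP (n + m - 1)) (ltP :: (nat \<Rightarrow>\<^sub>0 'k) tree \<Rightarrow> _)"
          using ltP_order unfolding monomial_order_def by blast
        from v'(4) have "ltP (normal_tree v') ?t"
        proof
          assume eq: "graft i (normal_tree v) (corolla m b) = normal_tree v'"
          show ?thesis using lt unfolding eq .
        next
          assume "ltP (normal_tree v') (graft i (normal_tree v) (corolla m b))"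
          then show ?thesis using lt by (rule transp_onD[OF tr mon' g])
        qed
        moreover have "eval_tree P_op ?t = monom v'" using ev v(3) v'(3) by (simp only:)
        ultimately show ?thesis using red v'(1,2) by blast
      qed
    qed
  qed
qed

text \<open>An irreducible leading monomial \<open>t\<close> is the normal tree of some
  \<open>v\<close>, and any other tree with value \<open>monom v\<close> is larger than
  \<open>t\<close>. So no other term of \<open>f\<close> contributes to the coefficient of
  \<open>monom v\<close> in the value, which is therefore nonzero, although \<open>f\<close> is a
  relation.\<close>

lemma quadratic_groebner_basis:
  "groebner_basis ltP (relation_ideal P_op basisP) (quadratic_relations :: nat \<Rightarrow> ((nat \<Rightarrow>\<^sub>0 'k::field) tree \<Rightarrow>\<^sub>0 'k) set)"
  unfolding groebner_basis_def
proof (intro conjI allI ballI impI)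
  fix n show "quadratic_relations n \<subseteq> relation_ideal P_op (basisP :: nat \<Rightarrow> (nat \<Rightarrow>\<^sub>0 'k) set) n"
    by (auto simp: quadratic_relations_def)
next
  fix n and f :: "(nat \<Rightarrow>\<^sub>0 'k) tree \<Rightarrow>\<^sub>0 'k"
  assume f: "f \<in> relation_ideal P_op basisP n" "f \<noteq> 0"
  then have ff: "f \<in> free_operad basisP n" and ev: "free_hom P_op (\<lambda>x. x) f = 0"
    by (auto simp: relation_ideal_eq)
  obtain t where t: "is_leading_monomial ltP f t"
    using leading_monomial_exists[OF ltP_order ff f(2)] by blast
  have mon: "s \<in> tree_monomials basisP n" if "s \<in> keys f" for s
    using ff that by (auto simp: free_operad_def)
  have tk: "t \<in> keys f" using t by (simp add: is_leading_monomial_def)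
  have ord: "irreflp_on (tree_monomials basisP n) (ltP :: (nat \<Rightarrow>\<^sub>0 'k) tree \<Rightarrow> _)"
    "transp_on (tree_monomials basisP n) (ltP :: (nat \<Rightarrow>\<^sub>0 'k) tree \<Rightarrow> _)"
    using ltP_order unfolding monomial_order_def by blast+
  have "reducible t"
  proof (rule ccontr)
    assume "\<not> reducible t"
    then obtain v where v: "v \<in> labelsP" "eval_tree P_op t = monom v" "t = normal_tree v"
      using tree_normal_form[OF mon[OF tk]] by blast
    have "lookup (eval_tree P_op s) (to_nat v) = 0" if s: "s \<in> keys f" "s \<noteq> t" for s
    proof (rule ccontr)
      assume nz: "lookup (eval_tree P_op s) (to_nat v) \<noteq> 0"
      then have "eval_tree P_op s \<noteq> 0" by auto
      then obtain v' where v': "eval_tree P_op s = monom v'" "s = normal_tree v' \<or> ltP (normal_tree v') s"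
        using tree_normal_form[OF mon[OF s(1)]] by blast
      have "v' = v" using nz unfolding v'(1) by (simp add: lookup_single when_def split: if_splits)
      then have "ltP t s" using v' v(3) s(2) by simp
      moreover have "ltP s t" using t s by (simp add: is_leading_monomial_def)
      ultimately show False using ord mon[OF s(1)] mon[OF tk] by (meson irreflp_onD transp_onD)
    qed
    then have "lookup (free_hom P_op (\<lambda>x. x) f) (to_nat v)
        = (\<Sum>s\<in>keys f. if s = t then lookup f t else 0)"
      unfolding free_hom_def linear_extension_def label_operad_simps tree.map_ident lookup_sum lookup_pscale
      by (intro sum.cong) (auto simp: v(2))
    then have "lookup f t = 0" using ev tk by simp
    then show False using tk by (simp add: in_keys_iff)
  qed
  then show "\<exists>m. \<exists>g\<in>quadratic_relations m. \<exists>s t. is_leading_monomial ltP g s \<and> is_leading_monomial ltP f t \<and> tree_divides s t"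
    using t unfolding reducible_def by blast
qed

section \<open>Consequences for the operad: Groebner bases, minimal relations, generation in weight
  one\<close>

lemma quadratic_relations_homogeneous:
  assumes "g \<in> quadratic_relations n"
  shows "homogeneous_of_weight 2 g"
proof -
  have v: "vertices (graft i (corolla k x) (corolla l y)) = 2" if "i < k" for i k l and x y :: "nat \<Rightarrow>\<^sub>0 'a"
    using vertices_graft[of i "corolla k x" "corolla l y"] leaves_corolla[of x k]
      vertices_corolla[of x k] vertices_corolla[of y l] that by (simp only:)
  from assms consider
    "g = single (graft 1 (corolla 4 op_e) (corolla 1 op_a)) 1 - single (graft 2 (corolla 4 op_f) (corolla 1 op_a)) 1"
    | k i l x y where "i < k" "g = single (graft i (corolla k x) (corolla l y)) 1"
    unfolding quadratic_relations_def mem_Collect_eq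
  proof (elim conjE disjE bexE exE)
    fix k i l x y assume "i < k" "g = single (graft i (corolla k x) (corolla l y)) 1"
    then show thesis by (rule that(2))
  qed (rule that(1))
  then show ?thesis
  proof cases
    case 1
    have keys: "keys g \<subseteq> {graft 1 (corolla 4 op_e) (corolla 1 op_a), graft 2 (corolla 4 op_f) (corolla 1 op_a)}"
      unfolding 1 by (rule order_trans[OF keys_minus_subset]) simp
    have v1: "vertices (graft 1 (corolla 4 op_e) (corolla 1 (op_a :: nat \<Rightarrow>\<^sub>0 'a))) = 2" by (rule v) simp
    have v2: "vertices (graft 2 (corolla 4 op_f) (corolla 1 (op_a :: nat \<Rightarrow>\<^sub>0 'a))) = 2" by (rule v) simp
    show ?thesis unfolding homogeneous_of_weight_def
    proof
      fix t assume "t \<in> keys g"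
      then have "t \<in> {graft 1 (corolla 4 op_e) (corolla 1 op_a), graft 2 (corolla 4 op_f) (corolla 1 op_a)}"
        by (rule subsetD[OF keys])
      then show "vertices t = 2" by (elim insertE emptyE) (simp_all only: v1 v2)
    qed
  next
    case 2
    show ?thesis unfolding 2(2) by (rule homogeneous_closed(4)) (rule v[OF 2(1)])
  qed
qed

lemma quadratic_relations_finite: "finite (\<Union>n. (quadratic_relations n :: ((nat \<Rightarrow>\<^sub>0 'k::field) tree \<Rightarrow>\<^sub>0 'k) set))"
proof -
  let ?S = "{op_a, op_e, op_f} :: (nat \<Rightarrow>\<^sub>0 'k) set"
  let ?F = "\<lambda>(i, k, l, x, y). single (graft i (corolla k x) (corolla l y)) (1 :: 'k)"
  let ?T = "{..<4} \<times> {1, 4} \<times> {1, 4} \<times> ?S \<times> ?S"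
  let ?g = "single (graft 1 (corolla 4 op_e) (corolla 1 op_a)) 1 - single (graft 2 (corolla 4 op_f) (corolla 1 op_a)) (1 :: 'k)"
  have "g \<in> insert ?g (?F ` ?T)" if g: "g \<in> quadratic_relations n" for g n
  proof (cases "g = ?g")
    case False
    then have "\<exists>k\<in>{1, 4}. \<exists>i<k. \<exists>l\<in>{1, 4}. \<exists>x\<in>?S. \<exists>y\<in>?S. g = single (graft i (corolla k x) (corolla l y)) 1"
      using g unfolding quadratic_relations_def mem_Collect_eq by (elim conjE disjE) simp_all
    then obtain k i l x y where kl: "k \<in> {1, 4}" "i < k" "l \<in> {1, 4}" "x \<in> ?S" "y \<in> ?S"
      and eq: "g = single (graft i (corolla k x) (corolla l y)) 1"
      by (elim bexE exE conjE)
    have "i \<in> {..<4}" using kl(1,2) by auto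
    then have "(i, k, l, x, y) \<in> ?T" using kl by (intro SigmaI)
    moreover have "g = ?F (i, k, l, x, y)" using eq by (simp only: prod.case)
    ultimately have "g \<in> ?F ` ?T" by (rule rev_image_eqI)
    then show ?thesis by (rule insertI2)
  qed simp
  then have "(\<Union>n. quadratic_relations n) \<subseteq> insert ?g (?F ` ?T)" by (intro UN_least subsetI)
  moreover have "finite (insert ?g (?F ` ?T))" by (intro finite.insertI finite_imageI finite_cartesian_product) simp_all
  ultimately show ?thesis by (rule finite_subset)
qed

lemma P_op_quadratic_groebner_basis: "has_quadratic_groebner_basis (P_op :: ('k::field, nat \<Rightarrow>\<^sub>0 'k) ns_operad)"
  unfolding has_quadratic_groebner_basis_def
  by (intro exI conjI, rule basisP_generator_basis, rule ltP_order, rule quadratic_groebner_basis)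
     (simp add: quadratic_relations_homogeneous)

lemma P_op_finite_groebner_basis: "has_finite_groebner_basis (P_op :: ('k::field, nat \<Rightarrow>\<^sub>0 'k) ns_operad)"
  unfolding has_finite_groebner_basis_def
  by (intro exI conjI, rule basisP_generator_basis, rule ltP_order, rule quadratic_groebner_basis)
     (rule quadratic_relations_finite)

lemma P_op_generated_by_quadratic:
  assumes f: "f \<in> relation_ideal P_op (basisP :: nat \<Rightarrow> (nat \<Rightarrow>\<^sub>0 'k::field) set) n"
  shows "generated_ideal basisP (relations_up_to P_op basisP 2) n f"
proof -
  have G: "quadratic_relations n \<subseteq> relation_ideal P_op (basisP :: nat \<Rightarrow> (nat \<Rightarrow>\<^sub>0 'k) set) n" for n
    using quadratic_groebner_basis unfolding groebner_basis_def by blast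
  have "generated_ideal basisP quadratic_relations n f"
    by (rule groebner_basis_generates[OF ltP_order quadratic_groebner_basis P.relation_ideal_free
          P.relation_ideal_subspace _ f])
       (rule P.generated_ideal_relations[OF P.generator_basis_part[OF basisP_generator_basis] _ G])
  then show ?thesis
  proof (rule generated_ideal_mono)
    fix n g assume g: "g \<in> (quadratic_relations n :: ((nat \<Rightarrow>\<^sub>0 'k) tree \<Rightarrow>\<^sub>0 'k) set)"
    then have "g \<in> relations_up_to P_op basisP 2 n"
      using G[of n] quadratic_relations_homogeneous[OF g] by (auto simp: relations_up_to_def)
    then show "generated_ideal basisP (relations_up_to P_op basisP 2) n g" by (rule ideal_base)
  qed
qed

lemma P_op_minimal_relations:
  assumes "N \<ge> 2"
  shows "minimal_relations_weight_le (P_op :: ('k::field, nat \<Rightarrow>\<^sub>0 'k) ns_operad) N"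
  unfolding minimal_relations_weight_le_def
proof (intro allI impI ballI, elim conjE)
  fix B R n and f :: "(nat \<Rightarrow>\<^sub>0 'k) tree \<Rightarrow>\<^sub>0 'k"
  assume B: "generator_basis P_op B" and R: "minimal_defining_relations P_op B R" and f: "f \<in> R n"
  \<comment> \<open>The arity of a nonzero element can be read off the labels in its support, as
    \<open>change_of_generators\<close> requires.\<close>
  have disj: "n = m" if x: "x \<in> part P_op n 1" "x \<in> part P_op m 1" "x \<noteq> 0" for n m and x :: "nat \<Rightarrow>\<^sub>0 'k"
  proof -
    have "keys x \<noteq> {}" using x(3) poly_mapping_eqI[of x 0] by (auto simp: in_keys_iff)
    then obtain p where "p \<in> keys x" by blast
    moreover have "keys x \<subseteq> to_nat ` {v \<in> labelsP. length v = n \<and> sum_list v = 1}"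
      "keys x \<subseteq> to_nat ` {v \<in> labelsP. length v = m \<and> sum_list v = 1}" using x(1,2) by simp_all
    ultimately have "p \<in> to_nat ` {v \<in> labelsP. length v = n \<and> sum_list v = 1}"
      "p \<in> to_nat ` {v \<in> labelsP. length v = m \<and> sum_list v = 1}" by (blast dest: subsetD)+
    then show ?thesis by auto
  qed
  have "generated_ideal B (relations_up_to P_op B 2) n f" if "f \<in> relation_ideal P_op B n" for n f
    by (rule P.change_of_generators[OF basisP_generator_basis B disj P_op_generated_by_quadratic that])
  from P.minimal_relations_weight_bound[OF P.generator_basis_part[OF B] this R f]
  have "\<exists>w\<le>2. homogeneous_of_weight w f" by simp
  then show "\<exists>w\<le>N. homogeneous_of_weight w f" using assms order_trans by blast
qed

lemma P_op_generated: "generated_in_weight_one (P_op :: ('k::field, nat \<Rightarrow>\<^sub>0 'k) ns_operad)"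
proof -
  let ?gen = "generated_suboperad P_op (\<lambda>m. part P_op m 1) :: nat \<Rightarrow> (nat \<Rightarrow>\<^sub>0 'k) \<Rightarrow> bool"
  have base: "?gen 1 op_a" "?gen 4 op_e" "?gen 4 op_f"
    by (rule gen_base, simp)+
  have unary: "?gen 1 (monom [n])" for n
  proof (induction n)
    case 0
    show ?case using gen_ident[of P_op "\<lambda>m. part P_op m 1"] by simp
  next
    case (Suc n)
    have "?gen (1 + 1 - 1) (circ P_op 0 (monom [n]) op_a)" by (rule gen_circ[OF Suc base(1)]) simp
    then show ?case by (simp add: label_comp_def)
  qed
  have add: "?gen 4 (monom (v[i := v ! i + k]))"
    if "?gen 4 (monom v)" "length v = 4" "i < 4" "v[i := v ! i + k] \<in> labelsP" for v i k
  proof -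
    have "?gen (4 + 1 - 1) (circ P_op i (monom v) (monom [k]))" by (rule gen_circ[OF that(1) unary that(3)])
    then show ?thesis using that by (simp add: label_comp_def)
  qed
  have mon: "?gen (length v) (monom v)" if "v \<in> labelsP" for v
    using that
  proof (cases rule: labelsP_cases)
    case (1 n)
    then show ?thesis using unary by simp
  next
    case (2 x y w z)
    have "?gen 4 (monom [x, y, w, z])"
    proof (cases "y = 0")
      case True
      have "?gen 4 (monom [x, 0, 1, 0])" using add[OF base(2), of 0 x] by simp
      then have "?gen 4 (monom [x, 0, w, 0])" using add[of "[x, 0, 1, 0]" 2 "w - 1"] True 2(3) by simp
      then show ?thesis using add[of "[x, 0, w, 0]" 3 z] True 2(3) by simp
    next
      case False
      then have x: "x = 0" using 2(2) by simp
      have "?gen 4 (monom [0, y, 0, 0])" using add[OF base(3), of 1 "y - 1"] False by simp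
      then have "?gen 4 (monom [0, y, w, 0])" using add[of "[0, y, 0, 0]" 2 w] False by simp
      then show ?thesis using add[of "[0, y, w, 0]" 3 z] False x by simp
    qed
    then show ?thesis using 2(1) by (simp add: eval_nat_numeral)
  qed
  have "?gen n f" if f: "f \<in> part P_op n k" for f n k
  proof -
    have "keys f \<subseteq> to_nat ` {v \<in> labelsP. length v = n}" using f by auto
    then show ?thesis
    proof (induction f rule: keys_subset_induct)
      case zero
      show ?case by (rule gen_zero)
    next
      case (add p c g)
      then obtain v where v: "p = to_nat v" "v \<in> labelsP" "length v = n" by blast
      have "?gen n (smul P_op c (monom v))" using gen_smul[OF mon[OF v(2)]] v(3) by simp
      then show ?case using gen_add add(3) v(1) by fastforce
    qed
  qed
  then show ?thesis by (simp add: generated_in_weight_one_def del: label_operad_simps)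
qed

subsection \<open>Off-diagonal homology of the Veronese powers\<close>

interpretation scalar: vector_space "(*) :: 'k::field \<Rightarrow> 'k \<Rightarrow> 'k"
  by unfold_locales (auto simp: algebra_simps)

text \<open>Quotients are handled by duality: an element lies outside a span as soon as some
  functional that vanishes on the spanning set does not vanish on the element.\<close>

abbreviation functional :: "('a \<Rightarrow> 'k::field) \<Rightarrow> ('a \<Rightarrow>\<^sub>0 'k) \<Rightarrow> 'k" where
  "functional \<equiv> linear_extension (*)"

lemma functional_simps [simp]:
  "functional F (f + g) = functional F f + functional F g"
  "functional F (f - g) = functional F f - functional F g"
  "functional F (pscale c f) = c * functional F f"
  "functional F (\<Sum>i\<in>A. f' i) = (\<Sum>i\<in>A. functional F (f' i))"
  by (simp_all add: scalar.linear_extension_add scalar.linear_extension_diff scalar.linear_extension_pscale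
      scalar.linear_extension_sum)

lemma functional_replace_child:
  "functional F (replace_child x ts j r) = functional (\<lambda>t. F (Node x (ts[j := t]))) r"
  unfolding replace_child_def linear_extension_comp[OF scalar.vector_space_axioms]
  by (rule scalar.linear_extension_cong) simp

lemma functional_span:
  assumes "\<And>r. r \<in> S \<Longrightarrow> functional F r = 0" "z \<in> pscale.span S"
  shows "functional F z = 0"
  using assms(2)
proof (induction rule: pscale.span_induct_alt)
  case (step c x y)
  then show ?case using assms(1) by simp
qed simp

text \<open>The functionals below distinguish a child that is a leaf from any other. Substituting
  the terms of a multilinearity relation for a child never runs into this exception.\<close>

lemma Leaf_notin_multilinearity: "r \<in> multilinearity P \<Longrightarrow> Leaf \<notin> keys r"
proof (induction rule: multilinearity.induct)
  case (multi_add w a ts b)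
  show ?case by (simp add: in_keys_iff lookup_minus lookup_single when_def)
next
  case (multi_smul w a ts c)
  show ?case by (simp add: in_keys_iff lookup_minus lookup_single when_def)
next
  case (multi_child r x ts j)
  show ?case
    using keys_linear_extension[of "\<lambda>t. single (Node x (ts[j := t])) 1" r] by (auto simp: replace_child_def)
qed

lemma functional_cong_multilinearity:
  assumes "r \<in> multilinearity P" "\<And>t. t \<noteq> Leaf \<Longrightarrow> F t = c * G t"
  shows "functional F r = c * functional G r"
proof -
  have "functional F r = functional (\<lambda>t. c * G t) r"
  proof (rule scalar.linear_extension_cong)
    fix t assume "t \<in> keys r"
    then have "t \<noteq> Leaf" using Leaf_notin_multilinearity[OF assms(1)] by auto
    then show "F t = c * G t" by (rule assms(2))
  qed
  then show ?thesis by (simp add: scalar.linear_extension_fun_scale)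
qed

definition branch_coeff :: "nat \<Rightarrow> (nat \<times> (nat \<Rightarrow>\<^sub>0 'k::field)) tree \<Rightarrow> 'k" where
  "branch_coeff d t = (case t of Leaf \<Rightarrow> 0
    | Node x ts \<Rightarrow> if fst x = 1 \<and> ts = [Leaf] then lookup (snd x) (to_nat [d]) else 0)"

lemma branch_coeff_simps [simp]:
  "branch_coeff d Leaf = 0"
  "branch_coeff d (Node (w, u) ts) = (if w = 1 \<and> ts = [Leaf] then lookup u (to_nat [d]) else 0)"
  by (simp_all add: branch_coeff_def)

lemma branch_coeff_multilinearity:
  assumes "r \<in> multilinearity (veronese P_op d)"
  shows "functional (branch_coeff d) r = 0"
  using assms
proof (induction rule: multilinearity.induct)
  case (multi_child r x ts j)
  have "functional (branch_coeff d) (replace_child x ts j r) = 0 * functional (branch_coeff d) r"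
    unfolding functional_replace_child
  proof (rule functional_cong_multilinearity[OF multi_child(1)])
    fix t :: "(nat \<times> (nat \<Rightarrow>\<^sub>0 'a)) tree" assume "t \<noteq> Leaf"
    then have "ts[j := t] \<noteq> [Leaf]"
      using multi_child(3) set_update_memI[of j ts t] by auto
    then show "branch_coeff d (Node x (ts[j := t])) = 0 * branch_coeff d t" by (cases x) simp
  qed
  then show ?case by simp
qed (auto simp: lookup_add algebra_simps)

text \<open>
  A cocycle detecting the relation \<open>[0, 0, 1, d - 1] \<circ>\<^sub>0 a\<^sup>d \<circ>\<^sub>1 a\<^sup>d = 0\<close>: the two ways of splitting off one of
  the two branches of this relation contribute with opposite signs to every boundary.
\<close>

definition cocycle :: "nat \<Rightarrow> (nat \<times> (nat \<Rightarrow>\<^sub>0 'k::field)) tree \<Rightarrow> 'k" where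
  "cocycle d t = (case t of Leaf \<Rightarrow> 0
    | Node x ts \<Rightarrow> if fst x = 2 \<and> length ts = 4 \<and> ts ! 2 = Leaf \<and> ts ! 3 = Leaf then
        (if ts ! 1 = Leaf then branch_coeff d (ts ! 0) * lookup (snd x) (to_nat [0, d, 1, d - 1])
         else if ts ! 0 = Leaf then branch_coeff d (ts ! 1) * lookup (snd x) (to_nat [d, 0, 1, d - 1]) else 0)
      else 0)"

lemma cocycle_simps [simp]:
  "cocycle d Leaf = 0"
  "cocycle d (Node (w, m) ts) = (if w = 2 \<and> length ts = 4 \<and> ts ! 2 = Leaf \<and> ts ! 3 = Leaf then
        (if ts ! 1 = Leaf then branch_coeff d (ts ! 0) * lookup m (to_nat [0, d, 1, d - 1])
         else if ts ! 0 = Leaf then branch_coeff d (ts ! 1) * lookup m (to_nat [d, 0, 1, d - 1]) else 0)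
      else 0)"
  by (simp_all add: cocycle_def)

lemma cocycle_multilinearity:
  assumes "r \<in> multilinearity (veronese P_op d)"
  shows "functional (cocycle d) r = 0"
  using assms
proof (induction rule: multilinearity.induct)
  case (multi_child r x ts j)
  obtain w m where x: "x = (w, m)" by (cases x)
  have "\<exists>c. \<forall>t. t \<noteq> Leaf \<longrightarrow> cocycle d (Node x (ts[j := t])) = c * branch_coeff d t"
  proof (cases "length ts = 4 \<and> w = 2")
    case True
    then obtain t0 t1 t2 t3 where ts: "ts = [t0, t1, t2, t3]"
      by (auto simp: eval_nat_numeral length_Suc_conv)
    have j: "j = 0 \<or> j = 1 \<or> j = 2 \<or> j = 3" using multi_child(3) ts by auto
    define c where "c = (if j = 0 \<and> t1 = Leaf \<and> t2 = Leaf \<and> t3 = Leaf then lookup m (to_nat [0, d, 1, d - 1])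
      else if j = 1 \<and> t0 = Leaf \<and> t2 = Leaf \<and> t3 = Leaf then lookup m (to_nat [d, 0, 1, d - 1]) else 0)"
    have "cocycle d (Node x (ts[j := t])) = c * branch_coeff d t" if "t \<noteq> Leaf" for t
    proof -
      have w: "w = 2" using True by blast
      show ?thesis
        using j that unfolding x ts w c_def
        by (elim disjE; cases "t0 = Leaf"; cases "t1 = Leaf"; cases "t2 = Leaf"; cases "t3 = Leaf"; simp)
    qed
    then show ?thesis by blast
  next
    case False
    then show ?thesis by (intro exI[of _ 0]) (auto simp: x)
  qed
  then obtain c where c: "\<And>t. t \<noteq> Leaf \<Longrightarrow> cocycle d (Node x (ts[j := t])) = c * branch_coeff d t" by blast
  have "functional (cocycle d) (replace_child x ts j r) = c * functional (branch_coeff d) r"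
    unfolding functional_replace_child by (rule functional_cong_multilinearity[OF multi_child(1) c])
  then show ?case using branch_coeff_multilinearity[OF multi_child(1)] by simp
next
  case (multi_add w a ts b)
  have "cocycle d (Node (w, a + b) ts) = cocycle d (Node (w, a) ts) + cocycle d (Node (w, b) ts)"
    unfolding cocycle_simps lookup_add distrib_left by (cases "w = 2 \<and> length ts = 4 \<and> ts ! 2 = Leaf \<and> ts ! 3 = Leaf"; cases "ts ! 1 = Leaf"; cases "ts ! 0 = Leaf") (simp_all only: if_True if_False simp_thms add_0_right)
  then show ?case by (simp del: cocycle_simps)
next
  case (multi_smul w a ts c)
  have "cocycle d (Node (w, pscale c a) ts) = c * cocycle d (Node (w, a) ts)"
    unfolding cocycle_simps lookup_pscale by (cases "w = 2 \<and> length ts = 4 \<and> ts ! 2 = Leaf \<and> ts ! 3 = Leaf"; cases "ts ! 1 = Leaf"; cases "ts ! 0 = Leaf") (simp_all only: if_True if_False simp_thms mult_zero_right mult.left_commute[of _ c])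
  then show ?case by (simp del: cocycle_simps)
qed


section \<open>The cocycle vanishes on boundaries\<close>

lemma keys_part_length: "f \<in> part P_op n k \<Longrightarrow> keys f \<subseteq> to_nat ` {v :: nat list. length v = n}"
  unfolding label_operad_simps mem_Collect_eq
  by (erule order_trans, intro image_mono subsetI) auto

lemma keys_part_unary: "f \<in> part P_op 1 d \<Longrightarrow> keys f \<subseteq> {to_nat [d]}"
proof -
  assume "f \<in> part P_op 1 d"
  then have "keys f \<subseteq> to_nat ` {v \<in> labelsP. length v = 1 \<and> sum_list v = d}" by simp
  also have "\<dots> \<subseteq> {to_nat [d]}" by (intro image_subsetI) (auto simp: length_Suc_conv)
  finally show ?thesis .
qed

text \<open>The unary part of weight \<open>d\<close> is spanned by \<open>[d]\<close>, and adding
  \<open>d\<close> to the entry \<open>j\<close> is injective, so each coefficient of the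
  composition comes from at most one label.\<close>

lemma lookup_circ_unary:
  assumes m: "m \<in> part P_op 4 d" and u: "u \<in> part P_op 1 d" and j: "j < 4"
    and r: "r \<in> labelsP" "length r = 4"
  shows "lookup (circ P_op j m u) (to_nat r)
    = (if d \<le> r ! j then lookup m (to_nat (r[j := r ! j - d])) * lookup u (to_nat [d]) else 0)"
proof -
  from keys_part_unary[OF u] have u': "u = single (to_nat [d]) (lookup u (to_nat [d]))" by (rule keys_subset_singleton)
  have "keys m \<subseteq> to_nat ` {v :: nat list. length v = 4}" by (rule keys_part_length[OF m])
  then show ?thesis
  proof (induction m rule: keys_subset_induct)
    case (add p x g)
    then obtain v :: "nat list" where v: "p = to_nat v" "length v = 4" by auto
    have eq: "v[j := v ! j + d] = r \<longleftrightarrow> d \<le> r ! j \<and> v = r[j := r ! j - d]"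
    proof
      assume r': "v[j := v ! j + d] = r"
      have rj: "r ! j = v ! j + d" unfolding r'[symmetric] using v(2) j by simp
      have "r[j := v ! j] = v" unfolding r'[symmetric] by simp
      then show "d \<le> r ! j \<and> v = r[j := r ! j - d]" unfolding rj by simp
    next
      assume v': "d \<le> r ! j \<and> v = r[j := r ! j - d]"
      then have "v ! j = r ! j - d" using r(2) j by simp
      then have "v ! j + d = r ! j" using v' by simp
      moreover have "r[j := r ! j - d, j := r ! j] = r" by simp
      ultimately show "v[j := v ! j + d] = r" using v' by (simp only:)
    qed
    have L: "lookup (opt_monom (label_comp labelsP j v [d])) (to_nat r) = (if v[j := v ! j + d] = r then 1 else (0 :: 'a))"
      using r(1) by (auto simp: label_comp_def Let_def lookup_single when_def)
    have "circ P_op j (single p x) u = pscale (x * lookup u (to_nat [d])) (opt_monom (label_comp labelsP j v [d]))"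
      unfolding v(1) by (subst u') simp
    then have "lookup (circ P_op j (single p x) u) (to_nat r)
        = (if v[j := v ! j + d] = r then x * lookup u (to_nat [d]) else 0)"
      using L by simp
    then have "lookup (circ P_op j (single p x) u) (to_nat r)
        = (if d \<le> r ! j then lookup (single p x) (to_nat (r[j := r ! j - d])) * lookup u (to_nat [d]) else 0)"
      unfolding eq v(1) by (simp add: lookup_single when_def)
    then show ?case using add(3) by (simp add: lookup_add algebra_simps)
  qed simp
qed

lemma vertices_le_bar_weight: "bar_tree P t \<Longrightarrow> vertices t \<le> bar_weight t"
proof (induction P t rule: bar_tree.induct)
  case (2 P w a ts)
  have "sum_list (map vertices ts) \<le> sum_list (map bar_weight ts)"
    by (rule sum_list_mono) (use 2 in auto)
  then show ?case using 2 by simp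
qed simp

text \<open>Merging the branch at input 0 into the root leaves the branch at input 1 to be read by
  \<open>branch_coeff\<close>, and conversely; both contractions therefore give the same product.
  Contractions at other inputs miss the two labels read by \<open>cocycle\<close>, whose remaining
  entries \<open>1\<close> and \<open>d - 1\<close> are below \<open>d\<close>.\<close>

lemma cocycle_contract:
  assumes d: "d \<ge> 2" and t: "bar_tree (veronese P_op d) (Node (1, m) ts)" and j: "j < length ts"
  shows "functional (cocycle d) (contract_child (veronese P_op d) (1, m) ts j)
    = (if length ts = 4 \<and> j < 2 \<and> ts ! 2 = Leaf \<and> ts ! 3 = Leaf
       then branch_coeff d (ts ! 0) * branch_coeff d (ts ! 1) * lookup m (to_nat [0, 0, 1, d - 1]) else 0)"
proof -
  let ?V = "veronese P_op d"
  have m: "m \<in> part P_op (length ts) d" using t by simp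
  show ?thesis
  proof (cases "ts ! j")
    case Leaf
    have "branch_coeff d (ts ! 0) * branch_coeff d (ts ! 1) = 0" if "j < 2"
    proof -
      from that have "j = 0 \<or> j = 1" by auto
      then show ?thesis using Leaf by (elim disjE) simp_all
    qed
    then show ?thesis by (simp add: contract_child_def Leaf)
  next
    case (Node y us)
    obtain w u where y: "y = (w, u)" by (cases y)
    have y_bar: "bar_tree ?V (Node (w, u) us)" 
    proof -
      have "\<forall>s\<in>set ts. bar_tree ?V s" using t by simp
      then have "bar_tree ?V (ts ! j)" using nth_mem[OF j] by blast
      then show ?thesis unfolding Node y .
    qed
    let ?ts = "take j ts @ us @ drop (Suc j) ts"
    have c: "functional (cocycle d) (contract_child ?V (1, m) ts j) = cocycle d (Node (1 + w, circ P_op j m u) ?ts)"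
      by (simp add: contract_child_def Node y)
    have len: "length ?ts = length ts + length us - 1" using j by simp
    show ?thesis
    proof (cases "w = 1 \<and> length ?ts = 4")
      case False
      have b0: "branch_coeff d (ts ! j) = 0" if "length ts = 4"
        using False that len unfolding Node y by auto
      have "branch_coeff d (ts ! 0) * branch_coeff d (ts ! 1) = 0" if "length ts = 4" "j < 2"
      proof -
        from that have "j = 0 \<or> j = 1" by auto
        then show ?thesis using b0[OF that(1)] by (elim disjE) simp_all
      qed
      moreover have "cocycle d (Node (1 + w, circ P_op j m u) ?ts) = 0"
        using False by auto
      ultimately show ?thesis unfolding c by simp
    next
      case True
      then have w: "w = 1" and u: "u \<in> part P_op (length us) d" using y_bar by auto
      show ?thesis
      proof (cases "length ts = 4")
        case False
        \<comment> \<open>Here either a quaternary operation is inserted into a multiple of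
          \<open>a^d\<close>, or the root has an arity other than 1 and 4 and hence the label
          zero.\<close>
        have "circ P_op j m u = 0"
        proof (cases "length ts = 1")
          case one: True
          then have us: "length us = 4" using True len by simp
          have km: "keys m \<subseteq> {to_nat [d]}" using keys_part_unary[of m d] m unfolding one by simp
          then have m': "m = single (to_nat [d]) (lookup m (to_nat [d]))" by (rule keys_subset_singleton)
          have "keys u \<subseteq> to_nat ` {v :: nat list. length v = 4}" using keys_part_length[OF u] unfolding us .
          then show ?thesis
          proof (induction u rule: keys_subset_induct)
            case (add p x g)
            then obtain v :: "nat list" where "p = to_nat v" "length v = 4" by auto
            then have "circ P_op j m (single p x) = 0" using d by (subst m') (simp add: label_comp_def)
            then show ?case using add(3) by simp
          qed simp
        next
          case False
          have none: "{v \<in> labelsP. length v = length ts \<and> sum_list v = d} = {}"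
          proof (rule equals0I)
            fix v :: "nat list" assume "v \<in> {v \<in> labelsP. length v = length ts \<and> sum_list v = d}"
            then have "v \<in> labelsP" "length v = length ts" by blast+
            moreover have "length v = 1 \<or> length v = 4" if "v \<in> labelsP" for v using that by (auto simp: labelsP_def)
            ultimately show False using \<open>length ts \<noteq> 4\<close> False by metis
          qed
          have "keys m \<subseteq> to_nat ` {v \<in> labelsP. length v = length ts \<and> sum_list v = d}" using m by simp
          then have "keys m = {}" unfolding none by simp
          then have "m = 0" by (intro poly_mapping_eqI) (auto simp: in_keys_iff)
          then show ?thesis by simp
        qed
        then show ?thesis unfolding c using False by simp
      next
        case four: True
        then have "length us = 1" using True len by simp
        then obtain b where us: "us = [b]" by (auto simp: length_Suc_conv)
        obtain t0 t1 t2 t3 where ts: "ts = [t0, t1, t2, t3]"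
          using four by (auto simp: eval_nat_numeral length_Suc_conv)
        have coeff: "lookup (circ P_op j m u) (to_nat r)
            = (if d \<le> r ! j then lookup m (to_nat (r[j := r ! j - d])) * lookup u (to_nat [d]) else 0)"
          if "r \<in> labelsP" "length r = 4" for r
          by (rule lookup_circ_unary) (use m u us four j that in auto)
        have cx: "lookup (circ P_op j m u) (to_nat [d, 0, 1, d - 1])
            = (if j = 0 then lookup m (to_nat [0, 0, 1, d - 1]) * lookup u (to_nat [d]) else 0)"
          and cy: "lookup (circ P_op j m u) (to_nat [0, d, 1, d - 1])
            = (if j = 1 then lookup m (to_nat [0, 0, 1, d - 1]) * lookup u (to_nat [d]) else 0)"
        proof -
          have j4: "j = 0 \<or> j = 1 \<or> j = 2 \<or> j = 3" using j four by linarith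
          have le: "d \<le> [d, 0, 1, d - 1] ! j \<longleftrightarrow> j = 0" "d \<le> [0, d, 1, d - 1] ! j \<longleftrightarrow> j = 1"
            using j4 d by (elim disjE; simp)+
          have lab: "[d, 0, 1, d - 1] \<in> labelsP" "[0, d, 1, d - 1] \<in> labelsP" by (simp_all add: labelsP_def)
          have upd: "[d, 0, 1, d - 1][0 := [d, 0, 1, d - 1] ! 0 - d] = [0, 0, 1, d - 1]"
            "[0, d, 1, d - 1][1 := [0, d, 1, d - 1] ! 1 - d] = [0, 0, 1, d - 1]" by simp_all
          have len4: "length [d, 0, 1, d - 1] = 4" "length [0, d, 1, d - 1] = 4" by simp_all
          show "lookup (circ P_op j m u) (to_nat [d, 0, 1, d - 1])
            = (if j = 0 then lookup m (to_nat [0, 0, 1, d - 1]) * lookup u (to_nat [d]) else 0)"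
            unfolding coeff[OF lab(1) len4(1)] le by (rule if_cong) (simp_all only: upd)
          show "lookup (circ P_op j m u) (to_nat [0, d, 1, d - 1])
            = (if j = 1 then lookup m (to_nat [0, 0, 1, d - 1]) * lookup u (to_nat [d]) else 0)"
            unfolding coeff[OF lab(2) len4(2)] le by (rule if_cong) (simp_all only: upd)
        qed
        define g where "g = circ P_op j m u"
        define e where "e = lookup m (to_nat [0, 0, 1, d - 1])"
        have node: "[t0, t1, t2, t3] ! j = Node (1, u) [b]" using Node unfolding ts y w us .
        have j4: "j = 0 \<or> j = 1 \<or> j = 2 \<or> j = 3" using j four by linarith
        have "cocycle d (Node (1 + 1, g) (take j [t0, t1, t2, t3] @ [b] @ drop (Suc j) [t0, t1, t2, t3]))
          = (if length [t0, t1, t2, t3] = 4 \<and> j < 2 \<and> [t0, t1, t2, t3] ! 2 = Leaf \<and> [t0, t1, t2, t3] ! 3 = Leaf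
             then branch_coeff d ([t0, t1, t2, t3] ! 0) * branch_coeff d ([t0, t1, t2, t3] ! 1) * e else 0)"
          using j4
        proof (elim disjE)
          assume 0: "j = 0"
          note c = cx[folded g_def e_def, unfolded if_P[OF 0]] and c' = cy[folded g_def e_def]
          have t: "t0 = Node (1, u) [b]" using node unfolding 0 nth_Cons_0 .
          have c'': "lookup g (to_nat [0, d, 1, d - 1]) = 0" unfolding c' 0 by simp
          show ?thesis unfolding 0 t by (cases "b = Leaf"; cases "t1 = Leaf") (simp_all add: c[unfolded 0, simplified] c''[simplified])
        next
          assume 1: "j = 1"
          note c = cy[folded g_def e_def, unfolded if_P[OF 1]] and c' = cx[folded g_def e_def]
          have t: "t1 = Node (1, u) [b]" using node unfolding 1 by simp
          have c'': "lookup g (to_nat [d, 0, 1, d - 1]) = 0" unfolding c' 1 by simp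
          show ?thesis unfolding 1 t by (cases "b = Leaf"; cases "t0 = Leaf") (simp_all add: c[unfolded 1, simplified] c''[simplified])
        next
          assume 2: "j = 2"
          have "t2 = Node (1, u) [b]" using node unfolding 2 by simp
          moreover have "lookup g (to_nat [d, 0, 1, d - 1]) = 0" unfolding g_def cx using 2 by simp
          moreover have "lookup g (to_nat [0, d, 1, d - 1]) = 0" unfolding g_def cy using 2 by simp
          ultimately show ?thesis unfolding 2 by simp
        next
          assume 3: "j = 3"
          have "t3 = Node (1, u) [b]" using node unfolding 3 by simp
          moreover have "lookup g (to_nat [d, 0, 1, d - 1]) = 0" unfolding g_def cx using 3 by simp
          moreover have "lookup g (to_nat [0, d, 1, d - 1]) = 0" unfolding g_def cy using 3 by simp
          ultimately show ?thesis unfolding 3 by simp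
        qed
        then show ?thesis unfolding c unfolding ts w us g_def e_def .
      qed
    qed
  qed
qed

text \<open>Weight three on three vertices forces weight one at each of them, so the root reaches
  weight two only by a contraction at the root. The contractions at inputs 0 and 1 have opposite
  signs, because the branch at input 0 is a single vertex.\<close>

lemma cocycle_boundary:
  assumes d: "d \<ge> 2" and t: "bar_tree (veronese P_op d) t" "vertices t = 3" "bar_weight t = 3"
  shows "functional (cocycle d) (bar_boundary (veronese P_op d) t) = 0"
proof (cases t)
  case (Node x ts)
  let ?V = "veronese P_op d"
  obtain w m where x: "x = (w, m)" by (cases x)
  have "sum_list (map vertices ts) \<le> sum_list (map bar_weight ts)"
    by (rule sum_list_mono) (use t(1) Node x vertices_le_bar_weight in auto)
  then have w: "w = 1" using t Node x by auto
  have rep: "functional (cocycle d) (replace_child x ts j r) = 0" for j r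
    unfolding functional_replace_child x w by (simp del: branch_coeff_simps)
  define T where "T = (if length ts = 4 \<and> ts ! 2 = Leaf \<and> ts ! 3 = Leaf
       then branch_coeff d (ts ! 0) * branch_coeff d (ts ! 1) * lookup m (to_nat [0, 0, 1, d - 1]) else 0)"
  have con: "functional (cocycle d) (contract_child ?V x ts j) = (if j < 2 then T else 0)" if "j < length ts" for j
    using cocycle_contract[OF d _ that] t(1) unfolding Node x w T_def by auto
  have "functional (cocycle d) (bar_boundary ?V t)
      = (\<Sum>j<length ts. (-1) ^ (1 + (\<Sum>l<j. vertices (ts ! l))) * (if j < 2 then T else 0))"
    unfolding Node bar_boundary.simps functional_simps rep by (intro sum.cong) (simp_all add: con)
  also have "\<dots> = 0"
  proof (cases "T = 0")
    case False
    then have four: "length ts = 4" and "branch_coeff d (ts ! 0) \<noteq> 0" by (auto simp: T_def split: if_splits)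
    then have v: "vertices (ts ! 0) = 1"
      by (cases "ts ! 0") (auto simp: branch_coeff_def split: if_splits)
    have "{..<4::nat} = {0, 1, 2, 3}" by auto
    then show ?thesis unfolding four using v by simp
  next
    case True
    then have z: "(if j < 2 then T else 0) = 0" for j :: nat by simp
    show ?thesis unfolding z by simp
  qed
  finally show ?thesis .
qed (use t(2) in simp)

text \<open>The cycle is one splitting of the cubic relation: \<open>[d, 0, 1, d - 1]\<close> with
  the branch \<open>a^d\<close> on input 1. Contracting its only edge gives the label zero, while
  \<open>cocycle\<close> takes the value 1 on it.\<close>

lemma veronese_bar_homology:
  assumes d: "d \<ge> 2"
  shows "bar_homology_nonzero (veronese P_op d :: ('k::field, nat \<Rightarrow>\<^sub>0 'k) ns_operad) 2 3"
proof -
  let ?V = "veronese P_op d :: ('k, nat \<Rightarrow>\<^sub>0 'k) ns_operad"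
  let ?b = "Node (1, monom [d]) [Leaf] :: (nat \<times> (nat \<Rightarrow>\<^sub>0 'k)) tree"
  let ?t = "Node (2, monom [d, 0, 1, d - 1]) [Leaf, ?b, Leaf, Leaf]"
  let ?z = "single ?t (1 :: 'k)"
  let ?gen = "generated_suboperad P_op (\<lambda>m. part P_op m d) :: nat \<Rightarrow> (nat \<Rightarrow>\<^sub>0 'k) \<Rightarrow> bool"
  have base: "?gen 1 (monom [d])" "?gen 4 (monom [0, 0, 1, d - 1])"
    by (rule gen_base, use d in simp)+
  have "?gen (4 + 1 - 1) (circ P_op 0 (monom [0, 0, 1, d - 1]) (monom [d]))"
    by (rule gen_circ[OF base(2,1)]) simp
  then have gen: "?gen 4 (monom [d, 0, 1, d - 1])" by (simp add: label_comp_def)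
  have bar: "bar_tree ?V ?t" using base(1) gen d by (simp add: eval_nat_numeral)
  have z: "?z \<in> bar_chains ?V 2 3"
    unfolding bar_chains_def using bar by (simp del: bar_tree.simps)
  have bdry: "bar_boundary ?V ?t = - single (Node (3, 0) [Leaf, Leaf, Leaf, Leaf]) 1"
  proof -
    have "{..<4::nat} = {0, 1, 2, 3}" by auto
    moreover have "bar_boundary ?V ?b = 0" by (simp add: contract_child_def replace_child_def)
    ultimately show ?thesis using d
      by (simp add: contract_child_def replace_child_def eval_nat_numeral label_comp_def del: bar_boundary.simps(2)
          add: bar_boundary.simps(2)[of _ "(2, _)"] bar_boundary.simps(2)[of _ "(Suc (Suc 0), _)"])
  qed
  have "0 \<in> part ?V 4 3" by (simp add: gen_zero)
  then have "bar_tree ?V (Node (3, 0) [Leaf, Leaf, Leaf, Leaf])" by (simp add: eval_nat_numeral)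
  \<comment> \<open>The scalar 0 in the homogeneity relation puts a tree with label zero into the
    span.\<close>
  from multi_smul[OF this, of 0]
  have "single (Node (3, 0) [Leaf, Leaf, Leaf, Leaf]) 1 \<in> pscale.span (multilinearity ?V)"
    by (simp add: pscale.span_base)
  then have "bar_boundary ?V ?t \<in> pscale.span (multilinearity ?V)"
    unfolding bdry by (rule pscale.span_neg)
  then have 1: "linear_extension pscale (bar_boundary ?V) ?z \<in> pscale.span (multilinearity ?V)"
    by (simp del: bar_boundary.simps)
  have 2: "?z - linear_extension pscale (bar_boundary ?V) y \<notin> pscale.span (multilinearity ?V)"
    if y: "y \<in> bar_chains ?V (2 + 1) 3" for y
  proof
    assume "?z - linear_extension pscale (bar_boundary ?V) y \<in> pscale.span (multilinearity ?V)"
    then have "functional (cocycle d) (?z - linear_extension pscale (bar_boundary ?V) y) = 0"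
      by (rule functional_span[where S = "multilinearity ?V", rotated]) (rule cocycle_multilinearity)
    moreover have "functional (cocycle d) (linear_extension pscale (bar_boundary ?V) y) = 0"
    proof -
      have "functional (cocycle d) (bar_boundary ?V t) = 0" if "t \<in> keys y" for t
        by (rule cocycle_boundary[OF d]) (use y that in \<open>simp_all add: bar_chains_def\<close>)
      then show ?thesis
        unfolding linear_extension_comp[OF scalar.vector_space_axioms]
        by (simp add: linear_extension_def[of "(*)"])
    qed
    ultimately show False by simp
  qed
  from z 1 2 show ?thesis unfolding bar_homology_nonzero_def by blast
qed

lemma veronese_rate:
  assumes "d \<ge> 2"
  shows "rate (veronese P_op d :: ('k::field, nat \<Rightarrow>\<^sub>0 'k) ns_operad) \<ge> 2"
proof -
  have "ereal ((real 3 - 1) / (real 2 - 1)) \<le> rate (veronese P_op d :: ('k, nat \<Rightarrow>\<^sub>0 'k) ns_operad)"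
    unfolding rate_def using veronese_bar_homology[OF assms, where 'k = 'k]
    by (intro Sup_upper CollectI exI[of _ 2] exI[of _ 3]) simp
  then show ?thesis by simp
qed

subsection \<open>The bar complex modulo multilinearity\<close>

text \<open>These are the functionals on the true bar complex, that is, on trees modulo the span of
  \<open>multilinearity P\<close>.\<close>

definition multilinear :: "('k::field, 'v::ab_group_add) ns_operad \<Rightarrow> ((nat \<times> 'v) tree \<Rightarrow> 'k) \<Rightarrow> bool" where
  "multilinear P F \<longleftrightarrow> (\<forall>r\<in>multilinearity P. functional F r = 0)"

lemma functional_fun_sum:
  "functional (\<lambda>t. \<Sum>l\<in>A. F l t) r = (\<Sum>l\<in>A. functional (F l) r)"
  by (simp add: linear_extension_def sum_distrib_left sum.swap[of _ A])

lemma functional_swap: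
  "functional (\<lambda>t. functional (F t) g) r = functional (\<lambda>t'. functional (\<lambda>t. F t t') r) g"
  unfolding linear_extension_def sum_distrib_left
  by (rule sum.swap[THEN trans]) (intro sum.cong refl mult.left_commute)

lemma functional_vanish: "(\<And>t. t \<in> keys r \<Longrightarrow> F t = 0) \<Longrightarrow> functional F r = 0"
  by (simp add: linear_extension_def)

lemma keys_sum_pscale: "s \<in> keys (\<Sum>j\<in>A. pscale (c j) (f j)) \<Longrightarrow> \<exists>j\<in>A. s \<in> keys (f j)"
proof -
  assume "s \<in> keys (\<Sum>j\<in>A. pscale (c j) (f j))"
  then have "s \<in> (\<Union>j\<in>A. keys (pscale (c j) (f j)))" by (rule subsetD[OF keys_sum_subset])
  then obtain j where "j \<in> A" "s \<in> keys (pscale (c j) (f j))" by (rule UN_E)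
  then show ?thesis using subsetD[OF keys_pscale] by (intro bexI[of _ j])
qed

text \<open>The signs of the boundary depend on the numbers of vertices in earlier children. As all
  terms of a relation agree in this number, they receive the same sign.\<close>

lemma multilinearity_vertices: "r \<in> multilinearity P \<Longrightarrow> \<exists>n. \<forall>t\<in>keys r. vertices t = n"
proof (induction rule: multilinearity.induct)
  case (multi_add w a ts b)
  show ?case
    by (intro exI[of _ "1 + sum_list (map vertices ts)"])
       (auto simp: in_keys_iff lookup_minus lookup_single when_def split: if_splits)
next
  case (multi_smul w a ts c)
  show ?case
    by (intro exI[of _ "1 + sum_list (map vertices ts)"])
       (auto simp: in_keys_iff lookup_minus lookup_single when_def split: if_splits)
next
  case (multi_child r x ts j)
  then obtain n where n: "\<forall>t\<in>keys r. vertices t = n" by blast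
  have "vertices s = 1 + sum_list ((map vertices ts)[j := n])" if s: "s \<in> keys (replace_child x ts j r)" for s
  proof -
    have "s \<in> (\<Union>t\<in>keys r. keys (single (Node x (ts[j := t])) (1 :: 'b)))"
      using s keys_linear_extension[of "\<lambda>t. single (Node x (ts[j := t])) 1" r] unfolding replace_child_def by blast
    then obtain t where "t \<in> keys r" "s = Node x (ts[j := t])" by auto
    then show ?thesis using n by (simp add: map_update)
  qed
  then show ?case by blast
qed

context weight_graded_ns_operad
begin

lemma bar_tree_contract:
  assumes "bar_tree P (Node (w, a) ts)" "j < length ts" "ts ! j = Node (w', c) us"
  shows "bar_tree P (Node (w + w', circ P j a c) (take j ts @ us @ drop (Suc j) ts))"
proof -
  have all: "\<forall>t\<in>set ts. bar_tree P t" and a: "w > 0" "a \<in> part P (length ts) w" using assms(1) by auto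
  then have "bar_tree P (Node (w', c) us)" using assms(2,3) nth_mem by metis
  then have c: "c \<in> part P (length us) w'" "\<forall>t\<in>set us. bar_tree P t" by auto
  have "length (take j ts @ us @ drop (Suc j) ts) = length ts + length us - 1" using assms(2) by simp
  then have "circ P j a c \<in> part P (length (take j ts @ us @ drop (Suc j) ts)) (w + w')"
    using circ_part[OF a(2) c(1) assms(2)] by simp
  then show ?thesis using a all c set_take_subset[of j ts] set_drop_subset[of "Suc j" ts] by auto
qed

lemma bar_tree_update: "\<lbrakk>bar_tree P (Node x ts); bar_tree P t\<rbrakk> \<Longrightarrow> bar_tree P (Node x (ts[j := t]))"
  using set_update_subset_insert[of ts j t] by (cases x) auto

lemma bar_tree_nth: "\<lbrakk>bar_tree P (Node x ts); j < length ts\<rbrakk> \<Longrightarrow> bar_tree P (ts ! j)"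
  by (cases x) auto

text \<open>Additivity and homogeneity of a multilinear functional are available only on proper bar
  trees, so boundaries have to be known to consist of such trees.\<close>

lemma keys_bar_boundary: "\<lbrakk>bar_tree P t; s \<in> keys (bar_boundary P t)\<rbrakk> \<Longrightarrow> bar_tree P s"
proof (induction t arbitrary: s)
  case (Node x ts)
  obtain w a where x: "x = (w, a)" by (cases x)
  obtain j where j0: "j \<in> {..<length ts}" and s0: "s \<in> keys (contract_child P x ts j + replace_child x ts j (bar_boundary P (ts ! j)))"
    using keys_sum_pscale[OF Node.prems(2)[unfolded bar_boundary.simps]] by (rule bexE)
  note j = j0[unfolded lessThan_iff] subsetD[OF Poly_Mapping.keys_add s0, unfolded Un_iff]
  from j(2) show ?case
  proof
    assume s: "s \<in> keys (contract_child P x ts j)"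
    show ?thesis
    proof (cases "ts ! j")
      case (Node y us)
      obtain w' c where y: "y = (w', c)" by (cases y)
      have "s = Node (w + w', circ P j a c) (take j ts @ us @ drop (Suc j) ts)"
        using s by (simp add: contract_child_def Node x y)
      then show ?thesis using bar_tree_contract[OF Node.prems(1)[unfolded x] j(1), of w' c us] Node y by simp
    qed (use s in \<open>simp add: contract_child_def\<close>)
  next
    assume "s \<in> keys (replace_child x ts j (bar_boundary P (ts ! j)))"
    then obtain t where "t \<in> keys (bar_boundary P (ts ! j))" "s = Node x (ts[j := t])"
      using keys_linear_extension[of "\<lambda>t. single (Node x (ts[j := t])) (1::'k)" "bar_boundary P (ts ! j)"]
      unfolding replace_child_def by auto
    then show ?thesis
      using Node.IH[of "ts ! j" t] j(1) Node.prems(1) bar_tree_nth[OF Node.prems(1) j(1)] bar_tree_update[of x ts t j]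
      by simp
  qed
qed simp

lemma multilinear_add:
  "\<lbrakk>multilinear P F; bar_tree P (Node (w, a) ts); bar_tree P (Node (w, b) ts)\<rbrakk> \<Longrightarrow>
    F (Node (w, a + b) ts) = F (Node (w, a) ts) + F (Node (w, b) ts)"
  using multi_add[of P w a ts b] unfolding multilinear_def by (force simp: algebra_simps)

lemma multilinear_smul:
  "\<lbrakk>multilinear P F; bar_tree P (Node (w, a) ts)\<rbrakk> \<Longrightarrow> F (Node (w, smul P c a) ts) = c * F (Node (w, a) ts)"
  using multi_smul[of P w a ts c] unfolding multilinear_def by force

lemma multilinear_child:
  "\<lbrakk>multilinear P F; bar_tree P (Node x ts); j < length ts\<rbrakk> \<Longrightarrow> multilinear P (\<lambda>t. F (Node x (ts[j := t])))"
  unfolding multilinear_def using multi_child[of _ P x ts j] functional_replace_child[of F x ts j] by metis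

lemma functional_boundary_Node:
  "functional F (bar_boundary P (Node x ts)) = (\<Sum>j<length ts. (-1) ^ (1 + (\<Sum>l<j. vertices (ts ! l))) *
    (functional F (contract_child P x ts j) + functional (\<lambda>t. F (Node x (ts[j := t]))) (bar_boundary P (ts ! j))))"
  unfolding bar_boundary.simps functional_simps functional_replace_child ..

lemma functional_contract_Node:
  "ts ! j = Node (w', c) us \<Longrightarrow> functional F (contract_child P (w, a) ts j)
    = F (Node (w + w', circ P j a c) (take j ts @ us @ drop (Suc j) ts))"
  by (simp add: contract_child_def)

lemma functional_contract_Leaf: "ts ! j = Leaf \<Longrightarrow> functional F (contract_child P x ts j) = 0"
  by (simp add: contract_child_def)

text \<open>Composition at the root is linear in the inserted label, so relations at the root of the
  child \<open>j\<close> become relations at the merged vertex; deeper relations become relations in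
  one of its children.\<close>

lemma multilinear_contract:
  assumes F: "multilinear P F" and r: "r \<in> multilinearity P" and x: "bar_tree P (Node x ts)" and j: "j < length ts"
  shows "functional (\<lambda>t. functional F (contract_child P x (ts[j := t]) j)) r = 0"
proof -
  obtain v m where xv: "x = (v, m)" by (cases x)
  let ?L = "\<lambda>us. take j ts @ us @ drop (Suc j) ts"
  let ?K = "\<lambda>t. functional F (contract_child P x (ts[j := t]) j)"
  have K: "?K (Node (w, c) us) = F (Node (v + w, circ P j m c) (?L us))" for w c us
    using functional_contract_Node[of "ts[j := Node (w, c) us]" j w c us F v m] j by (simp add: xv)
  have bt: "bar_tree P (Node (v + w, circ P j m c) (?L us))" if "bar_tree P (Node (w, c) us)" for w c us
    using bar_tree_contract[of v m "ts[j := Node (w, c) us]" j w c us] bar_tree_update[OF x that, of j] j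
    by (simp add: xv)
  have m: "m \<in> AP (length ts)" using x part_AP by (auto simp: xv)
  from r show ?thesis
  proof (cases rule: multilinearity.cases)
    case (multi_add w a us b)
    have ab: "a \<in> AP (length us)" "b \<in> AP (length us)" using multi_add part_AP by auto
    show ?thesis
      unfolding multi_add(1) functional_simps scalar.linear_extension_single K
        circ_add_right[OF m ab j] multilinear_add[OF F bt[OF multi_add(2)] bt[OF multi_add(3)]]
      by simp
  next
    case (multi_smul w a us c)
    have a: "a \<in> AP (length us)" using multi_smul part_AP by auto
    show ?thesis
      unfolding multi_smul(1) functional_simps scalar.linear_extension_single K
        circ_smul_right[OF m a j] multilinear_smul[OF F bt[OF multi_smul(2)]]
      by simp
  next
    case (multi_child r' y us i)
    obtain w c where y: "y = (w, c)" by (cases y)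
    have b: "bar_tree P (Node (v + w, circ P j m c) (?L us))" using bt multi_child(3) y by simp
    have "?L (us[i := t]) = (?L us)[j + i := t]" for t
      using multi_child(4) j by (simp add: list_update_append)
    then have "?K (Node y (us[i := t])) = F (Node (v + w, circ P j m c) ((?L us)[j + i := t]))" for t
      unfolding y K by simp
    moreover have "j + i < length (?L us)" using multi_child(4) j by simp
    ultimately show ?thesis
      using multilinear_child[OF F b] multi_child(2) unfolding multi_child(1) functional_replace_child multilinear_def
      by simp
  qed
qed

text \<open>The boundary descends to the quotient by \<open>multilinearity P\<close>, stated dually.
  For a relation inside the child \<open>i\<close>, operations at other children commute with it,
  while those at \<open>i\<close> are covered by \<open>multilinear_contract\<close> and the
  induction hypothesis.\<close>

lemma multilinear_boundary:
  "r \<in> multilinearity P \<Longrightarrow> multilinear P F \<Longrightarrow> functional (\<lambda>t. functional F (bar_boundary P t)) r = 0"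
proof (induction arbitrary: F rule: multilinearity.induct)
  case (multi_add w a ts b)
  have "functional F (bar_boundary P (Node (w, a + b) ts))
    = functional F (bar_boundary P (Node (w, a) ts)) + functional F (bar_boundary P (Node (w, b) ts))"
    unfolding functional_boundary_Node sum.distrib[symmetric]
  proof (intro sum.cong refl)
    fix j assume "j \<in> {..<length ts}"
    then have j: "j < length ts" by simp
    have ab: "a \<in> AP (length ts)" "b \<in> AP (length ts)" using multi_add part_AP by auto
    have 1: "functional F (contract_child P (w, a + b) ts j)
      = functional F (contract_child P (w, a) ts j) + functional F (contract_child P (w, b) ts j)"
    proof (cases "ts ! j")
      case (Node y us)
      obtain w' c where y: "y = (w', c)" by (cases y)
      have nd: "ts ! j = Node (w', c) us" using Node y by simp
      have "bar_tree P (Node (w', c) us)" using bar_tree_nth[OF multi_add(1) j] nd by simp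
      then have c: "c \<in> AP (length us)" using part_AP by auto
      show ?thesis
        unfolding functional_contract_Node[OF nd] circ_add_left[OF ab c j]
        by (rule multilinear_add[OF multi_add(3) bar_tree_contract[OF multi_add(1) j nd]
            bar_tree_contract[OF multi_add(2) j nd]])
    qed (simp add: functional_contract_Leaf)
    have "F (Node (w, a + b) (ts[j := t])) = F (Node (w, a) (ts[j := t])) + F (Node (w, b) (ts[j := t]))"
      if "t \<in> keys (bar_boundary P (ts ! j))" for t
      using multilinear_add[OF multi_add(3) bar_tree_update[OF multi_add(1)] bar_tree_update[OF multi_add(2)]]
        keys_bar_boundary[OF bar_tree_nth[OF multi_add(1) j] that] by blast
    then have 2: "functional (\<lambda>t. F (Node (w, a + b) (ts[j := t]))) (bar_boundary P (ts ! j))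
      = functional (\<lambda>t. F (Node (w, a) (ts[j := t])) + F (Node (w, b) (ts[j := t]))) (bar_boundary P (ts ! j))"
      by (intro scalar.linear_extension_cong)
    show "(-1) ^ (1 + (\<Sum>l<j. vertices (ts ! l))) * (functional F (contract_child P (w, a + b) ts j)
        + functional (\<lambda>t. F (Node (w, a + b) (ts[j := t]))) (bar_boundary P (ts ! j)))
      = (-1) ^ (1 + (\<Sum>l<j. vertices (ts ! l))) * (functional F (contract_child P (w, a) ts j)
        + functional (\<lambda>t. F (Node (w, a) (ts[j := t]))) (bar_boundary P (ts ! j)))
      + (-1) ^ (1 + (\<Sum>l<j. vertices (ts ! l))) * (functional F (contract_child P (w, b) ts j)
        + functional (\<lambda>t. F (Node (w, b) (ts[j := t]))) (bar_boundary P (ts ! j)))"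
      unfolding 1 2 scalar.linear_extension_fun_add by (simp only: distrib_left ac_simps)
  qed
  then show ?case by (simp only: functional_simps scalar.linear_extension_single) simp
next
  case (multi_smul w a ts c)
  have "functional F (bar_boundary P (Node (w, smul P c a) ts)) = c * functional F (bar_boundary P (Node (w, a) ts))"
    unfolding functional_boundary_Node sum_distrib_left
  proof (intro sum.cong refl)
    fix j assume "j \<in> {..<length ts}"
    then have j: "j < length ts" by simp
    have a: "a \<in> AP (length ts)" using multi_smul part_AP by auto
    have 1: "functional F (contract_child P (w, smul P c a) ts j) = c * functional F (contract_child P (w, a) ts j)"
    proof (cases "ts ! j")
      case (Node y us)
      obtain w' e where y: "y = (w', e)" by (cases y)
      have nd: "ts ! j = Node (w', e) us" using Node y by simp
      have "bar_tree P (Node (w', e) us)" using bar_tree_nth[OF multi_smul(1) j] nd by simp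
      then have e: "e \<in> AP (length us)" using part_AP by auto
      show ?thesis
        unfolding functional_contract_Node[OF nd] circ_smul_left[OF a e j]
        by (rule multilinear_smul[OF multi_smul(2) bar_tree_contract[OF multi_smul(1) j nd]])
    qed (simp add: functional_contract_Leaf)
    have "F (Node (w, smul P c a) (ts[j := t])) = c * F (Node (w, a) (ts[j := t]))"
      if "t \<in> keys (bar_boundary P (ts ! j))" for t
      using multilinear_smul[OF multi_smul(2) bar_tree_update[OF multi_smul(1)]]
        keys_bar_boundary[OF bar_tree_nth[OF multi_smul(1) j] that] by blast
    then have 2: "functional (\<lambda>t. F (Node (w, smul P c a) (ts[j := t]))) (bar_boundary P (ts ! j))
      = functional (\<lambda>t. c * F (Node (w, a) (ts[j := t]))) (bar_boundary P (ts ! j))"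
      by (intro scalar.linear_extension_cong)
    show "(-1) ^ (1 + (\<Sum>l<j. vertices (ts ! l))) * (functional F (contract_child P (w, smul P c a) ts j)
        + functional (\<lambda>t. F (Node (w, smul P c a) (ts[j := t]))) (bar_boundary P (ts ! j)))
      = c * ((-1) ^ (1 + (\<Sum>l<j. vertices (ts ! l))) * (functional F (contract_child P (w, a) ts j)
        + functional (\<lambda>t. F (Node (w, a) (ts[j := t]))) (bar_boundary P (ts ! j))))"
      unfolding 1 2 scalar.linear_extension_fun_scale by (simp only: distrib_left ac_simps)
  qed
  then show ?case by (simp only: functional_simps scalar.linear_extension_single) simp
next
  case (multi_child r x ts i)
  obtain n where n: "\<And>t. t \<in> keys r \<Longrightarrow> vertices t = n" using multilinearity_vertices[OF multi_child(1)] by blast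
  have rF: "functional (\<lambda>t. F (Node y (us[k := t]))) r = 0" if "bar_tree P (Node y us)" "k < length us" for y us k
    using multilinear_child[OF multi_child(5) that] multi_child(1) by (simp add: multilinear_def)
  let ?C = "\<lambda>l t. functional F (contract_child P x (ts[i := t]) l)"
  let ?R = "\<lambda>l t. functional (\<lambda>t'. F (Node x (ts[i := t, l := t']))) (bar_boundary P (ts[i := t] ! l))"
  have C: "functional (?C l) r = 0" if l: "l < length ts" for l
  proof (cases "l = i")
    case True
    then show ?thesis using multilinear_contract[OF multi_child(5,1,2,3)] by simp
  next
    case False
    show ?thesis
    proof (cases "ts ! l")
      case Leaf
      then show ?thesis using False by (intro functional_vanish functional_contract_Leaf) simp
    next
      case (Node y us)
      obtain v m w c where xy: "x = (v, m)" "y = (w, c)" by (cases x, cases y)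
      let ?L = "take l ts @ us @ drop (Suc l) ts"
      \<comment> \<open>The position of the old child \<open>i\<close> after the contraction, where
        the children of \<open>ts ! l\<close> have taken the place of \<open>ts ! l\<close>.\<close>
      let ?k = "if i < l then i else l + length us + (i - Suc l)"
      have upd: "take l (ts[i := t]) @ us @ drop (Suc l) (ts[i := t]) = ?L[?k := t]" for t
      proof (cases "i < l")
        case True
        then show ?thesis using l by (simp add: take_update_swap list_update_append)
      next
        case False
        then obtain m where "i = Suc (l + m)" using \<open>l \<noteq> i\<close> less_imp_Suc_add[of l i] by auto
        then show ?thesis using l by (simp add: drop_update_swap list_update_append)
      qed
      have "?C l t = F (Node (v + w, circ P l m c) (?L[?k := t]))" for t
        using functional_contract_Node[of "ts[i := t]" l w c us F v m] Node False xy upd[of t] by simp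
      moreover have "bar_tree P (Node (v + w, circ P l m c) ?L)"
        using bar_tree_contract[of v m ts l w c us] multi_child(2) l Node xy by simp
      moreover have "?k < length ?L" using l multi_child(3) False by auto
      ultimately show ?thesis using rF by simp
    qed
  qed
  have R: "functional (?R l) r = 0" if l: "l < length ts" for l
  proof (cases "l = i")
    case True
    then show ?thesis
      using multi_child.IH[OF multilinear_child[OF multi_child(5,2,3)]] multi_child(3) by simp
  next
    case False
    have "functional (?R l) r = functional (\<lambda>t'. functional (\<lambda>t. F (Node x (ts[l := t', i := t]))) r) (bar_boundary P (ts ! l))"
      using False by (simp add: functional_swap[of _ "bar_boundary P (ts ! l)"] list_update_swap)
    also have "\<dots> = 0"
    proof (rule functional_vanish)
      fix t' assume "t' \<in> keys (bar_boundary P (ts ! l))"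
      then have "bar_tree P t'" using keys_bar_boundary[OF bar_tree_nth[OF multi_child(2) l]] by blast
      then show "functional (\<lambda>t. F (Node x (ts[l := t', i := t]))) r = 0"
        using rF[OF bar_tree_update[OF multi_child(2)], of t' i l] multi_child(3) by simp
    qed
    finally show ?thesis .
  qed
  have "functional (\<lambda>t. functional F (bar_boundary P (Node x (ts[i := t])))) r
    = functional (\<lambda>t. \<Sum>l<length ts. (-1) ^ (1 + (\<Sum>k<l. if k = i then n else vertices (ts ! k))) * (?C l t + ?R l t)) r"
  proof (rule scalar.linear_extension_cong)
    fix t assume t: "t \<in> keys r"
    have "(\<Sum>k<l. vertices (ts[i := t] ! k)) = (\<Sum>k<l. if k = i then n else vertices (ts ! k))" if "l < length ts" for l
      using that n[OF t] multi_child(3) by (intro sum.cong) auto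
    then show "functional F (bar_boundary P (Node x (ts[i := t])))
      = (\<Sum>l<length ts. (-1) ^ (1 + (\<Sum>k<l. if k = i then n else vertices (ts ! k))) * (?C l t + ?R l t))"
      unfolding functional_boundary_Node length_list_update by (intro sum.cong) simp_all
  qed
  also have "\<dots> = 0"
    unfolding functional_fun_sum scalar.linear_extension_fun_scale scalar.linear_extension_fun_add
    by (intro sum.neutral) (simp add: C R)
  finally show ?case unfolding functional_replace_child .
qed

end

subsection \<open>A contracting homotopy\<close>

text \<open>
  The bar complex of \<open>P_op\<close> has a basis of trees labelled by the monomials of \<open>labelsP\<close>. In a tree of large
  weight some input of a vertex carries, together with the chain of unary vertices above it, at least two
  letters; the homotopy splits off one letter of the first such input as a separate unary vertex.
\<close>

fun itree :: "nat list tree \<Rightarrow> bool" where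
  "itree Leaf \<longleftrightarrow> True"
| "itree (Node v us) \<longleftrightarrow> v \<in> labelsP \<and> sum_list v > 0 \<and> length v = length us \<and> (\<forall>u\<in>set us. itree u)"

fun iweight :: "nat list tree \<Rightarrow> nat" where
  "iweight Leaf = 0"
| "iweight (Node v us) = sum_list v + sum_list (map iweight us)"

text \<open>Counts the letters in the chain of unary vertices at the root. Unlike the root label,
  this number is unchanged when vertices of the chain are merged.\<close>

fun ilen :: "nat list tree \<Rightarrow> nat" where
  "ilen (Node [n] [s]) = n + ilen s"
| "ilen _ = 0"

definition root_sign :: "'x tree list \<Rightarrow> nat \<Rightarrow> 'k::field" where
  "root_sign us j = (-1) ^ (1 + (\<Sum>l<j. vertices (us ! l)))"

lemma root_sign_0 [simp]: "root_sign us 0 = -1"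
  by (simp add: root_sign_def)

text \<open>Only a unary vertex can be merged into its parent: inserting a quaternary monomial into
  anything but the unit gives zero, and positive weight excludes the unit as a label.\<close>

definition icontract :: "nat list \<Rightarrow> nat list tree list \<Rightarrow> nat \<Rightarrow> (nat list tree \<Rightarrow>\<^sub>0 'k::field)" where
  "icontract v us j = (case us ! j of
     Node [n] [s] \<Rightarrow> if v[j := v ! j + n] \<in> labelsP then single (Node (v[j := v ! j + n]) (us[j := s])) 1 else 0
   | _ \<Rightarrow> 0)"

fun iboundary :: "nat list tree \<Rightarrow> (nat list tree \<Rightarrow>\<^sub>0 'k::field)" where
  "iboundary Leaf = 0"
| "iboundary (Node v us) = (\<Sum>j<length us. pscale (root_sign us j)
    (icontract v us j + replace_child v us j (iboundary (us ! j))))"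

fun splits :: "nat list tree \<Rightarrow> bool" where
  "splits Leaf = False"
| "splits (Node v us) = (\<exists>j\<in>{..<length us}. v ! j + ilen (us ! j) \<ge> 2 \<or> splits (us ! j))"

definition splits_at :: "nat list \<Rightarrow> nat list tree list \<Rightarrow> nat \<Rightarrow> bool" where
  "splits_at v us j \<longleftrightarrow> v ! j + ilen (us ! j) \<ge> 2 \<or> splits (us ! j)"

definition first_split :: "nat list \<Rightarrow> nat list tree list \<Rightarrow> nat \<Rightarrow> bool" where
  "first_split v us j \<longleftrightarrow> splits_at v us j \<and> (\<forall>l<j. \<not> splits_at v us l)"

text \<open>If the first suitable input already has one letter separated above it, the value is 0:
  such trees are the ones produced by splitting. A suitable input inside the child takes precedence
  over splitting at the root.\<close>

fun homotopy :: "nat list tree \<Rightarrow> (nat list tree \<Rightarrow>\<^sub>0 'k::field)" where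
  "homotopy Leaf = 0"
| "homotopy (Node v us) = (\<Sum>j<length us. if first_split v us j then pscale (root_sign us j)
     (if splits (us ! j) then replace_child v us j (homotopy (us ! j))
      else if ilen (us ! j) = 0 then single (Node (v[j := v ! j - 1]) (us[j := Node [1] [us ! j]])) 1 else 0) else 0)"

declare iboundary.simps(2) [simp del] homotopy.simps(2) [simp del] splits.simps(2) [simp del]

lemma first_split_unique: "first_split v us j \<Longrightarrow> first_split v us l \<longleftrightarrow> l = j"
  unfolding first_split_def by (metis linorder_neqE_nat)

lemma splits_first: "splits (Node v us) \<longleftrightarrow> (\<exists>j<length us. first_split v us j)"
proof
  assume "splits (Node v us)"
  then have ex: "\<exists>j. j < length us \<and> splits_at v us j" by (auto simp: splits_at_def splits.simps(2))
  define j where "j = (LEAST j. j < length us \<and> splits_at v us j)"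
  have "j < length us \<and> splits_at v us j" unfolding j_def by (rule LeastI_ex[OF ex])
  moreover have "\<not> splits_at v us l" if "l < j" for l
    using not_less_Least[OF that[unfolded j_def]] that calculation by auto
  ultimately show "\<exists>j<length us. first_split v us j" unfolding first_split_def by blast
qed (auto simp: first_split_def splits_at_def splits.simps(2))

lemma homotopy_first:
  assumes "first_split v us j" "j < length us"
  shows "homotopy (Node v us) = pscale (root_sign us j)
     (if splits (us ! j) then replace_child v us j (homotopy (us ! j))
      else if ilen (us ! j) = 0 then single (Node (v[j := v ! j - 1]) (us[j := Node [1] [us ! j]])) 1 else 0)"
  unfolding homotopy.simps(2) using assms(2) by (simp add: first_split_unique[OF assms(1)])

lemma ilen_neq_0: "ilen u \<noteq> 0 \<Longrightarrow> \<exists>n s. u = Node [n] [s]"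
  by (cases u rule: ilen.cases) simp_all

lemma icontract_unary: "us ! j = Node [n] [s] \<Longrightarrow> icontract v us j =
    (if v[j := v ! j + n] \<in> labelsP then single (Node (v[j := v ! j + n]) (us[j := s])) 1 else 0)"
  by (simp add: icontract_def)

lemma icontract_other: "(\<And>n s. us ! j \<noteq> Node [n] [s]) \<Longrightarrow> icontract v us j = 0"
proof -
  assume "\<And>n s. us ! j \<noteq> Node [n] [s]"
  then have "\<not> (\<exists>n s. us ! j = Node [n] [s])" by blast
  then show ?thesis unfolding icontract_def by (auto split: tree.splits list.splits)
qed

text \<open>Membership depends only on which entries are zero. Hence splitting one letter off an
  entry of at least 2, or merging it back, never leaves \<open>labelsP\<close>.\<close>

lemma labelsP_pattern:
  assumes "v \<in> labelsP" "length v' = length v" "\<And>l. l < length v \<Longrightarrow> v' ! l = 0 \<longleftrightarrow> v ! l = 0"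
  shows "v' \<in> labelsP"
proof (cases "length v = 1")
  case False
  then have "length v = 4" using assms(1) by (auto simp: labelsP_def)
  have p: "v' ! 0 = 0 \<longleftrightarrow> v ! 0 = 0" "v' ! 1 = 0 \<longleftrightarrow> v ! 1 = 0" "v' ! 2 = 0 \<longleftrightarrow> v ! 2 = 0"
    using \<open>length v = 4\<close> by (intro assms(3); simp)+
  have a: "v ! 0 = 0 \<or> v ! 1 = 0" "v ! 1 \<noteq> 0 \<or> v ! 2 \<noteq> 0"
    using assms(1) \<open>length v = 4\<close> by (auto simp: labelsP_def)
  have "v' ! 0 = 0 \<or> v' ! 1 = 0" "v' ! 1 \<noteq> 0 \<or> v' ! 2 \<noteq> 0" using a unfolding p by blast+
  moreover have "length v' = 4" using assms(2) \<open>length v = 4\<close> by simp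
  ultimately show ?thesis unfolding labelsP_def by simp
qed (use assms in \<open>simp add: labelsP_def\<close>)

lemma labelsP_update:
  assumes "0 < v ! j" "0 < x" "v \<in> labelsP"
  shows "v[j := x] \<in> labelsP"
proof (rule labelsP_pattern[OF assms(3)])
  fix l assume "l < length v"
  then show "v[j := x] ! l = 0 \<longleftrightarrow> v ! l = 0" using assms(1,2) by (cases "l = j") simp_all
qed simp

lemma itree_update: "\<lbrakk>itree (Node v us); itree t\<rbrakk> \<Longrightarrow> itree (Node v (us[j := t]))"
  using set_update_subset_insert[of us j t] by auto

lemma itree_nth: "\<lbrakk>itree (Node v us); j < length us\<rbrakk> \<Longrightarrow> itree (us ! j)"
  by auto

lemma sum_list_update_add:
  fixes xs :: "nat list"
  shows "j < length xs \<Longrightarrow> sum_list (xs[j := y]) + xs ! j = sum_list xs + y"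
  by (induction xs arbitrary: j) (auto split: nat.split simp: less_Suc_eq_0_disj)

lemma vertices_update: "j < length us \<Longrightarrow> vertices (Node v (us[j := t])) + vertices (us ! j) = vertices (Node w us) + vertices t"
  using sum_list_update_add[of j "map vertices us" "vertices t"] by (simp add: map_update)

lemma iweight_update: "j < length us \<Longrightarrow> iweight (Node v (us[j := t])) + iweight (us ! j) + sum_list w = iweight (Node w us) + iweight t + sum_list v"
  using sum_list_update_add[of j "map iweight us" "iweight t"] by (simp add: map_update)

lemma ilen_eq_0: "\<not> (length v = 1 \<and> length us = 1) \<Longrightarrow> ilen (Node v us) = 0"
  using ilen_neq_0[of "Node v us"] by fastforce

lemma ilen_Node_update:
  assumes "ilen t = ilen (us ! j)" shows "ilen (Node v (us[j := t])) = ilen (Node v us)"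
proof (cases "length v = 1 \<and> length us = 1")
  case True
  then obtain n s where "v = [n]" "us = [s]" by (auto simp: length_Suc_conv)
  then show ?thesis using assms by (cases j) auto
next
  case False
  then show ?thesis using ilen_eq_0[of v us] ilen_eq_0[of v "us[j := t]"] by simp
qed

lemma keys_iboundary:
  assumes "s \<in> keys (iboundary (Node v us) :: _ \<Rightarrow>\<^sub>0 'k::field)"
  obtains j n t where "j < length us" "us ! j = Node [n] [t]" "v[j := v ! j + n] \<in> labelsP"
      "s = Node (v[j := v ! j + n]) (us[j := t])"
    | j t where "j < length us" "t \<in> keys (iboundary (us ! j) :: _ \<Rightarrow>\<^sub>0 'k)" "s = Node v (us[j := t])"
proof -
  obtain j where j0: "j \<in> {..<length us}" and s0: "s \<in> keys (icontract v us j + replace_child v us j (iboundary (us ! j)) :: _ \<Rightarrow>\<^sub>0 'k)"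
    using keys_sum_pscale[OF assms[unfolded iboundary.simps]] by (rule bexE)
  note j = j0[unfolded lessThan_iff] subsetD[OF Poly_Mapping.keys_add s0, unfolded Un_iff]
  from j(2) show ?thesis
  proof
    assume s: "s \<in> keys (icontract v us j :: _ \<Rightarrow>\<^sub>0 'k)"
    then obtain n t where nt: "us ! j = Node [n] [t]" using icontract_other[of us j v] by (metis keys_zero empty_iff)
    then show ?thesis using s that(1)[OF j(1) nt] unfolding icontract_unary[OF nt] by (simp split: if_splits)
  next
    assume "s \<in> keys (replace_child v us j (iboundary (us ! j) :: _ \<Rightarrow>\<^sub>0 'k))"
    then obtain t where "t \<in> keys (iboundary (us ! j) :: _ \<Rightarrow>\<^sub>0 'k)" "s = Node v (us[j := t])"
      using keys_linear_extension[of "\<lambda>t. single (Node v (us[j := t])) (1::'k)" "iboundary (us ! j)"]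
      unfolding replace_child_def by auto
    then show ?thesis using that(2)[OF j(1)] by blast
  qed
qed

lemma splits_at_contract:
  assumes "us ! j = Node [n] [t]" "j < length us" "length v = length us"
  shows "splits_at (v[j := v ! j + n]) (us[j := t]) l \<longleftrightarrow> splits_at v us l"
  using assms by (cases "l = j") (auto simp: splits_at_def splits.simps(2))

lemma splits_at_replace:
  assumes "ilen t = ilen (us ! j)" "splits t = splits (us ! j)"
  shows "splits_at v (us[j := t]) l \<longleftrightarrow> splits_at v us l"
proof (cases "j < length us")
  case True
  then show ?thesis using assms by (cases "l = j") (simp_all add: splits_at_def)
qed (simp add: list_update_beyond)

lemma splits_splits_at: "splits (Node v us) \<longleftrightarrow> (\<exists>j<length us. splits_at v us j)"
  by (auto simp add: splits_at_def splits.simps(2))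

text \<open>A contraction moves letters between a vertex and the chain above it but keeps their
  total on each input. Hence \<open>splits\<close> and \<open>first_split\<close> select the same
  input before and after taking the boundary.\<close>

lemma iboundary_invariants:
  assumes "itree u" "s \<in> keys (iboundary u :: _ \<Rightarrow>\<^sub>0 'k::field)"
  shows "itree s \<and> vertices u = vertices s + 1 \<and> ilen s = ilen u \<and> splits s = splits u"
  using assms
proof (induction u arbitrary: s)
  case (Node v us)
  have len: "length v = length us" using Node.prems(1) by simp
  from Node.prems(2) show ?case
  proof (cases rule: keys_iboundary)
    case (1 j n t)
    have jt: "itree (Node [n] [t])" using itree_nth[OF Node.prems(1) 1(1)] 1(2) by simp
    have "itree s"
    proof -
      have "itree (Node v (us[j := t]))" by (rule itree_update[OF Node.prems(1)]) (use jt in simp)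
      moreover have "sum_list (v[j := v ! j + n]) > 0"
        using sum_list_update_add[of j v "v ! j + n"] 1(1) len jt by simp
      ultimately show ?thesis using 1 len by simp
    qed
    moreover have "vertices (Node v us) = vertices s + 1"
      using vertices_update[OF 1(1), of "v[j := v ! j + n]" t v] 1(2,4) by simp
    moreover have "ilen s = ilen (Node v us)"
    proof (cases "length v = 1 \<and> length us = 1")
      case True
      then obtain m r where "v = [m]" "us = [r]" by (auto simp: length_Suc_conv)
      then show ?thesis using 1 by auto
    next
      case False
      then show ?thesis using ilen_eq_0[of v us] ilen_eq_0[of "v[j := v ! j + n]" "us[j := t]"] 1(4) by simp
    qed
    moreover have "splits s = splits (Node v us)"
      unfolding 1(4) splits_splits_at by (simp add: splits_at_contract[OF 1(2,1) len])
    ultimately show ?thesis by blast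
  next
    case (2 j t)
    have IH: "itree t" "vertices (us ! j) = vertices t + 1" "ilen t = ilen (us ! j)" "splits t = splits (us ! j)"
      using Node.IH[OF nth_mem[OF 2(1)] itree_nth[OF Node.prems(1) 2(1)] 2(2)] by blast+
    have "vertices (Node v us) = vertices s + 1"
      using vertices_update[OF 2(1), of v t v] IH(2) unfolding 2(3) by simp
    moreover have "splits s = splits (Node v us)"
      unfolding 2(3) splits_splits_at by (simp add: splits_at_replace[OF IH(3,4)])
    ultimately show ?thesis
      using itree_update[OF Node.prems(1) IH(1)] ilen_Node_update[of t us j v, OF IH(3)] unfolding 2(3) by blast
  qed
qed simp

lemma keys_replace_child: "s \<in> keys (replace_child v us j r) \<Longrightarrow> \<exists>t\<in>keys r. s = Node v (us[j := t])"
  using keys_linear_extension[of "\<lambda>t. single (Node v (us[j := t])) 1" r] unfolding replace_child_def by auto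

lemma homotopy_invariants:
  assumes "itree u" "s \<in> keys (homotopy u :: _ \<Rightarrow>\<^sub>0 'k::field)"
  shows "itree s \<and> vertices s = vertices u + 1 \<and> iweight s = iweight u"
  using assms
proof (induction u arbitrary: s)
  case (Node v us)
  have len: "length v = length us" using Node.prems(1) by simp
  have "splits (Node v us)"
  proof (rule ccontr)
    assume "\<not> splits (Node v us)"
    then have "homotopy (Node v us) = (0 :: _ \<Rightarrow>\<^sub>0 'k)" unfolding splits_first homotopy.simps by (intro sum.neutral) auto
    then show False using Node.prems(2) by simp
  qed
  then obtain j where j: "j < length us" "first_split v us j" unfolding splits_first by blast
  show ?case
  proof (cases "splits (us ! j)")
    case True
    have "s \<in> keys (pscale (root_sign us j) (replace_child v us j (homotopy (us ! j) :: _ \<Rightarrow>\<^sub>0 'k)))"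
      using Node.prems(2) unfolding homotopy_first[OF j(2,1)] by (simp only: True if_True)
    then have "s \<in> keys (replace_child v us j (homotopy (us ! j) :: _ \<Rightarrow>\<^sub>0 'k))" by (rule subsetD[OF keys_pscale])
    then have "\<exists>t\<in>keys (homotopy (us ! j) :: _ \<Rightarrow>\<^sub>0 'k). s = Node v (us[j := t])" by (rule keys_replace_child)
    then obtain t where t: "t \<in> keys (homotopy (us ! j) :: _ \<Rightarrow>\<^sub>0 'k)" "s = Node v (us[j := t])" by (rule bexE)
    have IH: "itree t" "vertices t = vertices (us ! j) + 1" "iweight t = iweight (us ! j)"
      using Node.IH[OF nth_mem[OF j(1)] itree_nth[OF Node.prems(1) j(1)] t(1)] by blast+
    have "itree s" unfolding t(2) by (rule itree_update[OF Node.prems(1) IH(1)])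
    moreover have "vertices s = vertices (Node v us) + 1"
      unfolding t(2) using vertices_update[OF j(1), of v t v] IH(2) by linarith
    moreover have "iweight s = iweight (Node v us)"
      unfolding t(2) using iweight_update[OF j(1), of v t v] IH(3) by linarith
    ultimately show ?thesis by blast
  next
    case False
    let ?v = "v[j := v ! j - 1]" and ?t = "Node [1] [us ! j]"
    have "s \<in> keys (pscale (root_sign us j) (if ilen (us ! j) = 0 then single (Node ?v (us[j := ?t])) (1 :: 'k) else 0))"
      using Node.prems(2) unfolding homotopy_first[OF j(2,1)] by (simp only: False if_False)
    then have "s \<in> keys (if ilen (us ! j) = 0 then single (Node ?v (us[j := ?t])) (1 :: 'k) else 0)"
      by (rule subsetD[OF keys_pscale])
    then have "ilen (us ! j) = 0 \<and> s = Node ?v (us[j := ?t])" by (cases "ilen (us ! j) = 0") simp_all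
    then have l0: "ilen (us ! j) = 0" and s: "s = Node ?v (us[j := ?t])" by blast+
    have v2: "v ! j \<ge> 2" using j(2) False l0 by (simp add: first_split_def splits_at_def)
    have lab: "?v \<in> labelsP"
      by (rule labelsP_update) (use Node.prems(1) v2 in simp_all)
    have sm: "sum_list ?v + 1 = sum_list v"
      using sum_list_update_add[of j v "v ! j - 1"] j(1) len v2 by linarith
    have "v ! j \<in> set v" using j(1) len by (intro nth_mem) simp
    then have "sum_list v \<ge> 2" using member_le_sum_list[of "v ! j" v] v2 by simp
    then have pos: "sum_list ?v > 0" using sm by linarith
    have it: "itree ?t" using itree_nth[OF Node.prems(1) j(1)] by (simp add: labelsP_def)
    have "\<forall>u\<in>set (us[j := ?t]). itree u" using itree_update[OF Node.prems(1) it] unfolding itree.simps by blast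
    then have "itree s" unfolding s itree.simps length_list_update using lab pos len by blast
    moreover have "vertices s = vertices (Node v us) + 1"
    proof -
      have "vertices ?t = vertices (us ! j) + 1" by simp
      then show ?thesis unfolding s using vertices_update[OF j(1), of ?v ?t v] by linarith
    qed
    moreover have "iweight s = iweight (Node v us)"
    proof -
      have "iweight ?t = iweight (us ! j) + 1" by simp
      then show ?thesis unfolding s using iweight_update[OF j(1), of ?v ?t v] sm by linarith
    qed
    ultimately show ?thesis by blast
  qed
qed simp

text \<open>If no input carries two letters, every entry is at most 1, and a vertex has at most four
  inputs; so each vertex contributes at most 4 to the weight.\<close>

lemma not_splits_weight: "\<lbrakk>itree u; \<not> splits u\<rbrakk> \<Longrightarrow> iweight u \<le> 4 * vertices u"
proof (induction u)
  case (Node v us)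
  have ns: "v ! j \<le> 1" "\<not> splits (us ! j)" if "j < length us" for j
  proof -
    have "\<not> splits_at v us j" using Node.prems(2) that unfolding splits_splits_at by blast
    then show "v ! j \<le> 1" "\<not> splits (us ! j)" by (simp_all add: splits_at_def)
  qed
  have "sum_list v \<le> sum_list (map (\<lambda>_. 1) v)"
    using sum_list_mono[of v "\<lambda>x. x" "\<lambda>_. 1"] ns(1) Node.prems(1) by (auto simp: in_set_conv_nth)
  moreover have "length v \<le> 4" using Node.prems(1) by (auto simp: labelsP_def)
  moreover have "sum_list (map iweight us) \<le> sum_list (map (\<lambda>u. 4 * vertices u) us)"
    by (rule sum_list_mono) (use Node ns(2) in \<open>auto simp: in_set_conv_nth\<close>)
  moreover have "sum_list (map (\<lambda>u. 4 * vertices u) us) = 4 * sum_list (map vertices us)"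
    by (simp add: sum_list_const_mult)
  moreover have "sum_list (map (\<lambda>_. 1) v) = length v" by (induction v) simp_all
  ultimately show ?case by simp
qed simp

section \<open>The homotopy formula on trees that split\<close>

lemma functional_iboundary_Node:
  "functional g (iboundary (Node v us)) = (\<Sum>l<length us. root_sign us l *
    (functional g (icontract v us l) + functional (\<lambda>t. g (Node v (us[l := t]))) (iboundary (us ! l))))"
  unfolding iboundary.simps functional_simps functional_replace_child ..

lemma root_sign_square [simp]: "root_sign us j * root_sign us j = (1 :: 'k::field)"
  unfolding root_sign_def by (simp flip: power_add mult_2)

lemma root_sign_update:
  assumes "j < length us"
  shows "root_sign (us[j := t]) l = (root_sign us l * (if j < l then (-1) ^ (vertices t + vertices (us ! j)) else 1) :: 'k::field)"
proof (cases "j < l")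
  case True
  have split: "(\<Sum>i<l. vertices (xs ! i)) = vertices (xs ! j) + (\<Sum>i\<in>{..<l} - {j}. vertices (xs ! i))" for xs :: "'a tree list"
    using True by (intro sum.remove) auto
  have "(\<Sum>i\<in>{..<l} - {j}. vertices (us[j := t] ! i)) = (\<Sum>i\<in>{..<l} - {j}. vertices (us ! i))"
    by (intro sum.cong) auto
  then have "(\<Sum>i<l. vertices (us[j := t] ! i)) + 2 * vertices (us ! j) = (\<Sum>i<l. vertices (us ! i)) + (vertices t + vertices (us ! j))"
    using split[of us] split[of "us[j := t]"] assms by simp
  then have "(-1 :: 'k) ^ ((\<Sum>i<l. vertices (us[j := t] ! i)) + 2 * vertices (us ! j))
    = (-1) ^ ((\<Sum>i<l. vertices (us ! i)) + (vertices t + vertices (us ! j)))"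
    by (rule arg_cong[where f = "\<lambda>n. (-1) ^ n"])
  then show ?thesis using True by (simp add: root_sign_def power_add power_mult)
next
  case False
  have "(\<Sum>i<l. vertices (us[j := t] ! i)) = (\<Sum>i<l. vertices (us ! i))" using False by (intro sum.cong) auto
  then show ?thesis using False by (simp add: root_sign_def)
qed

lemma first_split_cong:
  "(\<And>l. splits_at v us l \<longleftrightarrow> splits_at v' us' l) \<Longrightarrow> first_split v us j \<longleftrightarrow> first_split v' us' j"
  by (simp add: first_split_def)

lemma functional_homotopy_nested:
  assumes "first_split v us j" "j < length us" "splits (us ! j)"
  shows "functional g (homotopy (Node v us)) = root_sign us j * functional (\<lambda>t. g (Node v (us[j := t]))) (homotopy (us ! j))"
  using assms by (simp only: homotopy_first if_True functional_simps functional_replace_child)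

lemma functional_homotopy_split:
  assumes "first_split v us j" "j < length us" "\<not> splits (us ! j)" "ilen (us ! j) = 0"
  shows "functional g (homotopy (Node v us)) = root_sign us j * g (Node (v[j := v ! j - 1]) (us[j := Node [1] [us ! j]]))"
  using assms by (simp only: homotopy_first if_True if_False functional_simps scalar.linear_extension_single) simp

lemma homotopy_target:
  assumes "first_split v us j" "j < length us" "\<not> splits (us ! j)" "ilen (us ! j) \<noteq> 0"
  shows "homotopy (Node v us) = 0"
  using assms by (simp only: homotopy_first if_False) simp

lemma regroup_sums:
  fixes p :: "'a::ab_group_add"
  assumes "p + q = 0" "r + t = c" shows "(p + r) + (q + t) = c"
proof -
  have "(p + r) + (q + t) = (p + q) + (r + t)" by (simp only: add.assoc add.left_commute[of r q t])
  then show ?thesis using assms by simp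
qed

text \<open>The homotopy at \<open>j\<close> adds a vertex and flips the signs at later children;
  the boundary at \<open>l\<close> removes a vertex and flips the signs at later children. For
  \<open>l \<noteq> j\<close> exactly one of the two flips occurs, so the mixed terms
  cancel.\<close>

lemma opposite_signs_cancel:
  fixes s r X Y :: "'k::field" and l j :: nat
  assumes "l \<noteq> j"
  shows "s * (if j < l then - r else r) * (X + Y)
    + r * ((if l < j then - 1 else 1) * s * X + (if l < j then - 1 else 1) * s * Y) = 0"
proof (cases "l < j")
  case True
  then have nl: "\<not> j < l" by simp
  show ?thesis unfolding if_P[OF True] if_not_P[OF nl] by algebra
next
  case False
  then have jl: "j < l" using assms by simp
  show ?thesis unfolding if_P[OF jl] if_not_P[OF False] by algebra
qed

text \<open>The identity that boundary and homotopy together give the identity on trees that split,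
  tested against an arbitrary \<open>g\<close>. With \<open>j\<close> the first suitable input of
  the root, all terms at other children cancel in pairs, and the terms at \<open>j\<close> leave
  \<open>g u\<close>.\<close>

lemma homotopy_formula:
  fixes g :: "nat list tree \<Rightarrow> 'k::field"
  assumes "itree u" "splits u"
  shows "functional (\<lambda>s. functional g (iboundary s)) (homotopy u)
    + functional (\<lambda>s. functional g (homotopy s)) (iboundary u) = g u"
  using assms
proof (induction u arbitrary: g)
  case (Node v us)
  obtain j where j: "j < length us" "first_split v us j" using Node.prems(2) unfolding splits_first by blast
  have len: "length v = length us" using Node.prems(1) by simp
  let ?n = "length us"
  define B where "B l = root_sign us l * (functional (\<lambda>s. functional g (homotopy s)) (icontract v us l)
    + functional (\<lambda>t. functional g (homotopy (Node v (us[l := t])))) (iboundary (us ! l)))" for l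
  have hd: "functional (\<lambda>s. functional g (homotopy s)) (iboundary (Node v us)) = (\<Sum>l<?n. B l)"
    unfolding B_def by (rule functional_iboundary_Node)
  have contr: "first_split (v[l := v ! l + n]) (us[l := t]) j" if "us ! l = Node [n] [t]" "l < ?n" for l n t
    using j(2) first_split_cong[OF splits_at_contract[OF that len]] by blast
  have repl: "first_split v (us[l := t]) j" "vertices (us ! l) = vertices t + 1" "ilen t = ilen (us ! l)" "splits t = splits (us ! l)"
    if "t \<in> keys (iboundary (us ! l) :: _ \<Rightarrow>\<^sub>0 'k)" "l < ?n" for l t
  proof -
    have inv: "itree t \<and> vertices (us ! l) = vertices t + 1 \<and> ilen t = ilen (us ! l) \<and> splits t = splits (us ! l)"
      by (rule iboundary_invariants[OF itree_nth[OF Node.prems(1) that(2)] that(1)])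
    then show "vertices (us ! l) = vertices t + 1" "ilen t = ilen (us ! l)" "splits t = splits (us ! l)" by blast+
    have "splits_at v (us[l := t]) i \<longleftrightarrow> splits_at v us i" for i using inv by (intro splits_at_replace) blast+
    then show "first_split v (us[l := t]) j" using j(2) first_split_cong by blast
  qed
  define \<epsilon> :: "nat \<Rightarrow> 'k" where "\<epsilon> l = (if l < j then - 1 else 1)" for l
  have sign_c: "root_sign (us[l := t]) j = \<epsilon> l * root_sign us j"
    if "vertices (us ! l) = vertices t + 1" "l < ?n" for l t
    unfolding root_sign_update[OF that(2)] that(1) \<epsilon>_def by (simp add: power_add flip: mult_2)
  have sign_h: "root_sign (us[j := t]) l = (if j < l then - root_sign us l else root_sign us l :: 'k)"
    if "vertices t = vertices (us ! j) + 1" for l t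
    unfolding root_sign_update[OF j(1)] that by (simp add: power_add flip: mult_2)
  have sg: "root_sign (us[j := t]) j = (root_sign us j :: 'k)" for t by (simp add: root_sign_update[OF j(1)])
  have sq: "root_sign us j * (root_sign us j * c) = (c :: 'k)" for c
    by (simp only: mult.assoc[symmetric] root_sign_square mult_1_left)
  show ?case
  proof (cases "splits (us ! j)")
    case nested: True
    \<comment> \<open>The split happens inside the child \<open>j\<close>. The induction hypothesis
      for that child, with \<open>g\<close> applied to the tree around it, supplies the term at
      \<open>j\<close>.\<close>
    define H where "H = (homotopy (us ! j) :: _ \<Rightarrow>\<^sub>0 'k)"
    have vH: "vertices t = vertices (us ! j) + 1" if "t \<in> keys H" for t
      using homotopy_invariants[OF itree_nth[OF Node.prems(1) j(1)] that[unfolded H_def]] by blast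
    define A where "A l = root_sign us j * (if j < l then - root_sign us l else root_sign us l) *
      (functional (\<lambda>t. functional g (icontract v (us[j := t]) l)) H
       + functional (\<lambda>t. functional (\<lambda>t'. g (Node v (us[j := t, l := t']))) (iboundary (us[j := t] ! l))) H)" for l
    have dh: "functional (\<lambda>s. functional g (iboundary s)) (homotopy (Node v us)) = (\<Sum>l<?n. A l)"
    proof -
      have "functional (\<lambda>t. functional g (iboundary (Node v (us[j := t])))) H
        = functional (\<lambda>t. \<Sum>l<?n. (if j < l then - root_sign us l else root_sign us l) *
           (functional g (icontract v (us[j := t]) l)
            + functional (\<lambda>t'. g (Node v (us[j := t, l := t']))) (iboundary (us[j := t] ! l)))) H"
      proof (rule scalar.linear_extension_cong)
        fix t assume "t \<in> keys H"
        then show "functional g (iboundary (Node v (us[j := t]))) = (\<Sum>l<?n. (if j < l then - root_sign us l else root_sign us l) *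
           (functional g (icontract v (us[j := t]) l)
            + functional (\<lambda>t'. g (Node v (us[j := t, l := t']))) (iboundary (us[j := t] ! l))))"
          unfolding functional_iboundary_Node length_list_update by (simp only: sign_h[OF vH])
      qed
      then show ?thesis
        unfolding functional_homotopy_nested[OF j(2,1) nested] H_def[symmetric] A_def
          functional_fun_sum scalar.linear_extension_fun_scale scalar.linear_extension_fun_add
        by (simp only: sum_distrib_left mult.assoc)
    qed
    have other: "A l + B l = 0" if l: "l < ?n" "l \<noteq> j" for l
    proof -
      have c: "functional (\<lambda>s. functional g (homotopy s)) (icontract v us l)
        = \<epsilon> l * root_sign us j * functional (\<lambda>t. functional g (icontract v (us[j := t]) l)) H"
      proof (cases "\<exists>n s. us ! l = Node [n] [s]")
        case True
        then obtain n s where ns: "us ! l = Node [n] [s]" by blast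
        have "us[j := t] ! l = Node [n] [s]" for t using ns l by simp
        note ic = icontract_unary[OF this, of v] icontract_unary[OF ns, of v]
        have "functional g (homotopy (Node (v[l := v ! l + n]) (us[l := s])))
          = \<epsilon> l * root_sign us j * functional (\<lambda>t. g (Node (v[l := v ! l + n]) (us[j := t, l := s]))) H"
        proof -
          have "functional g (homotopy (Node (v[l := v ! l + n]) (us[l := s]))) = root_sign (us[l := s]) j *
            functional (\<lambda>t. g (Node (v[l := v ! l + n]) (us[l := s, j := t]))) (homotopy (us[l := s] ! j))"
            by (rule functional_homotopy_nested[OF contr[OF ns l(1)]]) (use l j(1) nested in simp_all)
          moreover have "root_sign (us[l := s]) j = \<epsilon> l * root_sign us j" by (rule sign_c[OF _ l(1)]) (simp add: ns)
          ultimately show ?thesis unfolding H_def list_update_swap[OF l(2)] nth_list_update_neq[OF l(2)] by simp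
        qed
        then show ?thesis unfolding ic by (simp add: scalar.linear_extension_fun_zero)
      next
        case False
        then have "icontract v (us[j := t]) l = (0 :: _ \<Rightarrow>\<^sub>0 'k)" "icontract v us l = (0 :: _ \<Rightarrow>\<^sub>0 'k)" for t
          using l by (auto intro!: icontract_other)
        then show ?thesis by simp
      qed
      have "functional (\<lambda>t. functional g (homotopy (Node v (us[l := t])))) (iboundary (us ! l))
        = functional (\<lambda>t. \<epsilon> l * root_sign us j * functional (\<lambda>t'. g (Node v (us[l := t, j := t']))) H) (iboundary (us ! l))"
      proof (rule scalar.linear_extension_cong)
        fix t assume t: "t \<in> keys (iboundary (us ! l) :: _ \<Rightarrow>\<^sub>0 'k)"
        show "functional g (homotopy (Node v (us[l := t]))) = \<epsilon> l * root_sign us j * functional (\<lambda>t'. g (Node v (us[l := t, j := t']))) H"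
        proof -
          have "functional g (homotopy (Node v (us[l := t]))) = root_sign (us[l := t]) j *
            functional (\<lambda>t'. g (Node v (us[l := t, j := t']))) (homotopy (us[l := t] ! j))"
            by (rule functional_homotopy_nested[OF repl(1)[OF t l(1)]]) (use l j(1) nested in simp_all)
          then show ?thesis unfolding sign_c[OF repl(2)[OF t l(1)] l(1)] nth_list_update_neq[OF l(2)] H_def .
        qed
      qed
      also have "\<dots> = \<epsilon> l * root_sign us j *
        functional (\<lambda>t. functional (\<lambda>t'. g (Node v (us[j := t, l := t']))) (iboundary (us[j := t] ! l))) H"
        unfolding scalar.linear_extension_fun_scale functional_swap[of _ H] list_update_swap[OF l(2)]
          nth_list_update_neq[OF l(2)[symmetric]] ..
      finally have R: "functional (\<lambda>t. functional g (homotopy (Node v (us[l := t])))) (iboundary (us ! l)) = \<epsilon> l * root_sign us j *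
        functional (\<lambda>t. functional (\<lambda>t'. g (Node v (us[j := t, l := t']))) (iboundary (us[j := t] ! l))) H" .
      show ?thesis unfolding A_def B_def c R \<epsilon>_def by (rule opposite_signs_cancel[OF l(2)])
    qed
    have self: "A j + B j = g (Node v us)"
    proof -
      \<comment> \<open>Merging the root of the child \<open>j\<close> into the root of the tree
        anticommutes with the homotopy inside the child, up to the sign of \<open>j\<close>.\<close>
      have ctr: "functional (\<lambda>t. functional g (icontract v (us[j := t]) j)) H
        + root_sign us j * functional (\<lambda>s. functional g (homotopy s)) (icontract v us j) = 0"
      proof (cases "\<exists>n s. us ! j = Node [n] [s]")
        case True
        then obtain n s where ns: "us ! j = Node [n] [s]" by blast
        let ?v = "v[j := v ! j + n]"
        have n: "n > 0" using itree_nth[OF Node.prems(1) j(1)] ns by simp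
        have f0: "first_split [n] [s] 0" using nested ns by (simp add: first_split_def splits_at_def splits.simps(2))
        have f: "first_split ?v (us[j := s]) j" by (rule contr[OF ns j(1)])
        have icj: "icontract v (us[j := Node [m] [t]]) j = (if v[j := v ! j + m] \<in> labelsP
            then single (Node (v[j := v ! j + m]) (us[j := t])) (1 :: 'k) else 0)" for m t
        proof -
          have nt: "us[j := Node [m] [t]] ! j = Node [m] [t]" using j(1) by simp
          show ?thesis unfolding icontract_unary[OF nt] list_update_overwrite ..
        qed
        \<comment> \<open>The first split of the unary child lies above its root, is made at its
          root, or its letter is already separated.\<close>
        consider (deep) "splits s" | (split) "\<not> splits s" "ilen s = 0" | (target) "\<not> splits s" "ilen s \<noteq> 0" by blast
        then show ?thesis
        proof cases
          case deep
          have "functional g (homotopy (Node ?v (us[j := s]))) = root_sign us j * functional (\<lambda>t. g (Node ?v (us[j := t]))) (homotopy s)"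
            using functional_homotopy_nested[OF f, of g] j(1) deep sg by simp
          moreover have "functional (\<lambda>t. functional g (icontract v (us[j := t]) j)) H
            = - functional (\<lambda>t. functional g (icontract v (us[j := Node [n] [t]]) j)) (homotopy s)"
            unfolding H_def ns using functional_homotopy_nested[OF f0] deep by simp
          ultimately show ?thesis unfolding icj icontract_unary[OF ns] by (simp add: sq)
        next
          case split
          have "n \<ge> 2" using nested split ns by (simp add: splits.simps(2))
          then have e: "v ! j + n - 1 = v ! j + (n - 1)" by simp
          have "functional g (homotopy (Node ?v (us[j := s]))) = root_sign us j * g (Node (v[j := v ! j + (n - 1)]) (us[j := Node [1] [s]]))"
            using functional_homotopy_split[OF f, of g] j(1) split sg len e by simp
          moreover have "functional (\<lambda>t. functional g (icontract v (us[j := t]) j)) H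
            = - functional g (icontract v (us[j := Node [n - 1] [Node [1] [s]]]) j)"
            unfolding H_def ns using functional_homotopy_split[OF f0] split by simp
          moreover have "v[j := v ! j + (n - 1)] \<in> labelsP \<longleftrightarrow> ?v \<in> labelsP"
          proof
            assume "v[j := v ! j + (n - 1)] \<in> labelsP"
            then show "?v \<in> labelsP"
              using labelsP_update[of "v[j := v ! j + (n - 1)]" j "v ! j + n"] j(1) len \<open>n \<ge> 2\<close> by simp
          next
            assume "?v \<in> labelsP"
            then show "v[j := v ! j + (n - 1)] \<in> labelsP"
              using labelsP_update[of ?v j "v ! j + (n - 1)"] j(1) len \<open>n \<ge> 2\<close> by simp
          qed
          ultimately show ?thesis unfolding icj icontract_unary[OF ns] by (simp add: sq)
        next
          case target
          have "homotopy (Node ?v (us[j := s])) = (0 :: _ \<Rightarrow>\<^sub>0 'k)"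
            using homotopy_target[OF f] j(1) target by simp
          moreover have "H = 0" unfolding H_def ns using homotopy_target[OF f0] target by simp
          ultimately show ?thesis unfolding icontract_unary[OF ns] by simp
        qed
      next
        case False
        \<comment> \<open>The homotopy keeps the number of inputs of the root of the child, so a
          child that is not unary stays so and its contraction vanishes.\<close>
        have "functional g (icontract v (us[j := t]) j) = 0" if "t \<in> keys H" for t
        proof -
          have "t \<noteq> Node [n] [s]" for n s
          proof
            assume "t = Node [n] [s]"
            obtain w ws where w: "us ! j = Node w ws" using nested by (cases "us ! j") auto
            have wl: "length w = length ws" using itree_nth[OF Node.prems(1) j(1)] w by simp
            obtain i where i: "i < length ws" "first_split w ws i" using nested unfolding w splits_first by blast
            have "length ws = 1"
              using that \<open>t = Node [n] [s]\<close> unfolding H_def w homotopy_first[OF i(2,1)]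
              by (auto dest!: keys_pscale[THEN subsetD] keys_replace_child split: if_splits)
                 (metis length_list_update length_Cons list.size(3))+
            then show False using False w wl by (metis One_nat_def length_0_conv length_Suc_conv)
          qed
          then show ?thesis using j(1) by (subst icontract_other) auto
        qed
        moreover have "icontract v us j = (0 :: _ \<Rightarrow>\<^sub>0 'k)" using False by (intro icontract_other) blast
        ultimately show ?thesis by (simp add: functional_vanish)
      qed
      have "functional (\<lambda>t. functional g (homotopy (Node v (us[j := t])))) (iboundary (us ! j))
        = functional (\<lambda>t. root_sign us j * functional (\<lambda>t'. g (Node v (us[j := t']))) (homotopy t)) (iboundary (us ! j))"
      proof (rule scalar.linear_extension_cong)
        fix t assume t: "t \<in> keys (iboundary (us ! j) :: _ \<Rightarrow>\<^sub>0 'k)"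
        show "functional g (homotopy (Node v (us[j := t]))) = root_sign us j * functional (\<lambda>t'. g (Node v (us[j := t']))) (homotopy t)"
        proof -
          have "functional g (homotopy (Node v (us[j := t]))) = root_sign (us[j := t]) j *
            functional (\<lambda>t'. g (Node v (us[j := t, j := t']))) (homotopy (us[j := t] ! j))"
            by (rule functional_homotopy_nested[OF repl(1)[OF t j(1)]]) (use j(1) nested repl(4)[OF t j(1)] in simp_all)
          then show ?thesis unfolding sg list_update_overwrite nth_list_update_eq[OF j(1)] .
        qed
      qed
      then have Bj: "B j = root_sign us j * functional (\<lambda>s. functional g (homotopy s)) (icontract v us j)
        + functional (\<lambda>t. functional (\<lambda>t'. g (Node v (us[j := t']))) (homotopy t)) (iboundary (us ! j))"
        unfolding B_def by (simp only: scalar.linear_extension_fun_scale distrib_left sq)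
      have Aj: "A j = functional (\<lambda>t. functional g (icontract v (us[j := t]) j)) H
        + functional (\<lambda>t. functional (\<lambda>t'. g (Node v (us[j := t']))) (iboundary t)) H"
        unfolding A_def using j(1) by (simp only: less_irrefl if_False root_sign_square mult_1_left list_update_overwrite nth_list_update_eq)
      have "functional (\<lambda>s. functional (\<lambda>t. g (Node v (us[j := t]))) (iboundary s)) (homotopy (us ! j))
        + functional (\<lambda>s. functional (\<lambda>t. g (Node v (us[j := t]))) (homotopy s)) (iboundary (us ! j)) = g (Node v (us[j := us ! j]))"
        by (rule Node.IH[OF nth_mem[OF j(1)] itree_nth[OF Node.prems(1) j(1)] nested])
      note IH = this[unfolded list_update_id H_def[symmetric]]
      show ?thesis unfolding Aj Bj by (rule regroup_sums[OF ctr IH])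
    qed
    have "(\<Sum>l<?n. A l) + (\<Sum>l<?n. B l) = (\<Sum>l<?n. if l = j then g (Node v us) else 0)"
      unfolding sum.distrib[symmetric] by (intro sum.cong) (auto simp: other self)
    then show ?thesis unfolding dh hd using j(1) by simp
  next
    case flat: False
    have at: "splits_at v us j" using j(2) by (simp add: first_split_def)
    show ?thesis
    proof (cases "ilen (us ! j) = 0")
      case zero: True
      \<comment> \<open>A letter is split off at \<open>j\<close>. Contracting the new edge returns
        the original tree; the boundaries inside the child occur twice with opposite signs.\<close>
      have v2: "v ! j \<ge> 2" using at flat zero by (simp add: splits_at_def)
      let ?v = "v[j := v ! j - 1]" and ?us = "us[j := Node [1] [us ! j]]"
      have vT: "vertices (Node [1] [us ! j]) = vertices (us ! j) + 1" by simp
      define A where "A l = root_sign us j * (if j < l then - root_sign us l else root_sign us l) *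
        (functional g (icontract ?v ?us l) + functional (\<lambda>t. g (Node ?v (?us[l := t]))) (iboundary (?us ! l)))" for l
      have dh: "functional (\<lambda>s. functional g (iboundary s)) (homotopy (Node v us)) = (\<Sum>l<?n. A l)"
        unfolding functional_homotopy_split[OF j(2,1) flat zero] functional_iboundary_Node length_list_update
          sign_h[OF vT] A_def sum_distrib_left mult.assoc ..
      have other: "A l + B l = 0" if l: "l < ?n" "l \<noteq> j" for l
      proof -
        have c: "functional (\<lambda>s. functional g (homotopy s)) (icontract v us l)
          = \<epsilon> l * root_sign us j * functional g (icontract ?v ?us l)"
        proof (cases "\<exists>n s. us ! l = Node [n] [s]")
          case True
          then obtain n s where ns: "us ! l = Node [n] [s]" by blast
          have ns': "?us ! l = Node [n] [s]" using ns l by simp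
          have eq: "?v[l := ?v ! l + n] = v[l := v ! l + n, j := v ! j - 1]" using l by (simp add: list_update_swap)
          have mem: "?v[l := ?v ! l + n] \<in> labelsP \<longleftrightarrow> v[l := v ! l + n] \<in> labelsP"
            unfolding eq
          proof
            assume a: "v[l := v ! l + n, j := v ! j - 1] \<in> labelsP"
            have "v[l := v ! l + n, j := v ! j] = v[l := v ! l + n]"
              using list_update_id[of "v[l := v ! l + n]" j] l(2) by simp
            then show "v[l := v ! l + n] \<in> labelsP"
              using labelsP_update[OF _ _ a, of j "v ! j"] j(1) len v2 by simp
          next
            assume a: "v[l := v ! l + n] \<in> labelsP"
            show "v[l := v ! l + n, j := v ! j - 1] \<in> labelsP"
              by (rule labelsP_update[OF _ _ a]) (use l(2) v2 in simp_all)
          qed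
          have "functional g (homotopy (Node (v[l := v ! l + n]) (us[l := s])))
            = \<epsilon> l * root_sign us j * g (Node (?v[l := ?v ! l + n]) (?us[l := s]))"
          proof -
            have "functional g (homotopy (Node (v[l := v ! l + n]) (us[l := s]))) = root_sign (us[l := s]) j *
              g (Node (v[l := v ! l + n, j := v[l := v ! l + n] ! j - 1]) (us[l := s, j := Node [1] [us[l := s] ! j]]))"
              by (rule functional_homotopy_split[OF contr[OF ns l(1)]]) (use l j(1) flat zero in simp_all)
            moreover have "root_sign (us[l := s]) j = \<epsilon> l * root_sign us j" by (rule sign_c[OF _ l(1)]) (simp add: ns)
            ultimately show ?thesis unfolding eq list_update_swap[OF l(2), of us] nth_list_update_neq[OF l(2)] by simp
          qed
          then show ?thesis unfolding icontract_unary[OF ns] icontract_unary[OF ns'] mem by simp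
        next
          case False
          then have "icontract ?v ?us l = (0 :: _ \<Rightarrow>\<^sub>0 'k)" "icontract v us l = (0 :: _ \<Rightarrow>\<^sub>0 'k)"
            using l by (auto intro!: icontract_other)
          then show ?thesis by simp
        qed
        have "functional (\<lambda>t. functional g (homotopy (Node v (us[l := t])))) (iboundary (us ! l))
          = functional (\<lambda>t. \<epsilon> l * root_sign us j * g (Node ?v (?us[l := t]))) (iboundary (us ! l))"
        proof (rule scalar.linear_extension_cong)
          fix t assume t: "t \<in> keys (iboundary (us ! l) :: _ \<Rightarrow>\<^sub>0 'k)"
          show "functional g (homotopy (Node v (us[l := t]))) = \<epsilon> l * root_sign us j * g (Node ?v (?us[l := t]))"
          proof -
            have "functional g (homotopy (Node v (us[l := t]))) = root_sign (us[l := t]) j *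
              g (Node ?v (us[l := t, j := Node [1] [us[l := t] ! j]]))"
              by (rule functional_homotopy_split[OF repl(1)[OF t l(1)]]) (use l j(1) flat zero in simp_all)
            then show ?thesis
              unfolding sign_c[OF repl(2)[OF t l(1)] l(1)] nth_list_update_neq[OF l(2)] list_update_swap[OF l(2)] .
          qed
        qed
        also have "\<dots> = \<epsilon> l * root_sign us j * functional (\<lambda>t. g (Node ?v (?us[l := t]))) (iboundary (?us ! l))"
          unfolding scalar.linear_extension_fun_scale nth_list_update_neq[OF l(2)[symmetric]] ..
        finally have R: "functional (\<lambda>t. functional g (homotopy (Node v (us[l := t])))) (iboundary (us ! l))
          = \<epsilon> l * root_sign us j * functional (\<lambda>t. g (Node ?v (?us[l := t]))) (iboundary (?us ! l))" .
        show ?thesis unfolding A_def B_def c R \<epsilon>_def by (rule opposite_signs_cancel[OF l(2)])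
      qed
      have not_unary: "us ! j \<noteq> Node [n] [s]" for n s
        using zero itree_nth[OF Node.prems(1) j(1)] by auto
      have "icontract ?v ?us j = single (Node v us) (1 :: 'k)"
        using icontract_unary[of ?us j 1 "us ! j" ?v] j(1) len v2 Node.prems(1) by simp
      moreover have "icontract [1] [us ! j] 0 = (0 :: _ \<Rightarrow>\<^sub>0 'k)" using not_unary by (intro icontract_other) simp
      ultimately have Aj: "A j = g (Node v us) - functional (\<lambda>t. g (Node ?v (us[j := Node [1] [t]]))) (iboundary (us ! j))"
        using j(1) functional_iboundary_Node[of "\<lambda>t. g (Node ?v (us[j := t]))" "[1]" "[us ! j]"]
        unfolding A_def by (simp add: sq)
      have "icontract v us j = (0 :: _ \<Rightarrow>\<^sub>0 'k)" using not_unary by (intro icontract_other) blast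
      moreover have "functional (\<lambda>t. functional g (homotopy (Node v (us[j := t])))) (iboundary (us ! j))
        = functional (\<lambda>t. root_sign us j * g (Node ?v (us[j := Node [1] [t]]))) (iboundary (us ! j))"
      proof (rule scalar.linear_extension_cong)
        fix t assume t: "t \<in> keys (iboundary (us ! j) :: _ \<Rightarrow>\<^sub>0 'k)"
        show "functional g (homotopy (Node v (us[j := t]))) = root_sign us j * g (Node ?v (us[j := Node [1] [t]]))"
        proof -
          have "functional g (homotopy (Node v (us[j := t]))) = root_sign (us[j := t]) j *
            g (Node ?v (us[j := t, j := Node [1] [us[j := t] ! j]]))"
            by (rule functional_homotopy_split[OF repl(1)[OF t j(1)]]) (use j(1) flat zero repl(3,4)[OF t j(1)] in simp_all)
          then show ?thesis unfolding sg list_update_overwrite nth_list_update_eq[OF j(1)] .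
        qed
      qed
      ultimately have Bj: "B j = functional (\<lambda>t. g (Node ?v (us[j := Node [1] [t]]))) (iboundary (us ! j))"
        unfolding B_def by (simp only: scalar.linear_extension_fun_scale scalar.linear_extension_zero add_0 sq)
      have "(\<Sum>l<?n. A l) + (\<Sum>l<?n. B l) = (\<Sum>l<?n. if l = j then g (Node v us) else 0)"
        unfolding sum.distrib[symmetric] by (intro sum.cong) (auto simp: other Aj Bj)
      then show ?thesis unfolding dh hd using j(1) by simp
    next
      case target: False
      \<comment> \<open>The homotopy vanishes on the tree and on all its boundary terms except the
        contraction of the separated letter at \<open>j\<close>, from which it recreates the
        tree.\<close>
      obtain n s where ns: "us ! j = Node [n] [s]" using ilen_neq_0[OF target] by blast
      have "n > 0" using itree_nth[OF Node.prems(1) j(1)] ns by simp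
      then have n: "n = 1" "ilen s = 0" "\<not> splits s" using flat ns by (auto simp: splits.simps(2))
      have v1: "v ! j \<ge> 1" using at flat ns n by (simp add: splits_at_def)
      have other: "B l = 0" if l: "l < ?n" "l \<noteq> j" for l
      proof -
        have "functional (\<lambda>s. functional g (homotopy s)) (icontract v us l) = 0"
        proof (cases "\<exists>n s. us ! l = Node [n] [s]")
          case True
          then obtain n s where nsl: "us ! l = Node [n] [s]" by blast
          have "homotopy (Node (v[l := v ! l + n]) (us[l := s])) = (0 :: _ \<Rightarrow>\<^sub>0 'k)"
            using l j(1) flat target by (intro homotopy_target[OF contr[OF nsl l(1)]]) simp_all
          then show ?thesis unfolding icontract_unary[OF nsl] by simp
        next
          case False
          then have "icontract v us l = (0 :: _ \<Rightarrow>\<^sub>0 'k)" by (intro icontract_other) blast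
          then show ?thesis by simp
        qed
        moreover have "functional (\<lambda>t. functional g (homotopy (Node v (us[l := t])))) (iboundary (us ! l)) = 0"
        proof (rule functional_vanish)
          fix t assume t: "t \<in> keys (iboundary (us ! l) :: _ \<Rightarrow>\<^sub>0 'k)"
          have "homotopy (Node v (us[l := t])) = (0 :: _ \<Rightarrow>\<^sub>0 'k)"
            using l j(1) flat target by (intro homotopy_target[OF repl(1)[OF t l(1)]]) simp_all
          then show "functional g (homotopy (Node v (us[l := t]))) = 0" by simp
        qed
        ultimately show ?thesis unfolding B_def by simp
      qed
      have "B j = g (Node v us)"
      proof -
        have mem: "v[j := v ! j + n] \<in> labelsP"
          by (rule labelsP_update) (use Node.prems(1) v1 n in simp_all)
        have "functional g (homotopy (Node (v[j := v ! j + n]) (us[j := s]))) = root_sign us j * g (Node v us)"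
        proof -
          have e: "v[j := v ! j + n, j := v[j := v ! j + n] ! j - 1] = v" "us[j := s, j := Node [1] [us[j := s] ! j]] = us"
            using j(1) len n ns by (simp_all add: list_update_same_conv)
          have "functional g (homotopy (Node (v[j := v ! j + n]) (us[j := s]))) = root_sign (us[j := s]) j *
            g (Node (v[j := v ! j + n, j := v[j := v ! j + n] ! j - 1]) (us[j := s, j := Node [1] [us[j := s] ! j]]))"
            by (rule functional_homotopy_split[OF contr[OF ns j(1)]]) (use j(1) n in simp_all)
          then show ?thesis unfolding e sg .
        qed
        moreover have "functional (\<lambda>t. functional g (homotopy (Node v (us[j := t])))) (iboundary (us ! j)) = 0"
        proof (rule functional_vanish)
          fix t assume t: "t \<in> keys (iboundary (us ! j) :: _ \<Rightarrow>\<^sub>0 'k)"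
          have "homotopy (Node v (us[j := t])) = (0 :: _ \<Rightarrow>\<^sub>0 'k)"
            using j(1) flat target repl(3,4)[OF t j(1)] by (intro homotopy_target[OF repl(1)[OF t j(1)]]) simp_all
          then show "functional g (homotopy (Node v (us[j := t]))) = 0" by simp
        qed
        ultimately show ?thesis unfolding B_def icontract_unary[OF ns] using mem by (simp add: sq)
      qed
      then have "(\<Sum>l<?n. B l) = (\<Sum>l<?n. if l = j then g (Node v us) else 0)"
        by (intro sum.cong) (auto simp: other)
      then show ?thesis unfolding hd homotopy_target[OF j(2,1) flat target] using j(1) by simp
    qed
  qed
qed simp

subsection \<open>The rate of the operad\<close>

lemma linear_extension_swap:
  "linear_extension pscale (\<lambda>x. linear_extension pscale (F x) g) f
    = linear_extension pscale (\<lambda>y. linear_extension pscale (\<lambda>x. F x y) f) g"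
  unfolding linear_extension_def pscale.scale_sum_right
  by (subst sum.swap) (simp add: mult.commute)

section \<open>Comparison of monomial trees with the bar complex\<close>

definition label_tree :: "nat list tree \<Rightarrow> (nat \<times> (nat \<Rightarrow>\<^sub>0 'k::field)) tree" where
  "label_tree = map_tree (\<lambda>v. (sum_list v, monom v))"

lemma label_tree_simps [simp]:
  "label_tree Leaf = Leaf"
  "label_tree (Node v us) = Node (sum_list v, monom v) (map label_tree us)"
  "vertices (label_tree u) = vertices u"
  by (simp_all add: label_tree_def)

lemma bar_weight_label_tree: "bar_weight (label_tree u) = iweight u"
  by (induction u) (simp_all add: comp_def cong: map_cong)

lemma bar_tree_label_tree: "itree u \<Longrightarrow> bar_tree P_op (label_tree u)"
  by (induction u) auto

lemma multilinear_zero: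
  assumes "multilinear (P_op :: ('k::field, _) ns_operad) G" "bar_tree (P_op :: ('k, _) ns_operad) (Node (w, a) ts)"
  shows "G (Node (w, 0) ts) = 0"
  using weight_graded_ns_operad.multilinear_smul[OF P_op_operad assms, of 0] by simp

lemma functional_contract_label_tree:
  fixes G :: "_ \<Rightarrow> 'k::field"
  assumes G: "multilinear (P_op :: ('k, _) ns_operad) G" and u: "itree (Node v us)" and l: "l < length us"
  shows "functional G (contract_child P_op (sum_list v, monom v) (map label_tree us) l)
    = functional (\<lambda>u. G (label_tree u)) (icontract v us l)"
proof (cases "us ! l")
  case Leaf
  then show ?thesis using l by (simp add: contract_child_def icontract_def)
next
  case (Node w ts)
  have w: "itree (Node w ts)" using itree_nth[OF u l] Node by simp
  have v0: "v \<noteq> [0]" using u by auto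
  let ?c = "opt_monom (label_comp labelsP l v w) :: nat \<Rightarrow>\<^sub>0 'k"
  let ?L = "take l (map label_tree us) @ map label_tree ts @ drop (Suc l) (map label_tree us)"
  have nth: "map label_tree us ! l = Node (sum_list w, monom w :: nat \<Rightarrow>\<^sub>0 'k) (map label_tree ts)" using l Node by simp
  have circ: "circ P_op l (monom v) (monom w) = ?c" by simp
  have eq: "functional G (contract_child P_op (sum_list v, monom v) (map label_tree us) l) = G (Node (sum_list v + sum_list w, ?c) ?L)"
    unfolding weight_graded_ns_operad.functional_contract_Node[OF P_op_operad nth] circ ..
  have bt: "bar_tree P_op (Node (sum_list v + sum_list w, ?c) ?L)"
    using weight_graded_ns_operad.bar_tree_contract[OF P_op_operad bar_tree_label_tree[OF u, unfolded label_tree_simps(2)] _ nth] l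
    unfolding circ by (simp only: length_map)
  show ?thesis
  proof (cases "length w = 1")
    case True
    then obtain n where n: "w = [n]" by (metis One_nat_def length_0_conv length_Suc_conv)
    obtain s where s: "ts = [s]" using w n by (metis One_nat_def length_0_conv length_Suc_conv itree.simps(2))
    have ns: "us ! l = Node [n] [s]" using Node n s by simp
    have sum: "sum_list (v[l := v ! l + n]) = sum_list v + n"
      using sum_list_update_add[of l v "v ! l + n"] u l by simp
    have L: "?L = map label_tree (us[l := s])" unfolding s map_update using l by (simp add: upd_conv_take_nth_drop)
    show ?thesis
    proof (cases "v[l := v ! l + n] \<in> labelsP")
      case True
      then show ?thesis unfolding eq icontract_unary[OF ns] L n using sum by (simp add: label_comp_def opt_monom_def)
    next
      case False
      then have "?c = 0" unfolding n by (simp add: label_comp_def opt_monom_def)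
      then have "G (Node (sum_list v + sum_list w, ?c) ?L) = 0" using multilinear_zero[OF G bt] by simp
      then show ?thesis unfolding eq icontract_unary[OF ns] using False by simp
    qed
  next
    case False
    then have "?c = 0" using v0 by (simp add: label_comp_def opt_monom_def)
    then have "G (Node (sum_list v + sum_list w, ?c) ?L) = 0" using multilinear_zero[OF G bt] by simp
    moreover have "icontract v us l = (0 :: _ \<Rightarrow>\<^sub>0 'k)" using False Node by (intro icontract_other) auto
    ultimately show ?thesis unfolding eq by simp
  qed
qed

text \<open>On monomial trees the bar boundary and \<open>iboundary\<close> differ only by trees
  with a zero label, which a multilinear functional does not see.\<close>

lemma functional_boundary_label_tree:
  fixes G :: "_ \<Rightarrow> 'k::field"
  assumes "multilinear (P_op :: ('k, _) ns_operad) G" "itree u"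
  shows "functional G (bar_boundary P_op (label_tree u)) = functional (\<lambda>u. G (label_tree u)) (iboundary u)"
  using assms
proof (induction u arbitrary: G)
  case (Node v us)
  have bt: "bar_tree (P_op :: ('k, _) ns_operad) (Node (sum_list v, monom v) (map label_tree us))"
    using bar_tree_label_tree[OF Node.prems(2)] by simp
  have IH: "functional (\<lambda>t. G (Node (sum_list v, monom v) ((map label_tree us)[l := t]))) (bar_boundary P_op (label_tree (us ! l)))
    = functional (\<lambda>t. G (label_tree (Node v (us[l := t])))) (iboundary (us ! l))" if l: "l < length us" for l
    using Node.IH[OF nth_mem[OF l] weight_graded_ns_operad.multilinear_child[OF P_op_operad Node.prems(1) bt, of l]
        itree_nth[OF Node.prems(2) l]] l by (simp add: map_update)
  have sg: "(\<Sum>i<l. vertices (map label_tree us ! i)) = (\<Sum>i<l. vertices (us ! i))" if "l < length us" for l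
    using that by (intro sum.cong) auto
  show ?case
    unfolding label_tree_simps(2) weight_graded_ns_operad.functional_boundary_Node[OF P_op_operad] functional_iboundary_Node length_map
    by (intro sum.cong refl) (use functional_contract_label_tree[OF Node.prems] IH sg in \<open>simp add: root_sign_def map_update\<close>)
qed simp

text \<open>The children are expanded one at a time from the left; \<open>pre\<close> holds those
  that are already monomial trees.\<close>

lemma multilinear_eq_0_children:
  fixes D :: "_ \<Rightarrow> 'k::field"
  assumes D: "multilinear P D"
    and IH: "\<And>t D. \<lbrakk>t \<in> set ts; multilinear P D; bar_tree P t;
      \<And>u. \<lbrakk>itree u; vertices u = vertices t; iweight u = bar_weight t\<rbrakk> \<Longrightarrow> D (label_tree u) = 0\<rbrakk> \<Longrightarrow> D t = 0"
    and P: "weight_graded_ns_operad P" and bt: "bar_tree P (Node x (pre @ ts))"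
    and lt: "\<And>u. itree u \<Longrightarrow> bar_tree P (label_tree u)"
    and vanish: "\<And>us. \<lbrakk>list_all2 (\<lambda>u t. itree u \<and> vertices u = vertices t \<and> iweight u = bar_weight t) us ts\<rbrakk>
      \<Longrightarrow> D (Node x (pre @ map label_tree us)) = 0"
  shows "D (Node x (pre @ ts)) = 0"
  using IH bt vanish
proof (induction ts arbitrary: pre)
  case (Cons t ts)
  let ?D = "\<lambda>s. D (Node x ((pre @ t # ts)[length pre := s]))"
  have upd: "(pre @ t # ts)[length pre := s] = pre @ s # ts" for s by simp
  have bt_t: "bar_tree P t" using Cons.prems(2) by (cases x) auto
  have "?D t = 0"
  proof (rule Cons.prems(1)[of t ?D])
    show "multilinear P ?D"
      by (rule weight_graded_ns_operad.multilinear_child[OF P D Cons.prems(2)]) simp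
    fix u assume u: "itree u" "vertices u = vertices t" "iweight u = bar_weight t"
    have bu: "bar_tree P (Node x ((pre @ [label_tree u]) @ ts))"
      using weight_graded_ns_operad.bar_tree_update[OF P Cons.prems(2) lt[OF u(1)], of "length pre"] by simp
    have "D (Node x ((pre @ [label_tree u]) @ ts)) = 0"
    proof (rule Cons.IH[OF _ bu])
      fix us assume "list_all2 (\<lambda>u t. itree u \<and> vertices u = vertices t \<and> iweight u = bar_weight t) us ts"
      then show "D (Node x ((pre @ [label_tree u]) @ map label_tree us)) = 0"
        using Cons.prems(3)[of "u # us"] u by simp
    qed (use Cons.prems(1) in simp)
    then show "?D (label_tree u) = 0" by simp
  qed (use bt_t in simp_all)
  then show ?case by simp
qed (use vanish in simp)

text \<open>After the children, the root label is expanded in monomials. Keeping track of the number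
  of vertices and of the weight matters, because these decide later that the monomial trees
  split.\<close>

lemma multilinear_eq_0:
  fixes D :: "_ \<Rightarrow> 'k::field"
  assumes "multilinear (P_op :: ('k, _) ns_operad) D" "bar_tree (P_op :: ('k, _) ns_operad) t"
    and "\<And>u. \<lbrakk>itree u; vertices u = vertices t; iweight u = bar_weight t\<rbrakk> \<Longrightarrow> D (label_tree u) = 0"
  shows "D t = 0"
  using assms
proof (induction t arbitrary: D)
  case Leaf
  then show ?case using Leaf(3)[of Leaf] by simp
next
  case (Node x ts)
  let ?P = "P_op :: ('k, _) ns_operad"
  obtain w a where x: "x = (w, a)" by (cases x)
  have "D (Node x ([] @ ts)) = 0"
  proof (rule multilinear_eq_0_children[where P = ?P and D = D and x = x and pre = "[]" and ts = ts])
    show "multilinear ?P D" by (rule Node.prems(1))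
    show "weight_graded_ns_operad ?P" by (rule P_op_operad)
    show "\<And>u. itree u \<Longrightarrow> bar_tree ?P (label_tree u)" by (rule bar_tree_label_tree)
    show "E t = 0" if "t \<in> set ts" "multilinear ?P E" "bar_tree ?P t"
      "\<And>u. \<lbrakk>itree u; vertices u = vertices t; iweight u = bar_weight t\<rbrakk> \<Longrightarrow> E (label_tree u) = 0" for t and E :: "_ \<Rightarrow> 'k"
      by (rule Node.IH[OF that])
    show "bar_tree ?P (Node x ([] @ ts))" using Node.prems(2) by simp
    fix us assume us: "list_all2 (\<lambda>u t. itree u \<and> vertices u = vertices t \<and> iweight u = bar_weight t) us ts"
    have len: "length us = length ts" using us by (rule list_all2_lengthD)
    have it: "\<forall>u\<in>set us. itree u" using us by (auto simp: list_all2_conv_all_nth in_set_conv_nth)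
    have vs: "map vertices us = map vertices ts" "map iweight us = map bar_weight ts"
      using us by (auto simp: list_all2_conv_all_nth intro!: nth_equalityI)
    have bt: "bar_tree ?P (Node (w, b) (map label_tree us)) \<longleftrightarrow> b \<in> part ?P (length ts) w" for b
      using Node.prems(2) it len unfolding x by (auto intro: bar_tree_label_tree simp del: label_operad_simps)
    have w: "w > 0" using Node.prems(2) x by simp
    have a: "keys a \<subseteq> to_nat ` {v \<in> labelsP. length v = length ts \<and> sum_list v = w}"
      using Node.prems(2) x by simp
    have "D (Node (w, a) (map label_tree us)) = 0 \<and> a \<in> part ?P (length ts) w"
      using a
    proof (induction a rule: keys_subset_induct)
      case zero
      have "0 \<in> part ?P (length ts) w" by simp
      then show ?case using multilinear_zero[OF Node.prems(1)] bt by blast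
    next
      case (add p c b)
      then obtain v where v: "p = to_nat v" "v \<in> labelsP" "length v = length ts" "sum_list v = w" by auto
      have mv: "(monom v :: nat \<Rightarrow>\<^sub>0 'k) \<in> part ?P (length ts) w" using v by simp
      have m: "(single p c :: nat \<Rightarrow>\<^sub>0 'k) \<in> part ?P (length ts) w" using v by simp
      have "D (label_tree (Node v us)) = 0"
        by (rule Node.prems(3)) (use v it w len vs in \<open>simp_all add: comp_def x\<close>)
      then have "D (Node (w, monom v) (map label_tree us)) = 0" using v(4) by simp
      moreover have "bar_tree ?P (Node (w, monom v) (map label_tree us))" using bt mv by blast
      note weight_graded_ns_operad.multilinear_smul[OF P_op_operad Node.prems(1) this, of c]
      ultimately have Dm: "D (Node (w, single p c) (map label_tree us)) = 0" unfolding v(1) by simp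
      have ab: "b \<in> part ?P (length ts) w" "D (Node (w, b) (map label_tree us)) = 0" using add by blast+
      have "bar_tree ?P (Node (w, single p c) (map label_tree us))" "bar_tree ?P (Node (w, b) (map label_tree us))"
        using bt m ab(1) by blast+
      note weight_graded_ns_operad.multilinear_add[OF P_op_operad Node.prems(1) this]
      then have "D (Node (w, single p c + b) (map label_tree us)) = 0" unfolding Dm ab(2) by simp
      moreover have "single p c + b \<in> part ?P (length ts) w"
        using m ab(1) Poly_Mapping.keys_add[of "single p c" b] by auto
      ultimately show ?case by blast
    qed
    then show "D (Node x ([] @ map label_tree us)) = 0" by (simp add: x)
  qed
  then show ?case by simp
qed

text \<open>A left inverse of \<open>label_tree\<close>, expanding every vertex label in monomials.
  It turns any function on monomial trees into a multilinear functional on the bar complex.\<close>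

fun expand :: "(nat \<times> (nat \<Rightarrow>\<^sub>0 'k::field)) tree \<Rightarrow> (nat list tree \<Rightarrow>\<^sub>0 'k)"
  and expands :: "(nat \<times> (nat \<Rightarrow>\<^sub>0 'k::field)) tree list \<Rightarrow> (nat list tree list \<Rightarrow>\<^sub>0 'k)" where
  "expand Leaf = single Leaf 1"
| "expand (Node x ts) = linear_extension pscale
    (\<lambda>p. linear_extension pscale (\<lambda>us. single (Node (from_nat p) us) 1) (expands ts)) (snd x)"
| "expands [] = single [] 1"
| "expands (t # ts) = linear_extension pscale
    (\<lambda>u. linear_extension pscale (\<lambda>us. single (u # us) 1) (expands ts)) (expand t)"

lemma expand_label_tree: "expand (label_tree u) = single u 1"
proof (induction u)
  case (Node v us)
  then have "expands (map label_tree us) = single us (1 :: 'a)" by (induction us) simp_all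
  then show ?case by simp
qed simp

text \<open>The rest of the list enters only through the fixed \<open>K\<close>, so the expansion is
  linear in each child. This is the inductive step for relations inside a child.\<close>

lemma expands_update:
  "j < length ts \<Longrightarrow> \<exists>K. \<forall>t. expands (ts[j := t]) = linear_extension pscale K (expand t)"
proof (induction ts arbitrary: j)
  case (Cons s ts)
  show ?case
  proof (cases j)
    case 0
    then show ?thesis by auto
  next
    case (Suc i)
    then obtain K where K: "\<And>t. expands (ts[i := t]) = linear_extension pscale K (expand t)"
      using Cons.IH[of i] Cons.prems by auto
    show ?thesis unfolding Suc
      by (simp add: K linear_extension_comp[OF pscale.vector_space_axioms] linear_extension_swap[of _ _ "expand s"]) blast
  qed
qed simp

lemma expand_multilinearity:
  "r \<in> multilinearity (P_op :: ('k::field, _) ns_operad) \<Longrightarrow> linear_extension pscale expand r = 0"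
proof (induction rule: multilinearity.induct)
  case (multi_child r x ts j)
  obtain K where K: "\<And>t. expands (ts[j := t]) = linear_extension pscale K (expand t)"
    using expands_update[OF multi_child(3)] by blast
  define K' where "K' u = linear_extension pscale (\<lambda>p. linear_extension pscale (\<lambda>us. single (Node (from_nat p) us) 1) (K u)) (snd x)" for u
  have K': "expand (Node x (ts[j := t])) = linear_extension pscale K' (expand t)" for t
    unfolding expand.simps K linear_extension_comp[OF pscale.vector_space_axioms] K'_def
    by (rule linear_extension_swap)
  have "linear_extension pscale expand (replace_child x ts j r) = linear_extension pscale (\<lambda>t. expand (Node x (ts[j := t]))) r"
    unfolding replace_child_def linear_extension_comp[OF pscale.vector_space_axioms] by simp
  also have "\<dots> = linear_extension pscale K' (linear_extension pscale expand r)"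
    unfolding K' linear_extension_comp[OF pscale.vector_space_axioms] ..
  finally show ?case using multi_child.IH by simp
qed (simp_all add: pscale.linear_extension_diff pscale.linear_extension_add pscale.linear_extension_pscale)

lemma multilinear_expand: "multilinear (P_op :: ('k::field, _) ns_operad) (\<lambda>t. functional g (expand t))"
  unfolding multilinear_def linear_extension_comp[OF scalar.vector_space_axioms, symmetric]
  by (simp add: expand_multilinearity)

text \<open>The coefficient of \<open>z\<close> in a basis containing \<open>z\<close> and a basis
  of the span of \<open>S\<close> has the required values.\<close>

lemma separating_functional:
  fixes z :: "'a \<Rightarrow>\<^sub>0 'k::field"
  assumes "z \<notin> pscale.span S"
  shows "\<exists>F. (\<forall>s\<in>S. functional F s = 0) \<and> functional F z = 1"
proof -
  obtain B where B: "B \<subseteq> S" "pscale.independent B" "S \<subseteq> pscale.span B"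
    by (rule pscale.maximal_independent_subset)
  have zB: "z \<notin> pscale.span B" using assms pscale.span_mono[OF B(1)] by blast
  have ind: "pscale.independent (insert z B)" by (rule pscale.independent_insertI[OF zB B(2)])
  define C where "C = pscale.extend_basis (insert z B)"
  have C: "insert z B \<subseteq> C" "pscale.independent C" "pscale.span C = UNIV"
    unfolding C_def using pscale.extend_basis_superset[OF ind] pscale.independent_extend_basis[OF ind]
      pscale.span_extend_basis[OF ind] by auto
  define f where "f v = pscale.representation C v z" for v
  have add: "f (a + b) = f a + f b" and sc: "f (pscale c a) = c * f a" for a b c
    unfolding f_def using pscale.representation_add[OF C(2), of b a] pscale.representation_scale[OF C(2), of a c] C(3) by simp_all
  have f0: "f 0 = 0" using sc[of 0 0] by simp
  define F where "F a = f (single a 1)" for a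
  have fs: "f (sum h A) = (\<Sum>a\<in>A. f (h a))" for h :: "'a \<Rightarrow> _" and A
    by (induction A rule: infinite_finite_induct) (simp_all add: f0 add)
  have F: "functional F v = f v" for v
  proof -
    have "f v = f (\<Sum>a\<in>keys v. pscale (lookup v a) (single a 1))" by (simp add: sum_singles)
    then show ?thesis unfolding fs sc linear_extension_def F_def by simp
  qed
  have fB: "f b = 0" if "b \<in> B" for b
  proof -
    have "b \<noteq> z" using that zB pscale.span_base by blast
    then show ?thesis unfolding f_def using pscale.representation_basis[OF C(2), of b] that C(1) by auto
  qed
  have "functional F s = 0" if "s \<in> S" for s
    by (rule functional_span[of B]) (use B(3) that fB F in auto)
  moreover have "functional F z = 1"
    unfolding F f_def using pscale.representation_basis[OF C(2), of z] C(1) by auto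
  ultimately show ?thesis by blast
qed

text \<open>A nontrivial class would give a functional \<open>F\<close> that vanishes on
  multilinearity relations and boundaries with \<open>F\<close> equal to 1 on \<open>z\<close>. Let
  \<open>g\<close> be \<open>F\<close> composed with the homotopy and \<open>G\<close> its
  multilinear extension. On trees that split, the homotopy formula shows that \<open>F\<close> is
  \<open>G\<close> composed with the boundary, because \<open>F\<close> kills the other term; so the
  value on the cycle \<open>z\<close> is 0.\<close>

lemma bar_homology_bound:
  assumes i: "i \<ge> 2" and "bar_homology_nonzero (P_op :: ('k::field, _) ns_operad) i j"
  shows "j \<le> 8 * (i - 1)"
proof (rule ccontr)
  assume big: "\<not> j \<le> 8 * (i - 1)"
  let ?P = "P_op :: ('k, _) ns_operad"
  let ?M = "multilinearity ?P" and ?d = "linear_extension pscale (bar_boundary ?P)"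
  obtain z where z: "z \<in> bar_chains ?P i j" "?d z \<in> pscale.span ?M"
    and none: "\<And>y. y \<in> bar_chains ?P (i + 1) j \<Longrightarrow> z - ?d y \<notin> pscale.span ?M"
    using assms(2) unfolding bar_homology_nonzero_def by blast
  define D where "D = ?d ` bar_chains ?P (i + 1) j"
  have sub: "pscale.subspace D"
  proof (rule pscale.subspaceI)
    have "0 \<in> bar_chains ?P (i + 1) j" by (simp add: bar_chains_def)
    then show "0 \<in> D" unfolding D_def by (force intro!: image_eqI[of _ _ 0])
  next
    fix a b assume "a \<in> D" "b \<in> D"
    then obtain a' b' where ab: "a = ?d a'" "b = ?d b'" "a' \<in> bar_chains ?P (i + 1) j" "b' \<in> bar_chains ?P (i + 1) j"
      unfolding D_def by blast
    have "a' + b' \<in> bar_chains ?P (i + 1) j" using ab(3,4) Poly_Mapping.keys_add[of a' b'] unfolding bar_chains_def by blast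
    then show "a + b \<in> D" unfolding D_def ab(1,2) pscale.linear_extension_add[symmetric] by (rule imageI)
  next
    fix c a assume "a \<in> D"
    then obtain a' where a: "a = ?d a'" "a' \<in> bar_chains ?P (i + 1) j" unfolding D_def by blast
    have "pscale c a' \<in> bar_chains ?P (i + 1) j" using a(2) keys_pscale[of c a'] unfolding bar_chains_def by blast
    then show "pscale c a \<in> D" unfolding D_def a(1) pscale.linear_extension_pscale[symmetric] by (rule imageI)
  qed
  have "z \<notin> pscale.span (?M \<union> D)"
  proof
    assume "z \<in> pscale.span (?M \<union> D)"
    then obtain m y where "z = m + ?d y" "m \<in> pscale.span ?M" "y \<in> bar_chains ?P (i + 1) j"
      unfolding pscale.span_Un pscale.span_eq_iff[THEN iffD2, OF sub] unfolding D_def by blast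
    then show False using none[of y] by simp
  qed
  then have "\<exists>F. (\<forall>s\<in>?M \<union> D. functional F s = 0) \<and> functional F z = 1" by (rule separating_functional)
  then obtain F where F': "\<forall>s\<in>?M \<union> D. functional F s = 0" and F2: "functional F z = 1" by blast
  note F = bspec[OF F'] F2
  have mF: "multilinear ?P F" unfolding multilinear_def using F(1) by blast
  define g where "g u = functional (\<lambda>s. F (label_tree s)) (homotopy u)" for u
  define G where "G t = functional g (expand t)" for t
  have mG: "multilinear ?P G" unfolding G_def by (rule multilinear_expand)
  have Gl: "G (label_tree u) = g u" for u unfolding G_def expand_label_tree by simp
  define E where "E t = F t - functional G (bar_boundary ?P t)" for t
  have Efun: "functional E r = functional F r - functional G (?d r)" for r
    unfolding E_def linear_extension_comp[OF scalar.vector_space_axioms]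
    by (simp add: linear_extension_def right_diff_distrib sum_subtractf)
  have mE: "multilinear ?P E"
    unfolding multilinear_def Efun linear_extension_comp[OF scalar.vector_space_axioms]
    using mF weight_graded_ns_operad.multilinear_boundary[OF P_op_operad _ mG] by (simp add: multilinear_def)
  have "E t = 0" if t: "t \<in> keys z" for t
  proof (rule multilinear_eq_0[OF mE])
    have t': "bar_tree ?P t" "vertices t = i" "bar_weight t = j" using z(1) t unfolding bar_chains_def by blast+
    show "bar_tree ?P t" by (rule t'(1))
    fix u assume u: "itree u" "vertices u = vertices t" "iweight u = bar_weight t"
    \<comment> \<open>\<open>j\<close> exceeds \<open>8 * (i - 1)\<close>, which is at least
      \<open>4 * i\<close> because \<open>i \<ge> 2\<close>.\<close>
    have "splits u"
    proof (rule ccontr)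
      assume "\<not> splits u"
      then have "iweight u \<le> 4 * vertices u" by (rule not_splits_weight[OF u(1)])
      then show False using u t' big i by simp
    qed
    have "functional (\<lambda>s. functional (\<lambda>s. F (label_tree s)) (iboundary s)) (homotopy u) = 0"
    proof (rule functional_vanish)
      fix s assume "s \<in> keys (homotopy u :: _ \<Rightarrow>\<^sub>0 'k)"
      then have s: "itree s" "vertices s = i + 1" "iweight s = j"
        using homotopy_invariants[OF u(1)] u(2,3) t'(2,3) by auto
      have "single (label_tree s) 1 \<in> bar_chains ?P (i + 1) j"
        using s bar_tree_label_tree[OF s(1)] by (simp add: bar_chains_def bar_weight_label_tree)
      then have "?d (single (label_tree s) 1) \<in> D" unfolding D_def by (rule imageI)
      then have "functional F (bar_boundary ?P (label_tree s)) = 0" using F(1) by simp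
      then show "functional (\<lambda>s. F (label_tree s)) (iboundary s) = 0"
        unfolding functional_boundary_label_tree[OF mF s(1)] .
    qed
    then have "functional g (iboundary u) = F (label_tree u)"
      using homotopy_formula[OF u(1) \<open>splits u\<close>, of "\<lambda>s. F (label_tree s)"] unfolding g_def by simp
    then show "E (label_tree u) = 0"
      unfolding E_def functional_boundary_label_tree[OF mG u(1)] Gl by simp
  qed
  then have "functional E z = 0" by (rule functional_vanish)
  moreover have "functional G (?d z) = 0"
    by (rule functional_span[OF _ z(2)]) (use mG in \<open>simp add: multilinear_def\<close>)
  ultimately show False using F(2) unfolding Efun by simp
qed

lemma rate_P_op: "rate (P_op :: ('k::field, _) ns_operad) \<le> 8"
  unfolding rate_def
proof (rule Sup_least)
  fix x assume "x \<in> {ereal ((real j - 1) / (real i - 1)) | i j. i \<ge> 2 \<and> bar_homology_nonzero (P_op :: ('k, _) ns_operad) i j}"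
  then obtain i j where ij: "x = ereal ((real j - 1) / (real i - 1))" "i \<ge> 2" "bar_homology_nonzero (P_op :: ('k, _) ns_operad) i j"
    by blast
  have "real j \<le> 8 * (real i - 1)" using bar_homology_bound[OF ij(2,3)] ij(2) by (simp add: of_nat_diff)
  then have "(real j - 1) / (real i - 1) \<le> 8" using ij(2) by (simp add: divide_le_eq)
  then show "x \<le> 8" unfolding ij(1) by simp
qed

text \<open>An infinite value below 8 is minus infinity, which \<open>ereal_ceiling\<close> leaves
  unchanged.\<close>

lemma ereal_ceiling_le_1: "x \<le> 8 \<Longrightarrow> ereal_ceiling (x / ereal (real 8)) \<le> 1"
  by (cases x) (auto simp: ereal_ceiling_def ceiling_le_iff one_ereal_def)

theorem proposition14:
  shows
    "\<not> (\<forall>(P :: ('k::field_char_0, nat \<Rightarrow>\<^sub>0 'k) ns_operad) d k.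
          weight_graded_ns_operad P \<and> generated_in_weight_one P \<and> d \<ge> 1 \<and> k \<ge> 1 \<and>
          minimal_relations_weight_le P ((k - 1) * d + 1) \<longrightarrow>
          minimal_relations_weight_le (veronese P d) k) \<and>
     \<not> (\<forall>(P :: ('k, nat \<Rightarrow>\<^sub>0 'k) ns_operad) d.
          weight_graded_ns_operad P \<and> generated_in_weight_one P \<and> d \<ge> 1 \<longrightarrow>
          rate (veronese P d) \<le> ereal_ceiling (rate P / ereal (real d))) \<and>
     \<not> (\<forall>P :: ('k, nat \<Rightarrow>\<^sub>0 'k) ns_operad.
          weight_graded_ns_operad P \<and> generated_in_weight_one P \<and>
          has_finite_groebner_basis P \<longrightarrow>
          (\<forall>\<^sub>F d in sequentially. has_quadratic_groebner_basis (veronese P d))) \<and>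
     \<not> (\<forall>(P :: ('k, nat \<Rightarrow>\<^sub>0 'k) ns_operad) d.
          weight_graded_ns_operad P \<and> generated_in_weight_one P \<and> d \<ge> 1 \<and>
          has_quadratic_groebner_basis P \<longrightarrow>
          has_quadratic_groebner_basis (veronese P d))"
proof (intro conjI notI)
  let ?P = "P_op :: ('k, nat \<Rightarrow>\<^sub>0 'k) ns_operad"
  {
    assume "\<forall>(P :: ('k, nat \<Rightarrow>\<^sub>0 'k) ns_operad) d k.
          weight_graded_ns_operad P \<and> generated_in_weight_one P \<and> d \<ge> 1 \<and> k \<ge> 1 \<and>
          minimal_relations_weight_le P ((k - 1) * d + 1) \<longrightarrow>
          minimal_relations_weight_le (veronese P d) k"
    \<comment> \<open>With \<open>k = d = 2\<close> the hypothesis allows weight 3, and all minimal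
      relations of the operad have weight at most 2.\<close>
    moreover have "minimal_relations_weight_le ?P ((2 - 1) * 2 + 1)" by (rule P_op_minimal_relations) simp
    ultimately have "minimal_relations_weight_le (veronese ?P 2) 2"
      using P_op_operad P_op_generated one_le_numeral by blast
    moreover have "\<not> minimal_relations_weight_le (veronese ?P 2) 2" by (rule veronese_minimal_relations) simp
    ultimately show False by blast
  next
    assume "\<forall>(P :: ('k, nat \<Rightarrow>\<^sub>0 'k) ns_operad) d.
          weight_graded_ns_operad P \<and> generated_in_weight_one P \<and> d \<ge> 1 \<longrightarrow>
          rate (veronese P d) \<le> ereal_ceiling (rate P / ereal (real d))"
    \<comment> \<open>The value 8 matches the bound \<open>rate_P_op\<close>, so the quotient under
      the ceiling is at most 1.\<close>
    then have "rate (veronese ?P 8) \<le> ereal_ceiling (rate ?P / ereal (real 8))"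
      using P_op_operad P_op_generated one_le_numeral by blast
    also have "\<dots> \<le> 1" by (rule ereal_ceiling_le_1[OF rate_P_op])
    finally have "rate (veronese ?P 8) \<le> 1" .
    moreover have "rate (veronese ?P 8) \<ge> 2" by (rule veronese_rate) simp
    ultimately have "(2 :: ereal) \<le> 1" by (rule order_trans[rotated])
    then show False by simp
  next
    assume "\<forall>P :: ('k, nat \<Rightarrow>\<^sub>0 'k) ns_operad.
          weight_graded_ns_operad P \<and> generated_in_weight_one P \<and>
          has_finite_groebner_basis P \<longrightarrow>
          (\<forall>\<^sub>F d in sequentially. has_quadratic_groebner_basis (veronese P d))"
    then have "\<forall>\<^sub>F d in sequentially. has_quadratic_groebner_basis (veronese ?P d)"
      using P_op_operad P_op_generated P_op_finite_groebner_basis by blast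
    then obtain N where "\<And>d. d \<ge> N \<Longrightarrow> has_quadratic_groebner_basis (veronese ?P d)"
      unfolding eventually_sequentially by blast
    \<comment> \<open>Adding 2 makes the index both large enough and at least 2, where the cubic
      relation appears.\<close>
    then have "has_quadratic_groebner_basis (veronese ?P (N + 2))" by simp
    moreover have "\<not> has_quadratic_groebner_basis (veronese ?P (N + 2))"
      by (rule veronese_no_quadratic_groebner_basis) simp
    ultimately show False by blast
  next
    assume "\<forall>(P :: ('k, nat \<Rightarrow>\<^sub>0 'k) ns_operad) d.
          weight_graded_ns_operad P \<and> generated_in_weight_one P \<and> d \<ge> 1 \<and>
          has_quadratic_groebner_basis P \<longrightarrow>
          has_quadratic_groebner_basis (veronese P d)"
    then have "has_quadratic_groebner_basis (veronese ?P 2)"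
      using P_op_operad P_op_generated P_op_quadratic_groebner_basis one_le_numeral by blast
    moreover have "\<not> has_quadratic_groebner_basis (veronese ?P 2)"
      by (rule veronese_no_quadratic_groebner_basis) simp
    ultimately show False by blast
  }
qed


end
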